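(* The Beurling measure algebra $\mathcal M(G,\omega)$, with convolution product and with the identification $\mathcal M(G,\omega)=C_0(G,\omega^{-1})^*$, is a dual Banach algebra.
   Context: A dual Banach algebra is a Banach algebra which is (isometrically) a dual Banach space such that multiplication is separately weak$^*$-continuous. $G$ is a locally compact group with identity $e_G$, and $\omega:G\to(0,\infty)$ is a continuous weight: $\omega(st)\le\omega(s)\omega(t)$ for $s,t\in G$, and $\omega(e_G)=1$. $C_0(G)$ is the space of continuous functions vanishing at infinity; $C_0(G,\omega^{-1})=\{\psi:\psi/\omega\in C_0(G)\}$ with norm $\|\psi\|_{\infty,\omega^{-1}}=\|\psi/\omega\|_\infty$. Measures: for a locally compact Hausdorff space $X$, $\mathfrak S(X)$ is the $\delta$-ring of all Borel subsets of $X$ with compact closure. A complex compacted-Borel measure is a countably additive function $\mu:\mathfrak S(X)\to\mathbb C$, with total variation $|\mu|$ (finite on $\mathfrak S(X)$). $\mu$ is regular if $|\mu|(A)=\sup\{|\mu|(C):C\subseteq A,\ C\text{ compact}\}$ for all $A\in\mathfrak S(X)$. $\mathcal M(X)$ is the space of all regular complex compacted-Borel measures; $\mathcal M_r(X)$ is the Banach space of bounded ones, with $\|\mu\|=\sup\{|\mu|(A):A\in\mathfrak S(X)\}<\infty$. Integration against a complex measure $\mu$ on a $\delta$-ring $\mathfrak S$: for each $A\in\mathfrak S$, $\mu$ restricts to an ordinary complex measure on the $\sigma$-algebra $\{B\in\mathfrak S:B\subseteq A\}$ of subsets of $A$. A function $f$ is locally $\mu$-measurable if $f|_A$ is measurable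 for the $|\mu|$-completion of this $\sigma$-algebra for every $A\in\mathfrak S$. $\mathcal L^1(\mu)$ consists of the locally $\mu$-measurable complex functions $f$ which vanish off a countable union $\bigcup_nA_n$ of an increasing sequence of sets in $\mathfrak S$ and satisfy $\lim_n\int_{A_n}|f|\,d|\mu|<\infty$; then $\int f\,d\mu=\lim_n\int_{A_n}f\,d\mu$. For continuous $h$ on $G$ and $\nu\in\mathcal M(G)$, $(h\nu)(A)=\int h\chi_A\,d\nu$. $\mathcal M(G,\omega)=\{\nu\in\mathcal M(G):\omega\nu\in\mathcal M_r(G)\}$ with norm $\|\nu\|_\omega=\|\omega\nu\|$; it is isometrically identified with $C_0(G,\omega^{-1})^*$ through $\langle\nu,\psi\rangle_\omega=\int\psi\,d\nu$, and this gives its weak$^*$-topology. Convolution: for $\sigma\in\mathcal M(X)$, $\mathcal E_\sigma$ is the $\delta$-ring of all Borel subsets $A$ of $X$ contained in some open set $U$ with $\sup\{|\sigma|(A'):A'\in\mathfrak S(X),\ A'\subseteq U\}<\infty$; $\sigma_e(A)=\lim_C\sigma(C)$ (limit along compact $C\subseteq A$, directed upward) defines a complex measure on $\mathcal E_\sigma$ extending $\sigma$. For $\mu,\nu\in\mathcal M(G)$, $\mu\times\nu$ is the unique element of $\mathcal M(G\times G)$ with $\int f\,d(\mu\times\nu)=\iint f(s,t)\,d\mu(s)\,d\nu(t)$ for all continuous compactly supported $f$ on $G\times G$. With $p(s,t)=st$, $\mu*\nu$ exists if $p^{-1}(A)\in\mathcal E_{\mu\times\nu}$ for every $A\in\mathfrak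 S(G)$, and then $(\mu*\nu)(A)=(\mu\times\nu)_e(p^{-1}(A))$. *)

theory Defs
  imports "HOL-Analysis.Analysis" "HOL-Library.Function_Algebras"
begin

section \<open>Complex Banach algebras and dual Banach algebras on carrier sets\<close>

text \<open>
  The algebra of measures depends on the weight, so all spaces are carrier sets inside an ambient
  complex vector space: an additive group together with a scalar multiplication satisfying
  the locale \<^locale>\<open>vector_space\<close>. For function types the additive group is the pointwise one of
  \<^theory>\<open>HOL-Library.Function_Algebras\<close>.
\<close>

definition fun_scale :: "complex \<Rightarrow> ('a \<Rightarrow> complex) \<Rightarrow> 'a \<Rightarrow> complex" where
  "fun_scale c f = (\<lambda>x. c * f x)"

locale complex_normed_space_on = vector_space scale
  for scale :: "complex \<Rightarrow> 'v::ab_group_add \<Rightarrow> 'v" +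
  fixes V :: "'v set" and N :: "'v \<Rightarrow> real"
  assumes subspace_carrier: "module.subspace scale V"
    and norm_nonneg: "x \<in> V \<Longrightarrow> 0 \<le> N x"
    and norm_definite: "x \<in> V \<Longrightarrow> N x = 0 \<Longrightarrow> x = 0"
    and norm_scale: "x \<in> V \<Longrightarrow> N (scale c x) = cmod c * N x"
    and norm_triangle: "x \<in> V \<Longrightarrow> y \<in> V \<Longrightarrow> N (x + y) \<le> N x + N y"

locale complex_banach_space_on = complex_normed_space_on scale V N
  for scale :: "complex \<Rightarrow> 'v::ab_group_add \<Rightarrow> 'v" and V N +
  assumes complete_carrier:
    "\<And>\<sigma> :: nat \<Rightarrow> 'v. (\<And>n. \<sigma> n \<in> V) \<Longrightarrow>
       (\<And>\<epsilon>. \<epsilon> > 0 \<Longrightarrow> \<exists>k. \<forall>m\<ge>k. \<forall>n\<ge>k. N (\<sigma> m - \<sigma> n) < \<epsilon>) \<Longrightarrow>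
       \<exists>x\<in>V. (\<lambda>n. N (\<sigma> n - x)) \<longlonglongrightarrow> 0"

locale complex_banach_algebra_on = complex_banach_space_on scale V N
  for scale :: "complex \<Rightarrow> 'v::ab_group_add \<Rightarrow> 'v" and V N +
  fixes mult :: "'v \<Rightarrow> 'v \<Rightarrow> 'v"
  assumes mult_closed: "x \<in> V \<Longrightarrow> y \<in> V \<Longrightarrow> mult x y \<in> V"
    and mult_assoc: "x \<in> V \<Longrightarrow> y \<in> V \<Longrightarrow> z \<in> V \<Longrightarrow> mult (mult x y) z = mult x (mult y z)"
    and mult_add_left: "x \<in> V \<Longrightarrow> y \<in> V \<Longrightarrow> z \<in> V \<Longrightarrow> mult (x + y) z = mult x z + mult y z"
    and mult_add_right: "x \<in> V \<Longrightarrow> y \<in> V \<Longrightarrow> z \<in> V \<Longrightarrow> mult x (y + z) = mult x y + mult x z"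
    and mult_scale_left: "x \<in> V \<Longrightarrow> y \<in> V \<Longrightarrow> mult (scale c x) y = scale c (mult x y)"
    and mult_scale_right: "x \<in> V \<Longrightarrow> y \<in> V \<Longrightarrow> mult x (scale c y) = scale c (mult x y)"
    and norm_mult_le: "x \<in> V \<Longrightarrow> y \<in> V \<Longrightarrow> N (mult x y) \<le> N x * N y"

definition bounded_functional_on ::
  "(complex \<Rightarrow> 'w::ab_group_add \<Rightarrow> 'w) \<Rightarrow> 'w set \<Rightarrow> ('w \<Rightarrow> real) \<Rightarrow> ('w \<Rightarrow> complex) \<Rightarrow> bool" where
  "bounded_functional_on scaleE E N \<phi> \<longleftrightarrow>
     (\<forall>x\<in>E. \<forall>y\<in>E. \<phi> (x + y) = \<phi> x + \<phi> y) \<and>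
     (\<forall>c. \<forall>x\<in>E. \<phi> (scaleE c x) = c * \<phi> x) \<and>
     (\<exists>K. \<forall>x\<in>E. cmod (\<phi> x) \<le> K * N x)"

definition functional_norm_on :: "'w set \<Rightarrow> ('w \<Rightarrow> real) \<Rightarrow> ('w \<Rightarrow> complex) \<Rightarrow> real" where
  "functional_norm_on E N \<phi> = (SUP x\<in>{x \<in> E. N x \<le> 1}. cmod (\<phi> x))"

text \<open>
  The topology induced on \<open>V\<close> by pointwise convergence on \<open>E\<close> under the pairing.
\<close>
definition weak_star_topology_on ::
  "'v set \<Rightarrow> 'w set \<Rightarrow> ('v \<Rightarrow> 'w \<Rightarrow> complex) \<Rightarrow> 'v topology" where
  "weak_star_topology_on V E pair =
     pullback_topology V (\<lambda>v. restrict (pair v) E) (product_topology (\<lambda>_. euclidean) E)"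

text \<open>
  The pairing assumptions say that \<open>v \<mapsto> pair v\<close> is an isometric linear bijection of \<open>V\<close> onto the
  Banach dual of \<open>E\<close>; injectivity is a consequence of being isometric.
\<close>
locale dual_banach_algebra =
  algebra: complex_banach_algebra_on scale V N mult +
  predual: complex_banach_space_on scaleE E NE
  for scale :: "complex \<Rightarrow> 'v::ab_group_add \<Rightarrow> 'v" and V N mult
    and scaleE :: "complex \<Rightarrow> 'w::ab_group_add \<Rightarrow> 'w" and E NE +
  fixes pair :: "'v \<Rightarrow> 'w \<Rightarrow> complex"
  assumes pair_bounded: "v \<in> V \<Longrightarrow> bounded_functional_on scaleE E NE (pair v)"
    and pair_add: "u \<in> V \<Longrightarrow> v \<in> V \<Longrightarrow> x \<in> E \<Longrightarrow> pair (u + v) x = pair u x + pair v x"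
    and pair_scale: "v \<in> V \<Longrightarrow> x \<in> E \<Longrightarrow> pair (scale c v) x = c * pair v x"
    and pair_isometric: "v \<in> V \<Longrightarrow> functional_norm_on E NE (pair v) = N v"
    and pair_surj: "bounded_functional_on scaleE E NE \<phi> \<Longrightarrow> \<exists>v\<in>V. \<forall>x\<in>E. pair v x = \<phi> x"
    and weak_star_continuous_left: "u \<in> V \<Longrightarrow>
          continuous_map (weak_star_topology_on V E pair) (weak_star_topology_on V E pair)
            (\<lambda>v. mult u v)"
    and weak_star_continuous_right: "u \<in> V \<Longrightarrow>
          continuous_map (weak_star_topology_on V E pair) (weak_star_topology_on V E pair)
            (\<lambda>v. mult v u)"


section \<open>Complex measures on \<open>\<delta>\<close>-rings\<close>

text \<open>
  A complex measure on a \<open>\<delta>\<close>-ring \<open>R\<close> is represented by a function on all sets that is \<open>0\<close> off \<open>R\<close>,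
  so that equality, sums and scalar multiples of functions are those of measures.
\<close>
definition complex_measure_on :: "'a set set \<Rightarrow> ('a set \<Rightarrow> complex) \<Rightarrow> bool" where
  "complex_measure_on R \<mu> \<longleftrightarrow>
     (\<forall>A :: nat \<Rightarrow> 'a set. range A \<subseteq> R \<longrightarrow> disjoint_family A \<longrightarrow> (\<Union>i. A i) \<in> R \<longrightarrow>
        (\<lambda>i. \<mu> (A i)) sums \<mu> (\<Union>i. A i)) \<and>
     (\<forall>A. A \<notin> R \<longrightarrow> \<mu> A = 0)"

definition total_variation :: "'a set set \<Rightarrow> ('a set \<Rightarrow> complex) \<Rightarrow> 'a set \<Rightarrow> ennreal" where
  "total_variation R \<mu> A =
     (SUP P\<in>{P. finite P \<and> partition_on A P \<and> P \<subseteq> R}. \<Sum>B\<in>P. ennreal (cmod (\<mu> B)))"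

text \<open>
  For a real measure \<open>\<nu>\<close> and \<open>B \<in> R\<close> this is the positive part \<open>\<nu>\<^sup>+ B\<close> of the Jordan decomposition;
  \<open>ennreal\<close> sends negative numbers to \<open>0 = \<nu> {}\<close>.
\<close>
definition positive_variation :: "'a set set \<Rightarrow> ('a set \<Rightarrow> real) \<Rightarrow> 'a set \<Rightarrow> ennreal" where
  "positive_variation R \<nu> B = (SUP C\<in>{C \<in> R. C \<subseteq> B}. ennreal (\<nu> C))"

text \<open>
  For \<open>A \<in> R\<close>, the sets \<open>B \<in> R\<close> with \<open>B \<subseteq> A\<close> form a \<open>\<sigma>\<close>-algebra on \<open>A\<close>.
\<close>
definition trace_measure :: "'a set set \<Rightarrow> ('a set \<Rightarrow> ennreal) \<Rightarrow> 'a set \<Rightarrow> 'a measure" where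
  "trace_measure R m A = measure_of A {B \<in> R. B \<subseteq> A} m"

definition locally_measurable_on ::
  "'a set set \<Rightarrow> ('a set \<Rightarrow> complex) \<Rightarrow> ('a \<Rightarrow> complex) \<Rightarrow> bool" where
  "locally_measurable_on R \<mu> f \<longleftrightarrow>
     (\<forall>A\<in>R. f \<in> borel_measurable (completion (trace_measure R (total_variation R \<mu>) A)))"

text \<open>
  \<open>\<integral>\<^sub>A f d\<mu>\<close> for \<open>A \<in> R\<close>, via the Jordan decompositions of the real and imaginary parts of the
  complex measure that \<open>\<mu>\<close> induces on the \<open>\<sigma>\<close>-algebra of subsets of \<open>A\<close>.
\<close>
definition integral_over ::
  "'a set set \<Rightarrow> ('a set \<Rightarrow> complex) \<Rightarrow> ('a \<Rightarrow> complex) \<Rightarrow> 'a set \<Rightarrow> complex" where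
  "integral_over R \<mu> f A =
     (let I = (\<lambda>\<nu>. integral\<^sup>L (completion (trace_measure R (positive_variation R \<nu>) A)) f)
      in (I (\<lambda>B. Re (\<mu> B)) - I (\<lambda>B. - Re (\<mu> B))) +
         \<i> * (I (\<lambda>B. Im (\<mu> B)) - I (\<lambda>B. - Im (\<mu> B))))"

definition L1_exhaustion ::
  "'a set set \<Rightarrow> ('a set \<Rightarrow> complex) \<Rightarrow> ('a \<Rightarrow> complex) \<Rightarrow> (nat \<Rightarrow> 'a set) \<Rightarrow> bool" where
  "L1_exhaustion R \<mu> f A \<longleftrightarrow>
     range A \<subseteq> R \<and> incseq A \<and> (\<forall>x. x \<notin> (\<Union>n. A n) \<longrightarrow> f x = 0) \<and>
     lim (\<lambda>n. \<integral>\<^sup>+x. ennreal (cmod (f x))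
                \<partial>completion (trace_measure R (total_variation R \<mu>) (A n))) < \<infinity>"

definition L1_on :: "'a set set \<Rightarrow> ('a set \<Rightarrow> complex) \<Rightarrow> ('a \<Rightarrow> complex) set" where
  "L1_on R \<mu> = {f. locally_measurable_on R \<mu> f \<and> (\<exists>A. L1_exhaustion R \<mu> f A)}"

text \<open>Meaningful for \<open>f \<in> L1_on R \<mu>\<close>; the limit does not depend on the exhaustion.\<close>
definition integral_on :: "'a set set \<Rightarrow> ('a set \<Rightarrow> complex) \<Rightarrow> ('a \<Rightarrow> complex) \<Rightarrow> complex" where
  "integral_on R \<mu> f =
     (THE z. \<exists>A. L1_exhaustion R \<mu> f A \<and> (\<lambda>n. integral_over R \<mu> f (A n)) \<longlonglongrightarrow> z)"


section \<open>Regular complex compacted-Borel measures\<close>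

definition compacted_borel :: "'a::topological_space set set" where
  "compacted_borel = {A \<in> sets borel. compact (closure A)}"

abbreviation cb_variation :: "('a::topological_space set \<Rightarrow> complex) \<Rightarrow> 'a set \<Rightarrow> ennreal" where
  "cb_variation \<equiv> total_variation compacted_borel"

abbreviation cb_L1 ::
  "('a::topological_space set \<Rightarrow> complex) \<Rightarrow> ('a \<Rightarrow> complex) set" where
  "cb_L1 \<equiv> L1_on compacted_borel"

abbreviation cb_integral ::
  "('a::topological_space set \<Rightarrow> complex) \<Rightarrow> ('a \<Rightarrow> complex) \<Rightarrow> complex" where
  "cb_integral \<equiv> integral_on compacted_borel"

definition regular_cb_measures :: "('a::t2_space set \<Rightarrow> complex) set" where
  "regular_cb_measures =
     {\<mu>. complex_measure_on compacted_borel \<mu> \<and>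
         (\<forall>A\<in>compacted_borel.
            cb_variation \<mu> A = (SUP C\<in>{C. compact C \<and> C \<subseteq> A}. cb_variation \<mu> C))}"

text \<open>The supremum of \<open>|\<mu>|\<close> over the compacted-Borel subsets of \<open>U\<close>.\<close>
definition sup_variation :: "('a::topological_space set \<Rightarrow> complex) \<Rightarrow> 'a set \<Rightarrow> ennreal" where
  "sup_variation \<mu> U = (SUP A\<in>{A \<in> compacted_borel. A \<subseteq> U}. cb_variation \<mu> A)"

definition bounded_cb_measures :: "('a::t2_space set \<Rightarrow> complex) set" where
  "bounded_cb_measures = {\<mu> \<in> regular_cb_measures. sup_variation \<mu> UNIV < \<infinity>}"

definition cb_norm :: "('a::topological_space set \<Rightarrow> complex) \<Rightarrow> real" where
  "cb_norm \<mu> = enn2real (sup_variation \<mu> UNIV)"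

definition density_cb ::
  "('a::topological_space \<Rightarrow> complex) \<Rightarrow> ('a set \<Rightarrow> complex) \<Rightarrow> 'a set \<Rightarrow> complex" where
  "density_cb h \<nu> =
     (\<lambda>A. if A \<in> compacted_borel then cb_integral \<nu> (\<lambda>x. h x * indicator A x) else 0)"


section \<open>Products and convolution\<close>

text \<open>
  Groups are written additively: the class \<^class>\<open>topological_group_add\<close> does not assume
  commutativity, so \<open>s + t\<close> is the group product \<open>st\<close>, and \<open>0\<close> is the identity.
\<close>

definition extended_domain :: "('a::topological_space set \<Rightarrow> complex) \<Rightarrow> 'a set set" where
  "extended_domain \<sigma> = {A \<in> sets borel. \<exists>U. open U \<and> A \<subseteq> U \<and> sup_variation \<sigma> U < \<infinity>}"

definition compact_subsets_at_top :: "'a::topological_space set \<Rightarrow> 'a set filter" where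
  "compact_subsets_at_top A =
     (INF K\<in>{K. compact K \<and> K \<subseteq> A}. principal {C. compact C \<and> K \<subseteq> C \<and> C \<subseteq> A})"

definition extend_cb ::
  "('a::topological_space set \<Rightarrow> complex) \<Rightarrow> 'a set \<Rightarrow> complex" where
  "extend_cb \<sigma> A = Lim (compact_subsets_at_top A) \<sigma>"

definition compactly_supported :: "('a::topological_space \<Rightarrow> complex) set" where
  "compactly_supported = {f. continuous_on UNIV f \<and> compact (closure {x. f x \<noteq> 0})}"

definition product_cb ::
  "('a::t2_space set \<Rightarrow> complex) \<Rightarrow> ('b::t2_space set \<Rightarrow> complex) \<Rightarrow> ('a \<times> 'b) set \<Rightarrow> complex" where
  "product_cb \<mu> \<nu> =
     (THE \<sigma>. \<sigma> \<in> regular_cb_measures \<and>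
        (\<forall>f\<in>compactly_supported.
           cb_integral \<sigma> f = cb_integral \<nu> (\<lambda>t. cb_integral \<mu> (\<lambda>s. f (s, t)))))"

definition convolution_exists ::
  "('g::{topological_group_add, t2_space} set \<Rightarrow> complex) \<Rightarrow> ('g set \<Rightarrow> complex) \<Rightarrow> bool" where
  "convolution_exists \<mu> \<nu> \<longleftrightarrow>
     (\<forall>A\<in>compacted_borel. (\<lambda>(s, t). s + t) -` A \<in> extended_domain (product_cb \<mu> \<nu>))"

definition convolution ::
  "('g::{topological_group_add, t2_space} set \<Rightarrow> complex) \<Rightarrow> ('g set \<Rightarrow> complex) \<Rightarrow>
   'g set \<Rightarrow> complex" where
  "convolution \<mu> \<nu> =
     (\<lambda>A. if A \<in> compacted_borel then extend_cb (product_cb \<mu> \<nu>) ((\<lambda>(s, t). s + t) -` A) else 0)"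


section \<open>Beurling measure algebras and their preduals\<close>

definition C0 :: "('a::topological_space \<Rightarrow> complex) set" where
  "C0 = {f. continuous_on UNIV f \<and> (\<forall>\<epsilon>>0. \<exists>K. compact K \<and> (\<forall>x. x \<notin> K \<longrightarrow> cmod (f x) < \<epsilon>))}"

definition weighted_C0 :: "('a::topological_space \<Rightarrow> real) \<Rightarrow> ('a \<Rightarrow> complex) set" where
  "weighted_C0 \<omega> = {\<psi>. (\<lambda>x. \<psi> x / complex_of_real (\<omega> x)) \<in> C0}"

definition weighted_sup_norm :: "('a \<Rightarrow> real) \<Rightarrow> ('a \<Rightarrow> complex) \<Rightarrow> real" where
  "weighted_sup_norm \<omega> \<psi> = (SUP x. cmod (\<psi> x / complex_of_real (\<omega> x)))"

definition beurling_measures :: "('a::t2_space \<Rightarrow> real) \<Rightarrow> ('a set \<Rightarrow> complex) set" where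
  "beurling_measures \<omega> =
     {\<nu> \<in> regular_cb_measures. density_cb (\<lambda>x. complex_of_real (\<omega> x)) \<nu> \<in> bounded_cb_measures}"

definition beurling_norm :: "('a::t2_space \<Rightarrow> real) \<Rightarrow> ('a set \<Rightarrow> complex) \<Rightarrow> real" where
  "beurling_norm \<omega> \<nu> = cb_norm (density_cb (\<lambda>x. complex_of_real (\<omega> x)) \<nu>)"

end

theory Submission
  imports Defs
begin

text \<open>
  A regular compacted-Borel measure is a combination, with coefficients \<open>1, \<i>, -1, -\<i>\<close>, of four inner
  regular Borel measures that are finite on compact sets, and \<open>\<mu>\<close> belongs to \<open>M(G, \<omega>)\<close> iff these can be
  chosen with \<open>\<integral>\<omega> < \<infinity>\<close>. Thus the pairing with \<open>\<psi>\<close> in \<open>C\<^sub>0(G, \<omega>\<^sup>-\<^sup>1)\<close> reduces to ordinary integrals, and the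
  duality is the Riesz representation theorem together with regularity, which gives the norm as a
  supremum over compactly supported functions bounded by \<open>\<omega>\<close>.

  By submultiplicativity the product of two such components integrates \<open>\<omega>(st)\<close>, so that its image under the
  group law is again a component of an element of \<open>M(G, \<omega>)\<close>; hence convolutions exist and are
  represented by these images. Fubini's theorem turns \<open>\<langle>\<mu> * \<nu>, \<psi>\<rangle>\<close> into \<open>\<langle>\<nu>, \<mu>\<cdot>\<psi>\<rangle>\<close> and \<open>\<langle>\<mu>, \<psi>\<cdot>\<nu>\<rangle>\<close>, where
  \<open>(\<mu>\<cdot>\<psi>)(t) = \<integral> \<psi>(st) d\<mu>(s)\<close> and \<open>(\<psi>\<cdot>\<nu>)(s) = \<integral> \<psi>(st) d\<nu>(t)\<close> again lie in the predual. Separate weak*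
  continuity, associativity and submultiplicativity of the norm follow from these two formulas.
\<close>

section \<open>Compacted Borel sets\<close>

text \<open>The group may fail to be \<sigma>-compact or second countable, and this shapes the proof
  in two ways. First, Borel sets of G x G, such as preimages under the group law, may lie outside
  the product of the Borel \<sigma>-algebras. Products of measures are therefore obtained by
  applying Riesz to the iterated integral, and Fubini is proved for continuous functions dominated
  by a multiple of \<open>\<omega> s * \<omega> t\<close>, with errors controlled by tails of the
  weight. Secondly, inner regularity is imposed on all Borel sets: compact sets then determine a
  measure, the property survives locally bounded densities, finite sums and continuous images that
  are finite on compact sets, and integrals become suprema over compact sets. Representations of a
  complex measure may be far from minimal; the integral is shown once not to depend on the choice.
  Completeness of the measure space is read off from duality, by taking limits of functionals
  instead of set functions.\<close>

lemma compacted_borel_borel: "A \<in> compacted_borel \<Longrightarrow> A \<in> sets borel"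
  by (simp add: compacted_borel_def)

lemma compact_compacted_borel:
  fixes K :: "'a::t2_space set"
  assumes "compact K" shows "K \<in> compacted_borel"
  using assms compact_imp_closed[OF assms] by (simp add: compacted_borel_def closure_closed)

lemma compacted_borel_subset:
  fixes A :: "'a::t2_space set"
  assumes "A \<in> compacted_borel" "B \<in> sets borel" "B \<subseteq> A" shows "B \<in> compacted_borel"
proof -
  have "closure B = closure A \<inter> closure B" using closure_mono[OF assms(3)] by blast
  then show ?thesis using assms compact_Int_closed[of "closure A" "closure B"]
    by (simp add: compacted_borel_def)
qed

lemma compacted_borel_subset_compact:
  fixes A :: "'a::t2_space set"
  assumes "compact K" "A \<in> sets borel" "A \<subseteq> K" shows "A \<in> compacted_borel"
  using compacted_borel_subset[OF compact_compacted_borel[OF assms(1)]] assms by blast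

lemma compacted_borel_Un:
  "A \<in> compacted_borel \<Longrightarrow> B \<in> compacted_borel \<Longrightarrow> A \<union> B \<in> compacted_borel"
  by (auto simp: compacted_borel_def compact_Un)

lemma compacted_borel_empty [simp]: "{} \<in> compacted_borel"
  by (simp add: compacted_borel_def)

lemma compacted_borel_Diff:
  fixes A :: "'a::t2_space set"
  shows "A \<in> compacted_borel \<Longrightarrow> B \<in> sets borel \<Longrightarrow> A - B \<in> compacted_borel"
  by (rule compacted_borel_subset[of A]) (auto simp: compacted_borel_borel)

lemma compacted_borel_Int:
  fixes A :: "'a::t2_space set"
  shows "A \<in> compacted_borel \<Longrightarrow> B \<in> sets borel \<Longrightarrow> A \<inter> B \<in> compacted_borel"
  by (rule compacted_borel_subset[of A]) (auto simp: compacted_borel_borel)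

lemma compacted_borel_Int':
  fixes A :: "'a::t2_space set"
  shows "A \<in> compacted_borel \<Longrightarrow> B \<in> sets borel \<Longrightarrow> B \<inter> A \<in> compacted_borel"
  using compacted_borel_Int[of A B] by (simp add: Int_commute)

lemma compacted_borel_finite_UN:
  assumes "finite I" "\<And>i. i \<in> I \<Longrightarrow> A i \<in> compacted_borel"
  shows "(\<Union>i\<in>I. A i) \<in> compacted_borel"
  using assms by (induction I) (auto intro: compacted_borel_Un)

lemma compact_borel: "compact K \<Longrightarrow> K \<in> sets borel" for K :: "'a::t2_space set"
  using compact_imp_closed borel_closed by blast


section \<open>Inner regular Borel measures\<close>

text \<open>Inner regularity is imposed on all Borel sets, also on those of infinite measure,
  instead of the common mixture of outer regularity and inner regularity on open sets. Such a
  measure is determined by its values on compact sets.\<close>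

definition radon :: "'a::t2_space measure \<Rightarrow> bool" where
  "radon M \<longleftrightarrow> sets M = sets borel \<and> (\<forall>K. compact K \<longrightarrow> emeasure M K < \<infinity>) \<and>
     (\<forall>B\<in>sets borel. emeasure M B = (SUP K\<in>{K. compact K \<and> K \<subseteq> B}. emeasure M K))"

lemma radon_sets [simp]: "radon M \<Longrightarrow> sets M = sets borel"
  and radon_space [simp]: "radon M \<Longrightarrow> space M = UNIV"
  and radon_compact: "radon M \<Longrightarrow> compact K \<Longrightarrow> emeasure M K < \<infinity>"
  and radon_inner: "radon M \<Longrightarrow> B \<in> sets borel \<Longrightarrow>
        emeasure M B = (SUP K\<in>{K. compact K \<and> K \<subseteq> B}. emeasure M K)"
  using sets_eq_imp_space_eq[of M borel] by (auto simp: radon_def)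

lemma radon_measurable: "radon M \<Longrightarrow> f \<in> borel_measurable borel \<Longrightarrow> f \<in> borel_measurable M"
  using measurable_cong_sets[OF radon_sets refl] by blast

lemma radon_compacted_borel:
  assumes "radon M" "A \<in> compacted_borel" shows "emeasure M A < \<infinity>"
proof -
  have "emeasure M A \<le> emeasure M (closure A)"
    using assms by (intro emeasure_mono closure_subset) simp
  also have "\<dots> < \<infinity>" using assms by (intro radon_compact) (auto simp: compacted_borel_def)
  finally show ?thesis .
qed

lemma radonI_le:
  assumes "sets M = sets borel" "\<And>K. compact K \<Longrightarrow> emeasure M K < \<infinity>"
    and "\<And>B. B \<in> sets borel \<Longrightarrow> emeasure M B \<le> (SUP K\<in>{K. compact K \<and> K \<subseteq> B}. emeasure M K)"
  shows "radon M"
  unfolding radon_def using assms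
  by (auto intro!: antisym SUP_least emeasure_mono)

lemma radon_approx:
  assumes M: "radon M" and B: "B \<in> sets borel" and fin: "emeasure M B < \<infinity>" and e: "(e::real) > 0"
  obtains K where "compact K" "K \<subseteq> B" "emeasure M (B - K) < ennreal e"
proof (cases "emeasure M B = 0")
  case True
  then show ?thesis using that[of "{}"] e by simp
next
  case False
  define b where "b = emeasure M B"
  have "b - ennreal e < b" 
    using fin False e unfolding b_def
    by (intro ennreal_between) (auto simp: zero_less_iff_neq_zero)
  then have "b - ennreal e < (SUP K\<in>{K. compact K \<and> K \<subseteq> B}. emeasure M K)"
    unfolding b_def using radon_inner[OF M B] by simp
  then obtain K where K: "compact K" "K \<subseteq> B" "b - ennreal e < emeasure M K"
    by (auto simp: less_SUP_iff)
  have KM: "K \<in> sets M" using K M compact_borel by auto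
  have fK: "emeasure M K < \<infinity>" using radon_compact[OF M K(1)] .
  have "emeasure M (B - K) = b - emeasure M K"
    unfolding b_def using KM K B M fK by (intro emeasure_Diff) auto
  also have "\<dots> < ennreal e"
  proof -
    have "emeasure M K \<le> b" unfolding b_def using KM K B M by (intro emeasure_mono) auto
    moreover have "b < ennreal e + emeasure M K"
    \<comment> \<open>Subtraction in \<open>ennreal\<close> is cut off at 0, so it can be undone
      only if \<open>e\<close> does not exceed \<open>b\<close>; otherwise the claim is
      immediate.\<close>
    proof (cases "ennreal e \<le> b")
      case True
      then show ?thesis using K(3) minus_less_iff_ennreal[of "ennreal e" b "emeasure M K"]
        by (simp add: add.commute)
    next
      case False
      then have "b < ennreal e" by simp
      also have "\<dots> \<le> ennreal e + emeasure M K" by simp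
      finally show ?thesis .
    qed
    ultimately show ?thesis using fK by (simp add: minus_less_iff_ennreal)
  qed
  finally show ?thesis using that K by blast
qed

lemma binary_additive:
  fixes m :: "'a set \<Rightarrow> ennreal"
  assumes ca: "\<And>A. range A \<subseteq> R \<Longrightarrow> disjoint_family A \<Longrightarrow> (\<Union>i. A i) \<in> R \<Longrightarrow>
        m (\<Union>i::nat. A i) = (\<Sum>i. m (A i))"
    and m0: "m {} = 0" "{} \<in> R"
    and "A \<in> R" "B \<in> R" "A \<union> B \<in> R" "A \<inter> B = {}"
  shows "m (A \<union> B) = m A + m B"
proof -
  have "m (\<Union>i. binaryset A B i) = (\<Sum>i. m (binaryset A B i))"
    using assms by (intro ca) (auto simp: range_binaryset_eq UN_binaryset_eq disjoint_family_on_def binaryset_def)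
  then show ?thesis using m0 by (simp add: UN_binaryset_eq suminf_binaryset_eq)
qed

text \<open>The two indices vary independently. In the applications the union of the two chosen sets
  or partitions is a single competitor that serves both suprema.\<close>

lemma SUP_add_SUP_le:
  fixes f :: "'a \<Rightarrow> ennreal" and g :: "'b \<Rightarrow> ennreal"
  assumes "\<And>i j. i \<in> I \<Longrightarrow> j \<in> J \<Longrightarrow> f i + g j \<le> c" "I \<noteq> {}" "J \<noteq> {}"
  shows "(SUP i\<in>I. f i) + (SUP j\<in>J. g j) \<le> c"
proof -
  have "(SUP i\<in>I. f i) + (SUP j\<in>J. g j) = (SUP i\<in>I. f i + (SUP j\<in>J. g j))"
    using assms by (simp add: ennreal_SUP_add_left)
  also have "\<dots> = (SUP i\<in>I. SUP j\<in>J. f i + g j)"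
    using assms by (simp add: ennreal_SUP_add_right)
  also have "\<dots> \<le> c" using assms by (intro SUP_least) auto
  finally show ?thesis .
qed

text \<open>The value of the extension on a Borel set is the supremum of \<open>m\<close> over its
  compact subsets. Superadditivity is free, because disjoint compact sets unite to a compact set.
  For the converse, a compact subset of a countable union is cut along the pieces, and these traces
  are compacted Borel sets, where \<open>m\<close> is countably additive.\<close>

lemma radon_extension:
  fixes m :: "'a::t2_space set \<Rightarrow> ennreal"
  assumes ca: "\<And>A. range A \<subseteq> compacted_borel \<Longrightarrow> disjoint_family A \<Longrightarrow> (\<Union>i. A i) \<in> compacted_borel \<Longrightarrow>
        m (\<Union>i::nat. A i) = (\<Sum>i. m (A i))"
    and m0: "m {} = 0"
    and fin: "\<And>K. compact K \<Longrightarrow> m K < \<infinity>"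
    and reg: "\<And>A. A \<in> compacted_borel \<Longrightarrow> m A \<le> (SUP K\<in>{K. compact K \<and> K \<subseteq> A}. m K)"
  obtains M where "radon M" "\<And>A. A \<in> compacted_borel \<Longrightarrow> emeasure M A = m A"
proof -
  define f where "f B = (SUP K\<in>{K. compact K \<and> K \<subseteq> B}. m K)" for B
  have add: "m (A \<union> B) = m A + m B" if "A \<in> compacted_borel" "B \<in> compacted_borel" "A \<inter> B = {}" for A B
    by (rule binary_additive[where R = compacted_borel]) (use that ca m0 in \<open>auto intro: compacted_borel_Un\<close>)
  have mono: "m A \<le> m B" if "A \<in> compacted_borel" "B \<in> compacted_borel" "A \<subseteq> B" for A B
    using add[of A "B - A"] that compacted_borel_Diff[of B A] compacted_borel_borel[of A]
    by (simp add: Un_absorb1)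
  have f_eq: "f A = m A" if "A \<in> compacted_borel" for A
    unfolding f_def using that
    by (intro antisym reg SUP_least mono) (auto simp: compact_compacted_borel)
  have f_mono: "f A \<le> f B" if "A \<subseteq> B" for A B
    unfolding f_def using that by (intro SUP_subset_mono) auto
  have f0: "f {} = 0" using f_eq[of "{}"] m0 by simp
  have superadd: "f A + f B \<le> f (A \<union> B)" if "A \<inter> B = {}" for A B
    unfolding f_def
  proof (rule SUP_add_SUP_le)
    fix K L assume KL: "K \<in> {K. compact K \<and> K \<subseteq> A}" "L \<in> {K. compact K \<and> K \<subseteq> B}"
    then have "m K + m L = m (K \<union> L)"
      using that by (intro add[symmetric]) (auto simp: compact_compacted_borel)
    also have "\<dots> \<le> (SUP K\<in>{K. compact K \<and> K \<subseteq> A \<union> B}. m K)"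
      using KL by (intro SUP_upper) (auto simp: compact_Un)
    finally show "m K + m L \<le> \<dots>" .
  qed auto
  have superadd_n: "(\<Sum>i<n. f (B i)) \<le> f (\<Union>i<n. B i)" if "disjoint_family B" for B :: "nat \<Rightarrow> 'a set" and n
  proof (induction n)
    case (Suc n)
    have "(\<Sum>i<Suc n. f (B i)) \<le> f (\<Union>i<n. B i) + f (B n)" using Suc by (simp add: add_right_mono)
    also have "\<dots> \<le> f ((\<Union>i<n. B i) \<union> B n)"
    proof (rule superadd)
      have "B i \<inter> B n = {}" if "i < n" for i
        using disjoint_family_onD[OF \<open>disjoint_family B\<close>, of i n] that by simp
      then show "(\<Union>i<n. B i) \<inter> B n = {}" by blast
    qed
    finally show ?case by (simp add: lessThan_Suc Un_commute)
  qed (simp add: f0)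
  have caf: "countably_additive (sets borel) f"
  proof (rule countably_additiveI)
    fix B :: "nat \<Rightarrow> 'a set" assume B: "range B \<subseteq> sets borel" "disjoint_family B"
    show "(\<Sum>i. f (B i)) = f (\<Union>i. B i)"
    proof (rule antisym)
      show "(\<Sum>i. f (B i)) \<le> f (\<Union>i. B i)"
      proof (rule suminf_le_const)
        show "(\<Sum>i<n. f (B i)) \<le> f (\<Union>i. B i)" for n
          using superadd_n[OF B(2), of n] f_mono[of "\<Union>i<n. B i" "\<Union>i. B i"] by (force intro: order_trans)
      qed simp
      show "f (\<Union>i. B i) \<le> (\<Sum>i. f (B i))"
        unfolding f_def[of "\<Union>i. B i"]
      proof (rule SUP_least)
        fix K assume "K \<in> {K. compact K \<and> K \<subseteq> (\<Union>i. B i)}"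
        then have K: "compact K" "K \<subseteq> (\<Union>i. B i)" by auto
        have KB: "K \<inter> B i \<in> compacted_borel" for i
          using B K by (intro compacted_borel_Int compact_compacted_borel) auto
        have eq: "K = (\<Union>i. K \<inter> B i)" using K by auto
        have "m K = (\<Sum>i. m (K \<inter> B i))"
          by (subst (1) eq, rule ca)
             (use B K KB eq compact_compacted_borel[of K] in \<open>auto simp: disjoint_family_on_def\<close>)
        also have "\<dots> \<le> (\<Sum>i. f (B i))"
          using KB by (intro suminf_le) (auto simp flip: f_eq intro: f_mono)
        finally show "m K \<le> (\<Sum>i. f (B i))" .
      qed
    qed
  qed
  define M where "M = measure_of UNIV (sets borel) f"
  have sM: "sets M = sets borel"
    unfolding M_def using sets.sets_measure_of_eq[of borel] by simp
  have eM: "emeasure M B = f B" if "B \<in> sets borel" for B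
  proof (rule emeasure_measure_of[OF M_def])
    show "positive (sets M) f" using f0 by (simp add: positive_def)
    show "countably_additive (sets M) f" using caf sM by simp
  qed (use that sM in auto)
  have "radon M"
  proof (rule radonI_le)
    fix K :: "'a set" assume "compact K"
    then show "emeasure M K < \<infinity>"
      using fin[of K] by (simp add: eM compact_borel f_eq compact_compacted_borel)
  next
    fix B :: "'a set" assume "B \<in> sets borel"
    then show "emeasure M B \<le> (SUP K\<in>{K. compact K \<and> K \<subseteq> B}. emeasure M K)"
      by (auto simp: eM f_def[of B] compact_borel f_eq compact_compacted_borel intro!: SUP_mono)
  qed (rule sM)
  then show ?thesis using that[of M] eM f_eq compacted_borel_borel by metis
qed

text \<open>Compact sets thus exhaust an integral even when no sequence of compact sets exhausts the
  space. The demand that \<open>K\<close> lie where \<open>f\<close> does not vanish serves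
  \<open>radon_density\<close>: for \<open>h\<close> times the indicator of \<open>B\<close> it
  forces \<open>K\<close> into \<open>B\<close>.\<close>

lemma radon_nn_integral_inner:
  assumes M: "radon M" and f: "f \<in> borel_measurable borel"
  shows "(\<integral>\<^sup>+x. f x \<partial>M) \<le> (SUP K\<in>{K. compact K \<and> K \<subseteq> {x. f x \<noteq> 0}}. \<integral>\<^sup>+x. f x * indicator K x \<partial>M)"
  using radon_measurable[OF M f]
proof (induction f rule: borel_measurable_induct)
  case (cong f g)
  then have "f = g" using M by auto
  then show ?case using cong by simp
next
  case (set A)
  have [simp]: "indicator A x * indicator K x = (indicator K x :: ennreal)" if "K \<subseteq> A" for K x
    using that by (auto split: split_indicator)
  have "emeasure M A = (SUP K\<in>{K. compact K \<and> K \<subseteq> A}. emeasure M K)"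
    using M set by (intro radon_inner) auto
  also have "\<dots> = (SUP K\<in>{K. compact K \<and> K \<subseteq> A}. \<integral>\<^sup>+x. indicator A x * indicator K x \<partial>M)"
    using M by (intro SUP_cong refl) (auto simp: compact_borel)
  finally show ?case using set by (simp add: indicator_eq_0_iff)
next
  case (mult u c)
  show ?case
  \<comment> \<open>For nonzero \<open>c\<close> the functions \<open>u\<close> and
    \<open>c * u\<close> have the same zeros; for \<open>c = 0\<close> the left side is 0.\<close>
  proof (cases "c = 0")
    case False
    have "(\<integral>\<^sup>+x. c * u x \<partial>M) = c * (\<integral>\<^sup>+x. u x \<partial>M)"
      using mult by (intro nn_integral_cmult) auto
    also have "\<dots> \<le> c * (SUP K\<in>{K. compact K \<and> K \<subseteq> {x. u x \<noteq> 0}}. \<integral>\<^sup>+x. u x * indicator K x \<partial>M)"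
      using mult by (intro mult_left_mono) auto
    also have "\<dots> = (SUP K\<in>{K. compact K \<and> K \<subseteq> {x. u x \<noteq> 0}}. c * (\<integral>\<^sup>+x. u x * indicator K x \<partial>M))"
      by (rule SUP_mult_left_ennreal)
    also have "\<dots> = (SUP K\<in>{K. compact K \<and> K \<subseteq> {x. u x \<noteq> 0}}. (\<integral>\<^sup>+x. c * u x * indicator K x \<partial>M))"
    proof (intro SUP_cong refl)
      fix K assume "K \<in> {K. compact K \<and> K \<subseteq> {x. u x \<noteq> 0}}"
      then have [measurable]: "K \<in> sets M" using M by (auto simp: compact_borel)
      show "c * (\<integral>\<^sup>+x. u x * indicator K x \<partial>M) = (\<integral>\<^sup>+x. c * u x * indicator K x \<partial>M)"
        using mult by (subst nn_integral_cmult[symmetric]) (auto simp: mult.assoc)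
    qed
    finally show ?thesis using False by simp
  qed simp
next
  case (add u v)
  have "(\<integral>\<^sup>+x. v x + u x \<partial>M) = (\<integral>\<^sup>+x. v x \<partial>M) + (\<integral>\<^sup>+x. u x \<partial>M)"
    using add by (intro nn_integral_add) auto
  also have "\<dots> \<le> (SUP K\<in>{K. compact K \<and> K \<subseteq> {x. v x \<noteq> 0}}. \<integral>\<^sup>+x. v x * indicator K x \<partial>M) +
     (SUP K\<in>{K. compact K \<and> K \<subseteq> {x. u x \<noteq> 0}}. \<integral>\<^sup>+x. u x * indicator K x \<partial>M)"
    using add by (intro add_mono) auto
  also have "\<dots> \<le> (SUP K\<in>{K. compact K \<and> K \<subseteq> {x. v x + u x \<noteq> 0}}. \<integral>\<^sup>+x. (v x + u x) * indicator K x \<partial>M)"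
  proof (rule SUP_add_SUP_le)
    fix K L assume K: "K \<in> {K. compact K \<and> K \<subseteq> {x. v x \<noteq> 0}}" and L: "L \<in> {K. compact K \<and> K \<subseteq> {x. u x \<noteq> 0}}"
    have [measurable]: "K \<in> sets M" "L \<in> sets M" using K L M compact_borel by auto
    have "(\<integral>\<^sup>+x. v x * indicator K x \<partial>M) + (\<integral>\<^sup>+x. u x * indicator L x \<partial>M)
        = (\<integral>\<^sup>+x. v x * indicator K x + u x * indicator L x \<partial>M)"
      using add by (intro nn_integral_add[symmetric]) auto
    also have "\<dots> \<le> (\<integral>\<^sup>+x. (v x + u x) * indicator (K \<union> L) x \<partial>M)"
      by (intro nn_integral_mono) (auto split: split_indicator)
    also have "\<dots> \<le> (SUP K\<in>{K. compact K \<and> K \<subseteq> {x. v x + u x \<noteq> 0}}. \<integral>\<^sup>+x. (v x + u x) * indicator K x \<partial>M)"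
      using K L by (intro SUP_upper) (auto simp: compact_Un)
    finally show "(\<integral>\<^sup>+x. v x * indicator K x \<partial>M) + (\<integral>\<^sup>+x. u x * indicator L x \<partial>M) \<le> \<dots>" .
  qed auto
  finally show ?case .
next
  case (seq U)
  have "(\<integral>\<^sup>+x. (SUP i. U i) x \<partial>M) = (SUP i. \<integral>\<^sup>+x. U i x \<partial>M)"
    using seq by (simp add: nn_integral_monotone_convergence_SUP image_comp)
  also have "\<dots> \<le> (SUP i. SUP K\<in>{K. compact K \<and> K \<subseteq> {x. U i x \<noteq> 0}}. \<integral>\<^sup>+x. U i x * indicator K x \<partial>M)"
    by (intro SUP_subset_mono[OF order_refl] seq.IH)
  also have "\<dots> \<le> (SUP K\<in>{K. compact K \<and> K \<subseteq> {x. (SUP i. U i) x \<noteq> 0}}. \<integral>\<^sup>+x. (SUP i. U i) x * indicator K x \<partial>M)"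
  proof (intro SUP_least)
    fix i K assume "K \<in> {K. compact K \<and> K \<subseteq> {x. U i x \<noteq> 0}}"
    moreover have le: "U i x \<le> (SUP i. U i) x" for x
      by (rule le_funD[OF SUP_upper]) simp
    moreover have "(SUP i. U i) x \<noteq> 0" if "U i x \<noteq> 0" for x using le[of x] that by (metis le_zero_eq)
    ultimately show "(\<integral>\<^sup>+x. U i x * indicator K x \<partial>M) \<le>
      (SUP K\<in>{K. compact K \<and> K \<subseteq> {x. (SUP i. U i) x \<noteq> 0}}. \<integral>\<^sup>+x. (SUP i. U i) x * indicator K x \<partial>M)"
      by (intro SUP_upper2[of K] nn_integral_mono mult_right_mono) auto
  qed
  finally show ?case .
qed

text \<open>The local bound gives finiteness on compact sets; inner regularity is
  \<open>radon_nn_integral_inner\<close> for \<open>h\<close> cut off to \<open>B\<close>.\<close>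

lemma radon_density:
  assumes M: "radon M" and h: "h \<in> borel_measurable borel"
    and bd: "\<And>K. compact K \<Longrightarrow> \<exists>c::real. \<forall>x\<in>K. h x \<le> ennreal c"
  shows "radon (density M h)"
proof (rule radonI_le)
  have hM[measurable]: "h \<in> borel_measurable M" using radon_measurable[OF M h] .
  fix K :: "'a set" assume K: "compact K"
  then obtain c where c: "\<forall>x\<in>K. h x \<le> ennreal c" using bd by blast
  have "emeasure (density M h) K = (\<integral>\<^sup>+x. h x * indicator K x \<partial>M)"
    using M K by (intro emeasure_density) (auto simp: compact_borel)
  also have "\<dots> \<le> (\<integral>\<^sup>+x. ennreal c * indicator K x \<partial>M)"
    using c by (intro nn_integral_mono) (auto split: split_indicator)
  also have "\<dots> = ennreal c * emeasure M K"
    using M K by (intro nn_integral_cmult_indicator) (auto simp: compact_borel)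
  also have "\<dots> < \<infinity>" using radon_compact[OF M K] by (simp add: ennreal_mult_less_top)
  finally show "emeasure (density M h) K < \<infinity>" .
next
  have hM[measurable]: "h \<in> borel_measurable M" using radon_measurable[OF M h] .
  fix B :: "'a set" assume B: "B \<in> sets borel"
  have "emeasure (density M h) B = (\<integral>\<^sup>+x. h x * indicator B x \<partial>M)"
    using M B by (intro emeasure_density) auto
  also have "\<dots> \<le> (SUP K\<in>{K. compact K \<and> K \<subseteq> {x. h x * indicator B x \<noteq> 0}}. \<integral>\<^sup>+x. (h x * indicator B x) * indicator K x \<partial>M)"
    using B h by (intro radon_nn_integral_inner M) auto
  also have "\<dots> \<le> (SUP K\<in>{K. compact K \<and> K \<subseteq> B}. emeasure (density M h) K)"
  proof (intro SUP_mono)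
    fix K assume "K \<in> {K. compact K \<and> K \<subseteq> {x. h x * indicator B x \<noteq> 0}}"
    then have K: "compact K" "K \<subseteq> B" by (auto simp: indicator_def split: if_splits)
    have "emeasure (density M h) K = (\<integral>\<^sup>+x. h x * indicator K x \<partial>M)"
      using M K by (intro emeasure_density) (auto simp: compact_borel)
    also have "\<dots> = (\<integral>\<^sup>+x. (h x * indicator B x) * indicator K x \<partial>M)"
      using K by (intro nn_integral_cong) (auto split: split_indicator)
    finally show "\<exists>m\<in>{K. compact K \<and> K \<subseteq> B}. (\<integral>\<^sup>+x. (h x * indicator B x) * indicator K x \<partial>M)
        \<le> emeasure (density M h) m" using K by (intro bexI[of _ K]) auto
  qed
  finally show "emeasure (density M h) B \<le> (SUP K\<in>{K. compact K \<and> K \<subseteq> B}. emeasure (density M h) K)" .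
qed (use M in simp)

text \<open>Inner regularity passes to images because a compact subset of the preimage of
  \<open>B\<close> may be replaced by its image, a compact subset of \<open>B\<close>. Finiteness
  has to be assumed, since preimages of compact sets under \<open>p\<close> need not be
  compact.\<close>

lemma radon_distr:
  fixes p :: "'a::t2_space \<Rightarrow> 'b::t2_space"
  assumes M: "radon M" and p: "continuous_on UNIV p"
    and fin: "\<And>K. compact K \<Longrightarrow> emeasure M (p -` K) < \<infinity>"
  shows "radon (distr M borel p)"
proof -
  have pm: "p \<in> borel_measurable borel" using borel_measurable_continuous_onI[OF p] .
  have pM: "p \<in> borel_measurable M" using radon_measurable[OF M pm] .
  have e: "emeasure (distr M borel p) B = emeasure M (p -` B)" if "B \<in> sets borel" for B
    using emeasure_distr[OF pM] that M by simp
  show ?thesis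
  proof (rule radonI_le)
    show "emeasure (distr M borel p) K < \<infinity>" if "compact K" for K
      using fin[OF that] e[OF compact_borel[OF that]] by simp
    fix B :: "'b set" assume B: "B \<in> sets borel"
    have "p -` B \<in> sets borel" using measurable_sets[OF pm B] by simp
    then have "emeasure M (p -` B) = (SUP K\<in>{K. compact K \<and> K \<subseteq> p -` B}. emeasure M K)"
      by (rule radon_inner[OF M])
    also have "\<dots> \<le> (SUP K\<in>{K. compact K \<and> K \<subseteq> B}. emeasure M (p -` K))"
    proof (rule SUP_mono)
      fix K assume K: "K \<in> {K. compact K \<and> K \<subseteq> p -` B}"
      then have c: "compact (p ` K)" using compact_continuous_image[OF continuous_on_subset[OF p]] by simp
      have "emeasure M K \<le> emeasure M (p -` p ` K)"
        using measurable_sets[OF pm compact_borel[OF c]] M by (intro emeasure_mono) auto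
      then show "\<exists>m\<in>{K. compact K \<and> K \<subseteq> B}. emeasure M K \<le> emeasure M (p -` m)"
        using c K by (intro bexI[of _ "p ` K"]) auto
    qed
    also have "\<dots> = (SUP K\<in>{K. compact K \<and> K \<subseteq> B}. emeasure (distr M borel p) K)"
      by (intro SUP_cong refl) (simp add: e compact_borel)
    finally show "emeasure (distr M borel p) B \<le> \<dots>" using e[OF B] by simp
  qed simp
qed

text \<open>The compact sets that nearly attain the suprema for the several measures differ; their
  union serves all of them at once.\<close>

lemma radon_sum:
  fixes a :: "'i \<Rightarrow> real" and N :: "'i \<Rightarrow> 'a::t2_space measure"
  assumes "finite J" "\<And>j. j \<in> J \<Longrightarrow> radon (N j)"
  obtains S where "radon S" "\<And>B. B \<in> sets borel \<Longrightarrow> emeasure S B = (\<Sum>j\<in>J. ennreal (a j) * emeasure (N j) B)"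
proof -
  define f where "f B = (\<Sum>j\<in>J. ennreal (a j) * emeasure (N j) B)" for B
  define S where "S = measure_of UNIV (sets borel) f"
  have sS: "sets S = sets borel"
    unfolding S_def using sets.sets_measure_of_eq[of borel] by simp
  have eS: "emeasure S B = f B" if "B \<in> sets borel" for B
  proof (rule emeasure_measure_of[OF S_def])
    show "positive (sets S) f" by (simp add: positive_def f_def)
    show "countably_additive (sets S) f"
    proof (rule countably_additiveI)
      fix A :: "nat \<Rightarrow> 'a set" assume A: "range A \<subseteq> sets S" "disjoint_family A"
      have "(\<Sum>i. f (A i)) = (\<Sum>j\<in>J. \<Sum>i. ennreal (a j) * emeasure (N j) (A i))"
        unfolding f_def by (rule suminf_sum) simp
      also have "\<dots> = (\<Sum>j\<in>J. ennreal (a j) * (\<Sum>i. emeasure (N j) (A i)))" by simp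
      also have "\<dots> = f (\<Union>i. A i)"
        unfolding f_def using A assms sS by (intro sum.cong refl arg_cong2[of _ _ _ _ "(*)"] suminf_emeasure) auto
      finally show "(\<Sum>i. f (A i)) = f (\<Union>i. A i)" .
    qed
  qed (use that sS in auto)
  have sup: "f B \<le> (SUP K\<in>{K. compact K \<and> K \<subseteq> B}. f K)" if B: "B \<in> sets borel" for B
    unfolding f_def using assms
  proof (induction J)
    case (insert j J)
    let ?F = "{K. compact K \<and> K \<subseteq> B}"
    let ?g = "\<lambda>K. ennreal (a j) * emeasure (N j) K" and ?h = "\<lambda>K. \<Sum>j\<in>J. ennreal (a j) * emeasure (N j) K"
    have "?g B = ennreal (a j) * (SUP K\<in>?F. emeasure (N j) K)"
      using insert B radon_inner[of "N j" B] by simp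
    also have "\<dots> = (SUP K\<in>?F. ?g K)" by (rule SUP_mult_left_ennreal)
    finally have "?g B + ?h B \<le> (SUP K\<in>?F. ?g K) + (SUP K\<in>?F. ?h K)"
      using insert by (intro add_mono) auto
    also have "\<dots> \<le> (SUP K\<in>?F. ?g K + ?h K)"
    proof (rule SUP_add_SUP_le)
      fix K L assume KL: "K \<in> ?F" "L \<in> ?F"
      have m: "emeasure (N i) K \<le> emeasure (N i) (K \<union> L)" "emeasure (N i) L \<le> emeasure (N i) (K \<union> L)" if "i \<in> insert j J" for i
        using KL insert.prems[OF that] by (auto intro!: emeasure_mono simp: compact_borel)
      have "?g K + ?h L \<le> ?g (K \<union> L) + ?h (K \<union> L)"
        using m by (intro add_mono sum_mono mult_left_mono) auto
      also have "\<dots> \<le> (SUP K\<in>?F. ?g K + ?h K)"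
        using KL by (intro SUP_upper) (auto simp: compact_Un)
      finally show "?g K + ?h L \<le> (SUP K\<in>?F. ?g K + ?h K)" .
    qed auto
    finally show ?case using insert by simp
  qed simp
  have "radon S"
  proof (rule radonI_le)
    fix K :: "'a set" assume K: "compact K"
    then show "emeasure S K < \<infinity>" using assms radon_compact[OF _ K]
      by (auto simp: eS compact_borel f_def ennreal_mult_less_top)
  next
    fix B :: "'a set" assume "B \<in> sets borel"
    moreover have "(SUP K\<in>{K. compact K \<and> K \<subseteq> B}. emeasure S K) = (SUP K\<in>{K. compact K \<and> K \<subseteq> B}. f K)"
      by (intro SUP_cong refl) (simp add: eS compact_borel)
    ultimately show "emeasure S B \<le> (SUP K\<in>{K. compact K \<and> K \<subseteq> B}. emeasure S K)"
      using sup[of B] by (simp add: eS)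
  qed (rule sS)
  then show ?thesis using that[of S] eS f_def by simp
qed

lemma superadditive_sum_le:
  fixes f :: "'a set \<Rightarrow> ennreal"
  assumes sup: "\<And>A B. A \<inter> B = {} \<Longrightarrow> f A + f B \<le> f (A \<union> B)" and B: "disjoint_family (B :: nat \<Rightarrow> _)"
  shows "(\<Sum>i<n. f (B i)) \<le> f (\<Union>i<n. B i)"
proof (induction n)
  case (Suc n)
  have "(\<Sum>i<Suc n. f (B i)) \<le> f (\<Union>i<n. B i) + f (B n)" using Suc by (simp add: add_right_mono)
  also have "\<dots> \<le> f ((\<Union>i<n. B i) \<union> B n)"
  proof (rule sup)
    have "B i \<inter> B n = {}" if "i < n" for i
      using disjoint_family_onD[OF B, of i n] that by simp
    then show "(\<Union>i<n. B i) \<inter> B n = {}" by blast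
  qed
  finally show ?case by (simp add: lessThan_Suc Un_commute)
qed simp

lemma superadditive_suminf_le:
  fixes f :: "'a set \<Rightarrow> ennreal"
  assumes sup: "\<And>A B. A \<inter> B = {} \<Longrightarrow> f A + f B \<le> f (A \<union> B)" and B: "disjoint_family (B :: nat \<Rightarrow> _)"
    and mono: "\<And>n. f (\<Union>i<n. B i) \<le> f (\<Union>i. B i)"
  shows "(\<Sum>i. f (B i)) \<le> f (\<Union>i. B i)"
  proof (rule suminf_le_const)
  show "(\<Sum>i<n. f (B i)) \<le> f (\<Union>i. B i)" for n
    using superadditive_sum_le[OF sup B, of n] mono[of n] by (rule order_trans)
qed simp

lemma superadditive_partition_le:
  fixes f :: "'a set \<Rightarrow> ennreal"
  assumes sup: "\<And>A B. A \<inter> B = {} \<Longrightarrow> f A + f B \<le> f (A \<union> B)" and "finite P" "disjoint P"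
  shows "(\<Sum>B\<in>P. f B) \<le> f (\<Union>P)"
  using assms(2,3)
proof (induction P)
  case (insert B P)
  have d: "B \<inter> \<Union>P = {}" using insert by (auto simp: disjoint_def)
  have "disjoint P" using insert.prems by (simp add: pairwise_insert)
  then have "(\<Sum>B\<in>insert B P. f B) \<le> f B + f (\<Union>P)" using insert by (simp add: add_left_mono)
  also have "\<dots> \<le> f (B \<union> \<Union>P)" by (rule sup[OF d])
  finally show ?case by simp
qed simp

section \<open>Jordan decomposition on compacted Borel sets\<close>

text \<open>Cutting negative numbers off at 0 makes \<open>ennreal\<close> subadditive on the reals,
  which lets positive variations be estimated termwise.\<close>

lemma ennreal_add_le: "ennreal (a + b) \<le> ennreal a + ennreal b"
proof (cases "a \<ge> 0 \<and> b \<ge> 0")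
  case False
  then consider "a < 0" | "b < 0" by linarith
  then show ?thesis
  proof cases
    case 1
    then have "ennreal (a + b) \<le> ennreal b" by (intro ennreal_leI) simp
    then show ?thesis using 1 by (simp add: ennreal_neg)
  next
    case 2
    then have "ennreal (a + b) \<le> ennreal a" by (intro ennreal_leI) simp
    then show ?thesis using 2 by (simp add: ennreal_neg)
  qed
qed simp

lemma ennreal_sum_le: "ennreal (\<Sum>i\<in>I. x i) \<le> (\<Sum>i\<in>I. ennreal (x i))"
proof (induction I rule: infinite_finite_induct)
  case (insert i I)
  have "ennreal (\<Sum>i\<in>insert i I. x i) \<le> ennreal (x i) + ennreal (\<Sum>i\<in>I. x i)"
    using insert ennreal_add_le by simp
  also have "\<dots> \<le> ennreal (x i) + (\<Sum>i\<in>I. ennreal (x i))" using insert by (intro add_left_mono)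
  finally show ?case using insert by simp
qed auto

lemma ennreal_sums_le:
  assumes "x sums s" shows "ennreal s \<le> (\<Sum>i. ennreal (x i))"
proof (rule LIMSEQ_le_const2)
  show "(\<lambda>n. ennreal (\<Sum>i<n. x i)) \<longlonglongrightarrow> ennreal s"
    using assms unfolding sums_def by (rule tendsto_ennrealI)
  have "ennreal (\<Sum>i<n. x i) \<le> (\<Sum>i. ennreal (x i))" for n
    using ennreal_sum_le[of x "{..<n}"] sum_le_suminf[of "\<lambda>i. ennreal (x i)" "{..<n}"]
    by (force intro: order_trans)
  then show "\<exists>N. \<forall>n\<ge>N. ennreal (\<Sum>i<n. x i) \<le> (\<Sum>i. ennreal (x i))" by blast
qed

text \<open>Jordan theory is carried out once for real set functions; the real and imaginary parts
  of a complex measure and their negatives are the four instances.\<close>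

locale signed_cb =
  fixes \<nu> :: "'a::t2_space set \<Rightarrow> real"
  assumes sums: "\<And>A :: nat \<Rightarrow> 'a set. range A \<subseteq> compacted_borel \<Longrightarrow> disjoint_family A \<Longrightarrow>
      (\<Union>i. A i) \<in> compacted_borel \<Longrightarrow> (\<lambda>i. \<nu> (A i)) sums \<nu> (\<Union>i. A i)"
begin

text \<open>The constant series with the value at the empty set as its term can converge only if
  that value is 0.\<close>

lemma empty [simp]: "\<nu> {} = 0"
proof -
  have "(\<lambda>i. \<nu> ((\<lambda>_::nat. {}) i)) sums \<nu> (\<Union>i::nat. {})"
    by (rule sums) (auto simp: disjoint_family_on_def)
  then have "summable (\<lambda>i::nat. \<nu> {})" by (simp only: sums_iff)
  then have "(\<lambda>i::nat. \<nu> {}) \<longlonglongrightarrow> 0" by (rule summable_LIMSEQ_zero)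
  then show ?thesis by (simp add: LIMSEQ_const_iff)
qed

lemma add:
  assumes "A \<in> compacted_borel" "B \<in> compacted_borel" "A \<inter> B = {}"
  shows "\<nu> (A \<union> B) = \<nu> A + \<nu> B"
proof -
  have "(\<lambda>i. \<nu> (binaryset A B i)) sums \<nu> (\<Union>i. binaryset A B i)"
    using assms
    by (intro sums) (auto simp: range_binaryset_eq UN_binaryset_eq disjoint_family_on_def binaryset_def
       intro: compacted_borel_Un)
  moreover have "(\<lambda>i. \<nu> (binaryset A B i)) sums (\<nu> A + \<nu> B)"
    using binaryset_sums[of \<nu> A B] by simp
  ultimately show ?thesis by (simp add: UN_binaryset_eq sums_unique2)
qed

lemma diff:
  assumes "A \<in> compacted_borel" "B \<in> sets borel" "B \<subseteq> A"
  shows "\<nu> (A - B) = \<nu> A - \<nu> B"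
  using add[of B "A - B"] assms compacted_borel_subset[of A B] compacted_borel_Diff[of A B]
  by (simp add: Un_absorb1)

abbreviation PV where "PV \<equiv> positive_variation compacted_borel \<nu>"

lemma PV_upper: "C \<in> compacted_borel \<Longrightarrow> C \<subseteq> B \<Longrightarrow> ennreal (\<nu> C) \<le> PV B"
  unfolding positive_variation_def by (rule SUP_upper) auto

lemma PV_mono: "A \<subseteq> B \<Longrightarrow> PV A \<le> PV B"
  unfolding positive_variation_def by (rule SUP_subset_mono) auto

lemma PV_empty [simp]: "PV {} = 0"
  unfolding positive_variation_def by (auto intro!: antisym SUP_least)

lemma PV_superadditive: "A \<inter> B = {} \<Longrightarrow> PV A + PV B \<le> PV (A \<union> B)"
  unfolding positive_variation_def[of _ _ A] positive_variation_def[of _ _ B]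
proof (rule SUP_add_SUP_le)
  fix C D assume AB: "A \<inter> B = {}" and "C \<in> {C \<in> compacted_borel. C \<subseteq> A}" "D \<in> {C \<in> compacted_borel. C \<subseteq> B}"
  then have CD: "C \<in> compacted_borel" "D \<in> compacted_borel" "C \<subseteq> A" "D \<subseteq> B" "C \<inter> D = {}" by auto
  \<comment> \<open>A negative value counts as 0 after \<open>ennreal\<close>, so the other set
    alone is then a competitor; with two nonnegative values the union is one.\<close>
  consider "\<nu> C < 0" | "\<nu> D < 0" | "\<nu> C \<ge> 0 \<and> \<nu> D \<ge> 0" by linarith
  then show "ennreal (\<nu> C) + ennreal (\<nu> D) \<le> PV (A \<union> B)"
  proof cases
    case 1 then show ?thesis using CD PV_upper[of D "A \<union> B"] by (auto simp: ennreal_neg)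
  next
    case 2 then show ?thesis using CD PV_upper[of C "A \<union> B"] by (auto simp: ennreal_neg)
  next
    case 3
    then have "ennreal (\<nu> C) + ennreal (\<nu> D) = ennreal (\<nu> (C \<union> D))" using add[OF CD(1,2,5)] by simp
    also have "\<dots> \<le> PV (A \<union> B)" using CD by (intro PV_upper compacted_borel_Un) auto
    finally show ?thesis .
  qed
qed (auto intro: compacted_borel_empty)

text \<open>A competitor \<open>C\<close> for the union is cut into the sets
  \<open>C \<inter> A i\<close>, which compete for the single terms.\<close>

lemma PV_suminf:
  fixes A :: "nat \<Rightarrow> 'a set"
  assumes A: "range A \<subseteq> compacted_borel" "disjoint_family A" "(\<Union>i. A i) \<in> compacted_borel"
  shows "PV (\<Union>i. A i) = (\<Sum>i. PV (A i))"
proof (rule antisym)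
  show "(\<Sum>i. PV (A i)) \<le> PV (\<Union>i. A i)"
    by (rule superadditive_suminf_le[OF PV_superadditive A(2)]) (auto intro: PV_mono)
  show "PV (\<Union>i. A i) \<le> (\<Sum>i. PV (A i))"
    unfolding positive_variation_def[of _ _ "\<Union>i. A i"]
  proof (rule SUP_least)
    fix C assume "C \<in> {C \<in> compacted_borel. C \<subseteq> (\<Union>i. A i)}"
    then have C: "C \<in> compacted_borel" "C \<subseteq> (\<Union>i. A i)" by auto
    have CA: "C \<inter> A i \<in> compacted_borel" for i
      using C A by (intro compacted_borel_Int compacted_borel_borel[of "A i"]) auto
    have eq: "(\<Union>i. C \<inter> A i) = C" using C by auto
    have "(\<lambda>i. \<nu> (C \<inter> A i)) sums \<nu> (\<Union>i. C \<inter> A i)"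
      using A CA C eq by (intro sums) (auto simp: disjoint_family_on_def)
    then have "ennreal (\<nu> C) \<le> (\<Sum>i. ennreal (\<nu> (C \<inter> A i)))" using eq ennreal_sums_le by simp
    also have "\<dots> \<le> (\<Sum>i. PV (A i))" using CA by (intro suminf_le PV_upper) auto
    finally show "ennreal (\<nu> C) \<le> (\<Sum>i. PV (A i))" .
  qed
qed

lemma PV_add:
  assumes "A \<in> compacted_borel" "B \<in> compacted_borel" "A \<inter> B = {}"
  shows "PV (A \<union> B) = PV A + PV B"
  by (rule binary_additive[where R = compacted_borel, OF PV_suminf])
     (use assms in \<open>auto intro: compacted_borel_Un\<close>)

text \<open>If \<open>\<nu>\<close> had infinite positive variation on \<open>A\<close>, one could split off successively infinitely many
  disjoint pieces on which \<open>\<bar>\<nu>\<bar> \<ge> 1\<close>, contradicting convergence.\<close>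

lemma PV_finite:
  assumes A: "A \<in> compacted_borel" shows "PV A < \<infinity>"
proof (rule ccontr)
  assume "\<not> PV A < \<infinity>"
  then have inf: "PV A = \<infinity>" by (metis top.not_eq_extremum infinity_ennreal_def)
  define Q where "Q E \<longleftrightarrow> E \<in> compacted_borel \<and> PV E = \<infinity>" for E
  have step: "\<exists>E'. Q E' \<and> E' \<subseteq> E \<and> \<bar>\<nu> (E - E')\<bar> \<ge> 1" if "Q E" for E
  proof -
    have E: "E \<in> compacted_borel" "PV E = \<infinity>" using that by (auto simp: Q_def)
    \<comment> \<open>The threshold makes both \<open>\<nu> C\<close> and
      \<open>\<bar>\<nu> (E - C)\<bar>\<close> exceed 1. So whichever of \<open>C\<close> and
      \<open>E - C\<close> keeps the infinite variation, the piece split off has absolute value at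
      least 1.\<close>
    have "ennreal (\<bar>\<nu> E\<bar> + 1) < PV E" using E by simp
    then obtain C where C: "C \<in> compacted_borel" "C \<subseteq> E" "ennreal (\<bar>\<nu> E\<bar> + 1) < ennreal (\<nu> C)"
      unfolding positive_variation_def by (auto simp: less_SUP_iff)
    then have nC: "\<nu> C > \<bar>\<nu> E\<bar> + 1" by (simp add: ennreal_less_iff del: ennreal_plus)
    have bC: "C \<in> sets borel" using C by (simp add: compacted_borel_borel)
    have d: "\<nu> (E - C) = \<nu> E - \<nu> C" using E C bC by (intro diff)
    have EC: "E - C \<in> compacted_borel" using E bC by (intro compacted_borel_Diff)
    have "PV E = PV C + PV (E - C)"
      using PV_add[OF C(1) EC] C(2) by (simp add: Un_absorb1)
    then consider "PV C = \<infinity>" | "PV (E - C) = \<infinity>" using E by (metis ennreal_add_eq_top infinity_ennreal_def)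
    then show ?thesis
    proof cases
      case 1
      then show ?thesis using C nC d by (intro exI[of _ C]) (auto simp: Q_def)
    next
      case 2
      moreover have "E - (E - C) = C" using C by auto
      ultimately show ?thesis using EC nC by (intro exI[of _ "E - C"]) (auto simp: Q_def)
    qed
  qed
  have "\<exists>E. \<forall>n. Q (E n) \<and> E (Suc n) \<subseteq> E n \<and> \<bar>\<nu> (E n - E (Suc n))\<bar> \<ge> 1"
    using dependent_nat_choice[of "\<lambda>_. Q" "\<lambda>_ E E'. E' \<subseteq> E \<and> \<bar>\<nu> (E - E')\<bar> \<ge> 1"] step A inf
    by (auto simp: Q_def)
  then obtain E :: "nat \<Rightarrow> 'a set" where E: "\<And>n. Q (E n)" "\<And>n. E (Suc n) \<subseteq> E n" "\<And>n. \<bar>\<nu> (E n - E (Suc n))\<bar> \<ge> 1"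
    by blast
  define D where "D n = E n - E (Suc n)" for n
  have dec: "E n \<subseteq> E m" if "m \<le> n" for m n using lift_Suc_antimono_le[of E m n] E(2) that by blast
  have Ecb: "E n \<in> compacted_borel" for n using E by (auto simp: Q_def)
  have Dcb: "D n \<in> compacted_borel" for n
    unfolding D_def using Ecb by (intro compacted_borel_Diff) (auto simp: compacted_borel_borel)
  have disj: "D m \<inter> D n = {}" if "m < n" for m n
    using dec[of "Suc m" n] that by (auto simp: D_def)
  have "disjoint_family D"
    unfolding disjoint_family_on_def using disj by (metis Int_commute linorder_neqE_nat)
  moreover have "(\<Union>n. D n) \<in> compacted_borel"
    using Dcb dec[of 0] by (intro compacted_borel_subset[OF Ecb[of 0]] sets.countable_UN)
      (auto simp: compacted_borel_borel D_def)
  ultimately have "(\<lambda>n. \<nu> (D n)) sums \<nu> (\<Union>n. D n)" using Dcb by (intro sums) auto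
  then have "(\<lambda>n. \<nu> (D n)) \<longlonglongrightarrow> 0" by (simp add: summable_LIMSEQ_zero sums_iff)
  then have "\<exists>n. \<bar>\<nu> (D n)\<bar> < 1"
    by (metis (no_types, lifting) LIMSEQ_iff le_refl real_norm_def diff_zero zero_less_one)
  then show False using E(3) D_def by (metis not_le)
qed

end

lemma signed_cb_uminus: "signed_cb \<nu> \<Longrightarrow> signed_cb (\<lambda>B. - \<nu> B)"
  unfolding signed_cb_def by (auto intro: sums_minus)

context signed_cb
begin

text \<open>Complementation in \<open>A\<close> exchanges the two variations:
  \<open>\<nu> C = \<nu> A - \<nu> (A - C)\<close> turns a bound for \<open>- \<nu>\<close> on the
  subsets of \<open>A\<close> into one for \<open>\<nu>\<close>, and conversely. By
  \<open>PV_finite\<close> the difference is one of real numbers.\<close>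

lemma jordan:
  assumes A: "A \<in> compacted_borel"
  shows "\<nu> A = enn2real (PV A) - enn2real (positive_variation compacted_borel (\<lambda>B. - \<nu> B) A)"
proof -
  interpret n: signed_cb "\<lambda>B. - \<nu> B" by (rule signed_cb_uminus) unfold_locales
  have le: "\<nu> C \<le> enn2real (PV A)" if "C \<in> compacted_borel" "C \<subseteq> A" for C
    using PV_upper[OF that] PV_finite[OF A] by (cases "\<nu> C \<ge> 0")
      (auto simp: enn2real_nonneg ennreal_enn2real_if order_trans[OF less_imp_le] intro: ennreal_le_iff[THEN iffD1]
        dest: enn2real_mono)
  have le': "- \<nu> C \<le> enn2real (n.PV A)" if "C \<in> compacted_borel" "C \<subseteq> A" for C
    using n.PV_upper[OF that] n.PV_finite[OF A] by (cases "- \<nu> C \<ge> 0")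
      (auto simp: enn2real_nonneg ennreal_enn2real_if order_trans[OF less_imp_le] intro: ennreal_le_iff[THEN iffD1]
        dest: enn2real_mono)
  have bd: "PV A \<le> ennreal r" if "\<And>C. C \<in> compacted_borel \<Longrightarrow> C \<subseteq> A \<Longrightarrow> \<nu> C \<le> r" for r
    unfolding positive_variation_def using that by (intro SUP_least ennreal_leI) auto
  have bd': "n.PV A \<le> ennreal r" if "\<And>C. C \<in> compacted_borel \<Longrightarrow> C \<subseteq> A \<Longrightarrow> - \<nu> C \<le> r" for r
    unfolding positive_variation_def using that by (intro SUP_least ennreal_leI) auto
  have AC: "\<nu> (A - C) = \<nu> A - \<nu> C" "A - C \<in> compacted_borel" if "C \<in> compacted_borel" "C \<subseteq> A" for C
    using diff[of A C] compacted_borel_Diff[of A C] that A by (auto simp: compacted_borel_borel)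
  have "PV A \<le> ennreal (\<nu> A + enn2real (n.PV A))"
  proof (rule bd)
    fix C assume C: "C \<in> compacted_borel" "C \<subseteq> A"
    show "\<nu> C \<le> \<nu> A + enn2real (n.PV A)" using le'[of "A - C"] AC[OF C] by auto
  qed
  then have 1: "enn2real (PV A) \<le> \<nu> A + enn2real (n.PV A)"
    using enn2real_leI le'[of A] A by auto
  have "n.PV A \<le> ennreal (- \<nu> A + enn2real (PV A))"
  proof (rule bd')
    fix C assume C: "C \<in> compacted_borel" "C \<subseteq> A"
    show "- \<nu> C \<le> - \<nu> A + enn2real (PV A)" using le[of "A - C"] AC[OF C] by auto
  qed
  then have 2: "enn2real (n.PV A) \<le> - \<nu> A + enn2real (PV A)"
    using enn2real_leI le[of A] A by auto
  show ?thesis using 1 2 by simp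
qed

end

section \<open>Total variation\<close>

lemma total_variation_upper:
  "finite P \<Longrightarrow> partition_on A P \<Longrightarrow> P \<subseteq> R \<Longrightarrow> (\<Sum>B\<in>P. ennreal (cmod (\<mu> B))) \<le> total_variation R \<mu> A"
  unfolding total_variation_def by (rule SUP_upper) auto

text \<open>For a set without a finite partition into members of \<open>R\<close> the supremum is
  empty and takes the default value 0; hence the two existence hypotheses.\<close>

lemma total_variation_superadditive:
  assumes "\<exists>P. finite P \<and> partition_on A P \<and> P \<subseteq> R" "\<exists>P. finite P \<and> partition_on B P \<and> P \<subseteq> R" "A \<inter> B = {}"
  shows "total_variation R \<mu> A + total_variation R \<mu> B \<le> total_variation R \<mu> (A \<union> B)"
  unfolding total_variation_def[of _ _ A] total_variation_def[of _ _ B]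
proof (rule SUP_add_SUP_le)
  fix P Q assume P: "P \<in> {P. finite P \<and> partition_on A P \<and> P \<subseteq> R}" and Q: "Q \<in> {P. finite P \<and> partition_on B P \<and> P \<subseteq> R}"
  \<comment> \<open>A common member would lie in \<open>A \<inter> B\<close> and so be empty, which
    partitions exclude.\<close>
  have "P \<inter> Q = {}"
  proof -
    have "B' = {}" if "B' \<in> P" "B' \<in> Q" for B'
      using that P Q assms(3) by (auto simp: partition_on_def)
    then show ?thesis using P by (auto simp: partition_on_def)
  qed
  then have "(\<Sum>B\<in>P. ennreal (cmod (\<mu> B))) + (\<Sum>B\<in>Q. ennreal (cmod (\<mu> B))) = (\<Sum>B\<in>P \<union> Q. ennreal (cmod (\<mu> B)))"
    using P Q by (intro sum.union_disjoint[symmetric]) auto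
  also have "\<dots> \<le> total_variation R \<mu> (A \<union> B)"
    using P Q assms(3)
    by (intro total_variation_upper) (auto simp: partition_on_def intro!: disjoint_union)
  finally show "(\<Sum>B\<in>P. ennreal (cmod (\<mu> B))) + (\<Sum>B\<in>Q. ennreal (cmod (\<mu> B))) \<le> total_variation R \<mu> (A \<union> B)" .
qed (use assms in auto)

lemma ennreal_norm_sums_le:
  fixes x :: "nat \<Rightarrow> 'a::real_normed_vector"
  assumes "x sums s" shows "ennreal (norm s) \<le> (\<Sum>i. ennreal (norm (x i)))"
proof (rule LIMSEQ_le_const2)
  show "(\<lambda>n. ennreal (norm (\<Sum>i<n. x i))) \<longlonglongrightarrow> ennreal (norm s)"
    using assms unfolding sums_def by (intro tendsto_ennrealI tendsto_norm)
  have "ennreal (norm (\<Sum>i<n. x i)) \<le> (\<Sum>i. ennreal (norm (x i)))" for n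
  proof -
    have "ennreal (norm (\<Sum>i<n. x i)) \<le> ennreal (\<Sum>i<n. norm (x i))" by (intro ennreal_leI norm_sum)
    also have "\<dots> = (\<Sum>i<n. ennreal (norm (x i)))" by (rule sum_ennreal[symmetric]) simp
    also have "\<dots> \<le> (\<Sum>i. ennreal (norm (x i)))" by (rule sum_le_suminf) auto
    finally show ?thesis .
  qed
  then show "\<exists>N. \<forall>n\<ge>N. ennreal (norm (\<Sum>i<n. x i)) \<le> (\<Sum>i. ennreal (norm (x i)))" by blast
qed

text \<open>The members of \<open>P\<close> may be any sets; only their traces on \<open>C\<close>
  have to lie in \<open>R\<close>. Empty traces, possibly several, are dropped because a partition
  contains no empty set; they contribute \<open>\<mu> {} = 0\<close>.\<close>

lemma total_variation_refine:
  assumes P: "finite P" "disjoint P" "C \<subseteq> \<Union>P" "\<And>B. B \<in> P \<Longrightarrow> B \<inter> C \<in> R" and e: "\<mu> {} = 0"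
  shows "(\<Sum>B\<in>P. ennreal (cmod (\<mu> (B \<inter> C)))) \<le> total_variation R \<mu> C"
proof -
  let ?h = "\<lambda>B. B \<inter> C"
  have "(\<Sum>B\<in>P. ennreal (cmod (\<mu> (B \<inter> C)))) = (\<Sum>D\<in>?h ` P. ennreal (cmod (\<mu> D)))"
  proof (subst sum.reindex_nontrivial)
    fix x y assume xy: "x \<in> P" "y \<in> P" "x \<noteq> y" "x \<inter> C = y \<inter> C"
    then have "x \<inter> y = {}" using P(2) by (auto simp: disjoint_def)
    then have "x \<inter> C = {}" using xy by auto
    then show "ennreal (cmod (\<mu> (x \<inter> C))) = 0" using e by simp
  qed (use P in auto)
  also have "\<dots> = (\<Sum>D\<in>?h ` P - {{}}. ennreal (cmod (\<mu> D)))"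
    using P e by (intro sum.mono_neutral_right) auto
  also have "\<dots> \<le> total_variation R \<mu> C"
  proof (rule total_variation_upper)
    show "partition_on C (?h ` P - {{}})"
      unfolding partition_on_def
    proof (intro conjI disjointI)
      fix a b assume "a \<in> ?h ` P - {{}}" "b \<in> ?h ` P - {{}}" "a \<noteq> b"
      then obtain B D where "B \<in> P" "D \<in> P" "a = B \<inter> C" "b = D \<inter> C" "B \<noteq> D" by auto
      then show "a \<inter> b = {}" using disjointD[OF P(2), of B D] by auto
    next
      show "\<Union> (?h ` P - {{}}) = C" using P(3) by blast
    qed auto
  qed (use P in auto)
  finally show ?thesis .
qed

lemma compacted_borel_partition:
  "A \<in> compacted_borel \<Longrightarrow> \<exists>P. finite P \<and> partition_on A P \<and> P \<subseteq> compacted_borel"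
  by (rule exI[of _ "{A} - {{}}"]) (auto simp: partition_on_def disjoint_def)

locale complex_cb =
  fixes \<mu> :: "'a::t2_space set \<Rightarrow> complex"
  assumes measure_on: "complex_measure_on compacted_borel \<mu>"
begin

lemma sums: "range A \<subseteq> compacted_borel \<Longrightarrow> disjoint_family A \<Longrightarrow>
      (\<Union>i::nat. A i) \<in> compacted_borel \<Longrightarrow> (\<lambda>i. \<mu> (A i)) sums \<mu> (\<Union>i. A i)"
  and off: "B \<notin> compacted_borel \<Longrightarrow> \<mu> B = 0"
  using measure_on unfolding complex_measure_on_def by auto

sublocale re: signed_cb "\<lambda>B. Re (\<mu> B)"
  by unfold_locales (intro sums_Re sums)

sublocale im: signed_cb "\<lambda>B. Im (\<mu> B)"
  by unfold_locales (intro sums_Im sums)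

sublocale nre: signed_cb "\<lambda>B. - Re (\<mu> B)"
  by (rule signed_cb_uminus) unfold_locales

sublocale nim: signed_cb "\<lambda>B. - Im (\<mu> B)"
  by (rule signed_cb_uminus) unfold_locales

lemma empty [simp]: "\<mu> {} = 0"
  using re.empty im.empty by (simp add: complex_eq_iff)

lemma tv_ge: "A \<in> compacted_borel \<Longrightarrow> ennreal (cmod (\<mu> A)) \<le> cb_variation \<mu> A"
  using total_variation_refine[of "{A}" A compacted_borel \<mu>] by simp

lemma tv_empty [simp]: "cb_variation \<mu> {} = 0"
proof -
  have "(\<Sum>B\<in>P. ennreal (cmod (\<mu> B))) = 0" if "partition_on {} P" for P
  proof -
    have "P = {}" using that by (auto simp: partition_on_def)
    then show ?thesis by simp
  qed
  then have "cb_variation \<mu> {} \<le> 0" unfolding total_variation_def by (intro SUP_least) auto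
  then show ?thesis by simp
qed

text \<open>Superadditivity is available only for sets with finite partitions, so the induction runs
  over finite unions of compacted Borel sets and the rest \<open>?V\<close> is split off explicitly.
  The other inequality refines a partition of the union along the sets \<open>A i\<close>.\<close>

lemma tv_suminf:
  fixes A :: "nat \<Rightarrow> 'a set"
  assumes A: "range A \<subseteq> compacted_borel" "disjoint_family A" "(\<Union>i. A i) \<in> compacted_borel"
  shows "cb_variation \<mu> (\<Union>i. A i) = (\<Sum>i. cb_variation \<mu> (A i))"
proof (rule antisym)
  have fin: "(\<Sum>i<n. cb_variation \<mu> (A i)) \<le> cb_variation \<mu> (\<Union>i<n. A i)" for n
  proof (induction n)
    case (Suc n)
    have "(\<Sum>i<Suc n. cb_variation \<mu> (A i)) \<le> cb_variation \<mu> (\<Union>i<n. A i) + cb_variation \<mu> (A n)"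
      using Suc by (simp add: add_right_mono)
    also have "\<dots> \<le> cb_variation \<mu> ((\<Union>i<n. A i) \<union> A n)"
    proof (rule total_variation_superadditive)
      have "A i \<inter> A n = {}" if "i < n" for i
        using disjoint_family_onD[OF A(2), of i n] that by simp
      then show "(\<Union>i<n. A i) \<inter> A n = {}" by blast
      show "\<exists>P. finite P \<and> partition_on (\<Union>i<n. A i) P \<and> P \<subseteq> compacted_borel"
        using A by (intro compacted_borel_partition compacted_borel_finite_UN) auto
      show "\<exists>P. finite P \<and> partition_on (A n) P \<and> P \<subseteq> compacted_borel"
        using A by (intro compacted_borel_partition) auto
    qed
    finally show ?case by (simp add: lessThan_Suc Un_commute)
  qed simp
  show "(\<Sum>i. cb_variation \<mu> (A i)) \<le> cb_variation \<mu> (\<Union>i. A i)"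
  proof (rule suminf_le_const)
    fix n
    let ?U = "\<Union>i<n. A i" and ?V = "(\<Union>i. A i) - (\<Union>i<n. A i)"
    have U: "?U \<in> compacted_borel" using A by (intro compacted_borel_finite_UN) auto
    have V: "?V \<in> compacted_borel" using A U by (intro compacted_borel_Diff compacted_borel_borel[OF U]) auto
    have "cb_variation \<mu> ?U \<le> cb_variation \<mu> ?U + cb_variation \<mu> ?V" by simp
    also have "\<dots> \<le> cb_variation \<mu> (?U \<union> ?V)"
      using U V by (intro total_variation_superadditive compacted_borel_partition) auto
    also have "?U \<union> ?V = (\<Union>i. A i)" by auto
    finally show "(\<Sum>i<n. cb_variation \<mu> (A i)) \<le> cb_variation \<mu> (\<Union>i. A i)" using fin[of n] by order
  qed simp
  show "cb_variation \<mu> (\<Union>i. A i) \<le> (\<Sum>i. cb_variation \<mu> (A i))"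
    unfolding total_variation_def[of _ _ "\<Union>i. A i"]
  proof (rule SUP_least)
    fix P assume "P \<in> {P. finite P \<and> partition_on (\<Union>i. A i) P \<and> P \<subseteq> compacted_borel}"
    then have P: "finite P" "partition_on (\<Union>i. A i) P" "P \<subseteq> compacted_borel" by auto
    have BA: "B \<inter> A i \<in> compacted_borel" if "B \<in> P" for B i
      using that A P by (intro compacted_borel_Int compacted_borel_borel[of "A i"]) auto
    have "(\<Sum>B\<in>P. ennreal (cmod (\<mu> B))) \<le> (\<Sum>B\<in>P. \<Sum>i. ennreal (cmod (\<mu> (B \<inter> A i))))"
    proof (rule sum_mono)
      fix B assume B: "B \<in> P"
      have eq: "(\<Union>i. B \<inter> A i) = B" using B P(2) by (auto simp: partition_on_def)
      have "(\<lambda>i. \<mu> (B \<inter> A i)) sums \<mu> (\<Union>i. B \<inter> A i)"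
      proof (rule sums)
        show "disjoint_family (\<lambda>i. B \<inter> A i)" using A(2) by (auto simp: disjoint_family_on_def)
        show "(\<Union>i. B \<inter> A i) \<in> compacted_borel" using B P eq by auto
      qed (use BA B in auto)
      then show "ennreal (cmod (\<mu> B)) \<le> (\<Sum>i. ennreal (cmod (\<mu> (B \<inter> A i))))"
        using ennreal_norm_sums_le eq by simp
    qed
    also have "\<dots> = (\<Sum>i. \<Sum>B\<in>P. ennreal (cmod (\<mu> (B \<inter> A i))))" by (rule suminf_sum[symmetric]) simp
    also have "\<dots> \<le> (\<Sum>i. cb_variation \<mu> (A i))"
      using P BA by (intro suminf_le total_variation_refine) (auto simp: partition_on_def)
    finally show "(\<Sum>B\<in>P. ennreal (cmod (\<mu> B))) \<le> (\<Sum>i. cb_variation \<mu> (A i))" .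
  qed
qed

lemma tv_add:
  assumes "A \<in> compacted_borel" "B \<in> compacted_borel" "A \<inter> B = {}"
  shows "cb_variation \<mu> (A \<union> B) = cb_variation \<mu> A + cb_variation \<mu> B"
  by (rule binary_additive[where R = compacted_borel, OF tv_suminf])
     (use assms in \<open>auto intro: compacted_borel_Un\<close>)

lemma tv_mono:
  assumes "A \<in> compacted_borel" "B \<in> sets borel" "B \<subseteq> A"
  shows "cb_variation \<mu> B \<le> cb_variation \<mu> A"
  using tv_add[of B "A - B"] assms compacted_borel_subset[of A B] compacted_borel_Diff[of A B]
  by (simp add: Un_absorb1)

lemma jordan_bounds:
  assumes "C \<in> compacted_borel"
  shows "re.PV C \<le> cb_variation \<mu> C" "nre.PV C \<le> cb_variation \<mu> C"
    "im.PV C \<le> cb_variation \<mu> C" "nim.PV C \<le> cb_variation \<mu> C"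
proof -
  have le: "(SUP D\<in>{D \<in> compacted_borel. D \<subseteq> C}. ennreal (f (\<mu> D))) \<le> cb_variation \<mu> C"
    if f: "\<And>z. f z \<le> cmod z" for f
  proof (rule SUP_least)
    fix D assume D: "D \<in> {D \<in> compacted_borel. D \<subseteq> C}"
    have "ennreal (f (\<mu> D)) \<le> ennreal (cmod (\<mu> D))" by (intro ennreal_leI f)
    also have "\<dots> \<le> cb_variation \<mu> D" using D by (intro tv_ge) auto
    also have "\<dots> \<le> cb_variation \<mu> C" using D assms by (intro tv_mono) (auto simp: compacted_borel_borel)
    finally show "ennreal (f (\<mu> D)) \<le> cb_variation \<mu> C" .
  qed
  show "re.PV C \<le> cb_variation \<mu> C" "im.PV C \<le> cb_variation \<mu> C"
    unfolding positive_variation_def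
    by (rule le, rule complex_Re_le_cmod, rule le, rule abs_Im_le_cmod[THEN order_trans[OF abs_ge_self]])
  have "- Re z \<le> cmod z" "- Im z \<le> cmod z" for z
    using abs_Re_le_cmod[of z] abs_Im_le_cmod[of z] by linarith+
  then show "nre.PV C \<le> cb_variation \<mu> C" "nim.PV C \<le> cb_variation \<mu> C"
    unfolding positive_variation_def by (auto intro: le[of "\<lambda>z. - Re z"] le[of "\<lambda>z. - Im z"])
qed

text \<open>The sum of the four positive variations majorises \<open>cmod (\<mu> B)\<close> and is
  superadditive, so its value at \<open>A\<close> bounds every partition sum.\<close>

lemma tv_finite:
  assumes A: "A \<in> compacted_borel" shows "cb_variation \<mu> A < \<infinity>"
proof -
  let ?f = "\<lambda>A. re.PV A + nre.PV A + (im.PV A + nim.PV A)"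
  have "cb_variation \<mu> A \<le> ?f A"
    unfolding total_variation_def
  proof (rule SUP_least)
    fix P assume P: "P \<in> {P. finite P \<and> partition_on A P \<and> P \<subseteq> compacted_borel}"
    have "(\<Sum>B\<in>P. ennreal (cmod (\<mu> B))) \<le> (\<Sum>B\<in>P. ?f B)"
    proof (rule sum_mono)
      fix B assume "B \<in> P"
      then have B: "B \<in> compacted_borel" using P by auto
      have pm: "ennreal \<bar>x\<bar> \<le> ennreal x + ennreal (- x)" for x
        by (cases "x \<ge> 0") (auto simp: ennreal_neg)
      have "ennreal (cmod (\<mu> B)) \<le> ennreal (\<bar>Re (\<mu> B)\<bar> + \<bar>Im (\<mu> B)\<bar>)" by (intro ennreal_leI cmod_le)
      also have "\<dots> = ennreal \<bar>Re (\<mu> B)\<bar> + ennreal \<bar>Im (\<mu> B)\<bar>" by simp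
      also have "\<dots> \<le>
        ennreal (Re (\<mu> B)) + ennreal (- Re (\<mu> B)) + (ennreal (Im (\<mu> B)) + ennreal (- Im (\<mu> B)))"
        by (intro add_mono pm)
      also have "\<dots> \<le> ?f B"
        using B by (intro add_mono re.PV_upper nre.PV_upper im.PV_upper nim.PV_upper) auto
      finally show "ennreal (cmod (\<mu> B)) \<le> ?f B" .
    qed
    also have "\<dots> \<le> ?f (\<Union>P)"
      unfolding sum.distrib using P
      by (intro add_mono superadditive_partition_le re.PV_superadditive nre.PV_superadditive
          im.PV_superadditive nim.PV_superadditive) (auto simp: partition_on_def)
    also have "\<Union>P = A" using P by (auto simp: partition_on_def)
    finally show "(\<Sum>B\<in>P. ennreal (cmod (\<mu> B))) \<le> ?f A" .
  qed
  also have "\<dots> < \<infinity>" using re.PV_finite[OF A] nre.PV_finite[OF A] im.PV_finite[OF A] nim.PV_finite[OF A] by simp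
  finally show ?thesis .
qed

end

section \<open>Complex measures as combinations of inner regular Borel measures\<close>

text \<open>Coefficients and components are arbitrary, not those of a Jordan decomposition: sums,
  multiples, densities and images then act on the components without any care for minimality. The
  last clause is the convention that a measure is 0 off its domain.\<close>

definition represents ::
  "'i set \<Rightarrow> ('i \<Rightarrow> complex) \<Rightarrow> ('i \<Rightarrow> 'a::t2_space measure) \<Rightarrow> ('a set \<Rightarrow> complex) \<Rightarrow> bool" where
  "represents J c N \<mu> \<longleftrightarrow> finite J \<and> (\<forall>j\<in>J. radon (N j)) \<and>
     (\<forall>A\<in>compacted_borel. \<mu> A = (\<Sum>j\<in>J. c j * of_real (measure (N j) A))) \<and>
     (\<forall>A. A \<notin> compacted_borel \<longrightarrow> \<mu> A = 0)"

lemma representsD: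
  assumes "represents J c N \<mu>"
  shows "finite J" and "j \<in> J \<Longrightarrow> radon (N j)"
    and "A \<in> compacted_borel \<Longrightarrow> \<mu> A = (\<Sum>j\<in>J. c j * of_real (measure (N j) A))"
    and "A \<notin> compacted_borel \<Longrightarrow> \<mu> A = 0"
proof -
  note a = assms[unfolded represents_def]
  show "finite J" by (rule conjunct1[OF a])
  show "radon (N j)" if "j \<in> J" by (rule bspec[OF conjunct1[OF conjunct2[OF a]] that])
  show "\<mu> A = (\<Sum>j\<in>J. c j * of_real (measure (N j) A))" if "A \<in> compacted_borel"
    by (rule bspec[OF conjunct1[OF conjunct2[OF conjunct2[OF a]]] that])
  show "\<mu> A = 0" if "A \<notin> compacted_borel"
    using conjunct2[OF conjunct2[OF conjunct2[OF a]]] that by simp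
qed

lemma radon_emeasure_eq:
  "radon M \<Longrightarrow> A \<in> compacted_borel \<Longrightarrow> emeasure M A = ennreal (measure M A)"
  using radon_compacted_borel[of M A] by (intro emeasure_eq_ennreal_measure) auto

text \<open>The measure \<Sum> |c_j| N_j. It majorises the total variation but may be strictly
  larger when the components overlap.\<close>

definition dominates ::
  "'a::t2_space measure \<Rightarrow> 'i set \<Rightarrow> ('i \<Rightarrow> complex) \<Rightarrow> ('i \<Rightarrow> 'a measure) \<Rightarrow> bool" where
  "dominates S J c N \<longleftrightarrow> radon S \<and>
     (\<forall>B\<in>sets borel. emeasure S B = (\<Sum>j\<in>J. ennreal (cmod (c j)) * emeasure (N j) B))"

lemma dominates_exists:
  assumes "represents J c N \<mu>" obtains S where "dominates S J c N"
proof (rule radon_sum[of J N "\<lambda>j. cmod (c j)"])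
  show "finite J" by (rule representsD(1)[OF assms])
  show "radon (N j)" if "j \<in> J" for j by (rule representsD(2)[OF assms that])
  fix S assume "radon S" "\<And>B. B \<in> sets borel \<Longrightarrow> emeasure S B = (\<Sum>j\<in>J. ennreal (cmod (c j)) * emeasure (N j) B)"
  then show thesis by (intro that[of S]) (simp add: dominates_def)
qed

lemma complex_measure_on_represents:
  fixes \<mu> :: "'a::t2_space set \<Rightarrow> complex"
  assumes R: "represents J c N \<mu>" shows "complex_measure_on compacted_borel \<mu>"
  unfolding complex_measure_on_def
proof (intro conjI allI impI)
  fix A :: "nat \<Rightarrow> 'a set" assume A: "range A \<subseteq> compacted_borel" "disjoint_family A" "(\<Union>i. A i) \<in> compacted_borel"
  have "(\<lambda>i. \<Sum>j\<in>J. c j * of_real (measure (N j) (A i))) sums (\<Sum>j\<in>J. c j * of_real (measure (N j) (\<Union>i. A i)))"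
  proof (intro sums_sum sums_mult sums_of_real)
    fix j assume "j \<in> J"
    then have N: "radon (N j)" using representsD(2)[OF R] by blast
    then show "(\<lambda>i. measure (N j) (A i)) sums measure (N j) (\<Union>i. A i)"
      using A radon_compacted_borel[OF N A(3)]
      by (intro measure_UNION) (auto simp: compacted_borel_borel)
  qed
  then show "(\<lambda>i. \<mu> (A i)) sums \<mu> (\<Union>i. A i)"
    using A representsD(3)[OF R] by (simp add: range_subsetD)
qed (rule representsD(4)[OF R])

lemma dominates_norm_le:
  assumes R: "represents J c N \<mu>" and S: "dominates S J c N" and A: "A \<in> compacted_borel"
  shows "ennreal (cmod (\<mu> A)) \<le> emeasure S A"
proof -
  have "cmod (\<mu> A) \<le> (\<Sum>j\<in>J. cmod (c j) * measure (N j) A)"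
    unfolding representsD(3)[OF R A] by (rule order_trans[OF norm_sum]) (simp add: norm_mult)
  then have "ennreal (cmod (\<mu> A)) \<le> ennreal (\<Sum>j\<in>J. cmod (c j) * measure (N j) A)"
    by (rule ennreal_leI)
  also have "\<dots> = (\<Sum>j\<in>J. ennreal (cmod (c j)) * ennreal (measure (N j) A))"
    by (simp add: sum_ennreal[symmetric] ennreal_mult del: sum_ennreal)
  also have "\<dots> = (\<Sum>j\<in>J. ennreal (cmod (c j)) * emeasure (N j) A)"
    using radon_emeasure_eq[OF representsD(2)[OF R] A] by simp
  also have "\<dots> = emeasure S A"
    using S A by (auto simp: dominates_def compacted_borel_borel)
  finally show ?thesis .
qed

lemma dominates_tv_le:
  assumes R: "represents J c N \<mu>" and S: "dominates S J c N" and A: "A \<in> compacted_borel"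
  shows "cb_variation \<mu> A \<le> emeasure S A"
  unfolding total_variation_def
proof (rule SUP_least)
  fix P assume "P \<in> {P. finite P \<and> partition_on A P \<and> P \<subseteq> compacted_borel}"
  then have P: "finite P" "partition_on A P" "P \<subseteq> compacted_borel" by auto
  have rS: "radon S" using S by (simp add: dominates_def)
  have "(\<Sum>B\<in>P. ennreal (cmod (\<mu> B))) \<le> (\<Sum>B\<in>P. emeasure S B)"
    using P by (intro sum_mono dominates_norm_le[OF R S]) auto
  also have "\<dots> = emeasure S (\<Union>B\<in>P. B)"
  proof (rule sum_emeasure)
    show "(\<lambda>B. B) ` P \<subseteq> sets S" using P rS by (auto simp: compacted_borel_borel)
    show "disjoint_family_on (\<lambda>B. B) P"
      using P(2) by (auto simp: partition_on_def disjoint_family_on_def disjoint_def)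
  qed (rule P)
  also have "(\<Union>B\<in>P. B) = A" using P(2) by (simp add: partition_on_def)
  finally show "(\<Sum>B\<in>P. ennreal (cmod (\<mu> B))) \<le> emeasure S A" .
qed

text \<open>Regularity of the variation is inherited from a dominating measure: a compact set that
  is almost all of \<open>A\<close> for \<open>S\<close> is almost all of \<open>A\<close> for the
  variation.\<close>

lemma regular_represents:
  fixes \<mu> :: "'a::t2_space set \<Rightarrow> complex"
  assumes R: "represents J c N \<mu>" shows "\<mu> \<in> regular_cb_measures"
proof -
  interpret complex_cb \<mu> by unfold_locales (rule complex_measure_on_represents[OF R])
  obtain S where S: "dominates S J c N" using dominates_exists[OF R] .
  then have rS: "radon S" by (simp add: dominates_def)
  have "cb_variation \<mu> A = (SUP C\<in>{C. compact C \<and> C \<subseteq> A}. cb_variation \<mu> C)" if A: "A \<in> compacted_borel" for A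
  proof (rule antisym)
    show "(SUP C\<in>{C. compact C \<and> C \<subseteq> A}. cb_variation \<mu> C) \<le> cb_variation \<mu> A"
      using A by (intro SUP_least tv_mono) (auto simp: compact_borel)
    show "cb_variation \<mu> A \<le> (SUP C\<in>{C. compact C \<and> C \<subseteq> A}. cb_variation \<mu> C)"
    proof (rule ennreal_le_epsilon)
      fix e :: real assume e: "e > 0"
      obtain K where K: "compact K" "K \<subseteq> A" "emeasure S (A - K) < ennreal e"
        using radon_approx[OF rS compacted_borel_borel[OF A] radon_compacted_borel[OF rS A] e] .
      have AK: "A - K \<in> compacted_borel" using A K by (intro compacted_borel_Diff compact_borel)
      have "cb_variation \<mu> A = cb_variation \<mu> K + cb_variation \<mu> (A - K)"
        using tv_add[OF compact_compacted_borel[OF K(1)] AK] K(2) by (simp add: Un_absorb1)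
      also have "\<dots> \<le> (SUP C\<in>{C. compact C \<and> C \<subseteq> A}. cb_variation \<mu> C) + ennreal e"
      proof (rule add_mono)
        show "cb_variation \<mu> K \<le> (SUP C\<in>{C. compact C \<and> C \<subseteq> A}. cb_variation \<mu> C)"
          using K by (intro SUP_upper) auto
        show "cb_variation \<mu> (A - K) \<le> ennreal e"
          using dominates_tv_le[OF R S AK] K(3) by simp
      qed
      finally show "cb_variation \<mu> A \<le> (SUP C\<in>{C. compact C \<and> C \<subseteq> A}. cb_variation \<mu> C) + ennreal e" .
    qed
  qed
  then show ?thesis using measure_on by (simp add: regular_cb_measures_def)
qed

lemma regular_approx:
  fixes \<mu> :: "'a::t2_space set \<Rightarrow> complex"
  assumes mu: "\<mu> \<in> regular_cb_measures" and A: "A \<in> compacted_borel" and e: "(e::real) > 0"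
  obtains K where "compact K" "K \<subseteq> A" "cb_variation \<mu> (A - K) \<le> ennreal e"
proof -
  interpret complex_cb \<mu> by unfold_locales (use mu in \<open>simp add: regular_cb_measures_def\<close>)
  have r: "cb_variation \<mu> A = (SUP C\<in>{C. compact C \<and> C \<subseteq> A}. cb_variation \<mu> C)"
    using mu A by (simp add: regular_cb_measures_def)
  show ?thesis
  proof (cases "cb_variation \<mu> A = 0")
    case True then show ?thesis using that[of "{}"] by simp
  next
    case False
    then have "cb_variation \<mu> A - ennreal e < cb_variation \<mu> A"
      using tv_finite[OF A] e by (intro ennreal_between) (auto simp: zero_less_iff_neq_zero)
    then obtain K where K: "compact K" "K \<subseteq> A" "cb_variation \<mu> A - ennreal e < cb_variation \<mu> K"
      by (subst (asm) (2) r) (auto simp: less_SUP_iff)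
    have Kcb: "K \<in> compacted_borel" by (rule compact_compacted_borel) fact
    have AK: "A - K \<in> compacted_borel" using A K by (intro compacted_borel_Diff compact_borel)
    have eq: "cb_variation \<mu> A = cb_variation \<mu> K + cb_variation \<mu> (A - K)"
      using tv_add[OF Kcb AK] K(2) by (simp add: Un_absorb1)
    have "cb_variation \<mu> (A - K) \<le> ennreal e"
    proof (rule ccontr)
      assume "\<not> cb_variation \<mu> (A - K) \<le> ennreal e"
      then have "cb_variation \<mu> K + ennreal e \<le> cb_variation \<mu> A" unfolding eq by (intro add_left_mono) auto
      then have "cb_variation \<mu> K \<le> cb_variation \<mu> A - ennreal e"
        by (simp add: ennreal_le_minus_iff)
      then show False using K(3) by simp
    qed
    then show ?thesis using that K by blast
  qed
qed

text \<open>Anything countably additive below the variation inherits its inner regularity and so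
  extends to all Borel sets. It is applied to the four Jordan parts and to the variation
  itself.\<close>

lemma regular_radon_part:
  fixes \<mu> :: "'a::t2_space set \<Rightarrow> complex"
  assumes mu: "\<mu> \<in> regular_cb_measures"
    and ca: "\<And>A. range A \<subseteq> compacted_borel \<Longrightarrow> disjoint_family A \<Longrightarrow> (\<Union>i. A i) \<in> compacted_borel \<Longrightarrow>
        m (\<Union>i::nat. A i) = (\<Sum>i. m (A i))"
    and m0: "m {} = 0"
    and le: "\<And>A. A \<in> compacted_borel \<Longrightarrow> m A \<le> cb_variation \<mu> A"
  obtains M where "radon M" "\<And>A. A \<in> compacted_borel \<Longrightarrow> emeasure M A = m A"
proof -
  interpret complex_cb \<mu> by unfold_locales (use mu in \<open>simp add: regular_cb_measures_def\<close>)
  have fin: "m K < \<infinity>" if "compact K" for K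
    using le[of K] tv_finite[of K] compact_compacted_borel[OF that] by (auto intro: order_le_less_trans)
  have reg: "m A \<le> (SUP K\<in>{K. compact K \<and> K \<subseteq> A}. m K)" if A: "A \<in> compacted_borel" for A
  proof (rule ennreal_le_epsilon)
    fix e :: real assume e: "e > 0"
    obtain K where K: "compact K" "K \<subseteq> A" "cb_variation \<mu> (A - K) \<le> ennreal e"
      using regular_approx[OF mu A e] .
    have AK: "A - K \<in> compacted_borel" using A K by (intro compacted_borel_Diff compact_borel)
    have "m (K \<union> (A - K)) = m K + m (A - K)"
      by (rule binary_additive[where R = compacted_borel, OF ca m0])
        (use K A AK compact_compacted_borel in \<open>auto simp: Un_absorb1\<close>)
    then have "m A = m K + m (A - K)" using K(2) by (simp add: Un_absorb1)
    also have "\<dots> \<le> (SUP K\<in>{K. compact K \<and> K \<subseteq> A}. m K) + ennreal e"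
    proof (rule add_mono)
      show "m K \<le> (SUP K\<in>{K. compact K \<and> K \<subseteq> A}. m K)" using K by (intro SUP_upper) auto
      show "m (A - K) \<le> ennreal e" using le[OF AK] K(3) by order
    qed
    finally show "m A \<le> (SUP K\<in>{K. compact K \<and> K \<subseteq> A}. m K) + ennreal e" .
  qed
  show thesis
    by (rule radon_extension[of m], erule (2) ca, rule m0, erule fin, erule reg, rule that)
qed

text \<open>The components come in the order positive real, positive imaginary, negative real,
  negative imaginary part, so that the j-th coefficient is \<open>\<i> ^ j\<close>.\<close>

lemma regular_jordan:
  fixes \<mu> :: "'a::t2_space set \<Rightarrow> complex"
  assumes mu: "\<mu> \<in> regular_cb_measures"
  obtains M where "represents {..<4::nat} (\<lambda>j. \<i> ^ j) M \<mu>"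
    "\<And>A. A \<in> compacted_borel \<Longrightarrow> emeasure (M 0) A = positive_variation compacted_borel (\<lambda>B. Re (\<mu> B)) A"
    "\<And>A. A \<in> compacted_borel \<Longrightarrow> emeasure (M 1) A = positive_variation compacted_borel (\<lambda>B. Im (\<mu> B)) A"
    "\<And>A. A \<in> compacted_borel \<Longrightarrow> emeasure (M 2) A = positive_variation compacted_borel (\<lambda>B. - Re (\<mu> B)) A"
    "\<And>A. A \<in> compacted_borel \<Longrightarrow> emeasure (M 3) A = positive_variation compacted_borel (\<lambda>B. - Im (\<mu> B)) A"
proof -
  interpret complex_cb \<mu> by unfold_locales (use mu in \<open>simp add: regular_cb_measures_def\<close>)
  obtain M0 where M0: "radon M0" "\<And>A. A \<in> compacted_borel \<Longrightarrow> emeasure M0 A = re.PV A"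
    by (rule regular_radon_part[OF mu, of re.PV], erule (2) re.PV_suminf, rule re.PV_empty, erule jordan_bounds(1), rule that)
  obtain M1 where M1: "radon M1" "\<And>A. A \<in> compacted_borel \<Longrightarrow> emeasure M1 A = im.PV A"
    by (rule regular_radon_part[OF mu, of im.PV], erule (2) im.PV_suminf, rule im.PV_empty, erule jordan_bounds(3), rule that)
  obtain M2 where M2: "radon M2" "\<And>A. A \<in> compacted_borel \<Longrightarrow> emeasure M2 A = nre.PV A"
    by (rule regular_radon_part[OF mu, of nre.PV], erule (2) nre.PV_suminf, rule nre.PV_empty, erule jordan_bounds(2), rule that)
  obtain M3 where M3: "radon M3" "\<And>A. A \<in> compacted_borel \<Longrightarrow> emeasure M3 A = nim.PV A"
    by (rule regular_radon_part[OF mu, of nim.PV], erule (2) nim.PV_suminf, rule nim.PV_empty, erule jordan_bounds(4), rule that)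
  define M where "M = (\<lambda>j::nat. [M0, M1, M2, M3] ! j)"
  have s: "(\<Sum>j<4. f j) = f 0 + f 1 + f 2 + f 3" for f :: "nat \<Rightarrow> complex"
    by (simp add: eval_nat_numeral)
  have "represents {..<4::nat} (\<lambda>j. \<i> ^ j) M \<mu>"
    unfolding represents_def
  proof (intro conjI ballI allI impI)
    fix j :: nat assume "j \<in> {..<4}"
    then have "j = 0 \<or> j = 1 \<or> j = 2 \<or> j = 3" by auto
    then show "radon (M j)" using M0 M1 M2 M3 by (auto simp: M_def)
  next
    fix A :: "'a set" assume A: "A \<in> compacted_borel"
    have i3: "\<i> ^ 3 = - \<i>" by (simp add: eval_nat_numeral)
    show "\<mu> A = (\<Sum>j<4. \<i> ^ j * of_real (measure (M j) A))"
      unfolding s using re.jordan[OF A] im.jordan[OF A] M0(2)[OF A] M1(2)[OF A] M2(2)[OF A] M3(2)[OF A]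
      by (simp add: complex_eq_iff M_def measure_def i3)
  qed (auto simp: off)
  then show ?thesis using that[of M] M0 M1 M2 M3 by (simp add: M_def)
qed

section \<open>Integration against complex measures\<close>

text \<open>Lets a function that is integrable for all components be recognised as integrable for a
  dominating measure.\<close>

lemma nn_integral_sum_measure:
  fixes N :: "'i \<Rightarrow> 'a::topological_space measure"
  assumes J: "finite J" and N: "\<And>j. j \<in> J \<Longrightarrow> sets (N j) = sets borel"
    and sS: "sets S = sets borel"
    and S: "\<And>B. B \<in> sets borel \<Longrightarrow> emeasure S B = (\<Sum>j\<in>J. a j * emeasure (N j) B)"
    and f: "f \<in> borel_measurable borel"
  shows "(\<integral>\<^sup>+x. f x \<partial>S) = (\<Sum>j\<in>J. a j * (\<integral>\<^sup>+x. f x \<partial>N j))"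
proof -
  have mN: "g \<in> borel_measurable (N j)" if "g \<in> borel_measurable borel" "j \<in> J" for g :: "'a \<Rightarrow> ennreal" and j
    using that measurable_cong_sets[OF N[OF that(2)] refl] by blast
  have mS: "g \<in> borel_measurable S" if "g \<in> borel_measurable borel" for g :: "'a \<Rightarrow> ennreal"
    using that measurable_cong_sets[OF sS refl] by blast
  show ?thesis using f
  proof (induction f rule: borel_measurable_induct)
    case (cong f g)
    then have "f = g" by auto
    then show ?case using cong by simp
  next
    case (set A)
    then show ?case using N sS S by simp
  next
    case (mult u c)
    have "(\<integral>\<^sup>+x. c * u x \<partial>S) = c * (\<integral>\<^sup>+x. u x \<partial>S)" by (intro nn_integral_cmult mS mult)
    also have "\<dots> = (\<Sum>j\<in>J. a j * (c * (\<integral>\<^sup>+x. u x \<partial>N j)))"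
      unfolding mult.IH by (simp add: sum_distrib_left ac_simps)
    also have "\<dots> = (\<Sum>j\<in>J. a j * (\<integral>\<^sup>+x. c * u x \<partial>N j))"
      by (intro sum.cong refl arg_cong2[of _ _ _ _ "(*)"] nn_integral_cmult[symmetric] mN mult)
    finally show ?case .
  next
    case (add u v)
    have "(\<integral>\<^sup>+x. v x + u x \<partial>S) = (\<integral>\<^sup>+x. v x \<partial>S) + (\<integral>\<^sup>+x. u x \<partial>S)"
      by (intro nn_integral_add mS add)
    also have "\<dots> = (\<Sum>j\<in>J. a j * ((\<integral>\<^sup>+x. v x \<partial>N j) + (\<integral>\<^sup>+x. u x \<partial>N j)))"
      unfolding add.IH by (simp add: sum.distrib distrib_left)
    also have "\<dots> = (\<Sum>j\<in>J. a j * (\<integral>\<^sup>+x. v x + u x \<partial>N j))"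
      by (intro sum.cong refl arg_cong2[of _ _ _ _ "(*)"] nn_integral_add[symmetric] mN add)
    finally show ?case .
  next
    case (seq U)
    have inc: "incseq (\<lambda>i. \<integral>\<^sup>+x. U i x \<partial>M)" for M
      using seq.hyps(3) by (intro monoI nn_integral_mono) (auto simp: incseq_def le_fun_def)
    have "(\<integral>\<^sup>+x. (SUP i. U i) x \<partial>S) = (SUP i. \<integral>\<^sup>+x. U i x \<partial>S)"
      using nn_integral_monotone_convergence_SUP[OF seq.hyps(3), of S] mS[OF seq.hyps(1)] by (simp add: image_comp)
    also have "\<dots> = (SUP i. \<Sum>j\<in>J. a j * (\<integral>\<^sup>+x. U i x \<partial>N j))" by (simp only: seq.IH)
    also have "\<dots> = (\<Sum>j\<in>J. SUP i. a j * (\<integral>\<^sup>+x. U i x \<partial>N j))"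
      using inc by (intro ennreal_SUP_sum) (auto simp: incseq_def intro!: mult_left_mono)
    also have "\<dots> = (\<Sum>j\<in>J. a j * (SUP i. \<integral>\<^sup>+x. U i x \<partial>N j))"
      by (simp add: SUP_mult_left_ennreal)
    also have "\<dots> = (\<Sum>j\<in>J. a j * (\<integral>\<^sup>+x. (SUP i. U i) x \<partial>N j))"
    proof (intro sum.cong refl arg_cong2[of _ _ _ _ "(*)"])
      fix j assume "j \<in> J"
      then show "(SUP i. \<integral>\<^sup>+x. U i x \<partial>N j) = (\<integral>\<^sup>+x. (SUP i. U i) x \<partial>N j)"
        using nn_integral_monotone_convergence_SUP[OF seq.hyps(3), of "N j"] mN[OF seq.hyps(1)] by (simp add: image_comp)
    qed
    finally show ?case .
  qed
qed

lemma integrable_mono_measure: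
  fixes f :: "'a::topological_space \<Rightarrow> complex"
  assumes "sets M = sets borel" "sets S = sets borel" "\<And>B. B \<in> sets borel \<Longrightarrow> emeasure M B \<le> emeasure S B"
    and "integrable S f"
  shows "integrable M f"
proof -
  have f: "f \<in> borel_measurable S" "(\<integral>\<^sup>+x. norm (f x) \<partial>S) < \<infinity>"
    using assms(4) by (auto simp: integrable_iff_bounded)
  have "M \<le> S" using assms by (subst le_measure) auto
  then have "(\<integral>\<^sup>+x. norm (f x) \<partial>M) \<le> (\<integral>\<^sup>+x. norm (f x) \<partial>S)"
    using assms by (intro nn_integral_mono_measure) auto
  moreover have "f \<in> borel_measurable M"
    using f(1) measurable_cong_sets[of S M borel borel] assms by auto
  ultimately show ?thesis using f(2) by (auto simp: integrable_iff_bounded)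
qed

text \<open>Two representations of one measure differ by a combination that vanishes on compacted
  Borel sets; the vanishing is carried over to integrals here. The induction takes place in L1 of
  the sum \<open>S\<close> of all components, so that one approximating sequence works for every
  \<open>j\<close>.\<close>

lemma integral_combination_zero:
  fixes N :: "'i \<Rightarrow> 'a::t2_space measure" and f :: "'a \<Rightarrow> complex"
  assumes J: "finite J" "\<And>j. j \<in> J \<Longrightarrow> radon (N j)"
    and z: "\<And>B. B \<in> compacted_borel \<Longrightarrow> (\<Sum>j\<in>J. c j * of_real (measure (N j) B)) = 0"
    and A: "A \<in> compacted_borel" and f: "\<And>j. j \<in> J \<Longrightarrow> integrable (N j) f" and fb: "f \<in> borel_measurable borel"
  shows "(\<Sum>j\<in>J. c j * (\<integral>x. indicator A x *\<^sub>R f x \<partial>N j)) = 0"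
proof -
  obtain S where S: "radon S" "\<And>B. B \<in> sets borel \<Longrightarrow> emeasure S B = (\<Sum>j\<in>J. ennreal 1 * emeasure (N j) B)"
    by (rule radon_sum[of J N "\<lambda>_. 1"], rule J, erule J, rule that)
  have le: "emeasure (N j) B \<le> emeasure S B" if "B \<in> sets borel" "j \<in> J" for j B
    using that J(1) S(2)[OF that(1)] member_le_sum[of j J "\<lambda>j. emeasure (N j) B"] by simp
  have int: "integrable (N j) g" if "integrable S g" "j \<in> J" for g :: "'a \<Rightarrow> complex" and j
    by (rule integrable_mono_measure[OF _ _ le that(1)]) (use that J S in auto)
  have intA: "integrable (N j) (\<lambda>x. indicator A x *\<^sub>R g x)" if "integrable S g" "j \<in> J" for g :: "'a \<Rightarrow> complex" and j
    using int[OF that] A J(2)[OF that(2)] by (intro integrable_mult_indicator) (auto simp: compacted_borel_borel)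
  have "(\<integral>\<^sup>+x. norm (f x) \<partial>S) = (\<Sum>j\<in>J. ennreal 1 * (\<integral>\<^sup>+x. norm (f x) \<partial>N j))"
    using J S fb by (intro nn_integral_sum_measure) auto
  also have "\<dots> < \<infinity>" using f J by (auto simp: integrable_iff_bounded)
  finally have "integrable S f"
    using radon_measurable[OF S(1) fb] by (simp add: integrable_iff_bounded)
  then show ?thesis
  proof (induction f rule: integrable_induct)
    case (base B w)
    have B: "B \<in> sets borel" using base S by simp
    have "(\<integral>x. indicator A x *\<^sub>R indicator B x *\<^sub>R w \<partial>N j) = of_real (measure (N j) (A \<inter> B)) * w" if "j \<in> J" for j
    proof -
      have "(\<integral>x. indicator A x *\<^sub>R indicator B x *\<^sub>R w \<partial>N j) = (\<integral>x. indicator (A \<inter> B) x *\<^sub>R w \<partial>N j)"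
        by (intro Bochner_Integration.integral_cong refl) (auto split: split_indicator)
      also have "\<dots> = measure (N j) (A \<inter> B) *\<^sub>R w"
        using A B J(2)[OF that] radon_compacted_borel[OF J(2)[OF that] compacted_borel_Int[OF A B]]
        by (subst integral_scaleR_left) (auto simp: compacted_borel_borel intro!: integrable_real_indicator)
      finally show ?thesis by (simp add: scaleR_conv_of_real)
    qed
    then have "(\<Sum>j\<in>J. c j * (\<integral>x. indicator A x *\<^sub>R indicator B x *\<^sub>R w \<partial>N j))
        = (\<Sum>j\<in>J. c j * of_real (measure (N j) (A \<inter> B))) * w"
      by (simp add: sum_distrib_right mult.assoc)
    then show ?case using z[OF compacted_borel_Int[OF A B]] by simp
  next
    case (add f g)
    have "(\<Sum>j\<in>J. c j * (\<integral>x. indicator A x *\<^sub>R (f x + g x) \<partial>N j)) =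
       (\<Sum>j\<in>J. c j * (\<integral>x. indicator A x *\<^sub>R f x \<partial>N j)) + (\<Sum>j\<in>J. c j * (\<integral>x. indicator A x *\<^sub>R g x \<partial>N j))"
      using intA[OF add.hyps(1)] intA[OF add.hyps(2)]
      by (simp add: scaleR_add_right distrib_left sum.distrib)
    then show ?case using add.IH by simp
  next
    case (lim f s)
    have "(\<lambda>i. \<Sum>j\<in>J. c j * (\<integral>x. indicator A x *\<^sub>R s i x \<partial>N j)) \<longlonglongrightarrow>
        (\<Sum>j\<in>J. c j * (\<integral>x. indicator A x *\<^sub>R f x \<partial>N j))"
    proof (intro tendsto_sum tendsto_mult tendsto_const)
      fix j assume j: "j \<in> J"
      show "(\<lambda>i. \<integral>x. indicator A x *\<^sub>R s i x \<partial>N j) \<longlonglongrightarrow> (\<integral>x. indicator A x *\<^sub>R f x \<partial>N j)"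
      proof (rule integral_dominated_convergence)
        show "integrable (N j) (\<lambda>x. 2 * norm (f x))" using int[OF lim.hyps(4) j] by simp
        show "AE x in N j. (\<lambda>i. indicator A x *\<^sub>R s i x) \<longlonglongrightarrow> indicator A x *\<^sub>R f x"
          using lim.hyps(2) S(1) by (intro AE_I2 tendsto_intros) auto
        show "AE x in N j. norm (indicator A x *\<^sub>R s i x) \<le> 2 * norm (f x)" for i
          using lim.hyps(3) S(1) by (intro AE_I2) (auto split: split_indicator)
      qed (use intA[OF lim.hyps(4) j] intA[OF lim.hyps(1) j] in auto)
    qed
    then show ?case using lim.IH by (simp add: LIMSEQ_const_iff)
  qed
qed

text \<open>Identifies the measure space built from traces with an ordinary restriction, so that the
  integrals in the definitions become integrals over Borel measures.\<close>

lemma trace_measure_eq: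
  fixes M :: "'a::t2_space measure"
  assumes M: "sets M = sets borel" and A: "A \<in> compacted_borel"
    and m: "\<And>B. B \<in> compacted_borel \<Longrightarrow> emeasure M B = m B"
  shows "trace_measure compacted_borel m A = restrict_space M A"
proof -
  let ?R = "restrict_space M A"
  have AM: "A \<in> sets M" using A M compacted_borel_borel by simp
  have sR: "sets ?R = {B \<in> compacted_borel. B \<subseteq> A}"
    unfolding sets_restrict_space M
  proof (intro subset_antisym subsetI)
    fix B assume "B \<in> (\<inter>) A ` sets borel"
    then show "B \<in> {B \<in> compacted_borel. B \<subseteq> A}" using compacted_borel_Int[OF A] by auto
  next
    fix B assume "B \<in> {B \<in> compacted_borel. B \<subseteq> A}"
    then have "B = A \<inter> B" "B \<in> sets borel" by (auto simp: compacted_borel_borel)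
    then show "B \<in> (\<inter>) A ` sets borel" by (rule image_eqI)
  qed
  have spR: "space ?R = A" using AM by (simp add: space_restrict_space2)
  have "trace_measure compacted_borel m A = measure_of (space ?R) (sets ?R) m"
    unfolding trace_measure_def sR spR ..
  also have "\<dots> = measure_of (space ?R) (sets ?R) (emeasure ?R)"
  proof (rule measure_of_eq)
    fix B assume "B \<in> sigma_sets (space ?R) (sets ?R)"
    then have "B \<in> sets ?R" by (simp only: sets.sigma_sets_eq)
    then have "B \<in> {B \<in> compacted_borel. B \<subseteq> A}" by (simp only: sR)
    then have "B \<in> compacted_borel" "B \<subseteq> A" by auto
    moreover have "emeasure ?R B = emeasure M B"
      using AM M \<open>B \<subseteq> A\<close> by (intro emeasure_restrict_space) auto
    ultimately show "m B = emeasure ?R B" using m by simp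
  qed (rule sets.space_closed)
  also have "\<dots> = ?R" by (rule measure_of_of_measure)
  finally show ?thesis .
qed

text \<open>The definition of the integral uses the Jordan parts. Any other representation gives the
  same value, by \<open>integral_combination_zero\<close> for the difference of the two.\<close>

lemma integral_over_represents:
  fixes \<mu> :: "'a::t2_space set \<Rightarrow> complex"
  assumes R: "represents J c N \<mu>" and A: "A \<in> compacted_borel"
    and f: "\<And>j. j \<in> J \<Longrightarrow> integrable (N j) f" and fb: "f \<in> borel_measurable borel"
  shows "integral_over compacted_borel \<mu> f A = (\<Sum>j\<in>J. c j * (\<integral>x. indicator A x *\<^sub>R f x \<partial>N j))"
proof -
  have mu: "\<mu> \<in> regular_cb_measures" by (rule regular_represents[OF R])
  interpret complex_cb \<mu> by unfold_locales (use mu in \<open>simp add: regular_cb_measures_def\<close>)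
  obtain M where M: "represents {..<4::nat} (\<lambda>j. \<i> ^ j) M \<mu>"
    and M0: "\<And>A. A \<in> compacted_borel \<Longrightarrow> emeasure (M 0) A = re.PV A"
    and M1: "\<And>A. A \<in> compacted_borel \<Longrightarrow> emeasure (M 1) A = im.PV A"
    and M2: "\<And>A. A \<in> compacted_borel \<Longrightarrow> emeasure (M 2) A = nre.PV A"
    and M3: "\<And>A. A \<in> compacted_borel \<Longrightarrow> emeasure (M 3) A = nim.PV A"
    by (rule regular_jordan[OF mu]) blast
  obtain S where S: "dominates S J c N" using dominates_exists[OF R] .
  then have rS: "radon S" by (simp add: dominates_def)
  have rM: "radon (M j)" if "j < 4" for j using representsD(2)[OF M, of j] that by simp
  have intS: "integrable S f"
  proof -
    have "(\<integral>\<^sup>+x. norm (f x) \<partial>S) = (\<Sum>j\<in>J. ennreal (cmod (c j)) * (\<integral>\<^sup>+x. norm (f x) \<partial>N j))"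
      using representsD(1,2)[OF R] rS S fb unfolding dominates_def by (intro nn_integral_sum_measure) auto
    also have "\<dots> < \<infinity>" using f representsD(1)[OF R] by (auto simp: integrable_iff_bounded ennreal_mult_less_top)
    finally show ?thesis using radon_measurable[OF rS fb] by (simp add: integrable_iff_bounded)
  qed
  \<comment> \<open>Integrability is given only for the components \<open>N j\<close>. It reaches
    the Jordan parts because on compact sets these lie below the variation, hence below
    \<open>S\<close>, and inner regularity extends this to all Borel sets.\<close>
  have MS: "emeasure (M j) B \<le> emeasure S B" if "B \<in> sets borel" "j < 4" for j B
  proof -
    have "emeasure (M j) B = (SUP K\<in>{K. compact K \<and> K \<subseteq> B}. emeasure (M j) K)"
      by (rule radon_inner[OF rM[OF that(2)] that(1)])
    also have "\<dots> \<le> emeasure S B"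
    proof (rule SUP_least)
      fix K assume K: "K \<in> {K. compact K \<and> K \<subseteq> B}"
      then have Kcb: "K \<in> compacted_borel" by (simp add: compact_compacted_borel)
      have "j = 0 \<or> j = 1 \<or> j = 2 \<or> j = 3" using that by auto
      then have "emeasure (M j) K \<le> cb_variation \<mu> K"
        using M0[OF Kcb] M1[OF Kcb] M2[OF Kcb] M3[OF Kcb] jordan_bounds[OF Kcb] by auto
      also have "\<dots> \<le> emeasure S K" by (rule dominates_tv_le[OF R S Kcb])
      also have "\<dots> \<le> emeasure S B" using K that rS by (intro emeasure_mono) auto
      finally show "emeasure (M j) K \<le> emeasure S B" .
    qed
    finally show ?thesis .
  qed
  have intM: "integrable (M j) f" if "j < 4" for j
    by (rule integrable_mono_measure[OF _ _ MS intS]) (use that rM rS in auto)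
  have tr: "integral\<^sup>L (completion (trace_measure compacted_borel m A)) f = (\<integral>x. indicator A x *\<^sub>R f x \<partial>M j)"
    if "j < 4" "\<And>B. B \<in> compacted_borel \<Longrightarrow> emeasure (M j) B = m B" for m j
  proof -
    have "trace_measure compacted_borel m A = restrict_space (M j) A"
      using rM[OF that(1)] A that(2) by (intro trace_measure_eq) auto
    moreover have "f \<in> borel_measurable (restrict_space (M j) A)"
      by (intro measurable_restrict_space1 radon_measurable[OF rM] that fb)
    ultimately show ?thesis
      using rM[OF that(1)] A by (simp add: integral_completion integral_restrict_space compacted_borel_borel)
  qed
  let ?I = "\<lambda>j. \<integral>x. indicator A x *\<^sub>R f x \<partial>M j"
  have "integral_over compacted_borel \<mu> f A = (?I 0 - ?I 2) + \<i> * (?I 1 - ?I 3)"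
    unfolding integral_over_def Let_def
    using tr[of 0, OF _ M0] tr[of 1, OF _ M1] tr[of 2, OF _ M2] tr[of 3, OF _ M3] by simp
  also have "\<dots> = (\<Sum>j<4. \<i> ^ j * ?I j)"
    by (simp add: eval_nat_numeral algebra_simps)
  also have "\<dots> = (\<Sum>j\<in>J. c j * (\<integral>x. indicator A x *\<^sub>R f x \<partial>N j))"
  proof -
    \<comment> \<open>The disjoint sum of both index sets, with the Jordan coefficients taken with
      the opposite sign, represents the zero measure.\<close>
    define K where "K = J <+> {..<4::nat}"
    define d where "d = case_sum c (\<lambda>j. - (\<i> ^ j))"
    define L where "L = case_sum N M"
    have sK: "(\<Sum>k\<in>K. d k * g (L k)) = (\<Sum>j\<in>J. c j * g (N j)) - (\<Sum>j<4. \<i> ^ j * g (M j))" for g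
      unfolding K_def d_def L_def using representsD(1)[OF R] by (simp add: sum.Plus sum_negf)
    have "(\<Sum>k\<in>K. d k * (\<integral>x. indicator A x *\<^sub>R f x \<partial>L k)) = 0"
    proof (rule integral_combination_zero)
      show "finite K" using representsD(1)[OF R] by (simp add: K_def)
      show "radon (L k)" "integrable (L k) f" if "k \<in> K" for k
        using that representsD(2)[OF R] rM f intM by (auto simp: K_def L_def)
      fix B :: "'a set" assume B: "B \<in> compacted_borel"
      show "(\<Sum>k\<in>K. d k * of_real (measure (L k) B)) = 0"
        using sK[of "\<lambda>M. of_real (measure M B)"] representsD(3)[OF R B] representsD(3)[OF M B] by simp
    qed (use A fb in auto)
    then show ?thesis using sK[of "\<lambda>M. \<integral>x. indicator A x *\<^sub>R f x \<partial>M"] by simp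
  qed
  finally show ?thesis .
qed

text \<open>The limit is computed for every exhaustion by dominated convergence in each component;
  this settles both existence and uniqueness of the value described in
  \<open>integral_on\<close>.\<close>

lemma cb_integral_represents:
  fixes \<mu> :: "'a::t2_space set \<Rightarrow> complex"
  assumes R: "represents J c N \<mu>"
    and f: "\<And>j. j \<in> J \<Longrightarrow> integrable (N j) f" and fb: "f \<in> borel_measurable borel"
    and supp: "incseq E" "range E \<subseteq> compacted_borel" "\<And>x. x \<notin> (\<Union>n. E n) \<Longrightarrow> f x = 0"
  shows "f \<in> cb_L1 \<mu>" and "cb_integral \<mu> f = (\<Sum>j\<in>J. c j * (\<integral>x. f x \<partial>N j))"
proof -
  have mu: "\<mu> \<in> regular_cb_measures" by (rule regular_represents[OF R])
  interpret complex_cb \<mu> by unfold_locales (use mu in \<open>simp add: regular_cb_measures_def\<close>)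
  \<comment> \<open>\<open>T\<close> extends the variation itself: local measurability and the
    exhaustion condition are phrased with it and not with the possibly larger
    \<open>S\<close>.\<close>
  obtain T where T: "radon T" "\<And>A. A \<in> compacted_borel \<Longrightarrow> emeasure T A = cb_variation \<mu> A"
    by (rule regular_radon_part[OF mu, of "cb_variation \<mu>"], erule (2) tv_suminf, rule tv_empty, rule order_refl, rule that)
  obtain S where S: "dominates S J c N" using dominates_exists[OF R] .
  then have rS: "radon S" by (simp add: dominates_def)
  have TS: "emeasure T B \<le> emeasure S B" if "B \<in> sets borel" for B
  proof -
    have "emeasure T B = (SUP K\<in>{K. compact K \<and> K \<subseteq> B}. emeasure T K)"
      by (rule radon_inner[OF T(1) that])
    also have "\<dots> \<le> emeasure S B"
    proof (rule SUP_least)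
      fix K assume K: "K \<in> {K. compact K \<and> K \<subseteq> B}"
      then have Kcb: "K \<in> compacted_borel" by (simp add: compact_compacted_borel)
      have "emeasure T K \<le> emeasure S K" using T(2)[OF Kcb] dominates_tv_le[OF R S Kcb] by simp
      also have "\<dots> \<le> emeasure S B" using K that rS by (intro emeasure_mono) auto
      finally show "emeasure T K \<le> emeasure S B" .
    qed
    finally show ?thesis .
  qed
  have "(\<integral>\<^sup>+x. norm (f x) \<partial>S) = (\<Sum>j\<in>J. ennreal (cmod (c j)) * (\<integral>\<^sup>+x. norm (f x) \<partial>N j))"
    using representsD(1,2)[OF R] rS S fb unfolding dominates_def by (intro nn_integral_sum_measure) auto
  also have "\<dots> < \<infinity>" using f representsD(1)[OF R] by (auto simp: integrable_iff_bounded ennreal_mult_less_top)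
  finally have intS: "integrable S f" using radon_measurable[OF rS fb] by (simp add: integrable_iff_bounded)
  have intT: "integrable T f"
    by (rule integrable_mono_measure[OF _ _ TS intS]) (use T rS in auto)
  have fT: "(\<integral>\<^sup>+x. ennreal (cmod (f x)) \<partial>T) < \<infinity>" using intT by (simp add: integrable_iff_bounded)
  have trT: "trace_measure compacted_borel (cb_variation \<mu>) A = restrict_space T A" if "A \<in> compacted_borel" for A
    using T that by (intro trace_measure_eq) auto
  have loc: "locally_measurable_on compacted_borel \<mu> f"
    unfolding locally_measurable_on_def
    by (intro ballI measurable_completion) (simp add: trT measurable_restrict_space1 radon_measurable[OF T(1) fb])
  have ex: "L1_exhaustion compacted_borel \<mu> f E"
  proof -
    let ?X = "\<lambda>n. \<integral>\<^sup>+x. ennreal (cmod (f x)) \<partial>completion (trace_measure compacted_borel (cb_variation \<mu>) (E n))"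
    have X: "?X n = (\<integral>\<^sup>+x. ennreal (cmod (f x)) * indicator (E n) x \<partial>T)" for n
    proof -
      have "E n \<in> compacted_borel" using supp by auto
      then show ?thesis
        using T(1) by (simp add: trT nn_integral_completion nn_integral_restrict_space compacted_borel_borel)
    qed
    have "incseq ?X"
      unfolding X using supp(1) by (intro monoI nn_integral_mono)
        (auto simp: incseq_def le_fun_def split: split_indicator)
    then have "?X \<longlonglongrightarrow> (SUP n. ?X n)" by (rule LIMSEQ_SUP)
    then have "lim ?X = (SUP n. ?X n)" by (rule limI)
    also have "\<dots> \<le> (\<integral>\<^sup>+x. ennreal (cmod (f x)) \<partial>T)"
      unfolding X by (intro SUP_least nn_integral_mono) (auto split: split_indicator)
    finally show ?thesis unfolding L1_exhaustion_def using supp fT by auto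
  qed
  show "f \<in> cb_L1 \<mu>" unfolding L1_on_def using loc ex by auto
  have lim: "(\<lambda>n. integral_over compacted_borel \<mu> f (A n)) \<longlonglongrightarrow> (\<Sum>j\<in>J. c j * (\<integral>x. f x \<partial>N j))"
    if A: "L1_exhaustion compacted_borel \<mu> f A" for A
  proof -
    have A: "range A \<subseteq> compacted_borel" "incseq A" "\<And>x. x \<notin> (\<Union>n. A n) \<Longrightarrow> f x = 0"
      using that by (auto simp: L1_exhaustion_def)
    have eq: "integral_over compacted_borel \<mu> f (A n) = (\<Sum>j\<in>J. c j * (\<integral>x. indicator (A n) x *\<^sub>R f x \<partial>N j))" for n
      using A(1) by (intro integral_over_represents[OF R _ f fb]) auto
    show ?thesis unfolding eq
    proof (intro tendsto_sum tendsto_mult tendsto_const)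
      fix j assume j: "j \<in> J"
      then have rN: "radon (N j)" using representsD(2)[OF R] by blast
      show "(\<lambda>n. \<integral>x. indicator (A n) x *\<^sub>R f x \<partial>N j) \<longlonglongrightarrow> (\<integral>x. f x \<partial>N j)"
      proof (rule integral_dominated_convergence)
        show "integrable (N j) (\<lambda>x. norm (f x))" using f[OF j] by simp
        show "AE x in N j. (\<lambda>n. indicator (A n) x *\<^sub>R f x) \<longlonglongrightarrow> f x"
        proof (intro AE_I2)
          fix x
          show "(\<lambda>n. indicator (A n) x *\<^sub>R f x) \<longlonglongrightarrow> f x"
          proof (cases "x \<in> (\<Union>n. A n)")
            case True
            then obtain n where n: "x \<in> A n" by blast
            have "eventually (\<lambda>m. indicator (A m) x *\<^sub>R f x = f x) sequentially"
              using A(2) n by (intro eventually_sequentiallyI[of n]) (auto simp: incseq_def indicator_def)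
            then show ?thesis by (rule tendsto_eventually)
          next
            case False then show ?thesis using A(3) by simp
          qed
        qed
        show "AE x in N j. norm (indicator (A n) x *\<^sub>R f x) \<le> norm (f x)" for n
          by (intro AE_I2) (auto split: split_indicator)
        show "(\<lambda>x. indicator (A n) x *\<^sub>R f x) \<in> borel_measurable (N j)" for n
        proof -
          have [measurable]: "A n \<in> sets borel" using A(1) compacted_borel_borel by auto
          show ?thesis using fb by (intro radon_measurable[OF rN]) measurable
        qed
      qed (rule radon_measurable[OF rN fb])
    qed
  qed
  show "cb_integral \<mu> f = (\<Sum>j\<in>J. c j * (\<integral>x. f x \<partial>N j))"
    unfolding integral_on_def
  proof (rule the_equality)
    show "\<exists>A. L1_exhaustion compacted_borel \<mu> f A \<and>
       (\<lambda>n. integral_over compacted_borel \<mu> f (A n)) \<longlonglongrightarrow> (\<Sum>j\<in>J. c j * (\<integral>x. f x \<partial>N j))"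
      using ex lim[OF ex] by blast
    fix z assume "\<exists>A. L1_exhaustion compacted_borel \<mu> f A \<and> (\<lambda>n. integral_over compacted_borel \<mu> f (A n)) \<longlonglongrightarrow> z"
    then obtain A where "L1_exhaustion compacted_borel \<mu> f A" "(\<lambda>n. integral_over compacted_borel \<mu> f (A n)) \<longlonglongrightarrow> z"
      by blast
    then show "z = (\<Sum>j\<in>J. c j * (\<integral>x. f x \<partial>N j))" using LIMSEQ_unique lim by blast
  qed
qed

section \<open>Compactly supported functions on locally compact spaces\<close>

lemma locally_compact_euclidean_iff:
  "locally_compact_space (euclidean :: 'a::topological_space topology) \<longleftrightarrow>
     (\<forall>x::'a. \<exists>U K. open U \<and> compact K \<and> x \<in> U \<and> U \<subseteq> K)"
  unfolding locally_compact_space_def by simp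

lemma locally_compact_euclidean_prod:
  assumes "locally_compact_space (euclidean :: 'a::topological_space topology)"
    and "locally_compact_space (euclidean :: 'b::topological_space topology)"
  shows "locally_compact_space (euclidean :: ('a \<times> 'b) topology)"
  unfolding locally_compact_euclidean_iff
proof
  fix x :: "'a \<times> 'b"
  obtain U K where 1: "open U" "compact K" "fst x \<in> U" "U \<subseteq> K"
    using assms(1) unfolding locally_compact_euclidean_iff by blast
  obtain V L where 2: "open V" "compact L" "snd x \<in> V" "V \<subseteq> L"
    using assms(2) unfolding locally_compact_euclidean_iff by blast
  show "\<exists>U K. open U \<and> compact K \<and> x \<in> U \<and> U \<subseteq> K"
    using 1 2 by (intro exI[of _ "U \<times> V"] exI[of _ "K \<times> L"])
      (auto simp: open_Times compact_Times mem_Times_iff)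
qed

lemma Hausdorff_space_t2: "Hausdorff_space (euclidean :: 'a::t2_space topology)"
  unfolding Hausdorff_space_def using hausdorff by (auto simp: disjnt_def)

lemma compact_open_between:
  fixes K U :: "'a::t2_space set"
  assumes lc: "locally_compact_space (euclidean :: 'a topology)" and K: "compact K" "K \<subseteq> U" "open U"
  obtains V where "open V" "K \<subseteq> V" "compact (closure V)" "closure V \<subseteq> U"
proof -
  have nb: "neighbourhood_base_of (\<lambda>C. compactin euclidean C \<and> closedin euclidean C) (euclidean :: 'a topology)"
    using lc locally_compact_space_neighbourhood_base_closedin[of "euclidean :: 'a topology"] Hausdorff_space_t2 by blast
  have "\<exists>W C. open W \<and> compact C \<and> x \<in> W \<and> W \<subseteq> C \<and> C \<subseteq> U" if "x \<in> K" for x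
  proof -
    have "openin euclidean U" "x \<in> U" using that K by auto
    then show ?thesis using nb unfolding neighbourhood_base_of by (metis open_openin compactin_euclidean_iff)
  qed
  then obtain W C where WC: "\<And>x. x \<in> K \<Longrightarrow> open (W x) \<and> compact (C x) \<and> x \<in> W x \<and> W x \<subseteq> C x \<and> C x \<subseteq> U"
    by metis
  obtain F where F: "F \<subseteq> K" "finite F" "K \<subseteq> (\<Union>x\<in>F. W x)"
    by (rule compactE_image[of K K W]) (use K WC in blast)+
  have cC: "compact (\<Union>x\<in>F. C x)" using F WC by (intro compact_UN) auto
  have sub: "closure (\<Union>x\<in>F. W x) \<subseteq> (\<Union>x\<in>F. C x)"
    using F WC compact_imp_closed[OF cC] by (intro closure_minimal) blast+
  have "compact (closure (\<Union>x\<in>F. W x))"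
    using compact_Int_closed[OF cC closed_closure, of "\<Union>x\<in>F. W x"] sub by (simp add: Int_absorb1)
  moreover have "(\<Union>x\<in>F. C x) \<subseteq> U" using F WC by blast
  moreover have "open (\<Union>x\<in>F. W x)" using F WC by (intro open_UN) auto
  ultimately show ?thesis using that[of "\<Union>x\<in>F. W x"] F sub by blast
qed

definition nonneg_cs :: "('a::topological_space \<Rightarrow> real) set" where
  "nonneg_cs = {f. continuous_on UNIV f \<and> (\<forall>x. 0 \<le> f x) \<and> (\<exists>K. compact K \<and> (\<forall>x. x \<notin> K \<longrightarrow> f x = 0))}"

lemma nonneg_csD:
  assumes "f \<in> nonneg_cs"
  shows "continuous_on UNIV f" "0 \<le> f x" "\<exists>K. compact K \<and> (\<forall>x. x \<notin> K \<longrightarrow> f x = 0)"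
  using assms by (auto simp: nonneg_cs_def)

lemma nonneg_csI:
  "continuous_on UNIV f \<Longrightarrow> (\<And>x. 0 \<le> f x) \<Longrightarrow> compact K \<Longrightarrow> (\<And>x. x \<notin> K \<Longrightarrow> f x = 0) \<Longrightarrow> f \<in> nonneg_cs"
  by (auto simp: nonneg_cs_def)

lemma compactly_supported_iff:
  fixes f :: "'a::t2_space \<Rightarrow> complex"
  shows "f \<in> compactly_supported \<longleftrightarrow> continuous_on UNIV f \<and> (\<exists>K. compact K \<and> (\<forall>x. x \<notin> K \<longrightarrow> f x = 0))"
proof
  assume "f \<in> compactly_supported"
  then show "continuous_on UNIV f \<and> (\<exists>K. compact K \<and> (\<forall>x. x \<notin> K \<longrightarrow> f x = 0))"
    using closure_subset[of "{x. f x \<noteq> 0}"] unfolding compactly_supported_def by blast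
next
  assume "continuous_on UNIV f \<and> (\<exists>K. compact K \<and> (\<forall>x. x \<notin> K \<longrightarrow> f x = 0))"
  then obtain K where K: "continuous_on UNIV f" "compact K" "\<forall>x. x \<notin> K \<longrightarrow> f x = 0" by auto
  have sub: "closure {x. f x \<noteq> 0} \<subseteq> K"
    using K compact_imp_closed by (intro closure_minimal) auto
  have "compact (closure {x. f x \<noteq> 0})"
    using compact_Int_closed[OF K(2) closed_closure, of "{x. f x \<noteq> 0}"] sub by (simp add: Int_absorb1)
  then show "f \<in> compactly_supported" using K by (simp add: compactly_supported_def)
qed

text \<open>The function is cut off at an intermediate relatively compact open set, whose closure is
  returned as \<open>C\<close>.\<close>

lemma urysohn:
  fixes K U :: "'a::t2_space set"
  assumes lc: "locally_compact_space (euclidean :: 'a topology)" and K: "compact K" "K \<subseteq> U" "open U"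
  obtains f C where "f \<in> nonneg_cs" "\<And>x. f x \<le> 1" "\<And>x. x \<in> K \<Longrightarrow> f x = 1"
    "compact C" "C \<subseteq> U" "\<And>x. x \<notin> C \<Longrightarrow> f x = 0"
proof -
  obtain V where V: "open V" "K \<subseteq> V" "compact (closure V)" "closure V \<subseteq> U"
    using compact_open_between[OF lc K] .
  have "completely_regular_space (euclidean :: 'a topology)"
    using lc Hausdorff_space_t2 locally_compact_Hausdorff_imp_regular_space
      locally_compact_regular_imp_completely_regular_space by blast
  moreover have "closedin euclidean (- V)" using V by (simp add: closed_Compl)
  moreover have "disjnt K (- V)" using V by (auto simp: disjnt_def)
  ultimately obtain f :: "'a \<Rightarrow> real" where f: "continuous_map euclidean (subtopology euclidean {0..1}) f"
      "f ` (- V) \<subseteq> {0}" "f ` K \<subseteq> {1}"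
    using Urysohn_completely_regular_compact_closed[of 0 1 "euclidean :: 'a topology" K "- V"] K by auto
  have c: "continuous_on UNIV f" and r: "\<And>x. f x \<in> {0..1}"
    using f(1) by (auto simp: continuous_map_in_subtopology)
  have o: "f x = 0" if "x \<notin> closure V" for x using f(2) that closure_subset[of V] by auto
  show ?thesis
  proof (rule that[of f "closure V"])
    show "f \<in> nonneg_cs" using c r V o by (intro nonneg_csI[where K = "closure V"]) auto
    show "f x = 1" if "x \<in> K" for x using f(3) that by auto
  qed (use r V o in auto)
qed

lemma bounded_of_compact_support:
  fixes f :: "'a::t2_space \<Rightarrow> 'b::real_normed_vector"
  assumes "continuous_on UNIV f" "compact K" "\<And>x. x \<notin> K \<Longrightarrow> f x = 0"
  obtains B where "B \<ge> 0" "\<And>x. norm (f x) \<le> B"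
proof -
  have "compact (f ` K)" using assms by (meson compact_continuous_image continuous_on_subset subset_UNIV)
  then obtain B where B: "\<And>y. y \<in> f ` K \<Longrightarrow> norm y \<le> B" using compact_imp_bounded bounded_iff by metis
  have "norm (f x) \<le> max 0 B" for x using B[of "f x"] assms(3)[of x] by (cases "x \<in> K") force+
  then show ?thesis using that[of "max 0 B"] by auto
qed

lemma radon_integrable_compact_support:
  fixes f :: "'a::t2_space \<Rightarrow> 'b::{banach, second_countable_topology}"
  assumes M: "radon M" and f: "continuous_on UNIV f" "compact K" "\<And>x. x \<notin> K \<Longrightarrow> f x = 0"
  shows "integrable M f"
proof -
  obtain B where B: "\<And>x. norm (f x) \<le> B" using bounded_of_compact_support[OF f] by blast
  show ?thesis
  proof (rule integrableI_bounded_set[where A = K and B = B])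
    show "K \<in> sets M" using f(2) M by (simp add: compact_borel)
    show "f \<in> borel_measurable M" by (rule radon_measurable[OF M borel_measurable_continuous_onI[OF f(1)]])
    show "emeasure M K < \<infinity>" by (rule radon_compact[OF M f(2)])
  qed (use B f(3) in auto)
qed

lemma cb_integral_compactly_supported:
  fixes \<mu> :: "'a::t2_space set \<Rightarrow> complex"
  assumes R: "represents J c N \<mu>" and f: "f \<in> compactly_supported"
  shows "cb_integral \<mu> f = (\<Sum>j\<in>J. c j * (\<integral>x. f x \<partial>N j))" and "f \<in> cb_L1 \<mu>"
proof -
  obtain K where K: "compact K" "\<And>x. x \<notin> K \<Longrightarrow> f x = 0" and c: "continuous_on UNIV f"
    using f unfolding compactly_supported_iff by blast
  have int: "integrable (N j) f" if "j \<in> J" for j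
    by (rule radon_integrable_compact_support[OF representsD(2)[OF R that] c K])
  have fb: "f \<in> borel_measurable borel" by (rule borel_measurable_continuous_onI[OF c])
  have E: "incseq (\<lambda>_::nat. K)" "range (\<lambda>_::nat. K) \<subseteq> compacted_borel"
     "\<And>x. x \<notin> (\<Union>n::nat. K) \<Longrightarrow> f x = 0"
    using K compact_compacted_borel by (auto simp: incseq_def)
  show "cb_integral \<mu> f = (\<Sum>j\<in>J. c j * (\<integral>x. f x \<partial>N j))" "f \<in> cb_L1 \<mu>"
    using cb_integral_represents[OF R int fb E] by auto
qed

text \<open>Outer approximation of \<open>A\<close> by open sets is not at hand. Instead a compact
  \<open>K\<close> that is almost all of \<open>A\<close> is enclosed in a relatively compact open
  \<open>V\<close>, and \<open>V - K\<close> is hollowed out by a compact \<open>L\<close> that is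
  almost all of it. Then \<open>V - L\<close> is an open neighbourhood of \<open>K\<close> with
  small excess.\<close>

lemma radon_L1_approx:
  fixes S :: "'a::t2_space measure"
  assumes lc: "locally_compact_space (euclidean :: 'a topology)"
    and S: "radon S" and A: "A \<in> compacted_borel" and e: "(e::real) > 0"
  obtains f where "f \<in> nonneg_cs" "\<And>x. f x \<le> 1"
    "(\<integral>\<^sup>+x. ennreal \<bar>indicator A x - f x\<bar> \<partial>S) < ennreal e"
proof -
  have e2: "e/2 > 0" using e by simp
  obtain K where K: "compact K" "K \<subseteq> A" "emeasure S (A - K) < ennreal (e/2)"
    by (rule radon_approx[OF S compacted_borel_borel[OF A] radon_compacted_borel[OF S A] e2], rule that)
  obtain V where V: "open V" "K \<subseteq> V" "compact (closure V)"
    by (rule compact_open_between[OF lc K(1) subset_UNIV open_UNIV], rule that)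
  have "V - K \<in> sets borel" using V K by (auto simp: compact_borel)
  moreover have "V - K \<subseteq> closure V" using closure_subset[of V] by blast
  ultimately have VK: "V - K \<in> compacted_borel" by (rule compacted_borel_subset_compact[OF V(3)])
  obtain L where L: "compact L" "L \<subseteq> V - K" "emeasure S (V - K - L) < ennreal (e/2)"
    by (rule radon_approx[OF S compacted_borel_borel[OF VK] radon_compacted_borel[OF S VK] e2], rule that)
  have oVL: "open (V - L)" "K \<subseteq> V - L" using V L compact_imp_closed by auto
  obtain f C where f: "f \<in> nonneg_cs" "\<And>x. f x \<le> 1" "\<And>x. x \<in> K \<Longrightarrow> f x = 1"
      "compact C" "C \<subseteq> V - L" "\<And>x. x \<notin> C \<Longrightarrow> f x = 0"
    by (rule urysohn[OF lc K(1) oVL(2,1)], rule that)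
  have m[measurable]: "A - K \<in> sets S" "V - K - L \<in> sets S"
    using A K L VK S by (auto simp: compact_borel compacted_borel_borel)
  \<comment> \<open>\<open>f\<close> is 1 on \<open>K\<close> and 0 off \<open>V - L\<close>, so it
    differs from the indicator only on \<open>A - K\<close> and on \<open>V - K - L\<close>, and
    there by at most 1.\<close>
  have "(\<integral>\<^sup>+x. ennreal \<bar>indicator A x - f x\<bar> \<partial>S) \<le> (\<integral>\<^sup>+x. indicator (A - K) x + indicator (V - K - L) x \<partial>S)"
  proof (rule nn_integral_mono)
    fix x
    have fx: "0 \<le> f x" "f x \<le> 1" using f(2) nonneg_csD(2)[OF f(1)] by auto
    have b: "ennreal \<bar>indicator A x - f x\<bar> \<le> 1"
      using fx by (auto simp: indicator_def intro!: ennreal_leI[of _ 1, simplified])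
    show "ennreal \<bar>indicator A x - f x\<bar> \<le> indicator (A - K) x + indicator (V - K - L) x"
    proof (cases "x \<in> K")
      case True then show ?thesis using K f(3) by (auto simp: indicator_def)
    next
      case False
      show ?thesis
      proof (cases "x \<in> A \<or> x \<in> V - L")
        case True
        then have "(1::ennreal) \<le> indicator (A - K) x + indicator (V - K - L) x"
          using False by (auto simp: indicator_def)
        then show ?thesis using b by order
      next
        case F: False
        then have "f x = 0" using f(5,6) by auto
        then show ?thesis using F by (auto simp: indicator_def)
      qed
    qed
  qed
  also have "\<dots> = emeasure S (A - K) + emeasure S (V - K - L)"
    by (subst nn_integral_add) auto
  also have "\<dots> < ennreal (e/2) + ennreal (e/2)" using K(3) L(3) by (rule add_strict_mono)
  also have "\<dots> = ennreal e" using e by (subst ennreal_plus[symmetric]) auto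
  finally show ?thesis using that f by blast
qed

lemma represents_integral_bound:
  fixes g :: "'a::t2_space \<Rightarrow> complex"
  assumes J: "finite J" "\<And>j. j \<in> J \<Longrightarrow> radon (N j)" and S: "dominates S J c N"
    and g: "g \<in> borel_measurable borel" "\<And>j. j \<in> J \<Longrightarrow> integrable (N j) g"
  shows "ennreal (cmod (\<Sum>j\<in>J. c j * (\<integral>x. g x \<partial>N j))) \<le> (\<integral>\<^sup>+x. ennreal (cmod (g x)) \<partial>S)"
proof -
  have rS: "radon S" using S by (simp add: dominates_def)
  have "ennreal (cmod (\<Sum>j\<in>J. c j * (\<integral>x. g x \<partial>N j))) \<le> ennreal (\<Sum>j\<in>J. cmod (c j) * cmod (\<integral>x. g x \<partial>N j))"
    by (intro ennreal_leI order_trans[OF norm_sum]) (simp add: norm_mult)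
  also have "\<dots> = (\<Sum>j\<in>J. ennreal (cmod (c j)) * ennreal (cmod (\<integral>x. g x \<partial>N j)))"
    by (simp add: sum_ennreal[symmetric] ennreal_mult del: sum_ennreal)
  also have "\<dots> \<le> (\<Sum>j\<in>J. ennreal (cmod (c j)) * (\<integral>\<^sup>+x. ennreal (cmod (g x)) \<partial>N j))"
    using g by (intro sum_mono mult_left_mono integral_norm_bound_ennreal) auto
  also have "\<dots> = (\<integral>\<^sup>+x. ennreal (cmod (g x)) \<partial>S)"
    using J S rS g(1) unfolding dominates_def by (intro nn_integral_sum_measure[symmetric]) auto
  finally show ?thesis .
qed

lemma compactly_supported_of_real:
  fixes f :: "'a::t2_space \<Rightarrow> real"
  assumes "f \<in> nonneg_cs" shows "(\<lambda>x. complex_of_real (f x)) \<in> compactly_supported"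
  using assms unfolding compactly_supported_iff nonneg_cs_def by (auto intro!: continuous_on_of_real)

text \<open>The indicator of \<open>A\<close> is approximated in L1 of a dominating measure by test
  functions, on which the combination vanishes.\<close>

lemma represents_zero:
  fixes \<sigma> :: "'a::t2_space set \<Rightarrow> complex"
  assumes lc: "locally_compact_space (euclidean :: 'a topology)" and R: "represents J c N \<sigma>"
    and z: "\<And>f. f \<in> compactly_supported \<Longrightarrow> (\<Sum>j\<in>J. c j * (\<integral>x. f x \<partial>N j)) = 0"
  shows "\<sigma> A = 0"
proof (cases "A \<in> compacted_borel")
  case False then show ?thesis using representsD(4)[OF R] by simp
next
  case A: True
  obtain S where S: "dominates S J c N" using dominates_exists[OF R] .
  then have rS: "radon S" by (simp add: dominates_def)
  have "cmod (\<sigma> A) \<le> e" if e: "e > 0" for e :: real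
  proof -
    obtain f where f: "f \<in> nonneg_cs" "\<And>x. f x \<le> 1" "(\<integral>\<^sup>+x. ennreal \<bar>indicator A x - f x\<bar> \<partial>S) < ennreal e"
      by (rule radon_L1_approx[OF lc rS A e], rule that)
    let ?f = "\<lambda>x. complex_of_real (f x)" and ?g = "\<lambda>x. complex_of_real (indicator A x - f x)"
    have c: "continuous_on UNIV ?f" using compactly_supported_of_real[OF f(1)] by (simp add: compactly_supported_iff)
    obtain K where K: "compact K" "\<And>x. x \<notin> K \<Longrightarrow> ?f x = 0" using nonneg_csD(3)[OF f(1)] by auto
    have intf: "integrable (N j) ?f" if "j \<in> J" for j
      by (rule radon_integrable_compact_support[OF representsD(2)[OF R that] c K])
    have intA: "integrable (N j) (\<lambda>x. complex_of_real (indicator A x))" if "j \<in> J" for j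
      using representsD(2)[OF R that] radon_compacted_borel[OF representsD(2)[OF R that] A] A
      by (intro integrable_of_real integrable_real_indicator) (auto simp: compacted_borel_borel)
    have sp: "measure (N j) A = (\<integral>x. indicator A x \<partial>N j)" if "j \<in> J" for j
      using representsD(2)[OF R that] by simp
    have "\<sigma> A = (\<Sum>j\<in>J. c j * (\<integral>x. complex_of_real (indicator A x) \<partial>N j)) - (\<Sum>j\<in>J. c j * (\<integral>x. ?f x \<partial>N j))"
      using z[OF compactly_supported_of_real[OF f(1)]] representsD(3)[OF R A] sp by simp
    also have "\<dots> = (\<Sum>j\<in>J. c j * (\<integral>x. ?g x \<partial>N j))"
      unfolding sum_subtractf[symmetric] right_diff_distrib[symmetric]
      using intf intA by (intro sum.cong refl) (simp add: Bochner_Integration.integral_diff)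
    finally have "ennreal (cmod (\<sigma> A)) \<le> (\<integral>\<^sup>+x. ennreal (cmod (?g x)) \<partial>S)"
    proof (simp only:, intro represents_integral_bound[OF representsD(1,2)[OF R] S])
      show "?g \<in> borel_measurable borel"
      proof -
        have [measurable]: "A \<in> sets borel" "f \<in> borel_measurable borel"
          using A borel_measurable_continuous_onI[OF nonneg_csD(1)[OF f(1)]] by (auto simp: compacted_borel_borel)
        show ?thesis by measurable
      qed
      show "integrable (N j) ?g" if "j \<in> J" for j using intf[OF that] intA[OF that] by simp
    qed
    also have "\<dots> = (\<integral>\<^sup>+x. ennreal \<bar>indicator A x - f x\<bar> \<partial>S)"
      by (intro nn_integral_cong) (simp only: norm_of_real)
    finally have "ennreal (cmod (\<sigma> A)) \<le> ennreal e" using f(3) by order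
    then show ?thesis using e by (simp add: ennreal_le_iff)
  qed
  then show ?thesis by (metis field_le_epsilon add_0 norm_le_zero_iff)
qed

lemma represents_add:
  assumes "represents J c N \<mu>" "represents K d M \<nu>"
  shows "represents (J <+> K) (case_sum c d) (case_sum N M) (\<mu> + \<nu>)"
  unfolding represents_def
proof (intro conjI ballI allI impI)
  note 1 = representsD[OF assms(1)] and 2 = representsD[OF assms(2)]
  show "finite (J <+> K)" using 1(1) 2(1) by simp
  show "radon (case_sum N M j)" if "j \<in> J <+> K" for j using that 1(2) 2(2) by auto
  show "(\<mu> + \<nu>) A = (\<Sum>j\<in>J <+> K. case_sum c d j * of_real (measure (case_sum N M j) A))"
    if "A \<in> compacted_borel" for A
    using 1(1,3) 2(1,3) that by (simp add: sum.Plus)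
  show "(\<mu> + \<nu>) A = 0" if "A \<notin> compacted_borel" for A using that 1(4) 2(4) by simp
qed

lemma represents_scale:
  assumes "represents J c N \<mu>"
  shows "represents J (\<lambda>j. a * c j) N (fun_scale a \<mu>)"
  unfolding represents_def
proof (intro conjI ballI allI impI)
  note 1 = representsD[OF assms]
  show "finite J" by (rule 1)
  show "radon (N j)" if "j \<in> J" for j by (rule 1(2)[OF that])
  show "fun_scale a \<mu> A = (\<Sum>j\<in>J. a * c j * of_real (measure (N j) A))" if "A \<in> compacted_borel" for A
    using 1(3)[OF that] by (simp add: fun_scale_def sum_distrib_left mult.assoc)
  show "fun_scale a \<mu> A = 0" if "A \<notin> compacted_borel" for A
    using 1(4)[OF that] by (simp add: fun_scale_def)
qed

text \<open>The uniqueness half of Riesz. It pins down the product measure, which is defined by a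
  description, and later any element of M(G, \<omega>).\<close>

lemma regular_eqI:
  fixes \<mu> \<nu> :: "'a::t2_space set \<Rightarrow> complex"
  assumes lc: "locally_compact_space (euclidean :: 'a topology)"
    and mu: "\<mu> \<in> regular_cb_measures" and nu: "\<nu> \<in> regular_cb_measures"
    and eq: "\<And>f. f \<in> compactly_supported \<Longrightarrow> cb_integral \<mu> f = cb_integral \<nu> f"
  shows "\<mu> = \<nu>"
proof
  fix A
  obtain M where M: "represents {..<4::nat} (\<lambda>j. \<i> ^ j) M \<mu>" by (rule regular_jordan[OF mu]) blast
  obtain N where N: "represents {..<4::nat} (\<lambda>j. \<i> ^ j) N \<nu>" by (rule regular_jordan[OF nu]) blast
  note R = represents_add[OF M represents_scale[OF N, of "-1"]]
  have "(\<mu> + fun_scale (-1) \<nu>) A = 0"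
  proof (rule represents_zero[OF lc R])
    fix f :: "'a \<Rightarrow> complex" assume f: "f \<in> compactly_supported"
    show "(\<Sum>j\<in>{..<4} <+> {..<4}. case_sum (\<lambda>j. \<i> ^ j) (\<lambda>j. -1 * \<i> ^ j) j * (\<integral>x. f x \<partial>case_sum M N j)) = 0"
      using eq[OF f] cb_integral_compactly_supported(1)[OF M f] cb_integral_compactly_supported(1)[OF N f]
      by (simp add: sum.Plus sum_negf)
  qed
  then show "\<mu> A = \<nu> A" by (simp add: fun_scale_def)
qed

section \<open>The Riesz representation theorem for positive functionals\<close>

lemma nonneg_cs_add: "f \<in> nonneg_cs \<Longrightarrow> g \<in> nonneg_cs \<Longrightarrow> (\<lambda>x. f x + g x) \<in> nonneg_cs"
proof -
  assume f: "f \<in> nonneg_cs" and g: "g \<in> nonneg_cs"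
  obtain K where K: "compact K" "\<forall>x. x \<notin> K \<longrightarrow> f x = 0" using nonneg_csD(3)[OF f] by blast
  obtain L where L: "compact L" "\<forall>x. x \<notin> L \<longrightarrow> g x = 0" using nonneg_csD(3)[OF g] by blast
  show ?thesis
    using nonneg_csD(1,2)[OF f] nonneg_csD(1,2)[OF g] K L
    by (intro nonneg_csI[where K = "K \<union> L"] continuous_on_add compact_Un) auto
qed

lemma nonneg_cs_dominated:
  assumes f: "f \<in> nonneg_cs" and g: "continuous_on UNIV g" "\<And>x. 0 \<le> g x" "\<And>x. f x = 0 \<Longrightarrow> g x = 0"
  shows "g \<in> nonneg_cs"
proof -
  obtain K where K: "compact K" "\<forall>x. x \<notin> K \<longrightarrow> f x = 0" using nonneg_csD(3)[OF f] by blast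
  show ?thesis using K g by (intro nonneg_csI[where K = K]) auto
qed

lemma nonneg_cs_diff:
  assumes "f \<in> nonneg_cs" "g \<in> nonneg_cs" "\<And>x. g x \<le> f x"
  shows "(\<lambda>x. f x - g x) \<in> nonneg_cs"
proof (rule nonneg_cs_dominated[OF assms(1)])
  show "continuous_on UNIV (\<lambda>x. f x - g x)"
    by (intro continuous_on_diff nonneg_csD(1) assms)
  show "f x - g x = 0" if "f x = 0" for x
    using that assms(3)[of x] nonneg_csD(2)[OF assms(2), of x] by simp
qed (use assms in simp)

lemma nonneg_cs_min:
  assumes "f \<in> nonneg_cs" "g \<in> nonneg_cs" shows "(\<lambda>x. min (f x) (g x)) \<in> nonneg_cs"
proof (rule nonneg_cs_dominated[OF assms(1)])
  show "continuous_on UNIV (\<lambda>x. min (f x) (g x))"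
    by (intro continuous_on_min nonneg_csD(1) assms)
qed (simp_all add: nonneg_csD(2) assms)

lemma nonneg_cs_scale:
  assumes "f \<in> nonneg_cs" "0 \<le> a" shows "(\<lambda>x. a * f x) \<in> nonneg_cs"
proof (rule nonneg_cs_dominated[OF assms(1)])
  show "continuous_on UNIV (\<lambda>x. a * f x)"
    by (intro continuous_on_mult_left nonneg_csD(1) assms)
qed (simp_all add: nonneg_csD(2) assms)

lemma nonneg_cs_zero: "(\<lambda>x. 0) \<in> nonneg_cs"
  by (rule nonneg_csI[where K = "{}"]) auto

text \<open>Additivity on the cone yields homogeneity under natural numbers (\<open>of_nat\<close>),
  and the comparisons with measures below are arranged to work with that alone.\<close>

locale positive_functional =
  fixes \<Lambda> :: "('a::t2_space \<Rightarrow> real) \<Rightarrow> real"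
  assumes lc: "locally_compact_space (euclidean :: 'a topology)"
    and add: "f \<in> nonneg_cs \<Longrightarrow> g \<in> nonneg_cs \<Longrightarrow> \<Lambda> (\<lambda>x. f x + g x) = \<Lambda> f + \<Lambda> g"
    and nonneg: "f \<in> nonneg_cs \<Longrightarrow> 0 \<le> \<Lambda> f"
begin

lemma mono:
  assumes "f \<in> nonneg_cs" "g \<in> nonneg_cs" "\<And>x. f x \<le> g x" shows "\<Lambda> f \<le> \<Lambda> g"
proof -
  have "\<Lambda> (\<lambda>x. f x + (g x - f x)) = \<Lambda> f + \<Lambda> (\<lambda>x. g x - f x)"
    using assms by (intro add nonneg_cs_diff) auto
  moreover have "0 \<le> \<Lambda> (\<lambda>x. g x - f x)" using assms by (intro nonneg nonneg_cs_diff) auto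
  ultimately show ?thesis by simp
qed

lemma zero: "\<Lambda> (\<lambda>x. 0) = 0"
  using add[OF nonneg_cs_zero nonneg_cs_zero] by simp

lemma of_nat: "f \<in> nonneg_cs \<Longrightarrow> \<Lambda> (\<lambda>x. real n * f x) = real n * \<Lambda> f"
proof (induction n)
  case (Suc n)
  have "\<Lambda> (\<lambda>x. f x + real n * f x) = \<Lambda> f + \<Lambda> (\<lambda>x. real n * f x)"
    using Suc.prems by (intro add nonneg_cs_scale) auto
  then show ?case using Suc by (simp add: distrib_right)
qed (simp add: zero)

lemma sum: "finite I \<Longrightarrow> (\<And>i. i \<in> I \<Longrightarrow> f i \<in> nonneg_cs) \<Longrightarrow>
  (\<lambda>x. \<Sum>i\<in>I. f i x) \<in> nonneg_cs \<and> \<Lambda> (\<lambda>x. \<Sum>i\<in>I. f i x) = (\<Sum>i\<in>I. \<Lambda> (f i))"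
proof (induction I rule: finite_induct)
  case (insert i I)
  then show ?case using add[of "f i" "\<lambda>x. \<Sum>i\<in>I. f i x"] nonneg_cs_add[of "f i" "\<lambda>x. \<Sum>i\<in>I. f i x"] by simp
qed (simp add: zero nonneg_cs_zero)

section \<open>The outer measure generated by a positive functional\<close>

definition below :: "'a set \<Rightarrow> ('a \<Rightarrow> real) set" where
  "below U = {f \<in> nonneg_cs. (\<forall>x. f x \<le> 1) \<and> (\<exists>C. compact C \<and> C \<subseteq> U \<and> (\<forall>x. x \<notin> C \<longrightarrow> f x = 0))}"

definition content :: "'a set \<Rightarrow> ennreal" where "content U = (SUP f\<in>below U. ennreal (\<Lambda> f))"

definition outer :: "'a set \<Rightarrow> ennreal" where "outer E = (INF U\<in>{U. open U \<and> E \<subseteq> U}. content U)"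

lemma below_mono: "U \<subseteq> V \<Longrightarrow> below U \<subseteq> below V" unfolding below_def by blast

lemma zero_below: "(\<lambda>x. 0) \<in> below U"
  unfolding below_def using nonneg_cs_zero by auto

lemma content_mono: "U \<subseteq> V \<Longrightarrow> content U \<le> content V"
  unfolding content_def by (rule SUP_subset_mono[OF below_mono]) auto

lemma content_upper: "f \<in> below U \<Longrightarrow> ennreal (\<Lambda> f) \<le> content U"
  unfolding content_def by (rule SUP_upper)

lemma content_empty: "content {} = 0"
proof -
  have "f = (\<lambda>x. 0)" if "f \<in> below {}" for f using that unfolding below_def by auto
  then have "ennreal (\<Lambda> f) = 0" if "f \<in> below {}" for f using that zero by force
  then have "content {} \<le> 0" unfolding content_def by (intro SUP_least) auto
  then show ?thesis by simp
qed

lemma outer_open: "open U \<Longrightarrow> outer U = content U"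
  unfolding outer_def by (intro antisym INF_lower INF_greatest content_mono) auto

lemma outer_le_content: "open U \<Longrightarrow> E \<subseteq> U \<Longrightarrow> outer E \<le> content U"
  unfolding outer_def by (rule INF_lower) simp

lemma outer_mono: "A \<subseteq> B \<Longrightarrow> outer A \<le> outer B"
  unfolding outer_def by (rule INF_superset_mono) auto

text \<open>A competitor for the union is split by truncation with a function \<open>h\<close> that
  is 1 near the part of its support outside \<open>V\<close>: \<open>min (f x) (h x)\<close>
  competes for \<open>U\<close>, and the remainder lives on \<open>C - W\<close>, inside
  \<open>V\<close>.\<close>

lemma content_Un:
  assumes U: "open U" "open V" shows "content (U \<union> V) \<le> content U + content V"
  unfolding content_def[of "U \<union> V"]
proof (rule SUP_least)
  fix f assume "f \<in> below (U \<union> V)"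
  then obtain C where f: "f \<in> nonneg_cs" "\<And>x. f x \<le> 1" and C: "compact C" "C \<subseteq> U \<union> V" "\<And>x. x \<notin> C \<Longrightarrow> f x = 0"
    unfolding below_def by blast
  have CV: "compact (C - V)" "C - V \<subseteq> U" using C U by (auto simp: compact_diff)
  obtain W where W: "open W" "C - V \<subseteq> W" "compact (closure W)" "closure W \<subseteq> U"
    by (rule compact_open_between[OF lc CV U(1)], rule that)
  obtain h D where h: "h \<in> nonneg_cs" "\<And>x. h x \<le> 1" "\<And>x. x \<in> closure W \<Longrightarrow> h x = 1"
      "compact D" "D \<subseteq> U" "\<And>x. x \<notin> D \<Longrightarrow> h x = 0"
    by (rule urysohn[OF lc W(3,4) U(1)], rule that)
  define f1 where "f1 = (\<lambda>x. min (f x) (h x))"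
  have f1: "f1 \<in> nonneg_cs" unfolding f1_def by (rule nonneg_cs_min) fact+
  have f2: "(\<lambda>x. f x - f1 x) \<in> nonneg_cs" using f(1) f1 by (rule nonneg_cs_diff) (simp add: f1_def)
  have "f1 \<in> below U"
    using f1 h(4,5,6) f(2) nonneg_csD(2)[OF f(1)] unfolding below_def
    by (auto simp: f1_def min_le_iff_disj intro!: exI[of _ D])
  moreover have "(\<lambda>x. f x - f1 x) \<in> below V"
  proof -
    have "compact (C - W)" "C - W \<subseteq> V" using C W by (auto simp: compact_diff)
    moreover have "f x - f1 x = 0" if "x \<notin> C - W" for x
    proof (cases "x \<in> C")
      case True
      then have "h x = 1" using that h(3) closure_subset[of W] by auto
      then show ?thesis using f(2)[of x] by (simp add: f1_def)
    next
      case False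
      then show ?thesis using C(3) nonneg_csD(2)[OF h(1)] by (simp add: f1_def)
    qed
    moreover have "f x - f1 x \<le> 1" for x using f(2)[of x] nonneg_csD(2)[OF f1, of x] by linarith
    ultimately show ?thesis unfolding below_def using f2 by (intro CollectI conjI exI[of _ "C - W"]) auto
  qed
  ultimately have "ennreal (\<Lambda> f1) + ennreal (\<Lambda> (\<lambda>x. f x - f1 x)) \<le> content U + content V"
    by (intro add_mono content_upper)
  moreover have "\<Lambda> f = \<Lambda> f1 + \<Lambda> (\<lambda>x. f x - f1 x)"
    using add[OF f1 f2] by simp
  ultimately show "ennreal (\<Lambda> f) \<le> content U + content V"
    using nonneg[OF f1] nonneg[OF f2] by simp
qed

lemma content_finite_UN: "(\<And>i. open (U i)) \<Longrightarrow> content (\<Union>i<n. U i) \<le> (\<Sum>i<n. content (U i))" for U :: "nat \<Rightarrow> _"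
proof (induction n)
  case (Suc n)
  have "content (\<Union>i<Suc n. U i) \<le> content (\<Union>i<n. U i) + content (U n)"
    using content_Un[of "\<Union>i<n. U i" "U n"] Suc.prems by (simp add: lessThan_Suc Un_commute open_UN)
  then show ?case using Suc by (simp add: add_right_mono order_trans)
qed (simp add: content_empty)

text \<open>A competitor vanishes off a compact set, which finitely many of the \<open>U i\<close>
  cover.\<close>

lemma content_UN:
  fixes U :: "nat \<Rightarrow> 'a set"
  assumes U: "\<And>i. open (U i)" shows "content (\<Union>i. U i) \<le> (\<Sum>i. content (U i))"
  unfolding content_def[of "\<Union>i. U i"]
proof (rule SUP_least)
  fix f assume f: "f \<in> below (\<Union>i. U i)"
  then obtain C where C: "compact C" "C \<subseteq> (\<Union>i. U i)" "\<forall>x. x \<notin> C \<longrightarrow> f x = 0"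
    unfolding below_def by blast
  obtain F where F: "F \<subseteq> UNIV" "finite F" "C \<subseteq> (\<Union>i\<in>F. U i)"
    by (rule compactE_image[OF C(1) U C(2)], rule that)
  obtain n where n: "F \<subseteq> {..<n}" using finite_nat_bounded[OF F(2)] by blast
  have "C \<subseteq> (\<Union>i<n. U i)" using F n by blast
  then have "f \<in> below (\<Union>i<n. U i)" using f C unfolding below_def by blast
  then have "ennreal (\<Lambda> f) \<le> content (\<Union>i<n. U i)" by (rule content_upper)
  also have "\<dots> \<le> (\<Sum>i<n. content (U i))" by (rule content_finite_UN[OF U])
  also have "\<dots> \<le> (\<Sum>i. content (U i))" by (rule sum_le_suminf) auto
  finally show "ennreal (\<Lambda> f) \<le> (\<Sum>i. content (U i))" .
qed

lemma outer_subadditive: "outer (\<Union>i. A i) \<le> (\<Sum>i. outer (A i))" for A :: "nat \<Rightarrow> 'a set"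
proof (rule ennreal_le_epsilon)
  fix e :: real assume fin: "(\<Sum>i. outer (A i)) < top" and e: "e > 0"
  have "\<exists>U. open U \<and> A i \<subseteq> U \<and> content U \<le> outer (A i) + ennreal (e * (1/2) ^ Suc i)" for i
  proof -
    have "outer (A i) \<noteq> \<infinity>" using ennreal_suminf_lessD[OF fin, of i] by simp
    then have "\<exists>U\<in>{U. open U \<and> A i \<subseteq> U}. content U < outer (A i) + ennreal (e * (1/2) ^ Suc i)"
      using e by (intro INF_approx_ennreal outer_def) auto
    then show ?thesis by (auto intro: less_imp_le)
  qed
  then obtain U where U: "\<And>i. open (U i)" "\<And>i. A i \<subseteq> U i"
      "\<And>i. content (U i) \<le> outer (A i) + ennreal (e * (1/2) ^ Suc i)"
    by metis
  have "outer (\<Union>i. A i) \<le> content (\<Union>i. U i)" using U by (intro outer_le_content open_UN) blast+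
  also have "\<dots> \<le> (\<Sum>i. content (U i))" by (rule content_UN[OF U(1)])
  also have "\<dots> \<le> (\<Sum>i. outer (A i) + ennreal (e * (1/2) ^ Suc i))" using U(3) by (intro suminf_le) auto
  also have "\<dots> = (\<Sum>i. outer (A i)) + (\<Sum>i. ennreal (e * (1/2) ^ Suc i))" by (rule suminf_add[symmetric]) auto
  also have "(\<Sum>i. ennreal (e * (1/2) ^ Suc i)) = ennreal (e * 1)"
    using e by (intro suminf_ennreal_eq sums_mult power_half_series) auto
  finally show "outer (\<Union>i. A i) \<le> (\<Sum>i. outer (A i)) + ennreal e" by simp
qed

lemma outer_measure_space: "outer_measure_space (Pow UNIV) outer"
  unfolding outer_measure_space_def positive_def increasing_def countably_subadditive_def
  using outer_open[OF open_empty] content_empty outer_mono outer_subadditive by simp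

text \<open>Caratheodory's criterion for an open \<open>V\<close>: given a competitor for
  \<open>U \<inter> V\<close> that vanishes off \<open>C\<close>, take one for \<open>U - C\<close>,
  which is open and contains \<open>U - V\<close>. They are nonzero on disjoint sets, so their sum
  competes for \<open>U\<close>.\<close>

lemma open_lambda_system:
  assumes V: "open V" shows "V \<in> lambda_system UNIV (Pow UNIV) outer"
proof -
  have le: "outer (E \<inter> V) + outer (E - V) \<le> outer E" for E
    unfolding outer_def[of E]
  proof (rule INF_greatest)
    fix U assume U: "U \<in> {U. open U \<and> E \<subseteq> U}"
    have "outer (E \<inter> V) + outer (E - V) \<le> content (U \<inter> V) + outer (U - V)"
      using U V by (intro add_mono outer_mono outer_le_content open_Int) auto
    also have "\<dots> = (SUP f\<in>below (U \<inter> V). ennreal (\<Lambda> f) + outer (U - V))"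
      unfolding content_def using zero_below[of "U \<inter> V"] by (intro ennreal_SUP_add_left[symmetric]) auto
    also have "\<dots> \<le> content U"
    proof (rule SUP_least)
      fix f assume "f \<in> below (U \<inter> V)"
      then obtain C where f: "f \<in> nonneg_cs" "\<And>x. f x \<le> 1" and C: "compact C" "C \<subseteq> U \<inter> V" "\<And>x. x \<notin> C \<Longrightarrow> f x = 0"
        unfolding below_def by blast
      have oUC: "open (U - C)" using U C compact_imp_closed by blast
      have "ennreal (\<Lambda> f) + outer (U - V) \<le> ennreal (\<Lambda> f) + content (U - C)"
        using C by (intro add_left_mono outer_le_content oUC) auto
      also have "\<dots> = (SUP g\<in>below (U - C). ennreal (\<Lambda> f) + ennreal (\<Lambda> g))"
        unfolding content_def using zero_below[of "U - C"] by (subst ennreal_SUP_add_right) auto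
      also have "\<dots> \<le> content U"
      proof (rule SUP_least)
        fix g assume "g \<in> below (U - C)"
        then obtain D where g: "g \<in> nonneg_cs" "\<And>x. g x \<le> 1" and D: "compact D" "D \<subseteq> U - C" "\<And>x. x \<notin> D \<Longrightarrow> g x = 0"
          unfolding below_def by blast
        have "f x + g x \<le> 1" for x
        proof (cases "x \<in> C")
          case True
          then have "g x = 0" using D by auto
          then show ?thesis using f(2)[of x] by simp
        next
          case False
          then show ?thesis using C(3)[of x] g(2)[of x] by simp
        qed
        moreover have "f x + g x = 0" if "x \<notin> C \<union> D" for x using that C D by auto
        ultimately have "(\<lambda>x. f x + g x) \<in> below U"
          unfolding below_def using nonneg_cs_add[OF f(1) g(1)] C D
          by (intro CollectI conjI exI[of _ "C \<union> D"]) (auto simp: compact_Un)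
        then have "ennreal (\<Lambda> (\<lambda>x. f x + g x)) \<le> content U" by (rule content_upper)
        then show "ennreal (\<Lambda> f) + ennreal (\<Lambda> g) \<le> content U"
          using add[OF f(1) g(1)] nonneg[OF f(1)] nonneg[OF g(1)] by simp
      qed
      finally show "ennreal (\<Lambda> f) + outer (U - V) \<le> content U" .
    qed
    finally show "outer (E \<inter> V) + outer (E - V) \<le> content U" .
  qed
  have ge: "outer E \<le> outer (E \<inter> V) + outer (E - V)" for E
  proof -
    have "outer (\<Union>i. binaryset (E \<inter> V) (E - V) i) \<le> (\<Sum>i. outer (binaryset (E \<inter> V) (E - V) i))"
      by (rule outer_subadditive)
    also have "(\<Union>i. binaryset (E \<inter> V) (E - V) i) = E" by (auto simp: UN_binaryset_eq)
    also have "(\<Sum>i. outer (binaryset (E \<inter> V) (E - V) i)) = outer (E \<inter> V) + outer (E - V)"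
      using outer_open[OF open_empty] content_empty by (intro suminf_binaryset_eq) simp
    finally show ?thesis .
  qed
  have "outer (V \<inter> E) + outer ((UNIV - V) \<inter> E) = outer E" for E
    using antisym[OF le[of E] ge[of E]] by (simp add: Int_commute Diff_eq)
  then show ?thesis unfolding lambda_system_def by simp
qed

lemma outer_countably_additive: "countably_additive (sets borel) outer"
proof -
  interpret P: sigma_algebra UNIV "Pow (UNIV :: 'a set)" by (rule sigma_algebra_Pow)
  have ms: "measure_space UNIV (lambda_system UNIV (Pow UNIV) outer) outer"
    by (rule P.caratheodory_lemma[OF outer_measure_space])
  then interpret L: sigma_algebra UNIV "lambda_system UNIV (Pow UNIV) outer"
    by (simp add: measure_space_def)
  have "sets (borel :: 'a measure) = sigma_sets UNIV {S. open S}"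
    unfolding borel_def by (simp add: sets_measure_of)
  also have "\<dots> \<subseteq> lambda_system UNIV (Pow UNIV) outer"
    using open_lambda_system by (intro L.sigma_sets_subset) auto
  finally have "sets borel \<subseteq> lambda_system UNIV (Pow UNIV) outer" .
  then show ?thesis using ms unfolding measure_space_def countably_additive_def by blast
qed

text \<open>The set where \<open>h\<close> exceeds \<open>(n + 1) / (n + 2)\<close> is an open
  neighbourhood of \<open>K\<close>. A threshold of this form lets the comparison of competitors
  with \<open>h\<close> use natural multiples only; the resulting factor
  \<open>(n + 2) / (n + 1)\<close> tends to 1.\<close>

lemma outer_compact_le:
  assumes K: "compact K" and h: "h \<in> nonneg_cs" "\<And>x. x \<in> K \<Longrightarrow> 1 \<le> h x"
  shows "outer K \<le> ennreal (\<Lambda> h)"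
proof -
  have le: "outer K \<le> ennreal (real (n + 2) / real (n + 1) * \<Lambda> h)" for n
  proof -
    define U where "U = {x. real (n + 1) < real (n + 2) * h x}"
    have "open U"
      unfolding U_def using nonneg_csD(1)[OF h(1)]
      by (intro open_Collect_less continuous_on_mult_left continuous_on_const)
    moreover have "K \<subseteq> U"
    proof
      fix x assume "x \<in> K"
      then have "real (n + 2) * 1 \<le> real (n + 2) * h x" using h(2) by (intro mult_left_mono) auto
      moreover have "real (n + 1) < real (n + 2) * 1" by simp
      ultimately show "x \<in> U" unfolding U_def by (intro CollectI) linarith
    qed
    ultimately have "outer K \<le> content U" by (rule outer_le_content)
    also have "\<dots> \<le> ennreal (real (n + 2) / real (n + 1) * \<Lambda> h)"
      unfolding content_def
    proof (intro SUP_least ennreal_leI)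
      fix g assume "g \<in> below U"
      then obtain C where g: "g \<in> nonneg_cs" "\<And>x. g x \<le> 1" "C \<subseteq> U" "\<And>x. x \<notin> C \<Longrightarrow> g x = 0"
        unfolding below_def by blast
      have "real (n + 1) * g x \<le> real (n + 2) * h x" for x
      proof (cases "x \<in> C")
        case True
        then have "real (n + 1) < real (n + 2) * h x" using g(3) by (auto simp: U_def)
        moreover have "real (n + 1) * g x \<le> real (n + 1)"
          using g(2)[of x] nonneg_csD(2)[OF g(1), of x] by (intro mult_left_le) auto
        ultimately show ?thesis by (rule order_trans[OF _ less_imp_le, rotated])
      next
        case False
        then show ?thesis using g(4) nonneg_csD(2)[OF h(1)] by simp
      qed
      then have "\<Lambda> (\<lambda>x. real (n + 1) * g x) \<le> \<Lambda> (\<lambda>x. real (n + 2) * h x)"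
        using g h by (intro mono nonneg_cs_scale) auto
      then have "real (n + 1) * \<Lambda> g \<le> real (n + 2) * \<Lambda> h" 
        by (simp only: of_nat[OF g(1)] of_nat[OF h(1)])
      then show "\<Lambda> g \<le> real (n + 2) / real (n + 1) * \<Lambda> h" by (simp add: field_simps)
    qed
    finally show ?thesis .
  qed
  have "(\<lambda>n. real (n + 2) / real (n + 1)) \<longlonglongrightarrow> 1" by real_asymp
  then have "(\<lambda>n. ennreal (real (n + 2) / real (n + 1) * \<Lambda> h)) \<longlonglongrightarrow> ennreal (1 * \<Lambda> h)"
    by (intro tendsto_ennrealI tendsto_mult tendsto_const)
  then have "outer K \<le> ennreal (1 * \<Lambda> h)" by (rule LIMSEQ_le_const) (use le in blast)
  then show ?thesis by simp
qed

text \<open>Since \<open>h\<close> vanishes off \<open>K\<close>, it competes for every open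
  superset of \<open>K\<close>.\<close>

lemma le_outer_compact:
  assumes K: "compact K" and h: "h \<in> nonneg_cs" "\<And>x. h x \<le> 1" "\<And>x. x \<notin> K \<Longrightarrow> h x = 0"
  shows "ennreal (\<Lambda> h) \<le> outer K"
  unfolding outer_def
proof (rule INF_greatest)
  fix U assume "U \<in> {U. open U \<and> K \<subseteq> U}"
  then have "h \<in> below U" unfolding below_def using K h by auto
  then show "ennreal (\<Lambda> h) \<le> content U" by (rule content_upper)
qed

lemma outer_compact_finite:
  assumes "compact K" shows "outer K < \<infinity>"
proof -
  obtain h C where "h \<in> nonneg_cs" "\<And>x. h x \<le> 1" "\<And>x. x \<in> K \<Longrightarrow> h x = 1"
    by (rule urysohn[OF lc assms subset_UNIV open_UNIV], rule that)
  then have "outer K \<le> ennreal (\<Lambda> h)" by (intro outer_compact_le assms) auto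
  then show ?thesis by (rule order_le_less_trans) simp
qed

text \<open>Inner regularity comes from the outer regularity built into \<open>outer\<close>,
  applied to the complement of \<open>A\<close> in its compact closure: an open set barely larger in
  content than \<open>closure A - A\<close> leaves a compact subset of \<open>A\<close> when removed
  from \<open>closure A\<close>.\<close>

lemma outer_inner:
  assumes A: "A \<in> compacted_borel"
  shows "outer A \<le> (SUP K\<in>{K. compact K \<and> K \<subseteq> A}. outer K)"
proof (rule ennreal_le_epsilon)
  fix e :: real assume e: "e > 0"
  define M where "M = measure_of UNIV (sets borel) outer"
  have sM: "sets M = sets borel" unfolding M_def using sets.sets_measure_of_eq[of borel] by simp
  have M: "emeasure M B = outer B" if "B \<in> sets borel" for B
  proof (rule emeasure_measure_of[OF M_def])
    show "positive (sets M) outer" using outer_open[OF open_empty] content_empty by (simp add: positive_def)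
    show "countably_additive (sets M) outer" using outer_countably_additive sM by simp
  qed (use that sM in auto)
  let ?C = "closure A"
  have C: "compact ?C" "?C \<in> sets M" "A \<in> sets M"
    using A sM by (auto simp: compacted_borel_def)
  have fCA: "outer (?C - A) < \<infinity>"
    using outer_mono[of "?C - A" ?C] outer_compact_finite[OF C(1)] by (auto intro: order_le_less_trans)
  then have "outer (?C - A) \<noteq> \<infinity>" by simp
  then have "\<exists>U\<in>{U. open U \<and> ?C - A \<subseteq> U}. content U < outer (?C - A) + ennreal e"
    using e by (intro INF_approx_ennreal outer_def) auto
  then obtain U where U: "open U" "?C - A \<subseteq> U" "content U < outer (?C - A) + ennreal e" by auto
  define K where "K = ?C - U"
  have K: "compact K" "K \<subseteq> A" unfolding K_def using U C closure_subset[of A] by (auto simp: compact_diff)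
  have KM: "K \<in> sets M" "?C - A \<in> sets M" using C sM by (auto simp: K_def U)
  have "A \<subseteq> K \<union> (A \<inter> U)" using closure_subset[of A] by (auto simp: K_def)
  moreover have AU: "A \<inter> U \<in> sets M" "U \<in> sets M" using C U sM by auto
  ultimately have 1: "emeasure M A \<le> emeasure M K + emeasure M (A \<inter> U)"
    using KM by (intro order_trans[OF emeasure_mono emeasure_subadditive]) auto
  \<comment> \<open>\<open>?C - A\<close> and \<open>A \<inter> U\<close> are disjoint parts of
    \<open>U\<close>; cancelling the finite measure of the first leaves at most \<open>e\<close> for
    the second.\<close>
  have "emeasure M (?C - A) + emeasure M (A \<inter> U) = emeasure M ((?C - A) \<union> (A \<inter> U))"
    using KM AU by (intro plus_emeasure) auto
  also have "\<dots> \<le> emeasure M U" using U AU KM by (intro emeasure_mono) auto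
  also have "\<dots> = content U" using M[of U] U AU sM outer_open by simp
  also have "\<dots> \<le> emeasure M (?C - A) + ennreal e" using U(3) M KM sM by simp
  finally have "emeasure M (A \<inter> U) \<le> ennreal e"
    using fCA M KM sM by (auto simp: ennreal_add_left_cancel_le)
  then have "outer A \<le> outer K + ennreal e"
    using 1 M C KM sM by (metis add_left_mono order_trans)
  also have "\<dots> \<le> (SUP K\<in>{K. compact K \<and> K \<subseteq> A}. outer K) + ennreal e"
    using K by (intro add_right_mono SUP_upper) auto
  finally show "outer A \<le> (SUP K\<in>{K. compact K \<and> K \<subseteq> A}. outer K) + ennreal e" .
qed

text \<open>Both functionals agree up to \<open>outer K / n\<close> on a function supported in \<open>K\<close>: write \<open>n f\<close> as the
  sum of the slices \<open>min (max (n f - i) 0) 1\<close> and compare each slice with the measures of two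
  consecutive superlevel sets.\<close>

theorem riesz: obtains M where "radon M" "\<And>f. f \<in> nonneg_cs \<Longrightarrow> \<Lambda> f = (\<integral>x. f x \<partial>M)"
proof -
  \<comment> \<open>On Borel sets of infinite measure \<open>outer\<close> may fail to be inner
    regular. Hence its restriction to compacted Borel sets is extended anew from compact
    sets.\<close>
  obtain M where M: "radon M" "\<And>A. A \<in> compacted_borel \<Longrightarrow> emeasure M A = outer A"
  proof (rule radon_extension[of outer])
    fix A :: "nat \<Rightarrow> 'a set" assume "range A \<subseteq> compacted_borel" "disjoint_family A" "(\<Union>i. A i) \<in> compacted_borel"
    then show "outer (\<Union>i. A i) = (\<Sum>i. outer (A i))"
      using outer_countably_additive unfolding countably_additive_def
      by (metis compacted_borel_borel subsetD subsetI)
  qed (use outer_open[OF open_empty] content_empty outer_compact_finite outer_inner in auto)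
  have cK: "emeasure M K = outer K" "emeasure M K < \<infinity>" "K \<in> sets M" if "compact K" for K
    using M(2)[OF compact_compacted_borel[OF that]] radon_compact[OF M(1) that] compact_borel[OF that] M(1) by auto
  have int: "integrable M f" if f: "f \<in> nonneg_cs" for f
  proof -
    obtain K where "compact K" "\<And>x. x \<notin> K \<Longrightarrow> f x = 0" using nonneg_csD(3)[OF f] by blast
    then show ?thesis by (rule radon_integrable_compact_support[OF M(1) nonneg_csD(1)[OF f]])
  qed
  \<comment> \<open>The bounds \<open>lower\<close> and \<open>upper\<close> hold for
    \<open>\<Lambda>\<close> and for the integral alike, so a slice squeezes both numbers into one
    interval.\<close>
  have lower: "measure M K \<le> \<Lambda> h" "measure M K \<le> (\<integral>x. h x \<partial>M)"
    if "compact K" "h \<in> nonneg_cs" "\<And>x. x \<in> K \<Longrightarrow> 1 \<le> h x" for K h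
  proof -
    have "emeasure M K \<le> ennreal (\<Lambda> h)" using outer_compact_le[OF that] cK(1)[OF that(1)] by simp
    then show "measure M K \<le> \<Lambda> h"
      using nonneg[OF that(2)] by (simp add: measure_def enn2real_leI)
    have "measure M K = (\<integral>x. indicator K x \<partial>M)" using M(1) by simp
    also have "\<dots> \<le> (\<integral>x. h x \<partial>M)"
      using that nonneg_csD(2)[OF that(2)] cK[OF that(1)] int[OF that(2)]
      by (intro integral_mono integrable_real_indicator) (auto simp: indicator_def)
    finally show "measure M K \<le> (\<integral>x. h x \<partial>M)" .
  qed
  have upper: "\<Lambda> h \<le> measure M K" "(\<integral>x. h x \<partial>M) \<le> measure M K"
    if "compact K" "h \<in> nonneg_cs" "\<And>x. h x \<le> 1" "\<And>x. x \<notin> K \<Longrightarrow> h x = 0" for K h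
  proof -
    have "ennreal (\<Lambda> h) \<le> emeasure M K" using le_outer_compact[OF that] cK(1)[OF that(1)] by simp
    then show "\<Lambda> h \<le> measure M K"
      using cK(2)[OF that(1)] by (simp add: emeasure_eq_ennreal_measure less_top[symmetric] ennreal_le_iff)
    have "(\<integral>x. h x \<partial>M) \<le> (\<integral>x. indicator K x \<partial>M)"
      using that nonneg_csD(2)[OF that(2)] cK[OF that(1)] int[OF that(2)]
      by (intro integral_mono integrable_real_indicator) (auto simp: indicator_def)
    also have "\<dots> = measure M K" using M(1) by simp
    finally show "(\<integral>x. h x \<partial>M) \<le> measure M K" .
  qed
  have "\<Lambda> f = (\<integral>x. f x \<partial>M)" if f: "f \<in> nonneg_cs" for f
  proof -
    obtain K where K: "compact K" "\<And>x. x \<notin> K \<Longrightarrow> f x = 0" using nonneg_csD(3)[OF f] by blast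
    obtain B where B: "\<And>x. norm (f x) \<le> B"
      by (rule bounded_of_compact_support[OF nonneg_csD(1)[OF f] K(1), OF K(2)], assumption, rule that)
    have close: "real n * \<bar>\<Lambda> f - (\<integral>x. f x \<partial>M)\<bar> \<le> measure M K" for n :: nat
    proof -
      obtain m :: nat where m: "real n * B \<le> real m" using real_arch_simple by blast
      define h where "h i x = min (max (real n * f x - real i) 0) 1" for i :: nat and x
      define L where "L i = K \<inter> {x. real i \<le> real n * f x}" for i :: nat
      have fc: "continuous_on UNIV f" by (rule nonneg_csD(1)[OF f])
      have L: "compact (L i)" for i
        unfolding L_def using fc
        by (intro compact_Int_closed K closed_Collect_le continuous_on_mult_left continuous_on_const)
      have h: "h i \<in> nonneg_cs" for i
      proof (rule nonneg_cs_dominated[OF f])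
        show "continuous_on UNIV (h i)" unfolding h_def using fc by (intro continuous_intros)
      qed (auto simp: h_def)
      have h1: "1 \<le> h i x" if "x \<in> L (Suc i)" for i x using that by (simp add: h_def L_def)
      have h2: "h i x \<le> 1" for i x by (simp add: h_def)
      have h3: "h i x = 0" if "x \<notin> L i" for i x
        using that K(2)[of x] by (auto simp: h_def L_def)
      \<comment> \<open>The i-th summand is the part of \<open>y\<close> between the heights
        \<open>i\<close> and \<open>i + 1\<close>.\<close>
      have slice: "min y (real k) = (\<Sum>i<k. min (max (y - real i) 0) 1)" if "y \<ge> 0" for y k
        using that by (induction k) (auto simp: min_def max_def)
      have sum_h: "(\<Sum>i<m. h i x) = real n * f x" for x
      proof -
        have "real n * f x \<le> real n * B" using B[of x] by (intro mult_left_mono) auto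
        then have "min (real n * f x) (real m) = real n * f x" using m by simp
        then show ?thesis unfolding h_def using slice[of "real n * f x" m] nonneg_csD(2)[OF f, of x] by simp
      qed
      have 1: "real n * \<Lambda> f = (\<Sum>i<m. \<Lambda> (h i))"
        using sum[of "{..<m}" h] h of_nat[OF f, of n] sum_h by simp
      have "(\<integral>x. real n * f x \<partial>M) = (\<Sum>i<m. (\<integral>x. h i x \<partial>M))"
        unfolding sum_h[symmetric] using int[OF h] by (intro Bochner_Integration.integral_sum) auto
      then have 2: "real n * (\<integral>x. f x \<partial>M) = (\<Sum>i<m. (\<integral>x. h i x \<partial>M))" by simp
      have "real n * \<bar>\<Lambda> f - (\<integral>x. f x \<partial>M)\<bar> = \<bar>\<Sum>i<m. \<Lambda> (h i) - (\<integral>x. h i x \<partial>M)\<bar>"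
        unfolding sum_subtractf 1[symmetric] 2[symmetric] by (simp add: abs_mult right_diff_distrib[symmetric])
      also have "\<dots> \<le> (\<Sum>i<m. \<bar>\<Lambda> (h i) - (\<integral>x. h i x \<partial>M)\<bar>)" by (rule sum_abs)
      also have "\<dots> \<le> (\<Sum>i<m. measure M (L i) - measure M (L (Suc i)))"
      proof (rule sum_mono)
        fix i
        show "\<bar>\<Lambda> (h i) - (\<integral>x. h i x \<partial>M)\<bar> \<le> measure M (L i) - measure M (L (Suc i))"
          using lower[OF L[of "Suc i"] h[of i] h1] upper[OF L[of i] h[of i] h2 h3] by linarith
      qed
      \<comment> \<open>Telescoping keeps the error bounded while the factor \<open>n\<close> on the
        left grows.\<close>
      also have "\<dots> = measure M (L 0) - measure M (L m)" by (rule sum_lessThan_telescope')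
      also have "\<dots> \<le> measure M K"
      proof -
        have "measure M (L 0) \<le> measure M K"
          using cK[OF K(1)] cK(3)[OF L[of 0]] by (intro measure_mono_fmeasurable) (auto simp: L_def fmeasurable_def)
        then show ?thesis using measure_nonneg[of M "L m"] by linarith
      qed
      finally show ?thesis .
    qed
    show ?thesis
    proof (rule ccontr)
      assume "\<Lambda> f \<noteq> (\<integral>x. f x \<partial>M)"
      then obtain n :: nat where "measure M K < real n * \<bar>\<Lambda> f - (\<integral>x. f x \<partial>M)\<bar>"
        using reals_Archimedean3[of "\<bar>\<Lambda> f - (\<integral>x. f x \<partial>M)\<bar>"] by auto
      then show False using close[of n] by simp
    qed
  qed
  then show thesis using that[OF M(1)] by blast
qed

end

section \<open>The Riesz representation theorem for locally bounded complex functionals\<close>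

text \<open>The positive part of \<open>R\<close> at \<open>f\<close> is the supremum of
  \<open>R g\<close> over \<open>0 \<le> g \<le> f\<close>. It is additive because a function below
  \<open>f + g\<close> splits, by truncation at \<open>f\<close>, into one below \<open>f\<close>
  and one below \<open>g\<close>. \<open>M\<close> represents this part and \<open>M'\<close> the
  part minus \<open>R\<close>. The last conclusion carries a bound on order intervals over to both
  measures; later it yields integrability of the weight.\<close>

lemma riesz_signed:
  fixes R :: "('a::t2_space \<Rightarrow> real) \<Rightarrow> real"
  assumes lc: "locally_compact_space (euclidean :: 'a topology)"
    and add: "\<And>f g. f \<in> nonneg_cs \<Longrightarrow> g \<in> nonneg_cs \<Longrightarrow> R (\<lambda>x. f x + g x) = R f + R g"
    and bdd: "\<And>f. f \<in> nonneg_cs \<Longrightarrow> \<exists>B. \<forall>g\<in>nonneg_cs. (\<forall>x. g x \<le> f x) \<longrightarrow> R g \<le> B"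
  obtains M M' where "radon M" "radon M'"
    "\<And>f. f \<in> nonneg_cs \<Longrightarrow> R f = (\<integral>x. f x \<partial>M) - (\<integral>x. f x \<partial>M')"
    "\<And>f B. f \<in> nonneg_cs \<Longrightarrow> \<forall>g\<in>nonneg_cs. (\<forall>x. g x \<le> f x) \<longrightarrow> \<bar>R g\<bar> \<le> B \<Longrightarrow>
       (\<integral>x. f x \<partial>M) \<le> B \<and> (\<integral>x. f x \<partial>M') \<le> B"
proof -
  define D where "D f = {g \<in> nonneg_cs. \<forall>x. g x \<le> f x}" for f :: "'a \<Rightarrow> real"
  define P where "P f = (SUP g\<in>D f. R g)" for f
  have R0: "R (\<lambda>x. 0) = 0" using add[OF nonneg_cs_zero nonneg_cs_zero] by simp
  have z: "(\<lambda>x. 0) \<in> D f" if "f \<in> nonneg_cs" for f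
    using that nonneg_cs_zero nonneg_csD(2) by (auto simp: D_def)
  have ne: "D f \<noteq> {}" if "f \<in> nonneg_cs" for f using z[OF that] by blast
  have bd: "bdd_above (R ` D f)" if "f \<in> nonneg_cs" for f
    using bdd[OF that] by (auto simp: bdd_above_def D_def)
  have up: "R g \<le> P f" if "f \<in> nonneg_cs" "g \<in> nonneg_cs" "\<And>x. g x \<le> f x" for f g
    unfolding P_def using that by (intro cSUP_upper bd) (auto simp: D_def)
  have least: "P f \<le> B" if "f \<in> nonneg_cs" "\<And>g. g \<in> nonneg_cs \<Longrightarrow> (\<And>x. g x \<le> f x) \<Longrightarrow> R g \<le> B" for f B
    unfolding P_def using that ne[OF that(1)] by (intro cSUP_least) (auto simp: D_def)
  have Rdiff: "R (\<lambda>x. f x - g x) = R f - R g" if "f \<in> nonneg_cs" "g \<in> nonneg_cs" "\<And>x. g x \<le> f x" for f g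
    using add[OF that(2) nonneg_cs_diff[OF that]] by simp
  have Padd: "P (\<lambda>x. f x + g x) = P f + P g" if f: "f \<in> nonneg_cs" and g: "g \<in> nonneg_cs" for f g
  proof (rule antisym)
    show "P (\<lambda>x. f x + g x) \<le> P f + P g"
    proof (rule least[OF nonneg_cs_add[OF f g]])
      fix h assume h: "h \<in> nonneg_cs" "\<And>x. h x \<le> f x + g x"
      have m: "(\<lambda>x. min (h x) (f x)) \<in> nonneg_cs" by (rule nonneg_cs_min[OF h(1) f])
      have "R h = R (\<lambda>x. min (h x) (f x)) + R (\<lambda>x. h x - min (h x) (f x))"
        using Rdiff[OF h(1) m] by simp
      also have "\<dots> \<le> P f + P g"
      proof (rule add_mono)
        show "R (\<lambda>x. min (h x) (f x)) \<le> P f" by (rule up[OF f m]) simp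
        show "R (\<lambda>x. h x - min (h x) (f x)) \<le> P g"
        proof (rule up[OF g nonneg_cs_diff[OF h(1) m]])
          show "h x - min (h x) (f x) \<le> g x" for x
            using h(2)[of x] nonneg_csD(2)[OF g, of x] by (auto simp: min_def)
        qed simp
      qed
      finally show "R h \<le> P f + P g" .
    qed
    have "P f \<le> P (\<lambda>x. f x + g x) - P g"
    proof (rule least[OF f])
      fix h assume h: "h \<in> nonneg_cs" "\<And>x. h x \<le> f x"
      have "P g \<le> P (\<lambda>x. f x + g x) - R h"
      proof (rule least[OF g])
        fix k assume k: "k \<in> nonneg_cs" "\<And>x. k x \<le> g x"
        have "R (\<lambda>x. h x + k x) \<le> P (\<lambda>x. f x + g x)"
          using h k by (intro up nonneg_cs_add f g add_mono) auto
        then show "R k \<le> P (\<lambda>x. f x + g x) - R h" using add[OF h(1) k(1)] by simp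
      qed
      then show "R h \<le> P (\<lambda>x. f x + g x) - P g" by simp
    qed
    then show "P f + P g \<le> P (\<lambda>x. f x + g x)" by simp
  qed
  have "positive_functional P"
  proof
    show "0 \<le> P f" if "f \<in> nonneg_cs" for f
      using up[OF that nonneg_cs_zero] nonneg_csD(2)[OF that] R0 by simp
  qed (use lc Padd in auto)
  then obtain M where M: "radon M" "\<And>f. f \<in> nonneg_cs \<Longrightarrow> P f = (\<integral>x. f x \<partial>M)"
    by (rule positive_functional.riesz) (rule that)
  have "positive_functional (\<lambda>f. P f - R f)"
  proof
    show "0 \<le> P f - R f" if "f \<in> nonneg_cs" for f
      using up[OF that that] by simp
  qed (use lc Padd add in auto)
  then obtain M' where M': "radon M'" "\<And>f. f \<in> nonneg_cs \<Longrightarrow> P f - R f = (\<integral>x. f x \<partial>M')"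
    by (rule positive_functional.riesz) (rule that)
  show ?thesis
  proof (rule that[OF M(1) M'(1)])
    show "R f = (\<integral>x. f x \<partial>M) - (\<integral>x. f x \<partial>M')" if "f \<in> nonneg_cs" for f
      using M(2)[OF that] M'(2)[OF that] by simp
    fix f B assume f: "f \<in> nonneg_cs" and B: "\<forall>g\<in>nonneg_cs. (\<forall>x. g x \<le> f x) \<longrightarrow> \<bar>R g\<bar> \<le> B"
    have 1: "P f \<le> B" using B by (intro least[OF f]) (auto simp: abs_le_iff)
    \<comment> \<open>The negative part obeys the same bound, since
      \<open>R g - R f = - R (f - g)\<close> and \<open>f - g\<close> lies in the same order
      interval.\<close>
    have "P f \<le> B + R f"
    proof (rule least[OF f])
      fix g assume g: "g \<in> nonneg_cs" "\<And>x. g x \<le> f x"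
      have "\<bar>R (\<lambda>x. f x - g x)\<bar> \<le> B"
        using B nonneg_cs_diff[OF f g] nonneg_csD(2)[OF g(1)] by auto
      then show "R g \<le> B + R f" using Rdiff[OF f g] by simp
    qed
    then show "(\<integral>x. f x \<partial>M) \<le> B \<and> (\<integral>x. f x \<partial>M') \<le> B" using 1 M(2)[OF f] M'(2)[OF f] by simp
  qed
qed

lemma compactly_supported_add:
  fixes f g :: "'a::t2_space \<Rightarrow> complex"
  assumes "f \<in> compactly_supported" "g \<in> compactly_supported"
  shows "(\<lambda>x. f x + g x) \<in> compactly_supported"
proof -
  obtain K L where "compact K" "\<forall>x. x \<notin> K \<longrightarrow> f x = 0" "compact L" "\<forall>x. x \<notin> L \<longrightarrow> g x = 0"
    using assms unfolding compactly_supported_iff by blast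
  then show ?thesis
    using assms unfolding compactly_supported_iff
    by (intro conjI continuous_on_add exI[of _ "K \<union> L"]) (auto simp: compact_Un)
qed

lemma compactly_supported_dominated:
  fixes f g :: "'a::t2_space \<Rightarrow> complex"
  assumes "f \<in> compactly_supported" "continuous_on UNIV g" "\<And>x. f x = 0 \<Longrightarrow> g x = 0"
  shows "g \<in> compactly_supported"
  using assms unfolding compactly_supported_iff by blast

lemma compactly_supported_scale:
  fixes f :: "'a::t2_space \<Rightarrow> complex"
  assumes "f \<in> compactly_supported"
  shows "(\<lambda>x. a * f x) \<in> compactly_supported"
  by (rule compactly_supported_dominated[OF assms])
    (use assms in \<open>auto simp: compactly_supported_iff intro: continuous_on_mult_left\<close>)

lemma compactly_supported_decompose:
  fixes f :: "'a::t2_space \<Rightarrow> complex"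
  assumes f: "f \<in> compactly_supported"
  obtains p where "\<And>j. p j \<in> nonneg_cs" "f = (\<lambda>x. \<Sum>j<4. \<i> ^ j * complex_of_real (p j x))"
proof -
  obtain K where K: "compact K" "\<And>x. x \<notin> K \<Longrightarrow> f x = 0" and c: "continuous_on UNIV f"
    using f unfolding compactly_supported_iff by blast
  \<comment> \<open>Dividing by \<open>\<i> ^ j\<close> rotates the j-th half-axis onto the positive
    reals; the four positive parts, rotated back, recombine to \<open>f\<close>.\<close>
  define p where "p j x = max 0 (Re (f x / \<i> ^ j))" for j :: nat and x
  have "p j \<in> nonneg_cs" for j
    unfolding p_def using K c
    by (intro nonneg_csI[where K = K] continuous_on_max continuous_on_const continuous_on_Re continuous_on_divide) auto
  moreover have "f x = (\<Sum>j<4. \<i> ^ j * complex_of_real (p j x))" for x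
    by (simp add: eval_nat_numeral p_def complex_eq_iff max_def)
  ultimately show thesis using that[of p] by blast
qed

text \<open>Boundedness is required on each order interval only, which covers functionals unbounded
  for the uniform norm, as may occur when the weight is not bounded below. Real and imaginary parts
  on real functions are represented separately; linearity recovers \<open>I\<close> from its values
  on the nonnegative cone.\<close>

lemma riesz_complex:
  fixes I :: "('a::t2_space \<Rightarrow> complex) \<Rightarrow> complex"
  assumes lc: "locally_compact_space (euclidean :: 'a topology)"
    and add: "\<And>f g. f \<in> compactly_supported \<Longrightarrow> g \<in> compactly_supported \<Longrightarrow> I (\<lambda>x. f x + g x) = I f + I g"
    and scale: "\<And>a f. f \<in> compactly_supported \<Longrightarrow> I (\<lambda>x. a * f x) = a * I f"
    and bdd: "\<And>f. f \<in> nonneg_cs \<Longrightarrow> \<exists>B. \<forall>g\<in>compactly_supported. (\<forall>x. cmod (g x) \<le> f x) \<longrightarrow> cmod (I g) \<le> B"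
  obtains M where "\<And>j. j < 4 \<Longrightarrow> radon (M j)"
    "\<And>f. f \<in> compactly_supported \<Longrightarrow> I f = (\<Sum>j<4. \<i> ^ j * (\<integral>x. f x \<partial>M j))"
    "\<And>j f B. j < 4 \<Longrightarrow> f \<in> nonneg_cs \<Longrightarrow>
       (\<And>g. g \<in> compactly_supported \<Longrightarrow> (\<And>x. cmod (g x) \<le> f x) \<Longrightarrow> cmod (I g) \<le> B) \<Longrightarrow> (\<integral>x. f x \<partial>M j) \<le> B"
proof -
  let ?c = "\<lambda>f x. complex_of_real (f x)"
  have cI: "\<bar>Re (I (?c g))\<bar> \<le> B" "\<bar>Im (I (?c g))\<bar> \<le> B"
    if "\<And>h. h \<in> compactly_supported \<Longrightarrow> (\<And>x. cmod (h x) \<le> f x) \<Longrightarrow> cmod (I h) \<le> B"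
       "g \<in> nonneg_cs" "\<And>x. g x \<le> f x" for f g B
  proof -
    have "cmod (I (?c g)) \<le> B"
      using that(3) nonneg_csD(2)[OF that(2)] by (intro that(1) compactly_supported_of_real that(2)) auto
    then show "\<bar>Re (I (?c g))\<bar> \<le> B" "\<bar>Im (I (?c g))\<bar> \<le> B"
      using abs_Re_le_cmod[of "I (?c g)"] abs_Im_le_cmod[of "I (?c g)"] by linarith+
  qed
  have addc: "I (?c (\<lambda>x. f x + g x)) = I (?c f) + I (?c g)" if "f \<in> nonneg_cs" "g \<in> nonneg_cs" for f g
    using add[OF compactly_supported_of_real[OF that(1)] compactly_supported_of_real[OF that(2)]] by simp
  have bddc: "\<exists>B. \<forall>g\<in>nonneg_cs. (\<forall>x. g x \<le> f x) \<longrightarrow> \<bar>Re (I (?c g))\<bar> \<le> B \<and> \<bar>Im (I (?c g))\<bar> \<le> B"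
    if "f \<in> nonneg_cs" for f
  proof -
    obtain B where B: "\<forall>h\<in>compactly_supported. (\<forall>x. cmod (h x) \<le> f x) \<longrightarrow> cmod (I h) \<le> B"
      using bdd[OF \<open>f \<in> nonneg_cs\<close>] by blast
    show ?thesis
    proof (intro exI[of _ B] ballI impI)
      fix g :: "'a \<Rightarrow> real" assume g: "g \<in> nonneg_cs" "\<forall>x. g x \<le> f x"
      show "\<bar>Re (I (?c g))\<bar> \<le> B \<and> \<bar>Im (I (?c g))\<bar> \<le> B"
        using cI[OF _ g(1), of f B] B g(2) by blast
    qed
  qed
  obtain M0 M2 where M02: "radon M0" "radon M2"
    "\<And>f. f \<in> nonneg_cs \<Longrightarrow> Re (I (?c f)) = (\<integral>x. f x \<partial>M0) - (\<integral>x. f x \<partial>M2)"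
    "\<And>f B. f \<in> nonneg_cs \<Longrightarrow> \<forall>g\<in>nonneg_cs. (\<forall>x. g x \<le> f x) \<longrightarrow> \<bar>Re (I (?c g))\<bar> \<le> B \<Longrightarrow>
       (\<integral>x. f x \<partial>M0) \<le> B \<and> (\<integral>x. f x \<partial>M2) \<le> B"
  proof (rule riesz_signed[OF lc, of "\<lambda>f. Re (I (?c f))"])
    show "Re (I (?c (\<lambda>x. f x + g x))) = Re (I (?c f)) + Re (I (?c g))" if "f \<in> nonneg_cs" "g \<in> nonneg_cs" for f g
      using addc[OF that] by simp
    show "\<exists>B. \<forall>g\<in>nonneg_cs. (\<forall>x. g x \<le> f x) \<longrightarrow> Re (I (?c g)) \<le> B" if "f \<in> nonneg_cs" for f
      using bddc[OF that] by (meson abs_le_D1)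
    fix M M'
    assume "radon M" "radon M'" "\<And>f. f \<in> nonneg_cs \<Longrightarrow> Re (I (?c f)) = (\<integral>x. f x \<partial>M) - (\<integral>x. f x \<partial>M')"
      "\<And>f B. f \<in> nonneg_cs \<Longrightarrow> \<forall>g\<in>nonneg_cs. (\<forall>x. g x \<le> f x) \<longrightarrow> \<bar>Re (I (?c g))\<bar> \<le> B \<Longrightarrow>
         (\<integral>x. f x \<partial>M) \<le> B \<and> (\<integral>x. f x \<partial>M') \<le> B"
    then show thesis by (rule that)
  qed
  obtain M1 M3 where M13: "radon M1" "radon M3"
    "\<And>f. f \<in> nonneg_cs \<Longrightarrow> Im (I (?c f)) = (\<integral>x. f x \<partial>M1) - (\<integral>x. f x \<partial>M3)"
    "\<And>f B. f \<in> nonneg_cs \<Longrightarrow> \<forall>g\<in>nonneg_cs. (\<forall>x. g x \<le> f x) \<longrightarrow> \<bar>Im (I (?c g))\<bar> \<le> B \<Longrightarrow>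
       (\<integral>x. f x \<partial>M1) \<le> B \<and> (\<integral>x. f x \<partial>M3) \<le> B"
  proof (rule riesz_signed[OF lc, of "\<lambda>f. Im (I (?c f))"])
    show "Im (I (?c (\<lambda>x. f x + g x))) = Im (I (?c f)) + Im (I (?c g))" if "f \<in> nonneg_cs" "g \<in> nonneg_cs" for f g
      using addc[OF that] by simp
    show "\<exists>B. \<forall>g\<in>nonneg_cs. (\<forall>x. g x \<le> f x) \<longrightarrow> Im (I (?c g)) \<le> B" if "f \<in> nonneg_cs" for f
      using bddc[OF that] by (meson abs_le_D1)
    fix M M'
    assume "radon M" "radon M'" "\<And>f. f \<in> nonneg_cs \<Longrightarrow> Im (I (?c f)) = (\<integral>x. f x \<partial>M) - (\<integral>x. f x \<partial>M')"
      "\<And>f B. f \<in> nonneg_cs \<Longrightarrow> \<forall>g\<in>nonneg_cs. (\<forall>x. g x \<le> f x) \<longrightarrow> \<bar>Im (I (?c g))\<bar> \<le> B \<Longrightarrow>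
         (\<integral>x. f x \<partial>M) \<le> B \<and> (\<integral>x. f x \<partial>M') \<le> B"
    then show thesis by (rule that)
  qed
  define M where "M = (\<lambda>j::nat. [M0, M1, M2, M3] ! j)"
  have M4: "M 0 = M0" "M 1 = M1" "M 2 = M2" "M 3 = M3" by (simp_all add: M_def)
  have c4: "j = 0 \<or> j = 1 \<or> j = 2 \<or> j = 3" if "j < 4" for j :: nat using that by auto
  have s4: "(\<Sum>j<4. h j) = h 0 + h 1 + h 2 + h 3" for h :: "nat \<Rightarrow> complex"
    by (simp add: eval_nat_numeral)
  have i3: "\<i> ^ 3 = - \<i>" by (simp add: eval_nat_numeral)
  have rM: "radon (M j)" if "j < 4" for j using c4[OF that] M02 M13 M4 by auto
  have real: "I (?c f) = (\<Sum>j<4. \<i> ^ j * (\<integral>x. ?c f x \<partial>M j))" if "f \<in> nonneg_cs" for f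
    unfolding s4 using M02(3)[OF that] M13(3)[OF that] by (simp add: M4 M4[simplified] i3 complex_eq_iff)
  show thesis
  proof (rule that[of M])
    show "radon (M j)" if "j < 4" for j by (rule rM[OF that])
    show "(\<integral>x. f x \<partial>M j) \<le> B"
      if j: "j < 4" and f: "f \<in> nonneg_cs" and B: "\<And>g. g \<in> compactly_supported \<Longrightarrow> (\<And>x. cmod (g x) \<le> f x) \<Longrightarrow> cmod (I g) \<le> B"
      for j f B
    proof -
      have "(\<integral>x. f x \<partial>M0) \<le> B \<and> (\<integral>x. f x \<partial>M2) \<le> B"
        using cI(1)[OF B] by (intro M02(4)[OF f]) auto
      moreover have "(\<integral>x. f x \<partial>M1) \<le> B \<and> (\<integral>x. f x \<partial>M3) \<le> B"
        using cI(2)[OF B] by (intro M13(4)[OF f]) auto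
      ultimately show ?thesis using c4[OF j] M4 by auto
    qed
    show "I f = (\<Sum>j<4. \<i> ^ j * (\<integral>x. f x \<partial>M j))" if f: "f \<in> compactly_supported" for f
    proof -
      obtain p where p: "\<And>j. p j \<in> nonneg_cs" "f = (\<lambda>x. \<Sum>j<4. \<i> ^ j * ?c (p j) x)"
        by (rule compactly_supported_decompose[OF f], rule that)
      have pc: "(\<lambda>x. \<i> ^ j * ?c (p j) x) \<in> compactly_supported" for j
        by (intro compactly_supported_scale compactly_supported_of_real p)
      have ps: "(\<lambda>x. \<Sum>j<n. \<i> ^ j * ?c (p j) x) \<in> compactly_supported \<and>
          I (\<lambda>x. \<Sum>j<n. \<i> ^ j * ?c (p j) x) = (\<Sum>j<n. \<i> ^ j * I (?c (p j)))" for n :: nat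
      proof (induction n)
        case 0
        have "?c (p 0) \<in> compactly_supported" by (rule compactly_supported_of_real[OF p(1)])
        from compactly_supported_scale[OF this, of 0] scale[OF this, of 0] show ?case by simp
      next
        case (Suc n)
        then show ?case
          using add[OF conjunct1[OF Suc] pc[of n]] compactly_supported_add[OF conjunct1[OF Suc] pc[of n]]
            scale[OF compactly_supported_of_real[OF p(1)], of "\<i> ^ n" n]
          by simp
      qed
      have int: "integrable (M j) (?c (p k))" if "j < 4" for j k
      proof -
        obtain K where "compact K" "\<And>x. x \<notin> K \<Longrightarrow> p k x = 0" using nonneg_csD(3)[OF p(1)[of k]] by blast
        then show ?thesis
          using radon_integrable_compact_support[OF rM[OF \<open>j < 4\<close>] nonneg_csD(1)[OF p(1)[of k]]]
          by (intro integrable_of_real) blast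
      qed
      have "I f = (\<Sum>k<4. \<i> ^ k * I (?c (p k)))" using ps[of 4] p(2) by simp
      also have "\<dots> = (\<Sum>k<4. \<i> ^ k * (\<Sum>j<4. \<i> ^ j * (\<integral>x. ?c (p k) x \<partial>M j)))"
        by (simp only: real[OF p(1)])
      also have "\<dots> = (\<Sum>j<4. \<i> ^ j * (\<Sum>k<4. \<i> ^ k * (\<integral>x. ?c (p k) x \<partial>M j)))"
        unfolding sum_distrib_left by (subst sum.swap) (simp only: ac_simps)
      also have "\<dots> = (\<Sum>j<4. \<i> ^ j * (\<integral>x. f x \<partial>M j))"
      proof (intro sum.cong refl arg_cong2[of _ _ _ _ "(*)"])
        fix j :: nat assume "j \<in> {..<4}"
        then have "integrable (M j) (?c (p k))" for k using int by simp
        then show "(\<Sum>k<4. \<i> ^ k * (\<integral>x. ?c (p k) x \<partial>M j)) = (\<integral>x. f x \<partial>M j)"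
          unfolding p(2) by (subst Bochner_Integration.integral_sum) (auto simp del: integral_complex_of_real)
      qed
      finally show ?thesis .
    qed
  qed
qed

section \<open>The total variation norm as a dual norm\<close>

text \<open>The radial retraction of the plane onto the closed unit disc. It restores the bound 1
  for approximating functions and keeps their zeros and their continuity.\<close>

definition disc_retract :: "complex \<Rightarrow> complex" where
  "disc_retract z = z / of_real (max 1 (cmod z))"

lemma disc_retract_le: "cmod (disc_retract z) \<le> 1"
  by (auto simp: disc_retract_def norm_divide divide_le_eq)

lemma disc_retract_id: "cmod z \<le> 1 \<Longrightarrow> disc_retract z = z"
  by (simp add: disc_retract_def max_def)

lemma disc_retract_0 [simp]: "disc_retract 0 = 0"
  by (simp add: disc_retract_def)

lemma continuous_disc_retract: "continuous_on UNIV disc_retract"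
  unfolding disc_retract_def
  by (intro continuous_on_divide continuous_on_of_real continuous_on_max continuous_intros)
     (auto simp: max_def split: if_splits)

text \<open>A point outside the disc is moved by \<open>cmod z - 1\<close>, which is at most its
  distance to any point \<open>w\<close> of the disc.\<close>

lemma disc_retract_dist:
  assumes "cmod w \<le> 1" shows "cmod (disc_retract z - w) \<le> 2 * cmod (z - w)"
proof (cases "cmod z \<le> 1")
  case True
  then show ?thesis by (simp add: disc_retract_id)
next
  case False
  then have z: "cmod z > 1" "z \<noteq> 0" by auto
  have "disc_retract z - z = z * of_real (1 / cmod z - 1)"
    using z by (auto simp: disc_retract_def algebra_simps)
  then have "cmod (disc_retract z - z) = cmod z * \<bar>1 / cmod z - 1\<bar>"
    by (simp only: norm_mult norm_of_real)
  also have "\<dots> = cmod z - 1" using z by (simp add: abs_if field_simps)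
  also have "\<dots> \<le> cmod (z - w)" using assms norm_triangle_ineq2[of z w] by linarith
  finally have "cmod (disc_retract z - z) \<le> cmod (z - w)" .
  then show ?thesis using norm_triangle_ineq[of "disc_retract z - z" "z - w"] by simp
qed

lemma integral_finite_range:
  fixes g :: "'a::t2_space \<Rightarrow> complex"
  assumes M: "radon M" and A: "A \<in> compacted_borel" and g: "g \<in> borel_measurable borel" "finite (range g)"
  shows "(\<integral>x. indicator A x *\<^sub>R g x \<partial>M) = (\<Sum>y\<in>range g. y * of_real (measure M (A \<inter> g -` {y})))"
proof -
  have m: "A \<inter> g -` {y} \<in> compacted_borel" for y
    using measurable_sets[OF g(1), of "{y}"] by (intro compacted_borel_Int A) simp
  have "(\<integral>x. indicator A x *\<^sub>R g x \<partial>M) = (\<integral>x. (\<Sum>y\<in>range g. indicator (A \<inter> g -` {y}) x *\<^sub>R y) \<partial>M)"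
  proof (intro Bochner_Integration.integral_cong refl)
    fix x
    have "(\<Sum>y\<in>range g. indicator (A \<inter> g -` {y}) x *\<^sub>R y) = (\<Sum>y\<in>range g. if y = g x then indicator A x *\<^sub>R y else 0)"
      by (intro sum.cong refl) (auto simp: indicator_def)
    also have "\<dots> = indicator A x *\<^sub>R g x" using g(2) by (simp add: sum.delta)
    finally show "indicator A x *\<^sub>R g x = (\<Sum>y\<in>range g. indicator (A \<inter> g -` {y}) x *\<^sub>R y)" by simp
  qed
  also have "\<dots> = (\<Sum>y\<in>range g. (\<integral>x. indicator (A \<inter> g -` {y}) x *\<^sub>R y \<partial>M))"
    using m M radon_compacted_borel[OF M m]
    by (intro Bochner_Integration.integral_sum integrable_scaleR_left integrable_real_indicator)
       (auto simp: compacted_borel_borel)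
  also have "\<dots> = (\<Sum>y\<in>range g. y * of_real (measure M (A \<inter> g -` {y})))"
  proof (intro sum.cong refl)
    fix y
    have "(\<integral>x. indicator (A \<inter> g -` {y}) x *\<^sub>R y \<partial>M) = (\<integral>x. indicator (A \<inter> g -` {y}) x \<partial>M) *\<^sub>R y"
      using m M radon_compacted_borel[OF M m]
      by (intro integral_scaleR_left integrable_real_indicator) (auto simp: compacted_borel_borel)
    then show "(\<integral>x. indicator (A \<inter> g -` {y}) x *\<^sub>R y \<partial>M) = y * of_real (measure M (A \<inter> g -` {y}))"
      using M by (simp add: scaleR_conv_of_real mult.commute)
  qed
  finally show ?thesis .
qed

text \<open>A dominating measure would give too large a bound, as it may exceed the variation. For
  functions with finitely many values the level sets partition \<open>A\<close>, and the bound is a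
  partition sum; the general case is a limit of such functions.\<close>

lemma integral_over_le_variation:
  fixes \<kappa> :: "'a::t2_space set \<Rightarrow> complex"
  assumes R: "represents J c N \<kappa>" and A: "A \<in> compacted_borel"
    and f: "f \<in> borel_measurable borel" "\<And>x. cmod (f x) \<le> 1"
  shows "ennreal (cmod (\<Sum>j\<in>J. c j * (\<integral>x. indicator A x *\<^sub>R f x \<partial>N j))) \<le> cb_variation \<kappa> A"
proof -
  interpret complex_cb \<kappa> by unfold_locales (rule complex_measure_on_represents[OF R])
  have simple: "ennreal (cmod (\<Sum>j\<in>J. c j * (\<integral>x. indicator A x *\<^sub>R g x \<partial>N j))) \<le> cb_variation \<kappa> A"
    if g: "g \<in> borel_measurable borel" "finite (range g)" "\<And>x. cmod (g x) \<le> 1" for g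
  proof -
    let ?B = "\<lambda>y. g -` {y} \<inter> A"
    have m: "?B y \<in> compacted_borel" for y
      using measurable_sets[OF g(1), of "{y}"] by (intro compacted_borel_Int' A) simp
    have "(\<Sum>j\<in>J. c j * (\<integral>x. indicator A x *\<^sub>R g x \<partial>N j)) =
        (\<Sum>j\<in>J. c j * (\<Sum>y\<in>range g. y * of_real (measure (N j) (?B y))))"
      using integral_finite_range[OF representsD(2)[OF R] A g(1,2)]
      by (intro sum.cong refl) (simp add: Int_commute)
    also have "\<dots> = (\<Sum>y\<in>range g. y * \<kappa> (?B y))"
      unfolding representsD(3)[OF R m] sum_distrib_left by (subst sum.swap) (simp only: ac_simps)
    finally have "cmod (\<Sum>j\<in>J. c j * (\<integral>x. indicator A x *\<^sub>R g x \<partial>N j)) \<le> (\<Sum>y\<in>range g. cmod (y * \<kappa> (?B y)))"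
      using norm_sum by simp
    also have "\<dots> \<le> (\<Sum>y\<in>range g. cmod (\<kappa> (?B y)))"
    proof (rule sum_mono)
      fix y assume "y \<in> range g"
      then have "cmod y \<le> 1" using g(3) by auto
      then show "cmod (y * \<kappa> (?B y)) \<le> cmod (\<kappa> (?B y))" by (simp add: norm_mult mult_left_le_one_le)
    qed
    finally have "ennreal (cmod (\<Sum>j\<in>J. c j * (\<integral>x. indicator A x *\<^sub>R g x \<partial>N j))) \<le> (\<Sum>y\<in>range g. ennreal (cmod (\<kappa> (?B y))))"
      by (simp add: sum_ennreal ennreal_leI)
    also have "\<dots> = (\<Sum>D\<in>(\<lambda>y. g -` {y}) ` range g. ennreal (cmod (\<kappa> (D \<inter> A))))"
    proof -
      have inj: "inj_on (\<lambda>y. g -` {y}) (range g)" by (rule inj_onI) blast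
      show ?thesis using sum.reindex[OF inj, of "\<lambda>D. ennreal (cmod (\<kappa> (D \<inter> A)))"] by (simp only: o_def)
    qed
    also have "\<dots> \<le> cb_variation \<kappa> A"
    proof (rule total_variation_refine)
      show "disjoint ((\<lambda>y. g -` {y}) ` range g)" by (rule disjointI) auto
      show "A \<subseteq> \<Union> ((\<lambda>y. g -` {y}) ` range g)" by blast
      show "D \<inter> A \<in> compacted_borel" if "D \<in> (\<lambda>y. g -` {y}) ` range g" for D using that m by blast
    qed (use g in auto)
    finally show ?thesis .
  qed
  obtain F where F: "\<And>i. simple_function borel (F i)" "\<And>x. (\<lambda>i. F i x) \<longlonglongrightarrow> f x"
    using borel_measurable_implies_sequence_metric[OF f(1), of 0] by auto
  \<comment> \<open>The simple approximations need not be bounded by 1; the retraction makes them so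
    without changing the limit, because \<open>f\<close> takes values in the disc.\<close>
  let ?G = "\<lambda>i x. disc_retract (F i x)"
  have rm: "disc_retract \<in> borel_measurable borel"
    by (rule borel_measurable_continuous_onI[OF continuous_disc_retract])
  have Gm: "?G i \<in> borel_measurable borel" for i
    using measurable_compose[OF borel_measurable_simple_function[OF F(1)] rm] .
  have Gf: "finite (range (?G i))" for i
    using finite_imageI[OF simple_functionD(1)[OF F(1)[of i]], of disc_retract] by (simp add: image_image)
  have lim: "(\<lambda>i. cmod (\<Sum>j\<in>J. c j * (\<integral>x. indicator A x *\<^sub>R ?G i x \<partial>N j))) \<longlonglongrightarrow>
     cmod (\<Sum>j\<in>J. c j * (\<integral>x. indicator A x *\<^sub>R f x \<partial>N j))"
  proof (intro tendsto_norm tendsto_sum tendsto_mult tendsto_const)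
    fix j assume "j \<in> J"
    then have N: "radon (N j)" by (rule representsD(2)[OF R])
    have [measurable]: "A \<in> sets borel" using A by (rule compacted_borel_borel)
    show "(\<lambda>i. \<integral>x. indicator A x *\<^sub>R ?G i x \<partial>N j) \<longlonglongrightarrow> (\<integral>x. indicator A x *\<^sub>R f x \<partial>N j)"
    proof (rule integral_dominated_convergence)
      show "integrable (N j) (indicator A :: 'a \<Rightarrow> real)"
        using N A radon_compacted_borel[OF N A] by (intro integrable_real_indicator) auto
      show "(\<lambda>x. indicator A x *\<^sub>R f x) \<in> borel_measurable (N j)"
        using f(1) by (intro radon_measurable[OF N]) measurable
      show "(\<lambda>x. indicator A x *\<^sub>R ?G i x) \<in> borel_measurable (N j)" for i
        using Gm[of i] by (intro radon_measurable[OF N]) measurable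
      show "AE x in N j. (\<lambda>i. indicator A x *\<^sub>R ?G i x) \<longlonglongrightarrow> indicator A x *\<^sub>R f x"
      proof (intro AE_I2 tendsto_scaleR tendsto_const)
        fix x
        have "isCont disc_retract (f x)" using continuous_disc_retract by (simp add: continuous_on_eq_continuous_at)
        then have "(\<lambda>i. ?G i x) \<longlonglongrightarrow> disc_retract (f x)" using F(2) by (rule isCont_tendsto_compose)
        then show "(\<lambda>i. ?G i x) \<longlonglongrightarrow> f x" using disc_retract_id[OF f(2)] by simp
      qed
      show "AE x in N j. norm (indicator A x *\<^sub>R ?G i x) \<le> indicator A x" for i
        using disc_retract_le by (intro AE_I2) (auto simp: indicator_def)
    qed
  qed
  have "(\<lambda>i. ennreal (cmod (\<Sum>j\<in>J. c j * (\<integral>x. indicator A x *\<^sub>R ?G i x \<partial>N j)))) \<longlonglongrightarrow>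
     ennreal (cmod (\<Sum>j\<in>J. c j * (\<integral>x. indicator A x *\<^sub>R f x \<partial>N j)))"
    by (rule tendsto_ennrealI[OF lim])
  then show ?thesis
    by (rule LIMSEQ_le_const2) (use simple[OF Gm Gf disc_retract_le] in blast)
qed

text \<open>Converse of \<open>integral_over_le_variation\<close>. For a partition \<open>P\<close>,
  the step function whose values are the conjugate phases of \<open>\<kappa> D\<close> integrates to
  the partition sum, and in L1 of a dominating measure it is close to a test function bounded by
  1.\<close>

lemma variation_le_dual:
  fixes \<kappa> :: "'a::t2_space set \<Rightarrow> complex"
  assumes lc: "locally_compact_space (euclidean :: 'a topology)"
    and R: "represents J c N \<kappa>" and A: "A \<in> compacted_borel"
    and le: "\<And>f. f \<in> compactly_supported \<Longrightarrow> (\<And>x. cmod (f x) \<le> 1) \<Longrightarrow>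
        cmod (\<Sum>j\<in>J. c j * (\<integral>x. f x \<partial>N j)) \<le> B"
  shows "cb_variation \<kappa> A \<le> ennreal B"
  unfolding total_variation_def
proof (rule SUP_least)
  fix P assume "P \<in> {P. finite P \<and> partition_on A P \<and> P \<subseteq> compacted_borel}"
  then have P: "finite P" "partition_on A P" "P \<subseteq> compacted_borel" by auto
  obtain S where S: "dominates S J c N" using dominates_exists[OF R] .
  then have rS: "radon S" by (simp add: dominates_def)
  have "(\<Sum>D\<in>P. cmod (\<kappa> D)) \<le> B + e" if e: "e > 0" for e :: real
  proof -
    \<comment> \<open>One error \<open>d\<close> for each member of \<open>P\<close>, doubled by
      \<open>disc_retract_dist\<close>; the summand 1 keeps the denominator positive for empty
      \<open>P\<close>.\<close>
    define d where "d = e / (2 * real (card P) + 1)"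
    have d: "d > 0" using e by (simp add: d_def)
    have "\<exists>f. f \<in> nonneg_cs \<and> (\<integral>\<^sup>+x. ennreal \<bar>indicator D x - f x\<bar> \<partial>S) < ennreal d" if "D \<in> P" for D
    proof -
      have D: "D \<in> compacted_borel" using that P by auto
      show ?thesis by (rule radon_L1_approx[OF lc rS D d]) blast
    qed
    then obtain f where f: "\<And>D. D \<in> P \<Longrightarrow> f D \<in> nonneg_cs"
       "\<And>D. D \<in> P \<Longrightarrow> (\<integral>\<^sup>+x. ennreal \<bar>indicator D x - f D x\<bar> \<partial>S) < ennreal d" by metis
    define u where "u D = cnj (sgn (\<kappa> D))" for D
    have u1: "cmod (u D) \<le> 1" for D by (simp add: u_def norm_sgn)
    have u2: "u D * \<kappa> D = of_real (cmod (\<kappa> D))" for D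
    proof (cases "\<kappa> D = 0")
      case False
      then show ?thesis unfolding u_def sgn_eq
        by (simp add: complex_norm_square[symmetric] mult.commute power2_eq_square field_simps)
    qed (simp add: u_def)
    define g where "g x = (\<Sum>D\<in>P. u D * of_real (f D x))" for x
    define h where "h x = (\<Sum>D\<in>P. u D * of_real (indicator D x))" for x
    have h1: "cmod (h x) \<le> 1" for x
    proof (cases "\<exists>D\<in>P. x \<in> D")
      case True
      then obtain D where D: "D \<in> P" "x \<in> D" by blast
      have "h x = (\<Sum>D'\<in>P. if D' = D then u D else 0)"
        unfolding h_def
      proof (intro sum.cong refl)
        fix D' assume "D' \<in> P"
        then have "D' = D \<or> x \<notin> D'" using P(2) D by (auto simp: partition_on_def disjoint_def)
        then show "u D' * of_real (indicator D' x) = (if D' = D then u D else 0)" using D by auto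
      qed
      also have "\<dots> = u D" using P(1) D by simp
      finally show ?thesis using u1 by simp
    next
      case False
      then have "h x = 0" unfolding h_def by (intro sum.neutral) auto
      then show ?thesis by simp
    qed
    have gcs: "(\<lambda>x. \<Sum>D\<in>Q. u D * of_real (f D x)) \<in> compactly_supported" if "finite Q" "Q \<subseteq> P" for Q
      using that
    proof (induction Q rule: finite_induct)
      case empty
      show ?case by (auto simp: compactly_supported_iff)
    next
      case (insert D Q)
      then have "(\<lambda>x. u D * of_real (f D x) + (\<Sum>D\<in>Q. u D * of_real (f D x))) \<in> compactly_supported"
        using f(1) by (intro compactly_supported_add compactly_supported_scale compactly_supported_of_real) auto
      then show ?case using insert by simp
    qed
    have g: "g \<in> compactly_supported" unfolding g_def using gcs[OF P(1)] by simp
    have gc: "continuous_on UNIV g" using g by (simp add: compactly_supported_iff)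
    \<comment> \<open>\<open>g\<close> may exceed 1 where the approximations of different indicators
      overlap; the retraction restores the bound under which \<open>le\<close> applies.\<close>
    let ?r = "\<lambda>x. disc_retract (g x)"
    have r: "?r \<in> compactly_supported"
      by (rule compactly_supported_dominated[OF g continuous_on_compose2[OF continuous_disc_retract gc]]) auto
    have rc: "continuous_on UNIV ?r" using r by (simp add: compactly_supported_iff)
    obtain K where K: "compact K" "\<And>x. x \<notin> K \<Longrightarrow> ?r x = 0" using r unfolding compactly_supported_iff by blast
    have intr: "integrable (N j) ?r" if "j \<in> J" for j
      by (rule radon_integrable_compact_support[OF representsD(2)[OF R that] rc K])
    have inti: "integrable (N j) (\<lambda>x. complex_of_real (indicator D x))" if "j \<in> J" "D \<in> P" for j D
    proof -
      have D: "D \<in> compacted_borel" using that P by auto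
      show ?thesis
        using representsD(2)[OF R that(1)] radon_compacted_borel[OF representsD(2)[OF R that(1)] D] D
        by (intro integrable_of_real integrable_real_indicator) (auto simp: compacted_borel_borel)
    qed
    have inth: "integrable (N j) h" if "j \<in> J" for j
      unfolding h_def using inti[OF that] by (intro Bochner_Integration.integrable_sum integrable_mult_right)
    have hm: "h \<in> borel_measurable borel"
      unfolding h_def
    proof (rule borel_measurable_sum)
      fix D assume "D \<in> P"
      then have [measurable]: "D \<in> sets borel" using P(3) by (auto simp: compacted_borel_borel)
      show "(\<lambda>x. u D * of_real (indicator D x)) \<in> borel_measurable borel" by measurable
    qed
    have rm: "?r \<in> borel_measurable borel" by (rule borel_measurable_continuous_onI[OF rc])
    have "(\<Sum>j\<in>J. c j * (\<integral>x. h x \<partial>N j)) = (\<Sum>j\<in>J. c j * (\<Sum>D\<in>P. u D * of_real (measure (N j) D)))"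
    proof (intro sum.cong refl arg_cong2[of _ _ _ _ "(*)"])
      fix j assume j: "j \<in> J"
      have "(\<integral>x. h x \<partial>N j) = (\<Sum>D\<in>P. (\<integral>x. u D * complex_of_real (indicator D x) \<partial>N j))"
        unfolding h_def using inti[OF j] by (intro Bochner_Integration.integral_sum integrable_mult_right)
      also have "\<dots> = (\<Sum>D\<in>P. u D * of_real (measure (N j) D))"
        using representsD(2)[OF R j] by (intro sum.cong refl) simp
      finally show "(\<integral>x. h x \<partial>N j) = (\<Sum>D\<in>P. u D * of_real (measure (N j) D))" .
    qed
    also have "\<dots> = (\<Sum>D\<in>P. \<Sum>j\<in>J. u D * (c j * of_real (measure (N j) D)))"
      unfolding sum_distrib_left by (subst sum.swap) (simp only: ac_simps)
    also have "\<dots> = (\<Sum>D\<in>P. u D * \<kappa> D)"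
      using representsD(3)[OF R] P(3) by (intro sum.cong refl) (auto simp: sum_distrib_left)
    also have "\<dots> = of_real (\<Sum>D\<in>P. cmod (\<kappa> D))" by (simp add: u2)
    finally have hs: "(\<Sum>j\<in>J. c j * (\<integral>x. h x \<partial>N j)) = of_real (\<Sum>D\<in>P. cmod (\<kappa> D))" .
    have eq: "(\<Sum>j\<in>J. c j * (\<integral>x. ?r x - h x \<partial>N j)) = (\<Sum>j\<in>J. c j * (\<integral>x. ?r x \<partial>N j)) - (\<Sum>j\<in>J. c j * (\<integral>x. h x \<partial>N j))"
      using intr inth by (simp add: Bochner_Integration.integral_diff right_diff_distrib sum_subtractf)
    have "ennreal (cmod (\<Sum>j\<in>J. c j * (\<integral>x. ?r x - h x \<partial>N j))) \<le> (\<integral>\<^sup>+x. ennreal (cmod (?r x - h x)) \<partial>S)"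
      using intr inth rm hm
      by (intro represents_integral_bound[OF representsD(1,2)[OF R] S] borel_measurable_diff Bochner_Integration.integrable_diff)
    also have "\<dots> \<le> (\<integral>\<^sup>+x. 2 * (\<Sum>D\<in>P. ennreal \<bar>indicator D x - f D x\<bar>) \<partial>S)"
    proof (rule nn_integral_mono)
      fix x
      have "cmod (g x - h x) \<le> (\<Sum>D\<in>P. cmod (u D * of_real (f D x - indicator D x)))"
        unfolding g_def h_def sum_subtractf[symmetric] right_diff_distrib[symmetric] of_real_diff[symmetric] by (rule norm_sum)
      also have "\<dots> \<le> (\<Sum>D\<in>P. \<bar>indicator D x - f D x\<bar>)"
      proof (rule sum_mono)
        fix D
        have "cmod (u D * of_real (f D x - indicator D x)) = cmod (u D) * \<bar>f D x - indicator D x\<bar>"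
          by (simp only: norm_mult norm_of_real)
        also have "\<dots> \<le> 1 * \<bar>f D x - indicator D x\<bar>" using u1 by (intro mult_right_mono) auto
        finally show "cmod (u D * of_real (f D x - indicator D x)) \<le> \<bar>indicator D x - f D x\<bar>"
          by (simp add: abs_minus_commute)
      qed
      finally have "cmod (?r x - h x) \<le> 2 * (\<Sum>D\<in>P. \<bar>indicator D x - f D x\<bar>)"
        using disc_retract_dist[OF h1[of x], of "g x"] by linarith
      then have "ennreal (cmod (?r x - h x)) \<le> ennreal (2 * (\<Sum>D\<in>P. \<bar>indicator D x - f D x\<bar>))" by (rule ennreal_leI)
      also have "\<dots> = 2 * (\<Sum>D\<in>P. ennreal \<bar>indicator D x - f D x\<bar>)"
        by (subst ennreal_mult) (auto simp: sum_nonneg)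
      finally show "ennreal (cmod (?r x - h x)) \<le> 2 * (\<Sum>D\<in>P. ennreal \<bar>indicator D x - f D x\<bar>)" .
    qed
    also have "\<dots> = 2 * (\<Sum>D\<in>P. (\<integral>\<^sup>+x. ennreal \<bar>indicator D x - f D x\<bar> \<partial>S))"
    proof -
      have m: "(\<lambda>x. ennreal \<bar>indicator D x - f D x\<bar>) \<in> borel_measurable S" if "D \<in> P" for D
      proof (rule radon_measurable[OF rS])
        have [measurable]: "D \<in> sets borel" "f D \<in> borel_measurable borel"
          using that P(3) borel_measurable_continuous_onI[OF nonneg_csD(1)[OF f(1)[OF that]]]
          by (auto simp: compacted_borel_borel)
        show "(\<lambda>x. ennreal \<bar>indicator D x - f D x\<bar>) \<in> borel_measurable borel" by measurable
      qed
      show ?thesis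
        by (subst nn_integral_cmult, rule borel_measurable_sum, erule m, subst nn_integral_sum, erule m, rule refl)
    qed
    also have "\<dots> \<le> 2 * (\<Sum>D\<in>P. ennreal d)"
      by (intro mult_left_mono sum_mono less_imp_le f(2)) auto
    also have "\<dots> = ennreal (2 * real (card P) * d)"
      using d by (simp add: ennreal_mult ennreal_of_nat_eq_real_of_nat mult.assoc)
    also have "\<dots> \<le> ennreal e"
    proof (rule ennreal_leI)
      have "2 * real (card P) * d \<le> (2 * real (card P) + 1) * d" using d by (simp add: distrib_right)
      also have "\<dots> = e" by (simp add: d_def)
      finally show "2 * real (card P) * d \<le> e" .
    qed
    finally have "cmod ((\<Sum>j\<in>J. c j * (\<integral>x. ?r x \<partial>N j)) - of_real (\<Sum>D\<in>P. cmod (\<kappa> D))) \<le> e"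
      using e by (simp add: eq hs ennreal_le_iff)
    moreover have "cmod (\<Sum>j\<in>J. c j * (\<integral>x. ?r x \<partial>N j)) \<le> B" by (rule le[OF r disc_retract_le])
    moreover have "cmod (of_real (\<Sum>D\<in>P. cmod (\<kappa> D))) = (\<Sum>D\<in>P. cmod (\<kappa> D))"
      by (simp only: norm_of_real) (simp add: sum_nonneg)
    ultimately show ?thesis
      using norm_triangle_ineq2[of "of_real (\<Sum>D\<in>P. cmod (\<kappa> D)) :: complex" "\<Sum>j\<in>J. c j * (\<integral>x. ?r x \<partial>N j)"]
      by (simp only: norm_minus_commute)
  qed
  then have "(\<Sum>D\<in>P. cmod (\<kappa> D)) \<le> B" by (rule field_le_epsilon)
  then have "ennreal (\<Sum>D\<in>P. cmod (\<kappa> D)) \<le> ennreal B" by (rule ennreal_leI)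
  then show "(\<Sum>D\<in>P. ennreal (cmod (\<kappa> D))) \<le> ennreal B" by (simp add: sum_ennreal)
qed

section \<open>Weighted measures and their predual\<close>

text \<open>The coefficients stay and only the components are multiplied by \<open>w\<close>.
  Continuity bounds \<open>w\<close> on compact sets, which keeps the new components finite
  there.\<close>

lemma density_represents:
  fixes \<mu> :: "'a::t2_space set \<Rightarrow> complex" and w :: "'a \<Rightarrow> real"
  assumes R: "represents J c N \<mu>" and w: "continuous_on UNIV w" "\<And>x. 0 \<le> w x"
  shows "represents J c (\<lambda>j. density (N j) (\<lambda>x. ennreal (w x))) (density_cb (\<lambda>x. complex_of_real (w x)) \<mu>)"
  unfolding represents_def
proof (intro conjI ballI allI impI)
  have wm: "w \<in> borel_measurable borel" by (rule borel_measurable_continuous_onI[OF w(1)])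
  have bd: "\<exists>c. \<forall>x\<in>K. w x \<le> c" if "compact K" for K
  proof -
    have "compact (w ` K)" using w(1) that by (meson compact_continuous_image continuous_on_subset subset_UNIV)
    then have "bdd_above (w ` K)" by (rule bounded_imp_bdd_above[OF compact_imp_bounded])
    then show ?thesis by (auto simp: bdd_above_def)
  qed
  show "finite J" by (rule representsD(1)[OF R])
  show "radon (density (N j) (\<lambda>x. ennreal (w x)))" if "j \<in> J" for j
  proof (rule radon_density[OF representsD(2)[OF R that]])
    show "(\<lambda>x. ennreal (w x)) \<in> borel_measurable borel" using wm by measurable
    show "\<exists>c. \<forall>x\<in>K. ennreal (w x) \<le> ennreal c" if "compact K" for K
      using bd[OF that] by (auto intro: ennreal_leI)
  qed
  fix A :: "'a set" assume A: "A \<in> compacted_borel"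
  have Ab[measurable]: "A \<in> sets borel" using A by (rule compacted_borel_borel)
  obtain B where B: "\<And>x. x \<in> A \<Longrightarrow> w x \<le> B"
    using bd[of "closure A"] A closure_subset[of A] by (auto simp: compacted_borel_def)
  let ?f = "\<lambda>x. complex_of_real (w x) * indicator A x"
  have fm: "?f \<in> borel_measurable borel" using wm by measurable
  have gm: "(\<lambda>x. w x * indicator A x) \<in> borel_measurable borel" using wm by measurable
  have intr: "integrable (N j) (\<lambda>x. w x * indicator A x)" if "j \<in> J" for j
  proof (rule integrableI_bounded_set[where A = A and B = "\<bar>B\<bar>"])
    note rN = representsD(2)[OF R that]
    show "A \<in> sets (N j)" "emeasure (N j) A < \<infinity>" using rN Ab radon_compacted_borel[OF rN A] by auto
    show "(\<lambda>x. w x * indicator A x) \<in> borel_measurable (N j)"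
      by (rule radon_measurable[OF rN gm])
    show "AE x in N j. x \<in> A \<longrightarrow> norm (w x * indicator A x) \<le> \<bar>B\<bar>"
    proof (intro AE_I2 impI)
      fix x assume "x \<in> A"
      then show "norm (w x * indicator A x) \<le> \<bar>B\<bar>" using B[of x] w(2)[of x] by simp
    qed
  qed (auto simp: indicator_def)
  have f_eq: "?f = (\<lambda>x. complex_of_real (w x * indicator A x))" by (auto simp: indicator_def)
  have int: "integrable (N j) ?f" if "j \<in> J" for j
    unfolding f_eq by (intro integrable_of_real intr that)
  have "density_cb (\<lambda>x. complex_of_real (w x)) \<mu> A = cb_integral \<mu> ?f"
    using A by (simp add: density_cb_def)
  also have "\<dots> = (\<Sum>j\<in>J. c j * (\<integral>x. ?f x \<partial>N j))"
    by (rule cb_integral_represents(2)[OF R int fm, of "\<lambda>_. A"]) (use A in \<open>auto simp: incseq_def\<close>)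
  also have "\<dots> = (\<Sum>j\<in>J. c j * of_real (measure (density (N j) (\<lambda>x. ennreal (w x))) A))"
  proof (intro sum.cong refl arg_cong2[of _ _ _ _ "(*)"])
    fix j assume j: "j \<in> J"
    note rN = representsD(2)[OF R j]
    have "emeasure (density (N j) (\<lambda>x. ennreal (w x))) A = (\<integral>\<^sup>+x. ennreal (w x) * indicator A x \<partial>N j)"
      using rN Ab radon_measurable[OF rN wm] by (intro emeasure_density) auto
    also have "\<dots> = (\<integral>\<^sup>+x. ennreal (w x * indicator A x) \<partial>N j)"
      by (intro nn_integral_cong) (auto simp: indicator_def)
    also have "\<dots> = ennreal (\<integral>x. w x * indicator A x \<partial>N j)"
      using w(2) by (intro nn_integral_eq_integral intr j) auto
    finally have "measure (density (N j) (\<lambda>x. ennreal (w x))) A = (\<integral>x. w x * indicator A x \<partial>N j)"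
      using w(2) by (simp add: measure_def)
    then show "(\<integral>x. ?f x \<partial>N j) = of_real (measure (density (N j) (\<lambda>x. ennreal (w x))) A)"
      unfolding f_eq by (simp only: integral_complex_of_real)
  qed
  finally show "density_cb (\<lambda>x. complex_of_real (w x)) \<mu> A =
      (\<Sum>j\<in>J. c j * of_real (measure (density (N j) (\<lambda>x. ennreal (w x))) A))" .
qed (simp add: density_cb_def)

text \<open>The duality concerns the topology and the weight alone; the group law enters with
  \<open>beurling_weight\<close>.\<close>

locale weighted_space =
  fixes \<omega> :: "'a::t2_space \<Rightarrow> real"
  assumes lc: "locally_compact_space (euclidean :: 'a topology)"
    and cont: "continuous_on UNIV \<omega>"
    and pos: "\<And>x. 0 < \<omega> x"
begin

abbreviation V where "V \<equiv> beurling_measures \<omega>"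
abbreviation E where "E \<equiv> weighted_C0 \<omega>"
abbreviation NV where "NV \<equiv> beurling_norm \<omega>"
abbreviation NE where "NE \<equiv> weighted_sup_norm \<omega>"

section \<open>The predual\<close>

lemma nonneg: "0 \<le> \<omega> x" and nz: "\<omega> x \<noteq> 0"
  using pos[of x] by auto

lemma meas [measurable]: "\<omega> \<in> borel_measurable borel"
  by (rule borel_measurable_continuous_onI[OF cont])

lemma E_iff: "\<psi> \<in> E \<longleftrightarrow> continuous_on UNIV \<psi> \<and>
    (\<forall>\<epsilon>>0. \<exists>K. compact K \<and> (\<forall>x. x \<notin> K \<longrightarrow> cmod (\<psi> x) < \<epsilon> * \<omega> x))"
proof -
  have n: "cmod (\<psi> x / of_real (\<omega> x)) < e \<longleftrightarrow> cmod (\<psi> x) < e * \<omega> x" for x e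
    using pos[of x] by (simp add: norm_divide pos_divide_less_eq)
  have "continuous_on UNIV (\<lambda>x. \<psi> x / of_real (\<omega> x)) \<longleftrightarrow> continuous_on UNIV \<psi>"
  proof
    assume "continuous_on UNIV (\<lambda>x. \<psi> x / of_real (\<omega> x))"
    then have "continuous_on UNIV (\<lambda>x. \<psi> x / of_real (\<omega> x) * of_real (\<omega> x))"
      by (intro continuous_on_mult continuous_on_of_real cont)
    then show "continuous_on UNIV \<psi>" using nz by simp
  next
    assume "continuous_on UNIV \<psi>"
    then show "continuous_on UNIV (\<lambda>x. \<psi> x / of_real (\<omega> x))"
      using nz by (intro continuous_on_divide continuous_on_of_real cont) auto
  qed
  then show ?thesis unfolding weighted_C0_def C0_def by (simp add: n)
qed

lemma E_continuous: "\<psi> \<in> E \<Longrightarrow> continuous_on UNIV \<psi>"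
  by (simp add: E_iff)

lemma E_bdd: assumes "\<psi> \<in> E" shows "bdd_above (range (\<lambda>x. cmod (\<psi> x / of_real (\<omega> x))))"
proof -
  obtain K where K: "compact K" "\<And>x. x \<notin> K \<Longrightarrow> cmod (\<psi> x) < 1 * \<omega> x"
    using assms zero_less_one unfolding E_iff by metis
  have "continuous_on K (\<lambda>x. \<psi> x / of_real (\<omega> x))"
    using E_continuous[OF assms] cont nz
    by (intro continuous_on_divide continuous_on_of_real) (auto intro: continuous_on_subset)
  then have "compact ((\<lambda>x. \<psi> x / of_real (\<omega> x)) ` K)" by (rule compact_continuous_image[OF _ K(1)])
  then have "bounded ((\<lambda>x. \<psi> x / of_real (\<omega> x)) ` K)" by (rule compact_imp_bounded)
  then obtain B where B: "\<And>x. x \<in> K \<Longrightarrow> cmod (\<psi> x / of_real (\<omega> x)) \<le> B"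
    unfolding bounded_iff by blast
  have "cmod (\<psi> x / of_real (\<omega> x)) \<le> max B 1" for x
  proof (cases "x \<in> K")
    case True then show ?thesis using B by (simp add: le_max_iff_disj)
  next
    case False
    then have "cmod (\<psi> x / of_real (\<omega> x)) \<le> 1"
      using K(2)[OF False] pos[of x] by (simp add: norm_divide divide_le_eq less_imp_le)
    then show ?thesis by simp
  qed
  then show ?thesis by (auto simp: bdd_above_def)
qed

lemma E_le: assumes "\<psi> \<in> E" shows "cmod (\<psi> x) \<le> NE \<psi> * \<omega> x"
proof -
  have "cmod (\<psi> x / of_real (\<omega> x)) \<le> NE \<psi>"
    unfolding weighted_sup_norm_def by (rule cSUP_upper[OF _ E_bdd[OF assms]]) simp
  then show ?thesis using pos[of x] by (simp add: norm_divide divide_le_eq)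
qed

lemma NE_le: assumes "\<And>x. cmod (\<psi> x) \<le> B * \<omega> x" shows "NE \<psi> \<le> B"
  unfolding weighted_sup_norm_def
proof (rule cSUP_least)
  show "cmod (\<psi> x / of_real (\<omega> x)) \<le> B" for x
    using assms[of x] pos[of x] by (simp add: norm_divide divide_le_eq)
qed simp

lemma NE_nonneg: assumes "\<psi> \<in> E" shows "0 \<le> NE \<psi>"
proof -
  have "0 \<le> NE \<psi> * \<omega> undefined" using E_le[OF assms, of undefined] norm_ge_zero order_trans by blast
  then show ?thesis using pos[of undefined] by (simp add: zero_le_mult_iff)
qed

lemma E_closed:
  assumes "continuous_on UNIV \<psi>" "\<And>e. e > 0 \<Longrightarrow> \<exists>\<phi>\<in>E. \<forall>x. cmod (\<psi> x - \<phi> x) \<le> e * \<omega> x"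
  shows "\<psi> \<in> E"
  unfolding E_iff
proof (intro conjI allI impI)
  fix e :: real assume e: "e > 0"
  then obtain \<phi> where p: "\<phi> \<in> E" "\<And>x. cmod (\<psi> x - \<phi> x) \<le> e/2 * \<omega> x" using assms(2)[of "e/2"] by auto
  obtain K where K: "compact K" "\<And>x. x \<notin> K \<Longrightarrow> cmod (\<phi> x) < e/2 * \<omega> x"
    using p(1) e unfolding E_iff by (metis half_gt_zero)
  have "cmod (\<psi> x) < e * \<omega> x" if "x \<notin> K" for x
    using norm_triangle_sub[of "\<psi> x" "\<phi> x"] p(2)[of x] K(2)[OF that] by (simp add: field_simps)
  then show "\<exists>K. compact K \<and> (\<forall>x. x \<notin> K \<longrightarrow> cmod (\<psi> x) < e * \<omega> x)" using K(1) by blast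
qed (rule assms(1))

lemma cs_in_E: assumes "f \<in> compactly_supported" shows "f \<in> E"
proof -
  obtain K where K: "compact K" "\<And>x. x \<notin> K \<Longrightarrow> f x = 0" and c: "continuous_on UNIV f"
    using assms unfolding compactly_supported_iff by blast
  show ?thesis unfolding E_iff using K c pos by (intro conjI allI impI exI[of _ K]) auto
qed

text \<open>Multiplication by a cutoff function. It also keeps \<open>\<phi>\<close> below
  \<open>\<psi>\<close> in modulus, so that pointwise bounds for \<open>\<psi>\<close> pass to
  \<open>\<phi>\<close>.\<close>

lemma E_approx_cs:
  assumes p: "\<psi> \<in> E" and e: "e > 0"
  obtains \<phi> where "\<phi> \<in> compactly_supported" "\<And>x. cmod (\<psi> x - \<phi> x) \<le> e * \<omega> x" "\<And>x. cmod (\<phi> x) \<le> cmod (\<psi> x)"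
proof -
  obtain K where K: "compact K" "\<And>x. x \<notin> K \<Longrightarrow> cmod (\<psi> x) < e * \<omega> x"
    using p e unfolding E_iff by metis
  obtain k C where k: "k \<in> nonneg_cs" "\<And>x. k x \<le> 1" "\<And>x. x \<in> K \<Longrightarrow> k x = 1"
    by (rule urysohn[OF lc K(1) subset_UNIV open_UNIV], rule that)
  have k0: "0 \<le> k x" for x by (rule nonneg_csD(2)[OF k(1)])
  show ?thesis
  proof (rule that[of "\<lambda>x. \<psi> x * of_real (k x)"])
    show "(\<lambda>x. \<psi> x * of_real (k x)) \<in> compactly_supported"
    proof (rule compactly_supported_dominated[OF compactly_supported_of_real[OF k(1)]])
      show "continuous_on UNIV (\<lambda>x. \<psi> x * of_real (k x))"
        using E_continuous[OF p] nonneg_csD(1)[OF k(1)] by (intro continuous_on_mult continuous_on_of_real)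
    qed auto
    show "cmod (\<psi> x * of_real (k x)) \<le> cmod (\<psi> x)" for x
      using k(2)[of x] k0[of x] by (simp add: norm_mult mult_left_le)
    show "cmod (\<psi> x - \<psi> x * of_real (k x)) \<le> e * \<omega> x" for x
    proof (cases "x \<in> K")
      case True
      then show ?thesis using k(3) e pos[of x] by simp
    next
      case False
      have "\<psi> x - \<psi> x * of_real (k x) = \<psi> x * of_real (1 - k x)" by (simp add: algebra_simps)
      then have "cmod (\<psi> x - \<psi> x * of_real (k x)) = cmod (\<psi> x) * \<bar>1 - k x\<bar>"
        by (simp only: norm_mult norm_of_real)
      also have "\<dots> \<le> cmod (\<psi> x)" using k(2)[of x] k0[of x] by (intro mult_left_le) auto
      also have "\<dots> \<le> e * \<omega> x" using K(2)[OF False] by simp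
      finally show ?thesis .
    qed
  qed
qed

text \<open>\<open>\<psi>\<close> is nonzero only on a countable union of compact sets, namely sets
  off which \<open>cmod (\<psi> x)\<close> is below \<open>\<omega> x / (n + 1)\<close>. Membership
  in L1 asks for exactly such a union.\<close>

lemma E_exhaustion:
  assumes "\<psi> \<in> E"
  obtains F where "incseq F" "range F \<subseteq> compacted_borel" "\<And>x. x \<notin> (\<Union>n. F n) \<Longrightarrow> \<psi> x = 0"
proof -
  have "\<forall>n::nat. \<exists>K. compact K \<and> (\<forall>x. x \<notin> K \<longrightarrow> cmod (\<psi> x) < inverse (real (Suc n)) * \<omega> x)"
    using assms unfolding E_iff by simp
  then obtain K where K: "\<And>n::nat. compact (K n)" "\<And>n x. x \<notin> K n \<Longrightarrow> cmod (\<psi> x) < inverse (real (Suc n)) * \<omega> x"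
    by metis
  define F where "F n = (\<Union>i\<le>n. K i)" for n
  have "compact (F n)" for n unfolding F_def using K by (intro compact_UN) auto
  moreover have "incseq F" unfolding F_def incseq_def by (intro allI impI UN_mono) auto
  moreover have "\<psi> x = 0" if "x \<notin> (\<Union>n. F n)" for x
  proof (rule ccontr)
    assume "\<psi> x \<noteq> 0"
    then have "0 < cmod (\<psi> x) / \<omega> x" using pos by simp
    then obtain n where n: "inverse (real (Suc n)) < cmod (\<psi> x) / \<omega> x" using reals_Archimedean by blast
    have "x \<notin> K n" using that unfolding F_def by auto
    then have "cmod (\<psi> x) < inverse (real (Suc n)) * \<omega> x" by (rule K(2))
    then show False using n pos[of x] by (simp add: less_divide_eq)
  qed
  ultimately show ?thesis using that[of F] compact_compacted_borel by blast
qed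

text \<open>Representations whose components integrate the weight. By \<open>wrep_in_V\<close> and
  \<open>V_wrep\<close> the measures possessing one are exactly the elements of M(G, \<omega>), and
  the further work with these elements goes through such a representation.\<close>

definition wrep :: "'i set \<Rightarrow> ('i \<Rightarrow> complex) \<Rightarrow> ('i \<Rightarrow> 'a measure) \<Rightarrow> ('a set \<Rightarrow> complex) \<Rightarrow> bool" where
  "wrep J c N \<mu> \<longleftrightarrow> represents J c N \<mu> \<and> (\<forall>j\<in>J. (\<integral>\<^sup>+x. ennreal (\<omega> x) \<partial>N j) < \<infinity>)"

lemma wrepD:
  assumes "wrep J c N \<mu>"
  shows "represents J c N \<mu>" and "j \<in> J \<Longrightarrow> (\<integral>\<^sup>+x. ennreal (\<omega> x) \<partial>N j) < \<infinity>"
    and "finite J" and "j \<in> J \<Longrightarrow> radon (N j)"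
proof -
  show r: "represents J c N \<mu>" using assms by (simp add: wrep_def)
  show "j \<in> J \<Longrightarrow> (\<integral>\<^sup>+x. ennreal (\<omega> x) \<partial>N j) < \<infinity>" using assms by (simp add: wrep_def)
  show "finite J" by (rule representsD(1)[OF r])
  show "j \<in> J \<Longrightarrow> radon (N j)" by (rule representsD(2)[OF r])
qed

lemma integrable_dominated:
  fixes f :: "'a \<Rightarrow> complex"
  assumes M: "radon M" and fin: "(\<integral>\<^sup>+x. ennreal (\<omega> x) \<partial>M) < \<infinity>"
    and f: "f \<in> borel_measurable borel" "\<And>x. cmod (f x) \<le> B * \<omega> x"
  shows "integrable M f"
proof (rule Bochner_Integration.integrable_bound)
  have "integrable M \<omega>"
    using fin radon_measurable[OF M meas] nonneg by (intro integrableI_nonneg) auto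
  then show "integrable M (\<lambda>x. B * \<omega> x)" by simp
  show "f \<in> borel_measurable M" by (rule radon_measurable[OF M f(1)])
  show "AE x in M. norm (f x) \<le> norm (B * \<omega> x)" using order_trans[OF f(2) abs_ge_self] by (intro AE_I2) simp
qed

lemma integrable_E:
  assumes M: "radon M" and fin: "(\<integral>\<^sup>+x. ennreal (\<omega> x) \<partial>M) < \<infinity>" and p: "\<psi> \<in> E"
  shows "integrable M \<psi>"
  by (rule integrable_dominated[OF M fin borel_measurable_continuous_onI[OF E_continuous[OF p]] E_le[OF p]])

lemma cb_integral_E:
  assumes R: "wrep J c N \<mu>" and p: "\<psi> \<in> E"
  shows "\<psi> \<in> cb_L1 \<mu>" and "cb_integral \<mu> \<psi> = (\<Sum>j\<in>J. c j * (\<integral>x. \<psi> x \<partial>N j))"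
proof -
  obtain F where F: "incseq F" "range F \<subseteq> compacted_borel" "\<And>x. x \<notin> (\<Union>n. F n) \<Longrightarrow> \<psi> x = 0"
    by (rule E_exhaustion[OF p], rule that)
  have int: "integrable (N j) \<psi>" if "j \<in> J" for j by (rule integrable_E[OF wrepD(4)[OF R that] wrepD(2)[OF R that] p])
  note * = cb_integral_represents[OF wrepD(1)[OF R] int borel_measurable_continuous_onI[OF E_continuous[OF p]] F]
  show "\<psi> \<in> cb_L1 \<mu>" by (rule *(1))
  show "cb_integral \<mu> \<psi> = (\<Sum>j\<in>J. c j * (\<integral>x. \<psi> x \<partial>N j))" by (rule *(2))
qed

text \<open>A dominating measure for the weighted representation has finite total mass and lies
  above the variation of \<omega>\<mu>.\<close>

lemma wrep_in_V:
  assumes R: "wrep J c N \<mu>" shows "\<mu> \<in> V"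
proof -
  let ?D = "\<lambda>j. density (N j) (\<lambda>x. ennreal (\<omega> x))" and ?k = "density_cb (\<lambda>x. complex_of_real (\<omega> x)) \<mu>"
  have RD: "represents J c ?D ?k" by (rule density_represents[OF wrepD(1)[OF R] cont nonneg])
  obtain S where S: "dominates S J c ?D" using dominates_exists[OF RD] .
  then have rS: "radon S" by (simp add: dominates_def)
  have "sup_variation ?k UNIV \<le> emeasure S UNIV"
    unfolding sup_variation_def
  proof (rule SUP_least)
    fix A :: "'a set" assume "A \<in> {A \<in> compacted_borel. A \<subseteq> UNIV}"
    then have A: "A \<in> compacted_borel" by simp
    have "cb_variation ?k A \<le> emeasure S A" by (rule dominates_tv_le[OF RD S A])
    also have "\<dots> \<le> emeasure S UNIV" using rS by (intro emeasure_mono) auto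
    finally show "cb_variation ?k A \<le> emeasure S UNIV" .
  qed
  also have "emeasure S UNIV = (\<Sum>j\<in>J. ennreal (cmod (c j)) * emeasure (?D j) UNIV)"
    using S by (simp add: dominates_def)
  also have "\<dots> < \<infinity>"
  proof -
    have "emeasure (?D j) UNIV < \<infinity>" if j: "j \<in> J" for j
      using wrepD(2)[OF R j] wrepD(4)[OF R j] radon_measurable[OF wrepD(4)[OF R j] meas]
      by (subst emeasure_density) auto
    then show ?thesis using wrepD(3)[OF R] by (auto simp: ennreal_mult_less_top)
  qed
  finally have "?k \<in> bounded_cb_measures"
    using regular_represents[OF RD] by (simp add: bounded_cb_measures_def)
  then show ?thesis
    using regular_represents[OF wrepD(1)[OF R]] by (simp add: beurling_measures_def)
qed

text \<open>The Jordan components of the bounded measure \<open>\<omega>\<mu>\<close>, divided by \<open>\<omega>\<close>, represent \<open>\<mu>\<close>.\<close>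

lemma V_wrep:
  assumes mu: "\<mu> \<in> V"
  obtains c N where "wrep {..<4::nat} c N \<mu>"
proof -
  let ?k = "density_cb (\<lambda>x. complex_of_real (\<omega> x)) \<mu>"
  have reg: "\<mu> \<in> regular_cb_measures" and kreg: "?k \<in> regular_cb_measures" and kb: "sup_variation ?k UNIV < \<infinity>"
    using mu by (auto simp: beurling_measures_def bounded_cb_measures_def)
  interpret k: complex_cb ?k by unfold_locales (use kreg in \<open>simp add: regular_cb_measures_def\<close>)
  obtain M where M: "represents {..<4::nat} (\<lambda>j. \<i> ^ j) M ?k"
    and M0: "\<And>A. A \<in> compacted_borel \<Longrightarrow> emeasure (M 0) A = k.re.PV A"
    and M1: "\<And>A. A \<in> compacted_borel \<Longrightarrow> emeasure (M 1) A = k.im.PV A"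
    and M2: "\<And>A. A \<in> compacted_borel \<Longrightarrow> emeasure (M 2) A = k.nre.PV A"
    and M3: "\<And>A. A \<in> compacted_borel \<Longrightarrow> emeasure (M 3) A = k.nim.PV A"
    by (rule regular_jordan[OF kreg]) blast
  have rM: "radon (M j)" if "j < 4" for j using representsD(2)[OF M, of j] that by simp
  \<comment> \<open>On compact sets the Jordan parts lie below the bounded variation of
    \<open>?k\<close>; inner regularity carries the bound to the whole space.\<close>
  have Mfin: "emeasure (M j) UNIV < \<infinity>" if j: "j < 4" for j
  proof -
    have "emeasure (M j) UNIV = (SUP K\<in>{K. compact K \<and> K \<subseteq> UNIV}. emeasure (M j) K)"
      by (rule radon_inner[OF rM[OF j]]) simp
    also have "\<dots> \<le> sup_variation ?k UNIV"
    proof (rule SUP_least)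
      fix K :: "'a set" assume K: "K \<in> {K. compact K \<and> K \<subseteq> UNIV}"
      then have Kcb: "K \<in> compacted_borel" by (simp add: compact_compacted_borel)
      have "j = 0 \<or> j = 1 \<or> j = 2 \<or> j = 3" using j by auto
      then have "emeasure (M j) K \<le> cb_variation ?k K"
        using M0[OF Kcb] M1[OF Kcb] M2[OF Kcb] M3[OF Kcb] k.jordan_bounds[OF Kcb] by auto
      also have "\<dots> \<le> sup_variation ?k UNIV"
        unfolding sup_variation_def using Kcb by (intro SUP_upper) auto
      finally show "emeasure (M j) K \<le> sup_variation ?k UNIV" .
    qed
    finally show ?thesis using kb by order
  qed
  obtain L where L: "represents {..<4::nat} (\<lambda>j. \<i> ^ j) L \<mu>" by (rule regular_jordan[OF reg]) blast
  note DL = density_represents[OF L cont nonneg]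
  let ?v = "\<lambda>x. 1 / \<omega> x"
  have vc: "continuous_on UNIV ?v" using cont nz by (intro continuous_on_divide continuous_on_const) auto
  have v0: "0 \<le> ?v x" for x using pos[of x] by simp
  have wv: "ennreal (\<omega> x) * ennreal (?v x) = 1" for x
  proof -
    have "ennreal (\<omega> x) * ennreal (?v x) = ennreal (\<omega> x * ?v x)"
      by (rule ennreal_mult[symmetric, OF nonneg v0])
    also have "\<omega> x * ?v x = 1" using nz[of x] by simp
    finally show ?thesis by simp
  qed
  have wme: "(\<lambda>x. ennreal (\<omega> x)) \<in> borel_measurable borel" "(\<lambda>x. ennreal (?v x)) \<in> borel_measurable borel"
    by measurable
  note R1 = density_represents[OF M vc v0] and R2 = density_represents[OF DL vc v0]
  let ?N = "\<lambda>j. density (M j) (\<lambda>x. ennreal (?v x))"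
  \<comment> \<open>The values are computed from a second representation, built from components
    \<open>L\<close> of \<open>\<mu>\<close> itself: multiplying these by \<open>\<omega>\<close>
    and then by \<open>?v\<close> returns them, and the density does not depend on which
    representation of \<open>?k\<close> is used.\<close>
  have keq: "density_cb (\<lambda>x. complex_of_real (?v x)) ?k = \<mu>"
  proof
    fix A
    show "density_cb (\<lambda>x. complex_of_real (?v x)) ?k A = \<mu> A"
    proof (cases "A \<in> compacted_borel")
      case False
      show ?thesis by (simp only: representsD(4)[OF R1 False] representsD(4)[OF L False])
    next
      case True
      have "density (density (L j) (\<lambda>x. ennreal (\<omega> x))) (\<lambda>x. ennreal (?v x)) = L j" if "j \<in> {..<4}" for j
      proof -
        note rL = representsD(2)[OF L that]
        have "density (density (L j) (\<lambda>x. ennreal (\<omega> x))) (\<lambda>x. ennreal (?v x)) = density (L j) (\<lambda>x. ennreal (\<omega> x) * ennreal (?v x))"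
          by (intro density_density_eq radon_measurable[OF rL] wme)
        also have "\<dots> = L j" unfolding wv by (rule density_1)
        finally show ?thesis .
      qed
      then show ?thesis
        unfolding representsD(3)[OF R2 True] representsD(3)[OF L True] by (intro sum.cong refl) simp
    qed
  qed
  have "wrep {..<4} (\<lambda>j. \<i> ^ j) ?N \<mu>"
    unfolding wrep_def
  proof (intro conjI ballI)
    show "represents {..<4} (\<lambda>j. \<i> ^ j) ?N \<mu>" using R1 unfolding keq .
    fix j :: nat assume "j \<in> {..<4}"
    then have j: "j < 4" by simp
    have "(\<integral>\<^sup>+x. ennreal (\<omega> x) \<partial>?N j) = (\<integral>\<^sup>+x. ennreal (?v x) * ennreal (\<omega> x) \<partial>M j)"
      by (intro nn_integral_density radon_measurable[OF rM[OF j]] wme)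
    also have "\<dots> = (\<integral>\<^sup>+x. 1 \<partial>M j)" by (simp only: wv mult.commute[of "ennreal (1 / _)"])
    also have "\<dots> = emeasure (M j) UNIV" using rM[OF j] by simp
    finally show "(\<integral>\<^sup>+x. ennreal (\<omega> x) \<partial>?N j) < \<infinity>" using Mfin[OF j] by simp
  qed
  then show ?thesis by (rule that)
qed

end

lemma vector_space_fun_scale: "vector_space fun_scale"
  by unfold_locales (auto simp: fun_scale_def fun_eq_iff algebra_simps)

context weighted_space
begin

section \<open>Linear structure and bilinearity of the pairing\<close>

lemma wrep_add:
  assumes "wrep J c N \<mu>" "wrep K d M \<nu>"
  shows "wrep (J <+> K) (case_sum c d) (case_sum N M) (\<mu> + \<nu>)"
  unfolding wrep_def
proof
  show "represents (J <+> K) (case_sum c d) (case_sum N M) (\<mu> + \<nu>)"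
    by (rule represents_add[OF wrepD(1)[OF assms(1)] wrepD(1)[OF assms(2)]])
  show "\<forall>j\<in>J <+> K. (\<integral>\<^sup>+x. ennreal (\<omega> x) \<partial>case_sum N M j) < \<infinity>"
    using wrepD(2)[OF assms(1)] wrepD(2)[OF assms(2)] by auto
qed

lemma wrep_scale: "wrep J c N \<mu> \<Longrightarrow> wrep J (\<lambda>j. a * c j) N (fun_scale a \<mu>)"
  unfolding wrep_def using represents_scale by blast

lemma V_add: assumes "\<mu> \<in> V" "\<nu> \<in> V" shows "\<mu> + \<nu> \<in> V"
proof -
  obtain c N where "wrep {..<4::nat} c N \<mu>" by (rule V_wrep[OF assms(1)])
  moreover obtain d M where "wrep {..<4::nat} d M \<nu>" by (rule V_wrep[OF assms(2)])
  ultimately show ?thesis by (rule wrep_in_V[OF wrep_add])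
qed

lemma V_scale: assumes "\<mu> \<in> V" shows "fun_scale a \<mu> \<in> V"
proof -
  obtain c N where "wrep {..<4::nat} c N \<mu>" by (rule V_wrep[OF assms])
  then show ?thesis by (rule wrep_in_V[OF wrep_scale])
qed

lemma V_zero: "0 \<in> V"
  by (rule wrep_in_V[of "{} :: nat set" undefined undefined]) (simp add: wrep_def represents_def)

lemma E_dominated:
  assumes "continuous_on UNIV \<phi>" "\<psi> \<in> E" "\<And>x. cmod (\<phi> x) \<le> B * cmod (\<psi> x)"
  shows "\<phi> \<in> E"
  unfolding E_iff
proof (intro conjI allI impI)
  fix e :: real assume e: "e > 0"
  have "e / (\<bar>B\<bar> + 1) > 0" using e by simp
  then obtain K where K: "compact K" "\<And>x. x \<notin> K \<Longrightarrow> cmod (\<psi> x) < e / (\<bar>B\<bar> + 1) * \<omega> x"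
    using assms(2) unfolding E_iff by metis
  have "cmod (\<phi> x) < e * \<omega> x" if "x \<notin> K" for x
  proof -
    have "B * cmod (\<psi> x) \<le> (\<bar>B\<bar> + 1) * cmod (\<psi> x)" by (rule mult_right_mono) auto
    then have "cmod (\<phi> x) \<le> (\<bar>B\<bar> + 1) * cmod (\<psi> x)"
      by (rule order_trans[OF assms(3)])
    also have "\<dots> < (\<bar>B\<bar> + 1) * (e / (\<bar>B\<bar> + 1) * \<omega> x)"
      using K(2)[OF that] by (intro mult_strict_left_mono) auto
    also have "\<dots> = e * \<omega> x" by (simp add: field_simps)
    finally show ?thesis .
  qed
  then show "\<exists>K. compact K \<and> (\<forall>x. x \<notin> K \<longrightarrow> cmod (\<phi> x) < e * \<omega> x)" using K(1) by blast
qed (rule assms(1))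

lemma E_add: assumes "\<phi> \<in> E" "\<psi> \<in> E" shows "\<phi> + \<psi> \<in> E"
  unfolding E_iff
proof (intro conjI allI impI)
  show "continuous_on UNIV (\<phi> + \<psi>)"
    unfolding plus_fun_def by (intro continuous_on_add E_continuous assms)
  fix e :: real assume "e > 0"
  then have e: "e/2 > 0" by simp
  obtain K where K: "compact K" "\<And>x. x \<notin> K \<Longrightarrow> cmod (\<phi> x) < e/2 * \<omega> x"
    using assms(1) e unfolding E_iff by metis
  obtain L where L: "compact L" "\<And>x. x \<notin> L \<Longrightarrow> cmod (\<psi> x) < e/2 * \<omega> x"
    using assms(2) e unfolding E_iff by metis
  have "cmod ((\<phi> + \<psi>) x) < e * \<omega> x" if "x \<notin> K \<union> L" for x
    using K(2)[of x] L(2)[of x] that norm_triangle_ineq[of "\<phi> x" "\<psi> x"] by (simp add: field_simps)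
  then show "\<exists>K. compact K \<and> (\<forall>x. x \<notin> K \<longrightarrow> cmod ((\<phi> + \<psi>) x) < e * \<omega> x)"
    using compact_Un[OF K(1) L(1)] by blast
qed

lemma E_scale: assumes "\<psi> \<in> E" shows "fun_scale a \<psi> \<in> E"
proof (rule E_dominated[OF _ assms])
  show "continuous_on UNIV (fun_scale a \<psi>)"
    unfolding fun_scale_def by (intro continuous_on_mult_left E_continuous assms)
  show "cmod (fun_scale a \<psi> x) \<le> cmod a * cmod (\<psi> x)" for x by (simp add: fun_scale_def norm_mult)
qed

lemma E_zero: "0 \<in> E"
  unfolding E_iff zero_fun_def using pos by (auto intro!: exI[of _ "{}"])

lemma E_diff: assumes "\<phi> \<in> E" "\<psi> \<in> E" shows "\<phi> - \<psi> \<in> E"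
proof -
  have "\<phi> - \<psi> = \<phi> + fun_scale (-1) \<psi>" by (auto simp: fun_scale_def fun_eq_iff)
  then show ?thesis using E_add[OF assms(1) E_scale[OF assms(2)]] by (simp only:)
qed

lemma pair_add_right:
  assumes mu: "\<mu> \<in> V" and p: "\<phi> \<in> E" "\<psi> \<in> E"
  shows "cb_integral \<mu> (\<phi> + \<psi>) = cb_integral \<mu> \<phi> + cb_integral \<mu> \<psi>"
proof -
  obtain c N where R: "wrep {..<4::nat} c N \<mu>" by (rule V_wrep[OF mu])
  have int: "integrable (N j) f" if "j \<in> {..<4}" "f \<in> E" for j f
    by (rule integrable_E[OF wrepD(4)[OF R that(1)] wrepD(2)[OF R that(1)] that(2)])
  show ?thesis
    unfolding cb_integral_E(2)[OF R p(1)] cb_integral_E(2)[OF R p(2)] cb_integral_E(2)[OF R E_add[OF p]]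
      sum.distrib[symmetric] distrib_left[symmetric]
    using int p by (intro sum.cong refl) (simp add: plus_fun_def)
qed

lemma pair_scale_right:
  assumes mu: "\<mu> \<in> V" and p: "\<psi> \<in> E"
  shows "cb_integral \<mu> (fun_scale a \<psi>) = a * cb_integral \<mu> \<psi>"
proof -
  obtain c N where R: "wrep {..<4::nat} c N \<mu>" by (rule V_wrep[OF mu])
  show ?thesis
    unfolding cb_integral_E(2)[OF R p] cb_integral_E(2)[OF R E_scale[OF p]]
    by (simp add: fun_scale_def sum_distrib_left mult.left_commute)
qed

lemma pair_diff_right:
  assumes mu: "\<mu> \<in> V" and p: "\<phi> \<in> E" "\<psi> \<in> E"
  shows "cb_integral \<mu> (\<phi> - \<psi>) = cb_integral \<mu> \<phi> - cb_integral \<mu> \<psi>"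
proof -
  have "\<phi> - \<psi> = \<phi> + fun_scale (-1) \<psi>" by (auto simp: fun_scale_def fun_eq_iff)
  then have "cb_integral \<mu> (\<phi> - \<psi>) = cb_integral \<mu> (\<phi> + fun_scale (-1) \<psi>)" by (simp only:)
  also have "\<dots> = cb_integral \<mu> \<phi> - cb_integral \<mu> \<psi>"
    unfolding pair_add_right[OF mu p(1) E_scale[OF p(2)]] pair_scale_right[OF mu p(2)] by simp
  finally show ?thesis .
qed

lemma pair_add_left:
  assumes "\<mu> \<in> V" "\<nu> \<in> V" "\<psi> \<in> E"
  shows "cb_integral (\<mu> + \<nu>) \<psi> = cb_integral \<mu> \<psi> + cb_integral \<nu> \<psi>"
proof -
  obtain c N where R: "wrep {..<4::nat} c N \<mu>" by (rule V_wrep[OF assms(1)])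
  obtain d M where S: "wrep {..<4::nat} d M \<nu>" by (rule V_wrep[OF assms(2)])
  show ?thesis
    unfolding cb_integral_E(2)[OF wrep_add[OF R S] assms(3)] cb_integral_E(2)[OF R assms(3)] cb_integral_E(2)[OF S assms(3)]
    by (simp add: sum.Plus)
qed

lemma pair_scale_left:
  assumes "\<mu> \<in> V" "\<psi> \<in> E"
  shows "cb_integral (fun_scale a \<mu>) \<psi> = a * cb_integral \<mu> \<psi>"
proof -
  obtain c N where R: "wrep {..<4::nat} c N \<mu>" by (rule V_wrep[OF assms(1)])
  show ?thesis
    unfolding cb_integral_E(2)[OF wrep_scale[OF R] assms(2)] cb_integral_E(2)[OF R assms(2)]
    by (simp add: sum_distrib_left mult.assoc)
qed

section \<open>The norm of a weighted measure as a dual norm\<close>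

lemma NV_sup:
  assumes "\<mu> \<in> V"
  shows "sup_variation (density_cb (\<lambda>x. complex_of_real (\<omega> x)) \<mu>) UNIV = ennreal (NV \<mu>)"
  using assms unfolding beurling_measures_def bounded_cb_measures_def beurling_norm_def cb_norm_def by simp

lemma NV_nonneg: "0 \<le> NV \<mu>"
  by (simp add: beurling_norm_def cb_norm_def)

lemma integral_density_weight:
  fixes f :: "'a \<Rightarrow> complex"
  assumes M: "radon M" and f: "f \<in> borel_measurable borel"
  shows "(\<integral>x. f x \<partial>density M (\<lambda>x. ennreal (\<omega> x))) = (\<integral>x. of_real (\<omega> x) * f x \<partial>M)"
  using radon_measurable[OF M f] radon_measurable[OF M meas] nonneg
  by (subst integral_density) (auto simp: scaleR_conv_of_real)

text \<open>Stated for a positive majorant \<open>a\<close> in place of the norm, so that one may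
  divide by \<open>a\<close> even when \<open>\<psi>\<close> is 0; \<open>pair_le\<close> lets
  \<open>a\<close> decrease to the norm. The variation bound is one on compacted Borel sets, hence
  the passage to the limit along an exhaustion off which \<open>\<psi>\<close> vanishes.\<close>

lemma pair_le_aux:
  assumes mu: "\<mu> \<in> V" and p: "\<psi> \<in> E" and a: "a > 0" "\<And>x. cmod (\<psi> x) \<le> a * \<omega> x"
  shows "cmod (cb_integral \<mu> \<psi>) \<le> NV \<mu> * a"
proof -
  let ?k = "density_cb (\<lambda>x. complex_of_real (\<omega> x)) \<mu>"
  obtain c N where R: "wrep {..<4::nat} c N \<mu>" by (rule V_wrep[OF mu])
  let ?D = "\<lambda>j. density (N j) (\<lambda>x. ennreal (\<omega> x))"
  have RD: "represents {..<4} c ?D ?k" by (rule density_represents[OF wrepD(1)[OF R] cont nonneg])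
  obtain F where F: "incseq F" "range F \<subseteq> compacted_borel" "\<And>x. x \<notin> (\<Union>n. F n) \<Longrightarrow> \<psi> x = 0"
    by (rule E_exhaustion[OF p], rule that)
  define f where "f x = \<psi> x / of_real (a * \<omega> x)" for x
  have fc: "continuous_on UNIV f"
    unfolding f_def using nz a(1) by (intro continuous_on_divide E_continuous[OF p] continuous_on_of_real continuous_on_mult_left cont) auto
  have fm[measurable]: "f \<in> borel_measurable borel" by (rule borel_measurable_continuous_onI[OF fc])
  have f1: "cmod (f x) \<le> 1" for x
    unfolding f_def using a(2)[of x] a(1) pos[of x] by (simp add: norm_divide norm_mult divide_le_eq)
  have pf: "\<psi> x = of_real a * (of_real (\<omega> x) * f x)" for x
    unfolding f_def using a(1) nz[of x] by simp
  have Fm[measurable]: "F n \<in> sets borel" for n using F(2) compacted_borel_borel by auto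
  let ?I = "\<lambda>n. \<Sum>j<4. c j * (\<integral>x. indicator (F n) x *\<^sub>R f x \<partial>?D j)"
  have bound: "cmod (?I n) \<le> NV \<mu>" for n
  proof -
    have Fn: "F n \<in> compacted_borel" using F(2) by auto
    have "ennreal (cmod (?I n)) \<le> cb_variation ?k (F n)"
      by (rule integral_over_le_variation[OF RD Fn fm f1])
    also have "\<dots> \<le> sup_variation ?k UNIV" unfolding sup_variation_def using Fn by (intro SUP_upper) auto
    finally show ?thesis using NV_nonneg by (simp add: NV_sup[OF mu] ennreal_le_iff)
  qed
  have lim: "?I \<longlonglongrightarrow> (\<Sum>j<4. c j * (\<integral>x. of_real (\<omega> x) * f x \<partial>N j))"
  proof (intro tendsto_sum tendsto_mult tendsto_const)
    fix j :: nat assume j: "j \<in> {..<4}"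
    note rN = wrepD(4)[OF R j]
    have eq: "(\<integral>x. indicator (F n) x *\<^sub>R f x \<partial>?D j) = (\<integral>x. of_real (\<omega> x) * (indicator (F n) x *\<^sub>R f x) \<partial>N j)" for n
    proof (rule integral_density_weight[OF rN])
      show "(\<lambda>x. indicator (F n) x *\<^sub>R f x) \<in> borel_measurable borel" by measurable
    qed
    show "(\<lambda>n. \<integral>x. indicator (F n) x *\<^sub>R f x \<partial>?D j) \<longlonglongrightarrow> (\<integral>x. of_real (\<omega> x) * f x \<partial>N j)"
      unfolding eq
    proof (rule integral_dominated_convergence)
      show "integrable (N j) \<omega>"
        using wrepD(2)[OF R j] radon_measurable[OF rN meas] nonneg by (intro integrableI_nonneg) auto
      show "(\<lambda>x. of_real (\<omega> x) * f x) \<in> borel_measurable (N j)"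
        by (rule radon_measurable[OF rN]) measurable
      show "(\<lambda>x. of_real (\<omega> x) * (indicator (F n) x *\<^sub>R f x)) \<in> borel_measurable (N j)" for n
        by (rule radon_measurable[OF rN]) measurable
      show "AE x in N j. (\<lambda>n. of_real (\<omega> x) * (indicator (F n) x *\<^sub>R f x)) \<longlonglongrightarrow> of_real (\<omega> x) * f x"
      proof (intro AE_I2 tendsto_mult tendsto_const)
        fix x
        show "(\<lambda>n. indicator (F n) x *\<^sub>R f x) \<longlonglongrightarrow> f x"
        proof (cases "x \<in> (\<Union>n. F n)")
          case True
          then obtain n where n: "x \<in> F n" by blast
          have "eventually (\<lambda>m. indicator (F m) x *\<^sub>R f x = f x) sequentially"
            using F(1) n by (intro eventually_sequentiallyI[of n]) (auto simp: incseq_def indicator_def)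
          then show ?thesis by (rule tendsto_eventually)
        next
          case False
          then have "f x = 0" using F(3)[OF False] by (simp add: f_def)
          then show ?thesis by simp
        qed
      qed
      show "AE x in N j. norm (of_real (\<omega> x) * (indicator (F n) x *\<^sub>R f x)) \<le> \<omega> x" for n
      proof (intro AE_I2)
        fix x
        have "norm (indicator (F n) x *\<^sub>R f x) \<le> 1" using f1[of x] by (auto simp: indicator_def)
        then have "\<omega> x * norm (indicator (F n) x *\<^sub>R f x) \<le> \<omega> x" using nonneg[of x] by (intro mult_left_le) auto
        then show "norm (of_real (\<omega> x) * (indicator (F n) x *\<^sub>R f x)) \<le> \<omega> x"
          using nonneg[of x] by (simp add: norm_mult mult.left_commute)
      qed
    qed
  qed
  have "cmod (\<Sum>j<4. c j * (\<integral>x. of_real (\<omega> x) * f x \<partial>N j)) \<le> NV \<mu>"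
    by (rule LIMSEQ_le_const2[OF tendsto_norm[OF lim]]) (use bound in blast)
  moreover have "cb_integral \<mu> \<psi> = of_real a * (\<Sum>j<4. c j * (\<integral>x. of_real (\<omega> x) * f x \<partial>N j))"
    unfolding cb_integral_E(2)[OF R p] pf by (simp add: sum_distrib_left mult.left_commute)
  ultimately show ?thesis using a(1) by (simp add: norm_mult mult.commute)
qed

lemma pair_le:
  assumes mu: "\<mu> \<in> V" and p: "\<psi> \<in> E"
  shows "cmod (cb_integral \<mu> \<psi>) \<le> NV \<mu> * NE \<psi>"
proof (rule field_le_epsilon)
  fix e :: real assume e: "e > 0"
  define d where "d = e / (NV \<mu> + 1)"
  have d: "d > 0" using e NV_nonneg[of \<mu>] by (simp add: d_def)
  have "cmod (\<psi> x) \<le> (NE \<psi> + d) * \<omega> x" for x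
    using E_le[OF p, of x] d pos[of x] by (simp add: distrib_right add_increasing2)
  then have "cmod (cb_integral \<mu> \<psi>) \<le> NV \<mu> * (NE \<psi> + d)"
    using NE_nonneg[OF p] d by (intro pair_le_aux[OF mu p]) auto
  also have "NV \<mu> * d \<le> e"
    using e NV_nonneg[of \<mu>] by (simp add: d_def divide_le_eq mult_right_mono field_simps)
  then have "NV \<mu> * (NE \<psi> + d) \<le> NV \<mu> * NE \<psi> + e" by (simp add: distrib_left)
  finally show "cmod (cb_integral \<mu> \<psi>) \<le> NV \<mu> * NE \<psi> + e" .
qed

text \<open>The criterion behind all norm estimates for measures. A test function bounded by 1 for
  the weighted measure, multiplied by \<open>\<omega>\<close>, is a test function below the weight
  for \<open>\<mu>\<close>.\<close>

lemma NV_le: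
  assumes mu: "\<mu> \<in> V" and B: "0 \<le> B"
    and le: "\<And>f. f \<in> compactly_supported \<Longrightarrow> (\<And>x. cmod (f x) \<le> \<omega> x) \<Longrightarrow> cmod (cb_integral \<mu> f) \<le> B"
  shows "NV \<mu> \<le> B"
proof -
  let ?k = "density_cb (\<lambda>x. complex_of_real (\<omega> x)) \<mu>"
  obtain c N where R: "wrep {..<4::nat} c N \<mu>" by (rule V_wrep[OF mu])
  let ?D = "\<lambda>j. density (N j) (\<lambda>x. ennreal (\<omega> x))"
  have RD: "represents {..<4} c ?D ?k" by (rule density_represents[OF wrepD(1)[OF R] cont nonneg])
  have "sup_variation ?k UNIV \<le> ennreal B"
    unfolding sup_variation_def
  proof (rule SUP_least)
    fix A :: "'a set" assume "A \<in> {A \<in> compacted_borel. A \<subseteq> UNIV}"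
    then have A: "A \<in> compacted_borel" by simp
    show "cb_variation ?k A \<le> ennreal B"
    proof (rule variation_le_dual[OF lc RD A])
      fix g :: "'a \<Rightarrow> complex" assume g: "g \<in> compactly_supported" "\<And>x. cmod (g x) \<le> 1"
      have gc: "continuous_on UNIV g" using g(1) by (simp add: compactly_supported_iff)
      have f: "(\<lambda>x. of_real (\<omega> x) * g x) \<in> compactly_supported"
        by (rule compactly_supported_dominated[OF g(1)]) (auto intro!: continuous_on_mult continuous_on_of_real cont gc)
      have "cmod (cb_integral \<mu> (\<lambda>x. of_real (\<omega> x) * g x)) \<le> B"
        using g(2) nonneg by (intro le[OF f]) (simp add: norm_mult mult_left_le)
      then show "cmod (\<Sum>j<4. c j * (\<integral>x. g x \<partial>?D j)) \<le> B"
        unfolding cb_integral_E(2)[OF R cs_in_E[OF f]]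
        using integral_density_weight[OF wrepD(4)[OF R] borel_measurable_continuous_onI[OF gc]] by simp
    qed
  qed
  then show ?thesis using B by (simp add: NV_sup[OF mu] ennreal_le_iff)
qed

lemma isometric:
  assumes mu: "\<mu> \<in> V"
  shows "functional_norm_on E NE (cb_integral \<mu>) = NV \<mu>"
proof (rule antisym)
  have le: "cmod (cb_integral \<mu> \<psi>) \<le> NV \<mu>" if "\<psi> \<in> {x \<in> E. NE x \<le> 1}" for \<psi>
  proof -
    have "cmod (cb_integral \<mu> \<psi>) \<le> NV \<mu> * NE \<psi>" using that by (intro pair_le[OF mu]) auto
    also have "\<dots> \<le> NV \<mu>" using that NV_nonneg by (intro mult_left_le) auto
    finally show ?thesis .
  qed
  have z: "0 \<in> {x \<in> E. NE x \<le> 1}" using E_zero NE_le[of 0 1] nonneg by simp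
  then show "functional_norm_on E NE (cb_integral \<mu>) \<le> NV \<mu>"
    unfolding functional_norm_on_def by (intro cSUP_least le) auto
  have bdd: "bdd_above ((\<lambda>x. cmod (cb_integral \<mu> x)) ` {x \<in> E. NE x \<le> 1})"
    using le by (auto simp: bdd_above_def)
  show "NV \<mu> \<le> functional_norm_on E NE (cb_integral \<mu>)"
  proof (rule NV_le[OF mu])
    show "cmod (cb_integral \<mu> f) \<le> functional_norm_on E NE (cb_integral \<mu>)"
      if "f \<in> compactly_supported" "\<And>x. cmod (f x) \<le> \<omega> x" for f
      unfolding functional_norm_on_def
      using cs_in_E[OF that(1)] NE_le[of f 1] that(2) by (intro cSUP_upper bdd) auto
    have "cmod (cb_integral \<mu> 0) \<le> functional_norm_on E NE (cb_integral \<mu>)"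
      unfolding functional_norm_on_def by (rule cSUP_upper[OF z bdd])
    then show "0 \<le> functional_norm_on E NE (cb_integral \<mu>)" using norm_ge_zero order_trans by blast
  qed
qed

lemma V_eqI:
  assumes mu: "\<mu> \<in> V" and nu: "\<nu> \<in> V"
    and eq: "\<And>f. f \<in> compactly_supported \<Longrightarrow> cb_integral \<mu> f = cb_integral \<nu> f"
  shows "\<mu> = \<nu>"
  using mu nu by (intro regular_eqI[OF lc _ _ eq]) (auto simp: beurling_measures_def)

section \<open>The predual as a Banach space\<close>

lemma NE_scale: assumes "\<psi> \<in> E" shows "NE (fun_scale a \<psi>) = cmod a * NE \<psi>"
proof -
  have le: "NE (fun_scale a \<psi>) \<le> cmod a * NE \<psi>" if "\<psi> \<in> E" for a \<psi>
    by (rule NE_le) (use E_le[OF that] in \<open>auto simp: fun_scale_def norm_mult mult.assoc intro: mult_left_mono\<close>)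
  show ?thesis
  proof (cases "a = 0")
    case True
    then show ?thesis using le[OF assms, of a] NE_nonneg[OF E_scale[OF assms, of a]] by simp
  next
    case False
    \<comment> \<open>The reverse inequality is the first one for the scalar
      \<open>inverse a\<close>.\<close>
    have "fun_scale (inverse a) (fun_scale a \<psi>) = \<psi>" using False by (simp add: fun_scale_def fun_eq_iff)
    then have "NE \<psi> \<le> cmod (inverse a) * NE (fun_scale a \<psi>)"
      using le[OF E_scale[OF assms, of a], of "inverse a"] by simp
    then have "cmod a * NE \<psi> \<le> cmod a * (cmod (inverse a) * NE (fun_scale a \<psi>))" by (rule mult_left_mono) simp
    also have "\<dots> = NE (fun_scale a \<psi>)" using False by (simp add: norm_inverse)
    finally have "cmod a * NE \<psi> \<le> NE (fun_scale a \<psi>)" .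
    then show ?thesis using le[OF assms, of a] by simp
  qed
qed

lemma NE_triangle: assumes "\<phi> \<in> E" "\<psi> \<in> E" shows "NE (\<phi> + \<psi>) \<le> NE \<phi> + NE \<psi>"
proof (rule NE_le)
  fix x
  have "cmod ((\<phi> + \<psi>) x) \<le> cmod (\<phi> x) + cmod (\<psi> x)" by (simp add: norm_triangle_ineq)
  also have "\<dots> \<le> NE \<phi> * \<omega> x + NE \<psi> * \<omega> x" by (intro add_mono E_le assms)
  finally show "cmod ((\<phi> + \<psi>) x) \<le> (NE \<phi> + NE \<psi>) * \<omega> x" by (simp add: distrib_right)
qed

text \<open>Division by \<open>\<omega>\<close> turns the weighted norm into the uniform norm, for
  which limits of continuous functions are continuous.\<close>

lemma E_complete:
  fixes \<sigma> :: "nat \<Rightarrow> 'a \<Rightarrow> complex"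
  assumes s: "\<And>n. \<sigma> n \<in> E"
    and C: "\<And>e. e > 0 \<Longrightarrow> \<exists>k. \<forall>m\<ge>k. \<forall>n\<ge>k. NE (\<sigma> m - \<sigma> n) < e"
  shows "\<exists>\<psi>\<in>E. (\<lambda>n. NE (\<sigma> n - \<psi>)) \<longlonglongrightarrow> 0"
proof -
  define s where "s n x = \<sigma> n x / of_real (\<omega> x)" for n x
  have d: "dist (s m x) (s n x) \<le> NE (\<sigma> m - \<sigma> n)" for m n x
  proof -
    have "cmod (\<sigma> m x - \<sigma> n x) \<le> NE (\<sigma> m - \<sigma> n) * \<omega> x" using E_le[OF E_diff[OF s[of m] s[of n]], of x] by simp
    then show ?thesis using pos[of x]
      by (simp add: s_def dist_norm diff_divide_distrib[symmetric] norm_divide divide_le_eq)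
  qed
  have "uniformly_Cauchy_on UNIV s"
    unfolding uniformly_Cauchy_on_def
  proof (intro allI impI)
    fix e :: real assume "e > 0"
    then obtain k where "\<forall>m\<ge>k. \<forall>n\<ge>k. NE (\<sigma> m - \<sigma> n) < e" using C by blast
    then show "\<exists>M. \<forall>x\<in>UNIV. \<forall>m\<ge>M. \<forall>n\<ge>M. dist (s m x) (s n x) < e"
      using d by (intro exI[of _ k]) (meson order_le_less_trans)
  qed
  then obtain l where l: "uniform_limit UNIV s l sequentially"
    using Cauchy_uniformly_convergent uniformly_convergent_on_def by blast
  have sc: "continuous_on UNIV (s n)" for n
    unfolding s_def using nz by (intro continuous_on_divide E_continuous s continuous_on_of_real cont) auto
  have lcont: "continuous_on UNIV l"
    by (rule uniform_limit_theorem[OF _ l]) (use sc in auto)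
  define \<psi> where "\<psi> x = of_real (\<omega> x) * l x" for x
  have pc: "continuous_on UNIV \<psi>"
    unfolding \<psi>_def by (intro continuous_on_mult continuous_on_of_real cont lcont)
  have ev: "\<exists>k. \<forall>n\<ge>k. \<forall>x. cmod (\<sigma> n x - \<psi> x) \<le> e * \<omega> x" if e: "e > 0" for e
  proof -
    have "eventually (\<lambda>n. \<forall>x\<in>UNIV. dist (s n x) (l x) < e) sequentially"
      using l e unfolding uniform_limit_iff by blast
    then obtain k where k: "\<And>n x. n \<ge> k \<Longrightarrow> dist (s n x) (l x) < e"
      unfolding eventually_sequentially by blast
    have "cmod (\<sigma> n x - \<psi> x) \<le> e * \<omega> x" if "n \<ge> k" for n x
    proof -
      have "\<sigma> n x - \<psi> x = of_real (\<omega> x) * (s n x - l x)"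
        using nz[of x] by (simp add: s_def \<psi>_def right_diff_distrib)
      then have "cmod (\<sigma> n x - \<psi> x) = \<omega> x * dist (s n x) (l x)"
        using nonneg[of x] by (simp add: norm_mult dist_norm)
      also have "\<dots> \<le> \<omega> x * e" using k[OF that, of x] nonneg[of x] by (intro mult_left_mono) auto
      finally show ?thesis by (simp add: mult.commute)
    qed
    then show ?thesis by blast
  qed
  have pE: "\<psi> \<in> E"
  proof (rule E_closed[OF pc])
    fix e :: real assume "e > 0"
    then obtain k where k: "\<forall>n\<ge>k. \<forall>x. cmod (\<sigma> n x - \<psi> x) \<le> e * \<omega> x" using ev by blast
    show "\<exists>\<phi>\<in>E. \<forall>x. cmod (\<psi> x - \<phi> x) \<le> e * \<omega> x"
      using k s[of k] by (intro bexI[of _ "\<sigma> k"]) (auto simp: norm_minus_commute)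
  qed
  have "(\<lambda>n. NE (\<sigma> n - \<psi>)) \<longlonglongrightarrow> 0"
  proof (rule LIMSEQ_I)
    fix e :: real assume e: "e > 0"
    then obtain k where k: "\<forall>n\<ge>k. \<forall>x. cmod (\<sigma> n x - \<psi> x) \<le> e/2 * \<omega> x" using ev[of "e/2"] by auto
    have "norm (NE (\<sigma> n - \<psi>) - 0) < e" if "n \<ge> k" for n
    proof -
      have "NE (\<sigma> n - \<psi>) \<le> e/2" using k that by (intro NE_le) auto
      then show ?thesis using NE_nonneg[OF E_diff[OF s[of n] pE]] e by simp
    qed
    then show "\<exists>no. \<forall>n\<ge>no. norm (NE (\<sigma> n - \<psi>) - 0) < e" by blast
  qed
  then show ?thesis using pE by blast
qed

lemma E_banach: "complex_banach_space_on fun_scale E NE"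
proof -
  interpret vs: vector_space fun_scale by (rule vector_space_fun_scale)
  show ?thesis
  proof
    show "module.subspace fun_scale E"
      unfolding vs.subspace_def using E_zero E_add E_scale by auto
    show "x = 0" if "x \<in> E" "NE x = 0" for x
    proof
      fix y show "x y = 0 y" using E_le[OF that(1), of y] that(2) by simp
    qed
  qed (use NE_nonneg NE_scale NE_triangle E_complete in auto)
qed

text \<open>Riesz represents the restriction of the functional to compactly supported functions. It
  remains to see that the components integrate \<open>\<omega>\<close> and that the representation
  persists on the whole predual, by density.\<close>

lemma pair_surj:
  assumes phi: "bounded_functional_on fun_scale E NE \<phi>"
  shows "\<exists>\<mu>\<in>V. \<forall>\<psi>\<in>E. cb_integral \<mu> \<psi> = \<phi> \<psi>"
proof -
  have add: "\<phi> (x + y) = \<phi> x + \<phi> y" if "x \<in> E" "y \<in> E" for x y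
    using phi that by (simp add: bounded_functional_on_def)
  have scale: "\<phi> (fun_scale a x) = a * \<phi> x" if "x \<in> E" for a x
    using phi that by (simp add: bounded_functional_on_def)
  obtain C where C: "\<forall>x\<in>E. cmod (\<phi> x) \<le> C * NE x" using phi by (auto simp: bounded_functional_on_def)
  have B: "cmod (\<phi> x) \<le> \<bar>C\<bar> * a" if "x \<in> E" "\<And>y. cmod (x y) \<le> a * \<omega> y" for x a
  proof -
    have "cmod (\<phi> x) \<le> C * NE x" using C that(1) by blast
    also have "\<dots> \<le> \<bar>C\<bar> * NE x" using NE_nonneg[OF that(1)] by (intro mult_right_mono) auto
    also have "\<dots> \<le> \<bar>C\<bar> * a" using NE_le[OF that(2)] by (intro mult_left_mono) auto
    finally show ?thesis .
  qed
  obtain M where M: "\<And>j. j < 4 \<Longrightarrow> radon (M j)"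
    "\<And>f. f \<in> compactly_supported \<Longrightarrow> \<phi> f = (\<Sum>j<4. \<i> ^ j * (\<integral>x. f x \<partial>M j))"
    "\<And>j f B. j < 4 \<Longrightarrow> f \<in> nonneg_cs \<Longrightarrow>
       (\<And>g. g \<in> compactly_supported \<Longrightarrow> (\<And>x. cmod (g x) \<le> f x) \<Longrightarrow> cmod (\<phi> g) \<le> B) \<Longrightarrow> (\<integral>x. f x \<partial>M j) \<le> B"
  proof (rule riesz_complex[OF lc, of \<phi>])
    show "\<phi> (\<lambda>x. f x + g x) = \<phi> f + \<phi> g" if "f \<in> compactly_supported" "g \<in> compactly_supported" for f g
      using add[OF cs_in_E[OF that(1)] cs_in_E[OF that(2)]] by (simp add: plus_fun_def)
    show "\<phi> (\<lambda>x. a * f x) = a * \<phi> f" if "f \<in> compactly_supported" for a f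
      using scale[OF cs_in_E[OF that]] by (simp add: fun_scale_def)
    show "\<exists>B. \<forall>g\<in>compactly_supported. (\<forall>x. cmod (g x) \<le> f x) \<longrightarrow> cmod (\<phi> g) \<le> B"
      if f: "f \<in> nonneg_cs" for f
    proof (intro exI[of _ "\<bar>C\<bar> * NE (\<lambda>x. complex_of_real (f x))"] ballI impI)
      fix g :: "'a \<Rightarrow> complex" assume g: "g \<in> compactly_supported" "\<forall>x. cmod (g x) \<le> f x"
      have fE: "(\<lambda>x. complex_of_real (f x)) \<in> E" by (intro cs_in_E compactly_supported_of_real f)
      show "cmod (\<phi> g) \<le> \<bar>C\<bar> * NE (\<lambda>x. complex_of_real (f x))"
      proof (rule B[OF cs_in_E[OF g(1)]])
        fix y
        have "cmod (g y) \<le> cmod (complex_of_real (f y))" using g(2)[rule_format, of y] nonneg_csD(2)[OF f, of y] by simp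
        also have "\<dots> \<le> NE (\<lambda>x. complex_of_real (f x)) * \<omega> y" by (rule E_le[OF fE])
        finally show "cmod (g y) \<le> NE (\<lambda>x. complex_of_real (f x)) * \<omega> y" .
      qed
    qed
  qed blast
  define \<mu> where "\<mu> A = (if A \<in> compacted_borel then \<Sum>j<4. \<i> ^ j * of_real (measure (M j) A) else 0)" for A
  \<comment> \<open>On compactly supported functions below \<open>\<omega>\<close> the functional is
    at most \<open>\<bar>C\<bar>\<close> in modulus, and the order bound of
    \<open>riesz_complex\<close> hands this to each component.
    \<open>radon_nn_integral_inner\<close> reduces the integral of \<open>\<omega>\<close> to such
    functions.\<close>
  have fin: "(\<integral>\<^sup>+x. ennreal (\<omega> x) \<partial>M j) < \<infinity>" if j: "j < 4" for j
  proof -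
    have "(\<integral>\<^sup>+x. ennreal (\<omega> x) \<partial>M j) \<le> (SUP K\<in>{K. compact K \<and> K \<subseteq> {x. ennreal (\<omega> x) \<noteq> 0}}. \<integral>\<^sup>+x. ennreal (\<omega> x) * indicator K x \<partial>M j)"
      by (rule radon_nn_integral_inner[OF M(1)[OF j]]) measurable
    also have "\<dots> \<le> ennreal \<bar>C\<bar>"
    proof (rule SUP_least)
      fix K assume "K \<in> {K. compact K \<and> K \<subseteq> {x. ennreal (\<omega> x) \<noteq> 0}}"
      then have K: "compact K" by simp
      obtain k D where k: "k \<in> nonneg_cs" "\<And>x. k x \<le> 1" "\<And>x. x \<in> K \<Longrightarrow> k x = 1"
        by (rule urysohn[OF lc K subset_UNIV open_UNIV], rule that)
      have k0: "0 \<le> k x" for x by (rule nonneg_csD(2)[OF k(1)])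
      let ?f = "\<lambda>x. \<omega> x * k x"
      have f: "?f \<in> nonneg_cs"
        by (rule nonneg_cs_dominated[OF k(1)])
          (use nonneg k0 in \<open>auto intro!: continuous_on_mult cont nonneg_csD(1)[OF k(1)]\<close>)
      obtain L where L: "compact L" "\<And>x. x \<notin> L \<Longrightarrow> ?f x = 0" using nonneg_csD(3)[OF f] by blast
      have intf: "integrable (M j) ?f"
        by (rule radon_integrable_compact_support[OF M(1)[OF j] nonneg_csD(1)[OF f] L])
      have le: "?f x \<le> 1 * \<omega> x" for x using k(2)[of x] nonneg[of x] by (simp add: mult_left_le)
      have "(\<integral>\<^sup>+x. ennreal (\<omega> x) * indicator K x \<partial>M j) \<le> (\<integral>\<^sup>+x. ennreal (?f x) \<partial>M j)"
        using k(3) by (intro nn_integral_mono) (auto simp: indicator_def)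
      also have "\<dots> = ennreal (\<integral>x. ?f x \<partial>M j)"
        using nonneg_csD(2)[OF f] by (intro nn_integral_eq_integral intf) auto
      also have "\<dots> \<le> ennreal \<bar>C\<bar>"
      proof (rule ennreal_leI, rule M(3)[OF j f])
        fix g assume g: "g \<in> compactly_supported" "\<And>x. cmod (g x) \<le> ?f x"
        show "cmod (\<phi> g) \<le> \<bar>C\<bar>"
          using B[OF cs_in_E[OF g(1)], of 1] order_trans[OF g(2) le] by simp
      qed
      finally show "(\<integral>\<^sup>+x. ennreal (\<omega> x) * indicator K x \<partial>M j) \<le> ennreal \<bar>C\<bar>" .
    qed
    finally show ?thesis by (rule order_le_less_trans) simp
  qed
  have R: "wrep {..<4::nat} (\<lambda>j. \<i> ^ j) M \<mu>"
    unfolding wrep_def represents_def using M(1) fin by (auto simp: \<mu>_def)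
  have mu: "\<mu> \<in> V" by (rule wrep_in_V[OF R])
  have "cb_integral \<mu> \<psi> = \<phi> \<psi>" if p: "\<psi> \<in> E" for \<psi>
  proof -
    \<comment> \<open>Both functionals are bounded and agree on the approximant \<open>f\<close>, so
      only the remainder \<open>\<psi> - f\<close> counts.\<close>
    have "cmod (cb_integral \<mu> \<psi> - \<phi> \<psi>) \<le> (NV \<mu> + \<bar>C\<bar>) * e" if e: "e > 0" for e
    proof -
      obtain f where f: "f \<in> compactly_supported" "\<And>x. cmod (\<psi> x - f x) \<le> e * \<omega> x"
        by (rule E_approx_cs[OF p e], rule that)
      note fE = cs_in_E[OF f(1)]
      note dE = E_diff[OF p fE]
      have le: "cmod ((\<psi> - f) x) \<le> e * \<omega> x" for x using f(2) by simp
      have "\<psi> = (\<psi> - f) + f" by (simp add: fun_eq_iff)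
      then have "\<phi> \<psi> = \<phi> (\<psi> - f) + \<phi> f" using add[OF dE fE] by (simp only:)
      moreover have "cb_integral \<mu> f = \<phi> f"
        unfolding cb_integral_E(2)[OF R fE] using M(2)[OF f(1)] by simp
      ultimately have "cb_integral \<mu> \<psi> - \<phi> \<psi> = cb_integral \<mu> (\<psi> - f) - \<phi> (\<psi> - f)"
        using pair_diff_right[OF mu p fE] by simp
      then have "cmod (cb_integral \<mu> \<psi> - \<phi> \<psi>) \<le> cmod (cb_integral \<mu> (\<psi> - f)) + cmod (\<phi> (\<psi> - f))"
        using norm_triangle_ineq4 by (simp only:)
      also have "\<dots> \<le> NV \<mu> * e + \<bar>C\<bar> * e"
        by (intro add_mono pair_le_aux[OF mu dE e le] B[OF dE le])
      finally show ?thesis by (simp add: distrib_right)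
    qed
    note b = this
    have "cmod (cb_integral \<mu> \<psi> - \<phi> \<psi>) \<le> 0 + e" if e: "e > 0" for e
    proof -
      define d where "d = e / (NV \<mu> + \<bar>C\<bar> + 1)"
      have c: "NV \<mu> + \<bar>C\<bar> + 1 > 0" using NV_nonneg[of \<mu>] by linarith
      have d: "d > 0" using e c by (simp add: d_def)
      have "cmod (cb_integral \<mu> \<psi> - \<phi> \<psi>) \<le> (NV \<mu> + \<bar>C\<bar>) * d" by (rule b[OF d])
      also have "\<dots> \<le> (NV \<mu> + \<bar>C\<bar> + 1) * d" using d by (intro mult_right_mono) auto
      also have "\<dots> = e" using c by (simp add: d_def)
      finally show ?thesis by simp
    qed
    then have "cmod (cb_integral \<mu> \<psi> - \<phi> \<psi>) \<le> 0" by (rule field_le_epsilon)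
    then show ?thesis by simp
  qed
  then show ?thesis using mu by blast
qed

section \<open>The measure space as a Banach space\<close>

lemma NV_triangle: assumes "\<mu> \<in> V" "\<nu> \<in> V" shows "NV (\<mu> + \<nu>) \<le> NV \<mu> + NV \<nu>"
proof (rule NV_le[OF V_add[OF assms]])
  fix f assume f: "f \<in> compactly_supported" "\<And>x. cmod (f x) \<le> \<omega> x"
  have le: "cmod (f x) \<le> 1 * \<omega> x" for x using f(2) by simp
  have "cmod (cb_integral \<mu> f) \<le> NV \<mu> * 1" "cmod (cb_integral \<nu> f) \<le> NV \<nu> * 1"
    by (rule pair_le_aux[OF assms(1) cs_in_E[OF f(1)] zero_less_one le],
        rule pair_le_aux[OF assms(2) cs_in_E[OF f(1)] zero_less_one le])
  then show "cmod (cb_integral (\<mu> + \<nu>) f) \<le> NV \<mu> + NV \<nu>"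
    using norm_triangle_ineq[of "cb_integral \<mu> f" "cb_integral \<nu> f"]
    by (simp add: pair_add_left[OF assms cs_in_E[OF f(1)]])
qed (use NV_nonneg in simp)

lemma NV_scale: assumes "\<mu> \<in> V" shows "NV (fun_scale a \<mu>) = cmod a * NV \<mu>"
proof -
  have le: "NV (fun_scale a \<mu>) \<le> cmod a * NV \<mu>" if mu: "\<mu> \<in> V" for a \<mu>
  proof (rule NV_le[OF V_scale[OF mu]])
    fix f assume f: "f \<in> compactly_supported" "\<And>x. cmod (f x) \<le> \<omega> x"
    have le: "cmod (f x) \<le> 1 * \<omega> x" for x using f(2) by simp
    have "cmod (cb_integral \<mu> f) \<le> NV \<mu> * 1"
      by (rule pair_le_aux[OF mu cs_in_E[OF f(1)] zero_less_one le])
    then show "cmod (cb_integral (fun_scale a \<mu>) f) \<le> cmod a * NV \<mu>"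
      by (simp add: pair_scale_left[OF mu cs_in_E[OF f(1)]] norm_mult mult_left_mono)
  qed (use NV_nonneg in simp)
  show ?thesis
  proof (cases "a = 0")
    case True
    then show ?thesis using le[OF assms, of a] NV_nonneg[of "fun_scale a \<mu>"] by simp
  next
    case False
    have "fun_scale (inverse a) (fun_scale a \<mu>) = \<mu>" using False by (simp add: fun_scale_def fun_eq_iff)
    then have "NV \<mu> \<le> cmod (inverse a) * NV (fun_scale a \<mu>)"
      using le[OF V_scale[OF assms, of a], of "inverse a"] by simp
    then have "cmod a * NV \<mu> \<le> cmod a * (cmod (inverse a) * NV (fun_scale a \<mu>))" by (rule mult_left_mono) simp
    also have "\<dots> = NV (fun_scale a \<mu>)" using False by (simp add: norm_inverse)
    finally have "cmod a * NV \<mu> \<le> NV (fun_scale a \<mu>)" .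
    then show ?thesis using le[OF assms, of a] by simp
  qed
qed

lemma V_diff_eq: "\<mu> - \<nu> = \<mu> + fun_scale (-1) \<nu>" for \<mu> \<nu> :: "'b \<Rightarrow> complex"
  by (auto simp: fun_scale_def fun_eq_iff)

lemma V_diff: "\<mu> \<in> V \<Longrightarrow> \<nu> \<in> V \<Longrightarrow> \<mu> - \<nu> \<in> V"
  unfolding V_diff_eq by (intro V_add V_scale)

lemma pair_diff_left:
  assumes "\<mu> \<in> V" "\<nu> \<in> V" "\<psi> \<in> E"
  shows "cb_integral (\<mu> - \<nu>) \<psi> = cb_integral \<mu> \<psi> - cb_integral \<nu> \<psi>"
  unfolding V_diff_eq pair_add_left[OF assms(1) V_scale[OF assms(2)] assms(3)] pair_scale_left[OF assms(2,3)] by simp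

text \<open>A Cauchy sequence converges pointwise as a sequence of functionals on the predual; the
  limit is bounded, and \<open>pair_surj\<close> represents it by a measure.\<close>

lemma V_complete:
  fixes \<sigma> :: "nat \<Rightarrow> 'a set \<Rightarrow> complex"
  assumes s: "\<And>n. \<sigma> n \<in> V"
    and C: "\<And>e. e > 0 \<Longrightarrow> \<exists>k. \<forall>m\<ge>k. \<forall>n\<ge>k. NV (\<sigma> m - \<sigma> n) < e"
  shows "\<exists>\<mu>\<in>V. (\<lambda>n. NV (\<sigma> n - \<mu>)) \<longlonglongrightarrow> 0"
proof -
  have d: "cmod (cb_integral (\<sigma> m) \<psi> - cb_integral (\<sigma> n) \<psi>) \<le> NV (\<sigma> m - \<sigma> n) * NE \<psi>" if "\<psi> \<in> E" for m n \<psi>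
    using pair_le[OF V_diff[OF s s] that, of m n] by (simp add: pair_diff_left[OF s s that])
  have conv: "\<exists>l. (\<lambda>n. cb_integral (\<sigma> n) \<psi>) \<longlonglongrightarrow> l" if p: "\<psi> \<in> E" for \<psi>
  proof -
    have "Cauchy (\<lambda>n. cb_integral (\<sigma> n) \<psi>)"
      unfolding Cauchy_def
    proof (intro allI impI)
      fix e :: real assume e: "e > 0"
      have n0: "NE \<psi> + 1 > 0" using NE_nonneg[OF p] by simp
      then have "e / (NE \<psi> + 1) > 0" using e by simp
      then obtain k where k: "\<forall>m\<ge>k. \<forall>n\<ge>k. NV (\<sigma> m - \<sigma> n) < e / (NE \<psi> + 1)" using C by blast
      have "dist (cb_integral (\<sigma> m) \<psi>) (cb_integral (\<sigma> n) \<psi>) < e" if "m \<ge> k" "n \<ge> k" for m n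
      proof -
        have lt: "NV (\<sigma> m - \<sigma> n) < e / (NE \<psi> + 1)" using k that by blast
        have "dist (cb_integral (\<sigma> m) \<psi>) (cb_integral (\<sigma> n) \<psi>) \<le> NV (\<sigma> m - \<sigma> n) * NE \<psi>"
          using d[OF p] by (simp add: dist_norm)
        also have "\<dots> \<le> NV (\<sigma> m - \<sigma> n) * (NE \<psi> + 1)" using NV_nonneg by (intro mult_left_mono) auto
        also have "\<dots> < e / (NE \<psi> + 1) * (NE \<psi> + 1)" using lt n0 by (intro mult_strict_right_mono)
        also have "\<dots> = e" using n0 by simp
        finally show ?thesis .
      qed
      then show "\<exists>M. \<forall>m\<ge>M. \<forall>n\<ge>M. dist (cb_integral (\<sigma> m) \<psi>) (cb_integral (\<sigma> n) \<psi>) < e" by blast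
    qed
    then show ?thesis using Cauchy_convergent convergent_def by blast
  qed
  define \<phi> where "\<phi> \<psi> = lim (\<lambda>n. cb_integral (\<sigma> n) \<psi>)" for \<psi>
  have phi: "(\<lambda>n. cb_integral (\<sigma> n) \<psi>) \<longlonglongrightarrow> \<phi> \<psi>" if "\<psi> \<in> E" for \<psi>
    using conv[OF that] unfolding \<phi>_def by (metis limI)
  \<comment> \<open>With \<open>n\<close> fixed the Cauchy bound passes to the limit in
    \<open>m\<close>. It is uniform in \<open>\<psi>\<close> relative to the norm of
    \<open>\<psi>\<close>, which upgrades pointwise convergence to convergence in norm.\<close>
  have close: "cmod (cb_integral (\<sigma> n) \<psi> - \<phi> \<psi>) \<le> e * NE \<psi>"
    if p: "\<psi> \<in> E" and k: "\<forall>m\<ge>k. \<forall>n\<ge>k. NV (\<sigma> m - \<sigma> n) < e" "n \<ge> k" for \<psi> e k n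
  proof (rule LIMSEQ_le_const2)
    show "(\<lambda>m. cmod (cb_integral (\<sigma> n) \<psi> - cb_integral (\<sigma> m) \<psi>)) \<longlonglongrightarrow> cmod (cb_integral (\<sigma> n) \<psi> - \<phi> \<psi>)"
      by (intro tendsto_norm tendsto_diff tendsto_const phi p)
    have "cmod (cb_integral (\<sigma> n) \<psi> - cb_integral (\<sigma> m) \<psi>) \<le> e * NE \<psi>" if "m \<ge> k" for m
    proof -
      have "NV (\<sigma> n - \<sigma> m) < e" using k that by blast
      then have "NV (\<sigma> n - \<sigma> m) * NE \<psi> \<le> e * NE \<psi>" using NE_nonneg[OF p] by (intro mult_right_mono) auto
      then show ?thesis using d[OF p, of n m] by linarith
    qed
    then show "\<exists>N. \<forall>m\<ge>N. cmod (cb_integral (\<sigma> n) \<psi> - cb_integral (\<sigma> m) \<psi>) \<le> e * NE \<psi>" by blast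
  qed
  have "bounded_functional_on fun_scale E NE \<phi>"
    unfolding bounded_functional_on_def
  proof (intro conjI ballI allI)
    show "\<phi> (x + y) = \<phi> x + \<phi> y" if "x \<in> E" "y \<in> E" for x y
      using tendsto_add[OF phi[OF that(1)] phi[OF that(2)]] phi[OF E_add[OF that]]
      unfolding pair_add_right[OF s that] by (rule LIMSEQ_unique[rotated])
    show "\<phi> (fun_scale c x) = c * \<phi> x" if "x \<in> E" for c x
      using tendsto_mult[OF tendsto_const phi[OF that], of c] phi[OF E_scale[OF that, of c]]
      unfolding pair_scale_right[OF s that] by (rule LIMSEQ_unique[rotated])
    obtain k where k: "\<forall>m\<ge>k. \<forall>n\<ge>k. NV (\<sigma> m - \<sigma> n) < 1" using C[of 1] by auto
    have "cmod (\<phi> x) \<le> (NV (\<sigma> k) + 1) * NE x" if "x \<in> E" for x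
    proof -
      have "cmod (\<phi> x) \<le> cmod (cb_integral (\<sigma> k) x) + cmod (cb_integral (\<sigma> k) x - \<phi> x)"
        using norm_triangle_ineq4[of "cb_integral (\<sigma> k) x" "cb_integral (\<sigma> k) x - \<phi> x"] by simp
      also have "\<dots> \<le> NV (\<sigma> k) * NE x + 1 * NE x"
        by (intro add_mono pair_le s that close[OF that k order_refl])
      finally show ?thesis by (simp add: distrib_right)
    qed
    then show "\<exists>K. \<forall>x\<in>E. cmod (\<phi> x) \<le> K * NE x" by blast
  qed
  then obtain \<mu> where mu: "\<mu> \<in> V" "\<forall>\<psi>\<in>E. cb_integral \<mu> \<psi> = \<phi> \<psi>" using pair_surj by blast
  have "(\<lambda>n. NV (\<sigma> n - \<mu>)) \<longlonglongrightarrow> 0"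
  proof (rule LIMSEQ_I)
    fix e :: real assume e: "e > 0"
    then obtain k where k: "\<forall>m\<ge>k. \<forall>n\<ge>k. NV (\<sigma> m - \<sigma> n) < e/2" using C[of "e/2"] by auto
    have "norm (NV (\<sigma> n - \<mu>) - 0) < e" if n: "n \<ge> k" for n
    proof -
      have "NV (\<sigma> n - \<mu>) \<le> e/2"
      proof (rule NV_le[OF V_diff[OF s mu(1)]])
        fix f assume f: "f \<in> compactly_supported" "\<And>x. cmod (f x) \<le> \<omega> x"
        note fE = cs_in_E[OF f(1)]
        have "cmod (cb_integral (\<sigma> n - \<mu>) f) \<le> e/2 * NE f"
          using close[OF fE k n] mu(2) fE by (simp add: pair_diff_left[OF s mu(1) fE])
        also have "\<dots> \<le> e/2" using NE_le[of f 1] f(2) e by (intro mult_left_le) auto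
        finally show "cmod (cb_integral (\<sigma> n - \<mu>) f) \<le> e/2" .
      qed (use e in simp)
      then show ?thesis using NV_nonneg[of "\<sigma> n - \<mu>"] e by simp
    qed
    then show "\<exists>no. \<forall>n\<ge>no. norm (NV (\<sigma> n - \<mu>) - 0) < e" by blast
  qed
  then show ?thesis using mu(1) by blast
qed

lemma V_banach: "complex_banach_space_on fun_scale V NV"
proof -
  interpret vs: vector_space fun_scale by (rule vector_space_fun_scale)
  show ?thesis
  proof
    show "module.subspace fun_scale V"
      unfolding vs.subspace_def using V_zero V_add V_scale by auto
    show "x = 0" if x: "x \<in> V" "NV x = 0" for x
    proof (rule V_eqI[OF x(1) V_zero])
      fix f :: "'a \<Rightarrow> complex" assume f: "f \<in> compactly_supported"
      have "cb_integral (fun_scale 0 x) f = 0"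
        unfolding pair_scale_left[OF x(1) cs_in_E[OF f]] by simp
      moreover have "fun_scale 0 x = 0" by (simp add: fun_scale_def fun_eq_iff)
      ultimately have "cb_integral 0 f = 0" by (simp only:)
      then show "cb_integral x f = cb_integral 0 f" using pair_le[OF x(1) cs_in_E[OF f]] x(2) by simp
    qed
  qed (use NV_nonneg NV_scale NV_triangle V_complete in auto)
qed

text \<open>A map with a preadjoint is continuous for the weak-star topology: followed by evaluation
  at \<open>\<psi>\<close> it is evaluation at \<open>\<phi>\<close>.\<close>

lemma weak_star_continuous:
  assumes T: "\<And>v. v \<in> V \<Longrightarrow> T v \<in> V"
    and dual: "\<And>\<psi>. \<psi> \<in> E \<Longrightarrow> \<exists>\<phi>\<in>E. \<forall>v\<in>V. cb_integral (T v) \<psi> = cb_integral v \<phi>"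
  shows "continuous_map (weak_star_topology_on V E cb_integral) (weak_star_topology_on V E cb_integral) T"
  unfolding weak_star_topology_on_def
proof (rule continuous_map_pullback')
  let ?P = "product_topology (\<lambda>_. euclidean) E :: (('a \<Rightarrow> complex) \<Rightarrow> complex) topology"
  let ?X = "pullback_topology V (\<lambda>v. restrict (cb_integral v) E) ?P"
  have top: "topspace ?X \<subseteq> V" by (auto simp: topspace_pullback_topology)
  then show "topspace ?X \<subseteq> T -` V" using T by auto
  show "continuous_map ?X ?P ((\<lambda>v. restrict (cb_integral v) E) \<circ> T)"
    unfolding continuous_map_componentwise
  proof (intro conjI ballI)
    show "((\<lambda>v. restrict (cb_integral v) E) \<circ> T) ` topspace ?X \<subseteq> extensional E" by auto
    fix \<psi> assume p: "\<psi> \<in> E"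
    then obtain \<phi> where phi: "\<phi> \<in> E" "\<forall>v\<in>V. cb_integral (T v) \<psi> = cb_integral v \<phi>" using dual by blast
    have "continuous_map ?X euclidean ((\<lambda>g. g \<phi>) \<circ> (\<lambda>v. restrict (cb_integral v) E))"
      by (intro continuous_map_pullback continuous_map_product_projection phi(1))
    then show "continuous_map ?X euclidean (\<lambda>v. ((\<lambda>v. restrict (cb_integral v) E) \<circ> T) v \<psi>)"
      by (rule continuous_map_eq) (use p phi top in auto)
  qed
qed

end

section \<open>Products of inner regular measures\<close>

lemma continuous_on_UNIV_metricI:
  fixes h :: "'a::topological_space \<Rightarrow> 'b::metric_space"
  assumes "\<And>y e. e > 0 \<Longrightarrow> \<exists>W. open W \<and> y \<in> W \<and> (\<forall>z\<in>W. dist (h z) (h y) \<le> e)"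
  shows "continuous_on UNIV h"
  unfolding continuous_on_def
proof (intro ballI tendstoI)
  fix y and e :: real assume "e > 0"
  then obtain W where W: "open W" "y \<in> W" "\<forall>z\<in>W. dist (h z) (h y) \<le> e/2"
    using assms[of "e/2" y] by auto
  show "eventually (\<lambda>z. dist (h z) (h y) < e) (at y)"
    unfolding eventually_at_topological using W \<open>e > 0\<close> by (intro exI[of _ W]) force
qed

lemma integral_norm_le_indicator:
  fixes h :: "'a::t2_space \<Rightarrow> complex"
  assumes M: "radon M" and A: "A \<in> compacted_borel" and h: "integrable M h"
    and le: "\<And>x. norm (h x) \<le> e * indicator A x"
  shows "norm (\<integral>x. h x \<partial>M) \<le> e * measure M A"
proof -
  have "norm (\<integral>x. h x \<partial>M) \<le> (\<integral>x. norm (h x) \<partial>M)" by (rule integral_norm_bound)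
  also have "\<dots> \<le> (\<integral>x. e * indicator A x \<partial>M)"
    using h le M radon_compacted_borel[OF M A] A
    by (intro integral_mono integrable_norm integrable_mult_right integrable_real_indicator)
      (auto simp: compacted_borel_borel)
  also have "\<dots> = e * measure M A" using M by simp
  finally show ?thesis .
qed

lemma compactly_supported_prodE:
  fixes f :: "'a::t2_space \<times> 'b::t2_space \<Rightarrow> complex"
  assumes "f \<in> compactly_supported"
  obtains K L where "compact K" "compact L" "\<And>s t. s \<notin> K \<Longrightarrow> f (s, t) = 0" "\<And>s t. t \<notin> L \<Longrightarrow> f (s, t) = 0"
proof -
  obtain Q where Q: "compact Q" "\<And>x. x \<notin> Q \<Longrightarrow> f x = 0"
    using assms unfolding compactly_supported_iff by blast
  have "compact (fst ` Q)" "compact (snd ` Q)"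
    using Q(1) by (auto intro!: compact_continuous_image continuous_on_fst continuous_on_snd continuous_on_id)
  then show ?thesis
  proof (rule that)
    show "f (s, t) = 0" if "s \<notin> fst ` Q" for s t using Q(2)[of "(s, t)"] that by force
    show "f (s, t) = 0" if "t \<notin> snd ` Q" for s t using Q(2)[of "(s, t)"] that by force
  qed
qed

lemma continuous_on_section1: "continuous_on UNIV f \<Longrightarrow> continuous_on UNIV (\<lambda>s. f (s, t))"
  by (rule continuous_on_compose2[of UNIV f]) (auto intro!: continuous_on_Pair continuous_on_id continuous_on_const)

lemma continuous_on_section2: "continuous_on UNIV f \<Longrightarrow> continuous_on UNIV (\<lambda>t. f (s, t))"
  by (rule continuous_on_compose2[of UNIV f]) (auto intro!: continuous_on_Pair continuous_on_id continuous_on_const)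

lemma compactly_supported_section1:
  fixes f :: "'a::t2_space \<times> 'b::t2_space \<Rightarrow> complex"
  assumes "f \<in> compactly_supported" shows "(\<lambda>s. f (s, t)) \<in> compactly_supported"
proof -
  obtain K L where "compact K" "compact L" "\<And>s t. s \<notin> K \<Longrightarrow> f (s, t) = 0" "\<And>s t. t \<notin> L \<Longrightarrow> f (s, t) = 0"
    by (rule compactly_supported_prodE[OF assms], rule that)
  then show ?thesis
    using assms continuous_on_section1[of f t] unfolding compactly_supported_iff by blast
qed

lemma compactly_supported_swap:
  fixes f :: "'a::t2_space \<times> 'b::t2_space \<Rightarrow> complex"
  assumes "f \<in> compactly_supported" shows "(\<lambda>(t, s). f (s, t)) \<in> compactly_supported"
proof -
  obtain K L where K: "compact K" "compact L" "\<And>s t. s \<notin> K \<Longrightarrow> f (s, t) = 0" "\<And>s t. t \<notin> L \<Longrightarrow> f (s, t) = 0"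
    by (rule compactly_supported_prodE[OF assms], rule that)
  have c: "continuous_on UNIV f" using assms by (simp add: compactly_supported_iff)
  have "continuous_on UNIV (\<lambda>x. f (prod.swap x))"
    by (rule continuous_on_compose2[OF c continuous_on_swap]) simp
  then have "continuous_on UNIV (\<lambda>(t, s). f (s, t))" by (simp add: case_prod_unfold prod.swap_def)
  then show ?thesis
    unfolding compactly_supported_iff using K by (intro conjI exI[of _ "L \<times> K"]) (auto simp: compact_Times)
qed

lemma compactly_supported_section2:
  fixes f :: "'a::t2_space \<times> 'b::t2_space \<Rightarrow> complex"
  assumes "f \<in> compactly_supported" shows "(\<lambda>t. f (s, t)) \<in> compactly_supported"
  using compactly_supported_section1[OF compactly_supported_swap[OF assms], of s] by simp

lemma compactly_supported_integrable:
  fixes f :: "'a::t2_space \<Rightarrow> complex"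
  assumes "radon M" "f \<in> compactly_supported" shows "integrable M f"
proof -
  obtain K where "compact K" "\<And>x. x \<notin> K \<Longrightarrow> f x = 0" and c: "continuous_on UNIV f"
    using assms(2) unfolding compactly_supported_iff by blast
  then show ?thesis by (intro radon_integrable_compact_support[OF assms(1) c])
qed

text \<open>Continuity in the parameter is uniform over the compact set \<open>K\<close>, as in the
  tube lemma. Only the integration is confined to \<open>K\<close>; \<open>g\<close> may have
  noncompact support, as a test function composed with the group law does.\<close>

lemma continuous_section_integral:
  fixes g :: "'a::t2_space \<times> 'b::t2_space \<Rightarrow> complex"
  assumes M: "radon M" and K: "compact K" and g: "continuous_on UNIV g"
  shows "continuous_on UNIV (\<lambda>t. \<integral>s. indicator K s *\<^sub>R g (s, t) \<partial>M)"
proof (rule continuous_on_UNIV_metricI)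
  fix t and e :: real assume e: "e > 0"
  define d where "d = e / (measure M K + 1)"
  have d: "d > 0" using e measure_nonneg[of M K] by (simp add: d_def add_nonneg_pos)
  have int: "integrable M (\<lambda>s. indicator K s *\<^sub>R g (s, t))" for t
  proof -
    have "compact ((\<lambda>s. g (s, t)) ` K)"
      using continuous_on_section1[OF g, of t] K by (meson compact_continuous_image continuous_on_subset subset_UNIV)
    then have "bounded ((\<lambda>s. g (s, t)) ` K)" by (rule compact_imp_bounded)
    then obtain B where B: "\<And>s. s \<in> K \<Longrightarrow> norm (g (s, t)) \<le> B" unfolding bounded_iff by blast
    show ?thesis
    proof (rule integrableI_bounded_set_indicator[where B = B])
      show "K \<in> sets M" using K M by (simp add: compact_borel)
      show "(\<lambda>s. g (s, t)) \<in> borel_measurable M"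
        by (rule radon_measurable[OF M borel_measurable_continuous_onI[OF continuous_on_section1[OF g]]])
      show "emeasure M K < \<infinity>" by (rule radon_compact[OF M K])
    qed (use B in auto)
  qed
  \<comment> \<open>The uniformity argument takes the compact set as second factor, hence the
    exchange of coordinates.\<close>
  have sw: "continuous_on UNIV (\<lambda>x. g (prod.swap x))"
    by (rule continuous_on_compose2[OF g continuous_on_swap]) simp
  obtain W where W: "t \<in> W" "open W"
      "\<forall>z\<in>W \<inter> UNIV. \<forall>s\<in>K. dist (g (prod.swap (z, s))) (g (prod.swap (t, s))) \<le> d"
    by (rule continuous_on_prod_compactE[OF continuous_on_subset[OF sw subset_UNIV] K UNIV_I[of t] d], rule that)
  have "dist (\<integral>s. indicator K s *\<^sub>R g (s, z) \<partial>M) (\<integral>s. indicator K s *\<^sub>R g (s, t) \<partial>M) \<le> e" if z: "z \<in> W" for z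
  proof -
    have "dist (\<integral>s. indicator K s *\<^sub>R g (s, z) \<partial>M) (\<integral>s. indicator K s *\<^sub>R g (s, t) \<partial>M)
        = norm (\<integral>s. indicator K s *\<^sub>R g (s, z) - indicator K s *\<^sub>R g (s, t) \<partial>M)"
      using int by (simp add: dist_norm Bochner_Integration.integral_diff)
    also have "\<dots> \<le> d * measure M K"
    proof (rule integral_norm_le_indicator[OF M compact_compacted_borel[OF K]])
      show "integrable M (\<lambda>s. indicator K s *\<^sub>R g (s, z) - indicator K s *\<^sub>R g (s, t))"
        by (intro Bochner_Integration.integrable_diff int)
      show "norm (indicator K s *\<^sub>R g (s, z) - indicator K s *\<^sub>R g (s, t)) \<le> d * indicator K s" for s
        using W(3) z by (auto simp: indicator_def dist_norm)
    qed
    also have "\<dots> \<le> d * (measure M K + 1)" using d by (intro mult_left_mono) auto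
    also have "\<dots> = e"
    proof -
      have "measure M K + 1 \<noteq> 0" using measure_nonneg[of M K] by linarith
      then show ?thesis by (simp add: d_def)
    qed
    finally show ?thesis .
  qed
  then show "\<exists>W. open W \<and> t \<in> W \<and> (\<forall>z\<in>W. dist (\<integral>s. indicator K s *\<^sub>R g (s, z) \<partial>M) (\<integral>s. indicator K s *\<^sub>R g (s, t) \<partial>M) \<le> e)"
    using W by blast
qed

lemma compactly_supported_section_integral:
  fixes f :: "'a::t2_space \<times> 'b::t2_space \<Rightarrow> complex"
  assumes M: "radon M" and f: "f \<in> compactly_supported"
  shows "(\<lambda>t. \<integral>s. f (s, t) \<partial>M) \<in> compactly_supported"
proof -
  obtain K L where K: "compact K" "compact L" "\<And>s t. s \<notin> K \<Longrightarrow> f (s, t) = 0" "\<And>s t. t \<notin> L \<Longrightarrow> f (s, t) = 0"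
    by (rule compactly_supported_prodE[OF f], rule that)
  have "indicator K s *\<^sub>R f (s, t) = f (s, t)" for s t using K(3)[of s t] by (auto simp: indicator_def)
  moreover have "continuous_on UNIV f" using f by (simp add: compactly_supported_iff)
  ultimately have "continuous_on UNIV (\<lambda>t. \<integral>s. f (s, t) \<partial>M)"
    using continuous_section_integral[OF M K(1), of f] by simp
  then show ?thesis using K(2,4) unfolding compactly_supported_iff by (intro conjI exI[of _ L]) auto
qed

text \<open>On a compactly supported \<open>f\<close> both orders of integration are close to the integrals of
  \<open>\<Sum>\<^sub>i 1\<^bsub>B\<^sub>i\<^esub>(s) f(s\<^sub>i, t)\<close>, where the \<open>B\<^sub>i\<close> partition the projection of the support finely enough.\<close>

lemma iterated_integral_swap:
  fixes f :: "'a::t2_space \<times> 'b::t2_space \<Rightarrow> complex"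
  assumes M: "radon M" and N: "radon N" and f: "f \<in> compactly_supported"
  shows "(\<integral>t. (\<integral>s. f (s, t) \<partial>M) \<partial>N) = (\<integral>s. (\<integral>t. f (s, t) \<partial>N) \<partial>M)"
proof -
  obtain K L where K: "compact K" "compact L" "\<And>s t. s \<notin> K \<Longrightarrow> f (s, t) = 0" "\<And>s t. t \<notin> L \<Longrightarrow> f (s, t) = 0"
    by (rule compactly_supported_prodE[OF f], rule that)
  have fc: "continuous_on UNIV f" using f by (simp add: compactly_supported_iff)
  have Kcb: "K \<in> compacted_borel" "L \<in> compacted_borel" using K by (auto intro: compact_compacted_borel)
  have i1: "integrable M (\<lambda>s. f (s, t))" for t
    by (rule compactly_supported_integrable[OF M compactly_supported_section1[OF f]])
  have i2: "integrable N (\<lambda>t. f (s, t))" for s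
    by (rule compactly_supported_integrable[OF N compactly_supported_section2[OF f]])
  have j1: "integrable N (\<lambda>t. \<integral>s. f (s, t) \<partial>M)"
    by (rule compactly_supported_integrable[OF N compactly_supported_section_integral[OF M f]])
  have j2: "integrable M (\<lambda>s. \<integral>t. f (s, t) \<partial>N)"
    using compactly_supported_integrable[OF M compactly_supported_section_integral[OF N compactly_supported_swap[OF f]]]
    by simp
  let ?c = "measure M K * measure N L"
  have "dist (\<integral>t. (\<integral>s. f (s, t) \<partial>M) \<partial>N) (\<integral>s. (\<integral>t. f (s, t) \<partial>N) \<partial>M) \<le> 2 * e * ?c" if e: "e > 0" for e :: real
  proof -
    have "\<exists>W. open W \<and> s \<in> W \<and> (\<forall>z\<in>W. \<forall>t\<in>L. dist (f (z, t)) (f (s, t)) \<le> e)" for s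
      by (rule continuous_on_prod_compactE[OF continuous_on_subset[OF fc subset_UNIV] K(2) UNIV_I[of s] e]) auto
    then obtain W where W: "\<And>s. open (W s)" "\<And>s. s \<in> W s" "\<And>s z t. z \<in> W s \<Longrightarrow> t \<in> L \<Longrightarrow> dist (f (z, t)) (f (s, t)) \<le> e"
      by metis
    obtain F where F: "F \<subseteq> K" "finite F" "K \<subseteq> (\<Union>s\<in>F. W s)"
      by (rule compactE_image[OF K(1), of K W]) (use W in blast)+
    obtain n and x :: "nat \<Rightarrow> 'a" where x: "F = x ` {..<n}"
      using finite_imp_nat_seg_image_inj_on[OF F(2)] by (metis lessThan_def)
    \<comment> \<open>The cover is made disjoint. On \<open>B i\<close> the section of
      \<open>f\<close> at \<open>s\<close> stays within \<open>e\<close> of the one at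
      \<open>x i\<close>, uniformly on \<open>L\<close>.\<close>
    define B where "B i = K \<inter> W (x i) - (\<Union>j<i. W (x j))" for i :: nat
    have Bcb: "B i \<in> compacted_borel" for i
      unfolding B_def using W(1) by (intro compacted_borel_Diff compacted_borel_Int Kcb) (auto intro: borel_open open_UN)
    have Bb: "B i \<in> sets M" for i using Bcb M by (simp add: compacted_borel_borel)
    have disj: "i = j" if "s \<in> B i" "s \<in> B j" for i j s
      using that unfolding B_def by (metis DiffD1 DiffD2 IntD2 UN_I lessThan_iff linorder_neqE_nat)
    have cover: "\<exists>i<n. s \<in> B i" if "s \<in> K" for s
    proof -
      have "\<exists>i. i < n \<and> s \<in> W (x i)" using F(3) that x by auto
      then have "\<exists>i. (i < n \<and> s \<in> W (x i)) \<and> (\<forall>j<i. \<not> (j < n \<and> s \<in> W (x j)))"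
        by (rule exists_least_iff[THEN iffD1])
      then obtain i where i: "i < n" "s \<in> W (x i)" "\<And>j. j < i \<Longrightarrow> \<not> (j < n \<and> s \<in> W (x j))"
        by blast
      then have "s \<in> B i" unfolding B_def using that by auto
      then show ?thesis using i by blast
    qed
    define h where "h s t = (\<Sum>i<n. indicator (B i) s *\<^sub>R f (x i, t))" for s t
    have h_eq: "h s t = f (x i, t)" if "i < n" "s \<in> B i" for i s t
    proof -
      have "h s t = (\<Sum>j<n. if j = i then f (x i, t) else 0)"
        unfolding h_def using disj that by (intro sum.cong refl) (auto simp: indicator_def)
      then show ?thesis using that by simp
    qed
    have h_0: "h s t = 0" if "s \<notin> K" for s t
      unfolding h_def using that by (intro sum.neutral) (auto simp: B_def)
    have close: "norm (f (s, t) - h s t) \<le> e * (indicator K s * indicator L t)" for s t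
    proof (cases "s \<in> K \<and> t \<in> L")
      case True
      then obtain i where i: "i < n" "s \<in> B i" using cover by blast
      then have "s \<in> W (x i)" by (auto simp: B_def)
      then have "dist (f (s, t)) (f (x i, t)) \<le> e" using W(3) True by blast
      then show ?thesis using True h_eq[OF i] by (simp add: dist_norm)
    next
      case False
      then have "f (s, t) = 0 \<and> h s t = 0"
        using K(3,4) h_0 unfolding h_def by (cases "s \<in> K") auto
      then show ?thesis using e by simp
    qed
    have ih1: "integrable M (\<lambda>s. h s t)" for t
      unfolding h_def using Bb radon_compacted_borel[OF M Bcb]
      by (intro Bochner_Integration.integrable_sum integrable_scaleR_left integrable_real_indicator)
    have ih2: "integrable N (\<lambda>t. h s t)" for s
      unfolding h_def by (intro Bochner_Integration.integrable_sum integrable_scaleR_right i2)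
    have h1: "(\<integral>s. h s t \<partial>M) = (\<Sum>i<n. measure M (B i) *\<^sub>R f (x i, t))" for t
    proof -
      have "(\<integral>s. h s t \<partial>M) = (\<Sum>i<n. \<integral>s. indicator (B i) s *\<^sub>R f (x i, t) \<partial>M)"
        unfolding h_def using Bb radon_compacted_borel[OF M Bcb]
        by (intro Bochner_Integration.integral_sum integrable_scaleR_left integrable_real_indicator)
      also have "\<dots> = (\<Sum>i<n. (\<integral>s. indicator (B i) s \<partial>M) *\<^sub>R f (x i, t))"
        using Bb radon_compacted_borel[OF M Bcb]
        by (intro sum.cong refl integral_scaleR_left integrable_real_indicator) auto
      finally show ?thesis using M by simp
    qed
    have h2: "(\<integral>t. h s t \<partial>N) = (\<Sum>i<n. indicator (B i) s *\<^sub>R (\<integral>t. f (x i, t) \<partial>N))" for s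
      unfolding h_def by (subst Bochner_Integration.integral_sum) (auto intro!: integrable_scaleR_right i2)
    have jh1: "integrable N (\<lambda>t. \<integral>s. h s t \<partial>M)"
      unfolding h1 by (intro Bochner_Integration.integrable_sum integrable_scaleR_right i2)
    have jh2: "integrable M (\<lambda>s. \<integral>t. h s t \<partial>N)"
      unfolding h2 using Bb radon_compacted_borel[OF M Bcb]
      by (intro Bochner_Integration.integrable_sum integrable_scaleR_left integrable_real_indicator)
    have eq: "(\<integral>t. (\<integral>s. h s t \<partial>M) \<partial>N) = (\<integral>s. (\<integral>t. h s t \<partial>N) \<partial>M)"
    proof -
      have "(\<integral>t. (\<integral>s. h s t \<partial>M) \<partial>N) = (\<Sum>i<n. measure M (B i) *\<^sub>R (\<integral>t. f (x i, t) \<partial>N))"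
        unfolding h1 by (subst Bochner_Integration.integral_sum) (auto intro!: integrable_scaleR_right i2)
      also have "\<dots> = (\<integral>s. (\<Sum>i<n. indicator (B i) s *\<^sub>R (\<integral>t. f (x i, t) \<partial>N)) \<partial>M)"
      proof (subst Bochner_Integration.integral_sum)
        show "integrable M (\<lambda>s. indicator (B i) s *\<^sub>R (\<integral>t. f (x i, t) \<partial>N))" for i
          using Bb radon_compacted_borel[OF M Bcb] by (intro integrable_scaleR_left integrable_real_indicator)
        show "(\<Sum>i<n. measure M (B i) *\<^sub>R (\<integral>t. f (x i, t) \<partial>N)) =
            (\<Sum>i<n. \<integral>s. indicator (B i) s *\<^sub>R (\<integral>t. f (x i, t) \<partial>N) \<partial>M)"
        proof (intro sum.cong refl)
          fix i
          have "(\<integral>s. indicator (B i) s *\<^sub>R (\<integral>t. f (x i, t) \<partial>N) \<partial>M) = (\<integral>s. indicator (B i) s \<partial>M) *\<^sub>R (\<integral>t. f (x i, t) \<partial>N)"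
            using Bb radon_compacted_borel[OF M Bcb] by (intro integral_scaleR_left integrable_real_indicator) auto
          then show "measure M (B i) *\<^sub>R (\<integral>t. f (x i, t) \<partial>N) = (\<integral>s. indicator (B i) s *\<^sub>R (\<integral>t. f (x i, t) \<partial>N) \<partial>M)"
            using M by simp
        qed
      qed
      finally show ?thesis unfolding h2 .
    qed
    have in1: "norm ((\<integral>s. f (s, t) \<partial>M) - (\<integral>s. h s t \<partial>M)) \<le> (e * measure M K) * indicator L t" for t
    proof -
      have "norm (\<integral>s. f (s, t) - h s t \<partial>M) \<le> (e * indicator L t) * measure M K"
        using close by (intro integral_norm_le_indicator[OF M Kcb(1)] Bochner_Integration.integrable_diff i1 ih1) (simp add: ac_simps)
      then show ?thesis using i1 ih1 by (simp add: Bochner_Integration.integral_diff ac_simps)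
    qed
    have "norm (\<integral>t. (\<integral>s. f (s, t) \<partial>M) - (\<integral>s. h s t \<partial>M) \<partial>N) \<le> e * measure M K * measure N L"
      by (intro integral_norm_le_indicator[OF N Kcb(2)] Bochner_Integration.integrable_diff j1 jh1 in1)
    then have 1: "dist (\<integral>t. (\<integral>s. f (s, t) \<partial>M) \<partial>N) (\<integral>t. (\<integral>s. h s t \<partial>M) \<partial>N) \<le> e * ?c"
      using j1 jh1 by (simp add: Bochner_Integration.integral_diff dist_norm mult.assoc)
    have in2: "norm ((\<integral>t. f (s, t) \<partial>N) - (\<integral>t. h s t \<partial>N)) \<le> (e * measure N L) * indicator K s" for s
    proof -
      have "norm (\<integral>t. f (s, t) - h s t \<partial>N) \<le> (e * indicator K s) * measure N L"
        using close by (intro integral_norm_le_indicator[OF N Kcb(2)] Bochner_Integration.integrable_diff i2 ih2) (simp add: ac_simps)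
      then show ?thesis using i2 ih2 by (simp add: Bochner_Integration.integral_diff ac_simps)
    qed
    have "norm (\<integral>s. (\<integral>t. f (s, t) \<partial>N) - (\<integral>t. h s t \<partial>N) \<partial>M) \<le> e * measure N L * measure M K"
      by (intro integral_norm_le_indicator[OF M Kcb(1)] Bochner_Integration.integrable_diff j2 jh2 in2)
    then have 2: "dist (\<integral>s. (\<integral>t. f (s, t) \<partial>N) \<partial>M) (\<integral>s. (\<integral>t. h s t \<partial>N) \<partial>M) \<le> e * ?c"
      using j2 jh2 by (simp add: Bochner_Integration.integral_diff dist_norm ac_simps)
    show ?thesis
      using dist_triangle2[of "\<integral>t. (\<integral>s. f (s, t) \<partial>M) \<partial>N" "\<integral>s. (\<integral>t. f (s, t) \<partial>N) \<partial>M" "\<integral>t. (\<integral>s. h s t \<partial>M) \<partial>N"] 1 2 eq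
      by simp
  qed
  note b = this
  have "dist (\<integral>t. (\<integral>s. f (s, t) \<partial>M) \<partial>N) (\<integral>s. (\<integral>t. f (s, t) \<partial>N) \<partial>M) \<le> 0 + e" if e: "e > 0" for e :: real
  proof -
    \<comment> \<open>The 2 comes from comparing each order of integration with the step function; 1
      is added because \<open>?c\<close> may be 0.\<close>
    define d where "d = e / 2 / (?c + 1)"
    have c: "?c + 1 > 0" by (simp add: add_nonneg_pos)
    then have d: "d > 0" using e by (simp add: d_def)
    have "2 * d * ?c \<le> 2 * d * (?c + 1)" using d by (intro mult_left_mono) auto
    also have "\<dots> = e" unfolding d_def using nonzero_eq_divide_eq[of "?c + 1" e e] c by (simp add: field_simps)
    finally show ?thesis using b[OF d] by simp
  qed
  then have "dist (\<integral>t. (\<integral>s. f (s, t) \<partial>M) \<partial>N) (\<integral>s. (\<integral>t. f (s, t) \<partial>N) \<partial>M) \<le> 0" by (rule field_le_epsilon)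
  then show ?thesis by simp
qed

text \<open>Riesz is applied to the iterated integral. Additivity is proved for complex test
  functions, whose sections and section integrals are again test functions, and is then taken back
  to the real cone.\<close>

lemma product_radon:
  fixes M :: "'a::t2_space measure" and N :: "'b::t2_space measure"
  assumes lc1: "locally_compact_space (euclidean :: 'a topology)" and lc2: "locally_compact_space (euclidean :: 'b topology)"
    and M: "radon M" and N: "radon N"
  obtains P where "radon P" "\<And>f. f \<in> compactly_supported \<Longrightarrow> (\<integral>x. f x \<partial>P) = (\<integral>t. (\<integral>s. f (s, t) \<partial>M) \<partial>N)"
proof -
  define \<Lambda> where "\<Lambda> f = (\<integral>t. (\<integral>s. f (s, t) \<partial>M) \<partial>N)" for f :: "'a \<times> 'b \<Rightarrow> real"
  define I where "I f = (\<integral>t. (\<integral>s. f (s, t) \<partial>M) \<partial>N)" for f :: "'a \<times> 'b \<Rightarrow> complex"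
  have i1: "integrable M (\<lambda>s. f (s, t))" if "f \<in> compactly_supported" for f :: "'a \<times> 'b \<Rightarrow> complex" and t
    by (rule compactly_supported_integrable[OF M compactly_supported_section1[OF that]])
  have j1: "integrable N (\<lambda>t. \<integral>s. f (s, t) \<partial>M)" if "f \<in> compactly_supported" for f :: "'a \<times> 'b \<Rightarrow> complex"
    by (rule compactly_supported_integrable[OF N compactly_supported_section_integral[OF M that]])
  have Iadd: "I (\<lambda>x. f x + g x) = I f + I g" if "f \<in> compactly_supported" "g \<in> compactly_supported" for f g
    unfolding I_def using i1[OF that(1)] i1[OF that(2)] j1[OF that(1)] j1[OF that(2)]
    by (simp add: Bochner_Integration.integral_add)
  have Iscale: "I (\<lambda>x. a * f x) = a * I f" for a f unfolding I_def by simp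
  have real: "I (\<lambda>x. complex_of_real (f x)) = of_real (\<Lambda> f)" for f
    unfolding I_def \<Lambda>_def by (simp only: integral_complex_of_real)
  have "positive_functional \<Lambda>"
  proof
    show "\<Lambda> (\<lambda>x. f x + g x) = \<Lambda> f + \<Lambda> g" if "f \<in> nonneg_cs" "g \<in> nonneg_cs" for f g
    proof -
      have "complex_of_real (\<Lambda> (\<lambda>x. f x + g x)) = complex_of_real (\<Lambda> f + \<Lambda> g)"
        using Iadd[OF compactly_supported_of_real[OF that(1)] compactly_supported_of_real[OF that(2)]]
        by (simp flip: real)
      then show ?thesis by (simp only: of_real_eq_iff)
    qed
    show "0 \<le> \<Lambda> f" if "f \<in> nonneg_cs" for f
      unfolding \<Lambda>_def using nonneg_csD(2)[OF that] by (intro Bochner_Integration.integral_nonneg) auto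
  qed (rule locally_compact_euclidean_prod[OF lc1 lc2])
  then obtain P where P: "radon P" "\<And>f. f \<in> nonneg_cs \<Longrightarrow> \<Lambda> f = (\<integral>x. f x \<partial>P)"
    by (rule positive_functional.riesz) (rule that)
  have "(\<integral>x. f x \<partial>P) = I f" if f: "f \<in> compactly_supported" for f
  proof -
    obtain p where p: "\<And>j. p j \<in> nonneg_cs" "f = (\<lambda>x. \<Sum>j<4. \<i> ^ j * complex_of_real (p j x))"
      by (rule compactly_supported_decompose[OF f], rule that)
    have pc: "(\<lambda>x. complex_of_real (p j x)) \<in> compactly_supported" for j by (intro compactly_supported_of_real p)
    have ps: "(\<lambda>x. \<Sum>j<n. \<i> ^ j * complex_of_real (p j x)) \<in> compactly_supported \<and>
        I (\<lambda>x. \<Sum>j<n. \<i> ^ j * complex_of_real (p j x)) = (\<Sum>j<n. \<i> ^ j * of_real (\<Lambda> (p j)))" for n :: nat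
    proof (induction n)
      case 0
      show ?case by (auto simp: compactly_supported_iff I_def)
    next
      case (Suc n)
      have c: "(\<lambda>x. \<i> ^ n * complex_of_real (p n x)) \<in> compactly_supported" by (rule compactly_supported_scale[OF pc])
      show ?case
        using Suc Iadd[OF conjunct1[OF Suc] c] compactly_supported_add[OF conjunct1[OF Suc] c]
          Iscale[of "\<i> ^ n" "\<lambda>x. complex_of_real (p n x)"] real[of "p n"]
        by simp
    qed
    have "I f = (\<Sum>j<4. \<i> ^ j * of_real (\<Lambda> (p j)))" using ps[of 4] p(2) by simp
    also have "\<dots> = (\<Sum>j<4. \<i> ^ j * (\<integral>x. complex_of_real (p j x) \<partial>P))"
      using P(2)[OF p(1)] by simp
    also have "\<dots> = (\<integral>x. f x \<partial>P)"
      unfolding p(2) using compactly_supported_integrable[OF P(1) pc]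
      by (subst Bochner_Integration.integral_sum) (auto simp del: integral_complex_of_real)
    finally show ?thesis by simp
  qed
  then show thesis using that[OF P(1)] by (simp add: I_def)
qed

text \<open>Cutoffs of \<open>g\<close> are test functions below \<open>g\<close>, and the product
  formula bounds their integrals by the iterated one. On the side of \<open>g\<close> only
  monotonicity of the iterated integral enters, so measurability of its inner integral is not at
  issue.\<close>

lemma product_nn_integral_le:
  fixes g :: "'a::t2_space \<times> 'b::t2_space \<Rightarrow> real"
  assumes lc1: "locally_compact_space (euclidean :: 'a topology)" and lc2: "locally_compact_space (euclidean :: 'b topology)"
    and M: "radon M" and N: "radon N" and P: "radon P"
    and prod: "\<And>f. f \<in> compactly_supported \<Longrightarrow> (\<integral>x. f x \<partial>P) = (\<integral>t. (\<integral>s. f (s, t) \<partial>M) \<partial>N)"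
    and g: "continuous_on UNIV g" "\<And>x. 0 \<le> g x"
  shows "(\<integral>\<^sup>+x. ennreal (g x) \<partial>P) \<le> (\<integral>\<^sup>+t. (\<integral>\<^sup>+s. ennreal (g (s, t)) \<partial>M) \<partial>N)"
proof -
  note lc = locally_compact_euclidean_prod[OF lc1 lc2]
  have "(\<lambda>x. ennreal (g x)) \<in> borel_measurable borel"
    using borel_measurable_continuous_onI[OF g(1)] by measurable
  then have "(\<integral>\<^sup>+x. ennreal (g x) \<partial>P) \<le> (SUP Q\<in>{Q. compact Q \<and> Q \<subseteq> {x. ennreal (g x) \<noteq> 0}}. \<integral>\<^sup>+x. ennreal (g x) * indicator Q x \<partial>P)"
    by (rule radon_nn_integral_inner[OF P])
  also have "\<dots> \<le> (\<integral>\<^sup>+t. (\<integral>\<^sup>+s. ennreal (g (s, t)) \<partial>M) \<partial>N)"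
  proof (rule SUP_least)
    fix Q assume "Q \<in> {Q. compact Q \<and> Q \<subseteq> {x. ennreal (g x) \<noteq> 0}}"
    then have Q: "compact Q" by simp
    obtain k D where k: "k \<in> nonneg_cs" "\<And>x. k x \<le> 1" "\<And>x. x \<in> Q \<Longrightarrow> k x = 1"
      by (rule urysohn[OF lc Q subset_UNIV open_UNIV], rule that)
    have k0: "0 \<le> k x" for x by (rule nonneg_csD(2)[OF k(1)])
    let ?f = "\<lambda>x. g x * k x" and ?F = "\<lambda>x. complex_of_real (g x * k x)"
    have f: "?f \<in> nonneg_cs"
      by (rule nonneg_cs_dominated[OF k(1)])
        (use g k0 in \<open>auto intro!: continuous_on_mult nonneg_csD(1)[OF k(1)]\<close>)
    have F: "?F \<in> compactly_supported" by (rule compactly_supported_of_real[OF f])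
    have f0: "0 \<le> ?f x" for x by (rule nonneg_csD(2)[OF f])
    have intP: "integrable P ?f"
      using compactly_supported_integrable[OF P F] by (simp only: complex_of_real_integrable_eq)
    have intM: "integrable M (\<lambda>s. ?f (s, t))" for t
      using compactly_supported_integrable[OF M compactly_supported_section1[OF F, of t]]
      by (simp only: complex_of_real_integrable_eq)
    have intN: "integrable N (\<lambda>t. \<integral>s. ?f (s, t) \<partial>M)"
      using compactly_supported_integrable[OF N compactly_supported_section_integral[OF M F]]
      by (simp only: complex_of_real_integrable_eq integral_complex_of_real)
    have "(\<integral>\<^sup>+x. ennreal (g x) * indicator Q x \<partial>P) \<le> (\<integral>\<^sup>+x. ennreal (?f x) \<partial>P)"
      using k(3) by (intro nn_integral_mono) (auto simp: indicator_def)
    also have "\<dots> = ennreal (\<integral>x. ?f x \<partial>P)" using f0 by (intro nn_integral_eq_integral intP) auto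
    also have "(\<integral>x. ?f x \<partial>P) = (\<integral>t. (\<integral>s. ?f (s, t) \<partial>M) \<partial>N)"
    proof -
      have "complex_of_real (\<integral>x. ?f x \<partial>P) = complex_of_real (\<integral>t. (\<integral>s. ?f (s, t) \<partial>M) \<partial>N)"
        using prod[OF F] by (simp only: integral_complex_of_real)
      then show ?thesis by (simp only: of_real_eq_iff)
    qed
    also have "ennreal \<dots> = (\<integral>\<^sup>+t. ennreal (\<integral>s. ?f (s, t) \<partial>M) \<partial>N)"
      using f0 by (intro nn_integral_eq_integral[symmetric] intN AE_I2 Bochner_Integration.integral_nonneg) auto
    also have "\<dots> = (\<integral>\<^sup>+t. (\<integral>\<^sup>+s. ennreal (?f (s, t)) \<partial>M) \<partial>N)"
      using f0 by (intro nn_integral_cong nn_integral_eq_integral[symmetric] intM) auto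
    also have "\<dots> \<le> (\<integral>\<^sup>+t. (\<integral>\<^sup>+s. ennreal (g (s, t)) \<partial>M) \<partial>N)"
      using g(2) k(2) k0 by (intro nn_integral_mono ennreal_leI) (simp add: mult_left_le)
    finally show "(\<integral>\<^sup>+x. ennreal (g x) * indicator Q x \<partial>P) \<le> (\<integral>\<^sup>+t. (\<integral>\<^sup>+s. ennreal (g (s, t)) \<partial>M) \<partial>N)" .
  qed
  finally show ?thesis .
qed

section \<open>Weighted tails, actions on the predual, and Fubini\<close>

context weighted_space
begin

text \<open>The density \<open>\<omega>\<close> turns \<open>M\<close> into a finite inner regular
  measure, for which the whole space is approximated by a compact set.\<close>

lemma weighted_tail:
  assumes M: "radon M" and fin: "(\<integral>\<^sup>+x. ennreal (\<omega> x) \<partial>M) < \<infinity>" and e: "(e::real) > 0"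
  obtains K where "compact K" "(\<integral>\<^sup>+x. ennreal (\<omega> x) * indicator (- K) x \<partial>M) \<le> ennreal e"
proof -
  let ?D = "density M (\<lambda>x. ennreal (\<omega> x))"
  have mw: "(\<lambda>x. ennreal (\<omega> x)) \<in> borel_measurable M" by (rule radon_measurable[OF M]) measurable
  have em: "emeasure ?D B = (\<integral>\<^sup>+x. ennreal (\<omega> x) * indicator B x \<partial>M)" if "B \<in> sets borel" for B
    using that M mw by (intro emeasure_density) auto
  have D: "radon ?D"
  proof (rule radon_density[OF M])
    show "(\<lambda>x. ennreal (\<omega> x)) \<in> borel_measurable borel" by measurable
    show "\<exists>c. \<forall>x\<in>K. ennreal (\<omega> x) \<le> ennreal c" if "compact K" for K
    proof -
      have "compact (\<omega> ` K)" using cont that by (meson compact_continuous_image continuous_on_subset subset_UNIV)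
      then have "bdd_above (\<omega> ` K)" by (rule bounded_imp_bdd_above[OF compact_imp_bounded])
      then show ?thesis by (auto simp: bdd_above_def intro: ennreal_leI)
    qed
  qed
  have "emeasure ?D UNIV < \<infinity>" using fin by (simp add: em)
  then obtain K where K: "compact K" "emeasure ?D (UNIV - K) < ennreal e"
    by (rule radon_approx[OF D _ _ e, of UNIV, rotated]) (auto intro: that)
  have "emeasure ?D (- K) = (\<integral>\<^sup>+x. ennreal (\<omega> x) * indicator (- K) x \<partial>M)"
    using compact_imp_closed[OF K(1)] by (intro em borel_open) (simp add: open_Compl)
  then show ?thesis using that[OF K(1)] K(2) by (simp add: Compl_eq_Diff_UNIV)
qed

text \<open>Approximability with error \<open>e * \<omega> x\<close> already gives continuity, since
  \<psi>/\<omega> is then a uniform limit of continuous functions.\<close>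

lemma E_closed':
  assumes "\<And>e. e > 0 \<Longrightarrow> \<exists>\<phi>\<in>E. \<forall>x. cmod (\<psi> x - \<phi> x) \<le> e * \<omega> x"
  shows "\<psi> \<in> E"
proof (rule E_closed[OF _ assms])
  have "\<forall>n::nat. \<exists>\<phi>\<in>E. \<forall>x. cmod (\<psi> x - \<phi> x) \<le> inverse (real (Suc n)) * \<omega> x"
    using assms by simp
  then obtain \<phi> where phi: "\<And>n::nat. \<phi> n \<in> E" "\<And>(n::nat) x. cmod (\<psi> x - \<phi> n x) \<le> inverse (real (Suc n)) * \<omega> x"
    by metis
  let ?s = "\<lambda>n x. \<phi> n x / of_real (\<omega> x)" and ?l = "\<lambda>x. \<psi> x / of_real (\<omega> x)"
  have d: "dist (?s n x) (?l x) \<le> inverse (real (Suc n))" for n x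
    using phi(2)[of x n] pos[of x]
    by (simp add: dist_norm diff_divide_distrib[symmetric] norm_divide divide_le_eq norm_minus_commute)
  have ul: "uniform_limit UNIV ?s ?l sequentially"
  proof (rule uniform_limitI)
    fix e :: real assume "e > 0"
    then obtain n where n: "inverse (real (Suc n)) < e" using reals_Archimedean by blast
    have "dist (?s m x) (?l x) < e" if "m \<ge> n" for m x
    proof -
      have "inverse (real (Suc m)) \<le> inverse (real (Suc n))" using that by (simp add: le_imp_inverse_le)
      then show ?thesis using d[of m x] n by linarith
    qed
    then show "eventually (\<lambda>m. \<forall>x\<in>UNIV. dist (?s m x) (?l x) < e) sequentially"
      unfolding eventually_sequentially by blast
  qed
  have sc: "continuous_on UNIV (?s n)" for n
    using nz by (intro continuous_on_divide E_continuous phi continuous_on_of_real cont) auto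
  have "continuous_on UNIV ?l"
    by (rule uniform_limit_theorem[OF _ ul]) (use sc in auto)
  then have "continuous_on UNIV (\<lambda>x. ?l x * of_real (\<omega> x))"
    by (intro continuous_on_mult continuous_on_of_real cont)
  then show "continuous_on UNIV \<psi>" using nz by simp
qed

text \<open>Covers the actions of a measure on the predual from either side: \<open>q\<close> is the group law or its opposite.\<close>

lemma action_in_E:
  fixes q :: "'a \<Rightarrow> 'a \<Rightarrow> 'a"
  assumes q: "continuous_on UNIV (\<lambda>x. q (fst x) (snd x))"
    and w: "\<And>s t. \<omega> (q s t) \<le> \<omega> s * \<omega> t"
    and proper: "\<And>K C. compact K \<Longrightarrow> compact C \<Longrightarrow> \<exists>D. compact D \<and> (\<forall>s\<in>K. \<forall>t. q s t \<in> C \<longrightarrow> t \<in> D)"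
    and M: "radon M" and fin: "(\<integral>\<^sup>+x. ennreal (\<omega> x) \<partial>M) < \<infinity>" and p: "\<psi> \<in> E"
  shows "(\<lambda>t. \<integral>s. \<psi> (q s t) \<partial>M) \<in> E"
proof (rule E_closed')
  fix e :: real assume e: "e > 0"
  define U where "U = (\<integral>x. \<omega> x \<partial>M)"
  have intw: "integrable M \<omega>"
    using fin radon_measurable[OF M meas] nonneg by (intro integrableI_nonneg) auto
  have U0: "0 \<le> U" unfolding U_def using nonneg by (intro Bochner_Integration.integral_nonneg) auto
  define B where "B = NE \<psi>"
  have B0: "0 \<le> B" unfolding B_def by (rule NE_nonneg[OF p])
  \<comment> \<open>Replacing \<open>\<psi>\<close> by \<open>f\<close> costs \<open>d * U\<close>,
    and discarding the tail of \<open>M\<close> off \<open>K\<close> costs at most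
    \<open>B * d\<close>, both relative to \<open>\<omega> t\<close>; the 1 excludes division by
    0.\<close>
  define d where "d = e / (U + B + 1)"
  have d: "d > 0" using e U0 B0 by (simp add: d_def add_nonneg_pos)
  obtain f where f: "f \<in> compactly_supported" "\<And>x. cmod (\<psi> x - f x) \<le> d * \<omega> x" "\<And>x. cmod (f x) \<le> cmod (\<psi> x)"
    by (rule E_approx_cs[OF p d], rule that)
  have fc: "continuous_on UNIV f" using f(1) by (simp add: compactly_supported_iff)
  obtain C where C: "compact C" "\<And>x. x \<notin> C \<Longrightarrow> f x = 0" using f(1) unfolding compactly_supported_iff by blast
  obtain K where K: "compact K" "(\<integral>\<^sup>+x. ennreal (\<omega> x) * indicator (- K) x \<partial>M) \<le> ennreal d"
    by (rule weighted_tail[OF M fin d], rule that)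
  have [measurable]: "K \<in> sets borel" using K(1) by (rule compact_borel)
  \<comment> \<open>For \<open>s\<close> in \<open>K\<close> the value \<open>f (q s t)\<close>
    vanishes unless \<open>t\<close> lies in \<open>D\<close>, so the integral truncated to
    \<open>K\<close> has compact support.\<close>
  obtain D where D: "compact D" "\<forall>s\<in>K. \<forall>t. q s t \<in> C \<longrightarrow> t \<in> D" using proper[OF K(1) C(1)] by blast
  let ?\<phi> = "\<lambda>t. \<integral>s. indicator K s *\<^sub>R f (q s t) \<partial>M"
  have "continuous_on UNIV (\<lambda>x. f (q (fst x) (snd x)))"
    by (rule continuous_on_compose2[OF fc q]) simp
  from continuous_section_integral[OF M K(1) this] have "continuous_on UNIV ?\<phi>" by simp
  moreover have "?\<phi> t = 0" if "t \<notin> D" for t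
  proof -
    have z: "indicator K s *\<^sub>R f (q s t) = 0" for s using D(2) C(2)[of "q s t"] that by (auto simp: indicator_def)
    show ?thesis unfolding z by simp
  qed
  ultimately have phi: "?\<phi> \<in> compactly_supported" unfolding compactly_supported_iff using D(1) by blast
  have qm: "(\<lambda>s. q s t) \<in> borel_measurable borel" for t
    using borel_measurable_continuous_onI[OF continuous_on_section1[OF q, of t]] by simp
  have pm: "(\<lambda>s. \<psi> (q s t)) \<in> borel_measurable borel" and fm[measurable]: "(\<lambda>s. f (q s t)) \<in> borel_measurable borel" for t
    using measurable_compose[OF qm borel_measurable_continuous_onI] E_continuous[OF p] fc by blast+
  have wq: "a * \<omega> (q s t) \<le> (a * \<omega> t) * \<omega> s" if "a \<ge> 0" for a s t
    using mult_left_mono[OF w that, of s t] by (simp add: ac_simps)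
  have le1: "cmod (\<psi> (q s t)) \<le> (B * \<omega> t) * \<omega> s" for s t
    using E_le[OF p, of "q s t"] wq[OF B0, of s t] unfolding B_def by linarith
  have le2: "cmod (f (q s t)) \<le> (B * \<omega> t) * \<omega> s" for s t
    using f(3)[of "q s t"] le1[of s t] by linarith
  have i1: "integrable M (\<lambda>s. \<psi> (q s t))" for t
    by (rule integrable_dominated[OF M fin pm le1])
  have i2: "integrable M (\<lambda>s. indicator K s *\<^sub>R f (q s t))" for t
  proof (rule integrable_dominated[OF M fin])
    show "(\<lambda>s. indicator K s *\<^sub>R f (q s t)) \<in> borel_measurable borel" by measurable
    show "cmod (indicator K s *\<^sub>R f (q s t)) \<le> (B * \<omega> t) * \<omega> s" for s
      using le2[of s t] order_trans[OF norm_ge_zero le2[of s t]] by (auto simp: indicator_def)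
  qed
  have it: "integrable M (\<lambda>s. \<omega> s * indicator (- K) s)"
    using integrable_mult_indicator[OF _ intw, of "- K"] M by (simp add: mult.commute compact_borel[OF K(1)] sets.compl_sets[of K borel, simplified] Compl_eq_Diff_UNIV)
  have tail: "(\<integral>s. \<omega> s * indicator (- K) s \<partial>M) \<le> d"
  proof -
    have "ennreal (\<integral>s. \<omega> s * indicator (- K) s \<partial>M) = (\<integral>\<^sup>+s. ennreal (\<omega> s * indicator (- K) s) \<partial>M)"
      using nonneg by (intro nn_integral_eq_integral[symmetric] it) auto
    also have "\<dots> = (\<integral>\<^sup>+x. ennreal (\<omega> x) * indicator (- K) x \<partial>M)"
      by (intro nn_integral_cong) (auto simp: indicator_def)
    also have "\<dots> \<le> ennreal d" by (rule K(2))
    finally show ?thesis by (simp only: ennreal_le_iff[OF less_imp_le[OF d]])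
  qed
  have "cmod ((\<integral>s. \<psi> (q s t) \<partial>M) - ?\<phi> t) \<le> e * \<omega> t" for t
  proof -
    have "cmod ((\<integral>s. \<psi> (q s t) \<partial>M) - ?\<phi> t) = cmod (\<integral>s. \<psi> (q s t) - indicator K s *\<^sub>R f (q s t) \<partial>M)"
      using i1 i2 by (simp add: Bochner_Integration.integral_diff)
    also have "\<dots> \<le> (\<integral>s. cmod (\<psi> (q s t) - indicator K s *\<^sub>R f (q s t)) \<partial>M)" by (rule integral_norm_bound)
    also have "\<dots> \<le> (\<integral>s. (d * \<omega> t) * \<omega> s + (B * \<omega> t) * (\<omega> s * indicator (- K) s) \<partial>M)"
    proof (intro integral_mono integrable_norm Bochner_Integration.integrable_diff i1 i2
        Bochner_Integration.integrable_add integrable_mult_right intw it)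
      fix s
      show "cmod (\<psi> (q s t) - indicator K s *\<^sub>R f (q s t)) \<le> (d * \<omega> t) * \<omega> s + (B * \<omega> t) * (\<omega> s * indicator (- K) s)"
      proof (cases "s \<in> K")
        case True
        then show ?thesis using f(2)[of "q s t"] wq[of d s t] d by (simp add: order_trans)
      next
        case False
        have "0 \<le> (d * \<omega> t) * \<omega> s" using d nonneg by simp
        then show ?thesis using False le1[of s t] by simp
      qed
    qed
    also have "\<dots> = (d * \<omega> t) * U + (B * \<omega> t) * (\<integral>s. \<omega> s * indicator (- K) s \<partial>M)"
      unfolding U_def using intw it by (subst Bochner_Integration.integral_add) auto
    also have "\<dots> \<le> (d * \<omega> t) * U + (B * \<omega> t) * d"
      using tail B0 nonneg by (intro add_left_mono mult_left_mono) auto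
    also have "\<dots> = \<omega> t * (d * (U + B))" by (simp add: algebra_simps)
    also have "\<dots> \<le> \<omega> t * (d * (U + B + 1))" using d nonneg by (intro mult_left_mono) auto
    also have "d * (U + B + 1) = e" using U0 B0 by (simp add: d_def)
    finally show ?thesis by (simp add: mult.commute)
  qed
  then show "\<exists>\<phi>\<in>E. \<forall>x. cmod ((\<integral>s. \<psi> (q s x) \<partial>M) - \<phi> x) \<le> e * \<omega> x"
    by (intro bexI[OF _ cs_in_E[OF phi]] allI)
qed

text \<open>For remainders that live off the rectangle \<open>K \<times> L\<close>: there one of the
  coordinates is in a tail, and the sum of the two complementary indicators splits the bound into
  two terms with separated variables.\<close>

lemma iterated_nn_bound:
  assumes M: "radon M" and N: "radon N"
    and K: "compact K" "(\<integral>\<^sup>+x. ennreal (\<omega> x) * indicator (- K) x \<partial>M) \<le> a"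
    and L: "compact L" "(\<integral>\<^sup>+x. ennreal (\<omega> x) * indicator (- L) x \<partial>N) \<le> b"
    and le: "\<And>s t. r (s, t) \<le> C * \<omega> s * \<omega> t * (indicator (- K) s + indicator (- L) t)" and C: "C \<ge> 0"
  shows "(\<integral>\<^sup>+t. (\<integral>\<^sup>+s. ennreal (r (s, t)) \<partial>M) \<partial>N) \<le>
    ennreal C * (a * (\<integral>\<^sup>+x. ennreal (\<omega> x) \<partial>N) + (\<integral>\<^sup>+x. ennreal (\<omega> x) \<partial>M) * b)"
proof -
  let ?w = "\<lambda>x. ennreal (\<omega> x)"
  have KL[measurable]: "- K \<in> sets borel" "- L \<in> sets borel" using compact_borel[OF K(1)] compact_borel[OF L(1)] by auto
  have mM: "g \<in> borel_measurable M" and mN: "g \<in> borel_measurable N" if "g \<in> borel_measurable borel" for g :: "'a \<Rightarrow> ennreal"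
    using radon_measurable[OF M that] radon_measurable[OF N that] .
  have inner: "(\<integral>\<^sup>+s. ennreal (r (s, t)) \<partial>M) \<le> ennreal C * (?w t * a + (\<integral>\<^sup>+x. ?w x \<partial>M) * (?w t * indicator (- L) t))" for t
  proof -
    have "(\<integral>\<^sup>+s. ennreal (r (s, t)) \<partial>M) \<le>
        (\<integral>\<^sup>+s. ennreal C * (?w t * (?w s * indicator (- K) s) + (?w t * indicator (- L) t) * ?w s) \<partial>M)"
    proof (rule nn_integral_mono)
      fix s
      have "ennreal (r (s, t)) \<le> ennreal (C * (\<omega> t * (\<omega> s * indicator (- K) s) + (\<omega> t * indicator (- L) t) * \<omega> s))"
        using le[of s t] by (intro ennreal_leI) (simp add: algebra_simps)
      also have "\<dots> = ennreal C * (?w t * (?w s * indicator (- K) s) + (?w t * indicator (- L) t) * ?w s)"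
        using C nonneg by (simp add: ennreal_mult ennreal_plus ennreal_indicator)
      finally show "ennreal (r (s, t)) \<le> \<dots>" .
    qed
    also have "\<dots> = ennreal C * (?w t * (\<integral>\<^sup>+s. ?w s * indicator (- K) s \<partial>M) + (?w t * indicator (- L) t) * (\<integral>\<^sup>+s. ?w s \<partial>M))"
    proof -
      have [measurable]: "?w \<in> borel_measurable M" "(\<lambda>s. ?w s * indicator (- K) s) \<in> borel_measurable M"
        by (auto intro!: mM)
      show ?thesis by (simp add: nn_integral_cmult nn_integral_add)
    qed
    also have "\<dots> \<le> ennreal C * (?w t * a + (?w t * indicator (- L) t) * (\<integral>\<^sup>+s. ?w s \<partial>M))"
      using K(2) by (intro mult_left_mono add_right_mono) auto
    finally show ?thesis by (simp add: ac_simps)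
  qed
  have "(\<integral>\<^sup>+t. (\<integral>\<^sup>+s. ennreal (r (s, t)) \<partial>M) \<partial>N) \<le>
     (\<integral>\<^sup>+t. ennreal C * (a * ?w t + (\<integral>\<^sup>+x. ?w x \<partial>M) * (?w t * indicator (- L) t)) \<partial>N)"
    using inner by (intro nn_integral_mono) (simp add: ac_simps)
  also have "\<dots> = ennreal C * (a * (\<integral>\<^sup>+t. ?w t \<partial>N) + (\<integral>\<^sup>+x. ?w x \<partial>M) * (\<integral>\<^sup>+t. ?w t * indicator (- L) t \<partial>N))"
  proof -
    have [measurable]: "?w \<in> borel_measurable N" "(\<lambda>s. ?w s * indicator (- L) s) \<in> borel_measurable N"
      by (auto intro!: mN)
    show ?thesis by (simp add: nn_integral_cmult nn_integral_add)
  qed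
  also have "\<dots> \<le> ennreal C * (a * (\<integral>\<^sup>+x. ?w x \<partial>N) + (\<integral>\<^sup>+x. ?w x \<partial>M) * b)"
    using L(2) by (intro mult_left_mono add_left_mono) auto
  finally show ?thesis .
qed

text \<open>The error is measured by an iterated nonnegative integral, so that joint measurability
  on the product is not involved.\<close>

lemma iterated_close:
  fixes g f :: "'a \<times> 'a \<Rightarrow> complex"
  assumes M: "radon M" and N: "radon N"
    and ig: "\<And>t. integrable M (\<lambda>s. g (s, t))" "integrable N (\<lambda>t. \<integral>s. g (s, t) \<partial>M)"
    and i_f: "\<And>t. integrable M (\<lambda>s. f (s, t))" "integrable N (\<lambda>t. \<integral>s. f (s, t) \<partial>M)"
    and bound: "(\<integral>\<^sup>+t. (\<integral>\<^sup>+s. ennreal (cmod (g (s, t) - f (s, t))) \<partial>M) \<partial>N) \<le> ennreal d" and d: "0 \<le> d"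
  shows "cmod ((\<integral>t. (\<integral>s. g (s, t) \<partial>M) \<partial>N) - (\<integral>t. (\<integral>s. f (s, t) \<partial>M) \<partial>N)) \<le> d"
proof -
  have eq: "(\<integral>t. (\<integral>s. g (s, t) \<partial>M) \<partial>N) - (\<integral>t. (\<integral>s. f (s, t) \<partial>M) \<partial>N) = (\<integral>t. (\<integral>s. g (s, t) - f (s, t) \<partial>M) \<partial>N)"
    using ig i_f by (simp add: Bochner_Integration.integral_diff)
  have int: "integrable N (\<lambda>t. \<integral>s. g (s, t) - f (s, t) \<partial>M)"
    using ig i_f by (simp add: Bochner_Integration.integral_diff)
  have "ennreal (cmod ((\<integral>t. (\<integral>s. g (s, t) \<partial>M) \<partial>N) - (\<integral>t. (\<integral>s. f (s, t) \<partial>M) \<partial>N)))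
      \<le> (\<integral>\<^sup>+t. ennreal (cmod (\<integral>s. g (s, t) - f (s, t) \<partial>M)) \<partial>N)"
    unfolding eq by (rule integral_norm_bound_ennreal[OF int])
  also have "\<dots> \<le> (\<integral>\<^sup>+t. (\<integral>\<^sup>+s. ennreal (cmod (g (s, t) - f (s, t))) \<partial>M) \<partial>N)"
    by (intro nn_integral_mono integral_norm_bound_ennreal Bochner_Integration.integrable_diff ig(1) i_f(1))
  also have "\<dots> \<le> ennreal d" by (rule bound)
  finally show ?thesis using d by (simp add: ennreal_le_iff)
qed

text \<open>With the group law present, \<open>\<omega> s * \<omega> t\<close> dominates the weight
  of the product of \<open>s\<close> and \<open>t\<close>; its integrability thus controls the image
  of \<open>P\<close>.\<close>

lemma product_weight:
  assumes M: "radon M" "(\<integral>\<^sup>+x. ennreal (\<omega> x) \<partial>M) < \<infinity>" and N: "radon N" "(\<integral>\<^sup>+x. ennreal (\<omega> x) \<partial>N) < \<infinity>"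
    and P: "radon P" and prod: "\<And>f. f \<in> compactly_supported \<Longrightarrow> (\<integral>x. f x \<partial>P) = (\<integral>t. (\<integral>s. f (s, t) \<partial>M) \<partial>N)"
  shows "(\<integral>\<^sup>+x. ennreal (\<omega> (fst x) * \<omega> (snd x)) \<partial>P) < \<infinity>"
proof -
  have "(\<integral>\<^sup>+x. ennreal (\<omega> (fst x) * \<omega> (snd x)) \<partial>P) \<le> (\<integral>\<^sup>+t. (\<integral>\<^sup>+s. ennreal (\<omega> (fst (s, t)) * \<omega> (snd (s, t))) \<partial>M) \<partial>N)"
    using nonneg
    by (intro product_nn_integral_le[OF lc lc M(1) N(1) P prod])
       (auto intro!: continuous_on_mult continuous_on_compose2[OF cont] continuous_on_fst continuous_on_snd continuous_on_id)
  also have "\<dots> = (\<integral>\<^sup>+t. (\<integral>\<^sup>+s. ennreal (\<omega> t) * ennreal (\<omega> s) \<partial>M) \<partial>N)"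
    using nonneg by (simp add: ennreal_mult mult.commute)
  also have "\<dots> = (\<integral>\<^sup>+t. (\<integral>\<^sup>+s. ennreal (\<omega> s) \<partial>M) * ennreal (\<omega> t) \<partial>N)"
    using radon_measurable[OF M(1) meas] by (simp add: nn_integral_cmult mult.commute)
  also have "\<dots> = (\<integral>\<^sup>+s. ennreal (\<omega> s) \<partial>M) * (\<integral>\<^sup>+t. ennreal (\<omega> t) \<partial>N)"
    using radon_measurable[OF N(1) meas] by (intro nn_integral_cmult) auto
  also have "\<dots> < \<infinity>" using M(2) N(2) by (simp add: ennreal_mult_less_top)
  finally show ?thesis .
qed

text \<open>By truncation to compact rectangles.\<close>

lemma product_fubini:
  fixes g :: "'a \<times> 'a \<Rightarrow> complex"
  assumes M: "radon M" "(\<integral>\<^sup>+x. ennreal (\<omega> x) \<partial>M) < \<infinity>" and N: "radon N" "(\<integral>\<^sup>+x. ennreal (\<omega> x) \<partial>N) < \<infinity>"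
    and P: "radon P" and prod: "\<And>f. f \<in> compactly_supported \<Longrightarrow> (\<integral>x. f x \<partial>P) = (\<integral>t. (\<integral>s. f (s, t) \<partial>M) \<partial>N)"
    and g: "continuous_on UNIV g" "\<And>s t. cmod (g (s, t)) \<le> C * \<omega> s * \<omega> t" and C: "C \<ge> 0"
    and j1: "integrable N (\<lambda>t. \<integral>s. g (s, t) \<partial>M)" and j2: "integrable M (\<lambda>s. \<integral>t. g (s, t) \<partial>N)"
  shows "integrable P g" and "(\<integral>x. g x \<partial>P) = (\<integral>t. (\<integral>s. g (s, t) \<partial>M) \<partial>N)"
    and "(\<integral>t. (\<integral>s. g (s, t) \<partial>M) \<partial>N) = (\<integral>s. (\<integral>t. g (s, t) \<partial>N) \<partial>M)"
proof -
  let ?U = "\<integral>\<^sup>+x. ennreal (\<omega> x) \<partial>M" and ?V = "\<integral>\<^sup>+x. ennreal (\<omega> x) \<partial>N"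
  have wc: "continuous_on UNIV (\<lambda>x. \<omega> (fst x) * \<omega> (snd x))"
    by (auto intro!: continuous_on_mult continuous_on_compose2[OF cont] continuous_on_fst continuous_on_snd continuous_on_id)
  have wP: "integrable P (\<lambda>x. \<omega> (fst x) * \<omega> (snd x))"
    using product_weight[OF M N P prod] nonneg radon_measurable[OF P borel_measurable_continuous_onI[OF wc]]
    by (intro integrableI_nonneg) auto
  show gP: "integrable P g"
  proof (rule Bochner_Integration.integrable_bound)
    show "integrable P (\<lambda>x. C * (\<omega> (fst x) * \<omega> (snd x)))" using wP by simp
    show "g \<in> borel_measurable P" by (rule radon_measurable[OF P borel_measurable_continuous_onI[OF g(1)]])
    show "AE x in P. norm (g x) \<le> norm (C * (\<omega> (fst x) * \<omega> (snd x)))"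
    proof (rule AE_I2)
      fix x :: "'a \<times> 'a"
      have "norm (g x) \<le> C * (\<omega> (fst x) * \<omega> (snd x))" using g(2)[of "fst x" "snd x"] by (simp add: mult.assoc)
      then show "norm (g x) \<le> norm (C * (\<omega> (fst x) * \<omega> (snd x)))" using abs_ge_self order_trans unfolding real_norm_def by blast
    qed
  qed
  have gl1: "cmod (g (s, t)) \<le> (C * \<omega> t) * \<omega> s" and gl2: "cmod (g (s, t)) \<le> (C * \<omega> s) * \<omega> t" for s t
    using g(2)[of s t] by (simp_all add: ac_simps)
  have ig1: "integrable M (\<lambda>s. g (s, t))" for t
    by (rule integrable_dominated[OF M borel_measurable_continuous_onI[OF continuous_on_section1[OF g(1)]] gl1])
  have ig2: "integrable N (\<lambda>t. g (s, t))" for s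
    by (rule integrable_dominated[OF N borel_measurable_continuous_onI[OF continuous_on_section2[OF g(1)]] gl2])
  obtain u where u: "?U = ennreal u" "u \<ge> 0" using M(2) by (cases ?U) auto
  obtain v where v: "?V = ennreal v" "v \<ge> 0" using N(2) by (cases ?V) auto
  \<comment> \<open>Multiplying \<open>g\<close> by a cutoff changes the integral over
    \<open>P\<close> and both iterated integrals by at most \<open>C * (e * v + u * e)\<close>. For
    the cut-off function all three agree, so each comparison costs two such errors.\<close>
  have key: "cmod ((\<integral>x. g x \<partial>P) - (\<integral>t. (\<integral>s. g (s, t) \<partial>M) \<partial>N)) \<le> 2 * (C * (e * v + u * e)) \<and>
     cmod ((\<integral>t. (\<integral>s. g (s, t) \<partial>M) \<partial>N) - (\<integral>s. (\<integral>t. g (s, t) \<partial>N) \<partial>M)) \<le> 2 * (C * (e * v + u * e))"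
    if e: "e > 0" for e
  proof -
    obtain K where K: "compact K" "(\<integral>\<^sup>+x. ennreal (\<omega> x) * indicator (- K) x \<partial>M) \<le> ennreal e"
      by (rule weighted_tail[OF M e], rule that)
    obtain L where L: "compact L" "(\<integral>\<^sup>+x. ennreal (\<omega> x) * indicator (- L) x \<partial>N) \<le> ennreal e"
      by (rule weighted_tail[OF N e], rule that)
    obtain k D where k: "k \<in> nonneg_cs" "\<And>x. k x \<le> 1" "\<And>x. x \<in> K \<times> L \<Longrightarrow> k x = 1"
      by (rule urysohn[OF locally_compact_euclidean_prod[OF lc lc] compact_Times[OF K(1) L(1)] subset_UNIV open_UNIV], rule that)
    have k0: "0 \<le> k x" for x by (rule nonneg_csD(2)[OF k(1)])
    have kc: "continuous_on UNIV k" by (rule nonneg_csD(1)[OF k(1)])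
    let ?f = "\<lambda>x. g x * of_real (k x)"
    have f: "?f \<in> compactly_supported"
      by (rule compactly_supported_dominated[OF compactly_supported_of_real[OF k(1)]])
         (auto intro!: continuous_on_mult g(1) continuous_on_of_real kc)
    let ?w = "\<lambda>x. C * (\<omega> (fst x) * \<omega> (snd x)) * (1 - k x)"
    have wcont: "continuous_on UNIV ?w"
      by (intro continuous_on_mult continuous_on_diff continuous_on_const wc kc)
    have w0: "0 \<le> ?w x" for x using C nonneg k(2)[of x] by simp
    have gf: "cmod (g x - ?f x) \<le> ?w x" for x
    proof -
      have "g x - ?f x = g x * of_real (1 - k x)" by (simp add: algebra_simps)
      then have "cmod (g x - ?f x) = cmod (g x) * (1 - k x)"
        using k(2)[of x] by (simp only: norm_mult norm_of_real)
      also have "\<dots> \<le> ?w x"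
        using g(2)[of "fst x" "snd x"] k(2)[of x] by (intro mult_right_mono) (auto simp: mult.assoc)
      finally show ?thesis .
    qed
    have wle: "?w (s, t) \<le> C * \<omega> s * \<omega> t * (indicator (- K) s + indicator (- L) t)" for s t
    proof -
      have "1 - k (s, t) \<le> indicator (- K) s + indicator (- L) t"
        using k(3)[of "(s, t)"] k0[of "(s, t)"] by (auto simp: indicator_def)
      then have "?w (s, t) \<le> C * (\<omega> s * \<omega> t) * (indicator (- K) s + indicator (- L) t)"
        using C nonneg by (simp add: mult_left_mono)
      then show ?thesis by (simp add: mult.assoc)
    qed
    have d0: "0 \<le> C * (e * v + u * e)" using C e u v by simp
    have dd: "ennreal C * (ennreal e * ?V + ?U * ennreal e) = ennreal (C * (e * v + u * e))"
      using C e u(2) v(2) unfolding u(1) v(1) by (simp add: ennreal_mult ennreal_plus)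
    have b1: "(\<integral>\<^sup>+t. (\<integral>\<^sup>+s. ennreal (?w (s, t)) \<partial>M) \<partial>N) \<le> ennreal (C * (e * v + u * e))"
      using iterated_nn_bound[OF M(1) N(1) K L wle C] unfolding dd .
    \<comment> \<open>The same bound with exchanged coordinates, so that
      \<open>iterated_nn_bound\<close> also covers the other order of integration.\<close>
    have wle': "(case (t, s) of (t, s) \<Rightarrow> ?w (s, t)) \<le> C * \<omega> t * \<omega> s * (indicator (- L) t + indicator (- K) s)" for s t
      using wle[of s t] by (simp add: ac_simps)
    have "(\<integral>\<^sup>+s. (\<integral>\<^sup>+t. ennreal (?w (s, t)) \<partial>N) \<partial>M) \<le> ennreal C * (ennreal e * ?U + ?V * ennreal e)"
      using iterated_nn_bound[OF N(1) M(1) L K wle' C] by (simp only: prod.case)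
    also have "\<dots> = ennreal C * (ennreal e * ?V + ?U * ennreal e)" by (simp add: ac_simps)
    finally have b2: "(\<integral>\<^sup>+s. (\<integral>\<^sup>+t. ennreal (?w (s, t)) \<partial>N) \<partial>M) \<le> ennreal (C * (e * v + u * e))"
      unfolding dd .
    have fP: "integrable P ?f" by (rule compactly_supported_integrable[OF P f])
    have "ennreal (cmod ((\<integral>x. g x \<partial>P) - (\<integral>x. ?f x \<partial>P))) = ennreal (cmod (\<integral>x. g x - ?f x \<partial>P))"
      using gP fP by (simp add: Bochner_Integration.integral_diff)
    also have "\<dots> \<le> (\<integral>\<^sup>+x. ennreal (cmod (g x - ?f x)) \<partial>P)"
      by (intro integral_norm_bound_ennreal Bochner_Integration.integrable_diff gP fP)
    also have "\<dots> \<le> (\<integral>\<^sup>+x. ennreal (?w x) \<partial>P)" by (intro nn_integral_mono ennreal_leI gf)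
    also have "\<dots> \<le> (\<integral>\<^sup>+t. (\<integral>\<^sup>+s. ennreal (?w (s, t)) \<partial>M) \<partial>N)"
      by (rule product_nn_integral_le[OF lc lc M(1) N(1) P prod wcont w0])
    also note b1
    finally have 0: "cmod ((\<integral>x. g x \<partial>P) - (\<integral>x. ?f x \<partial>P)) \<le> C * (e * v + u * e)"
      using d0 by (simp add: ennreal_le_iff)
    have 1: "cmod ((\<integral>t. (\<integral>s. g (s, t) \<partial>M) \<partial>N) - (\<integral>t. (\<integral>s. ?f (s, t) \<partial>M) \<partial>N)) \<le> C * (e * v + u * e)"
    proof (rule iterated_close[OF M(1) N(1) ig1 j1 _ _ _ d0])
      show "integrable M (\<lambda>s. ?f (s, t))" for t
        by (rule compactly_supported_integrable[OF M(1) compactly_supported_section1[OF f]])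
      show "integrable N (\<lambda>t. \<integral>s. ?f (s, t) \<partial>M)"
        by (rule compactly_supported_integrable[OF N(1) compactly_supported_section_integral[OF M(1) f]])
      have "(\<integral>\<^sup>+t. (\<integral>\<^sup>+s. ennreal (cmod (g (s, t) - ?f (s, t))) \<partial>M) \<partial>N) \<le> (\<integral>\<^sup>+t. (\<integral>\<^sup>+s. ennreal (?w (s, t)) \<partial>M) \<partial>N)"
        by (intro nn_integral_mono ennreal_leI gf)
      then show "(\<integral>\<^sup>+t. (\<integral>\<^sup>+s. ennreal (cmod (g (s, t) - ?f (s, t))) \<partial>M) \<partial>N) \<le> ennreal (C * (e * v + u * e))"
        using b1 by (rule order_trans)
    qed
    have 2: "cmod ((\<integral>s. (\<integral>t. g (s, t) \<partial>N) \<partial>M) - (\<integral>s. (\<integral>t. ?f (s, t) \<partial>N) \<partial>M)) \<le> C * (e * v + u * e)"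
    proof -
      let ?g' = "\<lambda>(t, s). g (s, t)" and ?f' = "\<lambda>(t, s). ?f (s, t)"
      have f': "?f' \<in> compactly_supported" by (rule compactly_supported_swap[OF f])
      have "cmod ((\<integral>s. (\<integral>t. ?g' (t, s) \<partial>N) \<partial>M) - (\<integral>s. (\<integral>t. ?f' (t, s) \<partial>N) \<partial>M)) \<le> C * (e * v + u * e)"
      proof (rule iterated_close[OF N(1) M(1) _ _ _ _ _ d0])
        show "integrable N (\<lambda>t. ?g' (t, s))" for s using ig2 by simp
        show "integrable M (\<lambda>s. \<integral>t. ?g' (t, s) \<partial>N)" using j2 by simp
        show "integrable N (\<lambda>t. ?f' (t, s))" for s
          by (rule compactly_supported_integrable[OF N(1) compactly_supported_section1[OF f']])
        show "integrable M (\<lambda>s. \<integral>t. ?f' (t, s) \<partial>N)"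
          by (rule compactly_supported_integrable[OF M(1) compactly_supported_section_integral[OF N(1) f']])
        have "(\<integral>\<^sup>+s. (\<integral>\<^sup>+t. ennreal (cmod (g (s, t) - ?f (s, t))) \<partial>N) \<partial>M) \<le> (\<integral>\<^sup>+s. (\<integral>\<^sup>+t. ennreal (?w (s, t)) \<partial>N) \<partial>M)"
          by (intro nn_integral_mono ennreal_leI gf)
        also note b2
        finally show "(\<integral>\<^sup>+s. (\<integral>\<^sup>+t. ennreal (cmod (?g' (t, s) - ?f' (t, s))) \<partial>N) \<partial>M) \<le> ennreal (C * (e * v + u * e))"
          by simp
      qed
      then show ?thesis by simp
    qed
    have eq1: "(\<integral>x. ?f x \<partial>P) = (\<integral>t. (\<integral>s. ?f (s, t) \<partial>M) \<partial>N)" by (rule prod[OF f])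
    have eq2: "(\<integral>t. (\<integral>s. ?f (s, t) \<partial>M) \<partial>N) = (\<integral>s. (\<integral>t. ?f (s, t) \<partial>N) \<partial>M)"
      by (rule iterated_integral_swap[OF M(1) N(1) f])
    show ?thesis
      using dist_triangle2[of "\<integral>x. g x \<partial>P" "\<integral>t. (\<integral>s. g (s, t) \<partial>M) \<partial>N" "\<integral>x. ?f x \<partial>P"] 0 1 2
        dist_triangle2[of "\<integral>t. (\<integral>s. g (s, t) \<partial>M) \<partial>N" "\<integral>s. (\<integral>t. g (s, t) \<partial>N) \<partial>M" "\<integral>x. ?f x \<partial>P"]
      unfolding dist_norm eq1 eq2[symmetric] by linarith
  qed
  have z: "x = 0" if h: "\<And>e. e > 0 \<Longrightarrow> cmod x \<le> 2 * (C * (e * v + u * e))" for x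
  proof -
    have "cmod x \<le> 0 + e" if e: "e > 0" for e
    proof -
      \<comment> \<open>The bound is \<open>r * e\<close>; \<open>r + 1\<close> serves as a divisor
        that is positive even when \<open>r\<close> is 0.\<close>
      define r where "r = 2 * (C * (v + u))"
      have r: "r + 1 > 0" using C u v by (simp add: r_def add_nonneg_pos)
      define a where "a = e / (r + 1)"
      have a: "a > 0" using e r by (simp add: a_def)
      have "cmod x \<le> 2 * (C * (a * v + u * a))" by (rule h[OF a])
      also have "\<dots> = r * a" by (simp add: r_def algebra_simps)
      also have "\<dots> \<le> (r + 1) * a" using a by (intro mult_right_mono) auto
      also have "\<dots> = e" using less_imp_neq[OF r] by (simp add: a_def)
      finally show ?thesis by simp
    qed
    then have "cmod x \<le> 0" by (rule field_le_epsilon)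
    then show ?thesis by simp
  qed
  show "(\<integral>x. g x \<partial>P) = (\<integral>t. (\<integral>s. g (s, t) \<partial>M) \<partial>N)"
    using z[of "(\<integral>x. g x \<partial>P) - (\<integral>t. (\<integral>s. g (s, t) \<partial>M) \<partial>N)"] key by auto
  show "(\<integral>t. (\<integral>s. g (s, t) \<partial>M) \<partial>N) = (\<integral>s. (\<integral>t. g (s, t) \<partial>N) \<partial>M)"
    using z[of "(\<integral>t. (\<integral>s. g (s, t) \<partial>M) \<partial>N) - (\<integral>s. (\<integral>t. g (s, t) \<partial>N) \<partial>M)"] key by auto
qed

end

section \<open>Convolution\<close>

text \<open>Unions direct the compact subsets, so an event for the infimum of principal filters is
  witnessed by a single one of them.\<close>

lemma eventually_compact_subsets:
  fixes A :: "'a::t2_space set"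
  shows "eventually Q (compact_subsets_at_top A) \<longleftrightarrow>
    (\<exists>K. compact K \<and> K \<subseteq> A \<and> (\<forall>C. compact C \<and> K \<subseteq> C \<and> C \<subseteq> A \<longrightarrow> Q C))"
  unfolding compact_subsets_at_top_def
proof (subst eventually_INF_base)
  show "{K. compact K \<and> K \<subseteq> A} \<noteq> {}" by (auto intro: exI[of _ "{}"])
  fix K L assume "K \<in> {K. compact K \<and> K \<subseteq> A}" "L \<in> {K. compact K \<and> K \<subseteq> A}"
  then show "\<exists>x\<in>{K. compact K \<and> K \<subseteq> A}. principal {C. compact C \<and> x \<subseteq> C \<and> C \<subseteq> A} \<le>
      inf (principal {C. compact C \<and> K \<subseteq> C \<and> C \<subseteq> A}) (principal {C. compact C \<and> L \<subseteq> C \<and> C \<subseteq> A})"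
    by (intro bexI[of _ "K \<union> L"]) (auto simp: compact_Un)
qed (auto simp: eventually_principal)

lemma compact_subsets_at_top_neq_bot: "compact_subsets_at_top A \<noteq> bot" for A :: "'a::t2_space set"
  unfolding trivial_limit_def eventually_compact_subsets by blast

locale beurling_weight = weighted_space \<omega>
  for \<omega> :: "'g::{topological_group_add, t2_space} \<Rightarrow> real" +
  assumes submult: "\<And>s t. \<omega> (s + t) \<le> \<omega> s * \<omega> t"
begin

section \<open>The two actions on the predual\<close>

lemma action_left:
  assumes M: "radon M" and fin: "(\<integral>\<^sup>+x. ennreal (\<omega> x) \<partial>M) < \<infinity>" and p: "\<psi> \<in> E"
  shows "(\<lambda>t. \<integral>s. \<psi> (s + t) \<partial>M) \<in> E"
proof (rule action_in_E[OF _ submult _ M fin p])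
  show "continuous_on UNIV (\<lambda>x::'g \<times> 'g. fst x + snd x)" by (intro continuous_on_add continuous_on_fst continuous_on_snd continuous_on_id)
  fix K C :: "'g set" assume K: "compact K" "compact C"
  \<comment> \<open>Here \<open>t = - s + (s + t)\<close>; the order of the summands matters, as the
    group may be noncommutative.\<close>
  let ?D = "(\<lambda>x. - fst x + snd x) ` (K \<times> C)"
  have "compact ?D"
    using K by (intro compact_continuous_image compact_Times continuous_on_add continuous_on_minus continuous_on_fst continuous_on_snd continuous_on_id)
  moreover have "t \<in> ?D" if "s \<in> K" "s + t \<in> C" for s t
    using that by (intro image_eqI[of _ _ "(s, s + t)"]) (auto simp: add.assoc[symmetric])
  ultimately show "\<exists>D. compact D \<and> (\<forall>s\<in>K. \<forall>t. s + t \<in> C \<longrightarrow> t \<in> D)" by blast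
qed

lemma action_right:
  assumes M: "radon M" and fin: "(\<integral>\<^sup>+x. ennreal (\<omega> x) \<partial>M) < \<infinity>" and p: "\<psi> \<in> E"
  shows "(\<lambda>s. \<integral>t. \<psi> (s + t) \<partial>M) \<in> E"
proof (rule action_in_E[where q = "\<lambda>t s. s + t", OF _ _ _ M fin p])
  show "continuous_on UNIV (\<lambda>x::'g \<times> 'g. snd x + fst x)" by (intro continuous_on_add continuous_on_fst continuous_on_snd continuous_on_id)
  show "\<omega> (s + t) \<le> \<omega> t * \<omega> s" for s t using submult[of s t] by (simp add: mult.commute)
  fix K C :: "'g set" assume K: "compact K" "compact C"
  \<comment> \<open>The integration variable \<open>t\<close> is now the right summand, so
    \<open>- t\<close> is added on the right.\<close>
  let ?D = "(\<lambda>x. snd x + - fst x) ` (K \<times> C)"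
  have "compact ?D"
    using K by (intro compact_continuous_image compact_Times continuous_on_add continuous_on_minus continuous_on_fst continuous_on_snd continuous_on_id)
  moreover have "s \<in> ?D" if "t \<in> K" "s + t \<in> C" for s t
    using that by (intro image_eqI[of _ _ "(t, s + t)"]) (auto simp: add.assoc)
  ultimately show "\<exists>D. compact D \<and> (\<forall>t\<in>K. \<forall>s. s + t \<in> C \<longrightarrow> s \<in> D)" by blast
qed

definition act_left :: "('g set \<Rightarrow> complex) \<Rightarrow> ('g \<Rightarrow> complex) \<Rightarrow> 'g \<Rightarrow> complex" where
  "act_left \<mu> \<psi> = (\<lambda>t. cb_integral \<mu> (\<lambda>s. \<psi> (s + t)))"

definition act_right :: "('g set \<Rightarrow> complex) \<Rightarrow> ('g \<Rightarrow> complex) \<Rightarrow> 'g \<Rightarrow> complex" where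
  "act_right \<nu> \<psi> = (\<lambda>s. cb_integral \<nu> (\<lambda>t. \<psi> (s + t)))"

lemma E_sum: "finite J \<Longrightarrow> (\<And>j. j \<in> J \<Longrightarrow> f j \<in> E) \<Longrightarrow> (\<lambda>x. \<Sum>j\<in>J. c j * f j x) \<in> E"
proof (induction J rule: finite_induct)
  case empty
  then show ?case using E_zero by (simp add: zero_fun_def)
next
  case (insert j J)
  then have "fun_scale (c j) (f j) + (\<lambda>x. \<Sum>j\<in>J. c j * f j x) \<in> E" by (intro E_add E_scale) auto
  then show ?case using insert by (simp add: fun_scale_def plus_fun_def)
qed

lemma translate_bound: "\<psi> \<in> E \<Longrightarrow> cmod (\<psi> (s + t)) \<le> NE \<psi> * \<omega> s * \<omega> t"
  using E_le[of \<psi> "s + t"] mult_left_mono[OF submult NE_nonneg, of \<psi> s t] by (simp add: mult.assoc)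

text \<open>Makes each value of \<open>act_left \<mu> \<psi>\<close> a pairing with an element of
  the predual, to which \<open>pair_le\<close> applies. The translation costs the constant factor
  \<open>\<omega> t\<close>, by submultiplicativity.\<close>

lemma translate_left_E:
  assumes p: "\<psi> \<in> E" shows "(\<lambda>s. \<psi> (s + t)) \<in> E"
  unfolding E_iff
proof (intro conjI allI impI)
  show "continuous_on UNIV (\<lambda>s. \<psi> (s + t))"
    by (rule continuous_on_compose2[OF E_continuous[OF p]]) (auto intro!: continuous_on_add continuous_on_id continuous_on_const)
  fix e :: real assume e: "e > 0"
  then have "e / \<omega> t > 0" using pos by simp
  then obtain K where K: "compact K" "\<And>x. x \<notin> K \<Longrightarrow> cmod (\<psi> x) < e / \<omega> t * \<omega> x"
    using p unfolding E_iff by metis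
  let ?L = "(\<lambda>x. x + - t) ` K"
  have "compact ?L" using K(1) by (intro compact_continuous_image continuous_on_add continuous_on_id continuous_on_const)
  moreover have "cmod (\<psi> (s + t)) < e * \<omega> s" if "s \<notin> ?L" for s
  proof -
    have "s + t \<notin> K" using that by (auto simp: image_iff add.assoc)
    then have "cmod (\<psi> (s + t)) < e / \<omega> t * \<omega> (s + t)" by (rule K(2))
    also have "\<dots> \<le> e / \<omega> t * (\<omega> s * \<omega> t)" using submult e pos by (intro mult_left_mono) (auto simp: less_imp_le)
    also have "\<dots> = e * \<omega> s" using nz by simp
    finally show ?thesis .
  qed
  ultimately show "\<exists>K. compact K \<and> (\<forall>s. s \<notin> K \<longrightarrow> cmod (\<psi> (s + t)) < e * \<omega> s)" by blast
qed

lemma translate_right_E: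
  assumes p: "\<psi> \<in> E" shows "(\<lambda>t. \<psi> (s + t)) \<in> E"
  unfolding E_iff
proof (intro conjI allI impI)
  show "continuous_on UNIV (\<lambda>t. \<psi> (s + t))"
    by (rule continuous_on_compose2[OF E_continuous[OF p]]) (auto intro!: continuous_on_add continuous_on_id continuous_on_const)
  fix e :: real assume e: "e > 0"
  then have "e / \<omega> s > 0" using pos by simp
  then obtain K where K: "compact K" "\<And>x. x \<notin> K \<Longrightarrow> cmod (\<psi> x) < e / \<omega> s * \<omega> x"
    using p unfolding E_iff by metis
  let ?L = "(\<lambda>x. - s + x) ` K"
  have "compact ?L" using K(1) by (intro compact_continuous_image continuous_on_add continuous_on_id continuous_on_const)
  moreover have "cmod (\<psi> (s + t)) < e * \<omega> t" if "t \<notin> ?L" for t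
  proof -
    have "s + t \<notin> K"
    proof
      assume "s + t \<in> K"
      moreover have "t = - s + (s + t)" by (simp add: add.assoc[symmetric])
      ultimately show False using that by blast
    qed
    then have "cmod (\<psi> (s + t)) < e / \<omega> s * \<omega> (s + t)" by (rule K(2))
    also have "\<dots> \<le> e / \<omega> s * (\<omega> s * \<omega> t)" using submult e pos by (intro mult_left_mono) (auto simp: less_imp_le)
    also have "\<dots> = e * \<omega> t" using nz by simp
    finally show ?thesis .
  qed
  ultimately show "\<exists>K. compact K \<and> (\<forall>t. t \<notin> K \<longrightarrow> cmod (\<psi> (s + t)) < e * \<omega> t)" by blast
qed

lemma act_left_wrep:
  assumes R: "wrep J c N \<mu>" and p: "\<psi> \<in> E"
  shows "act_left \<mu> \<psi> = (\<lambda>t. \<Sum>j\<in>J. c j * (\<integral>s. \<psi> (s + t) \<partial>N j))"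
  unfolding act_left_def cb_integral_E(2)[OF R translate_left_E[OF p]] ..

lemma act_right_wrep:
  assumes R: "wrep J c N \<nu>" and p: "\<psi> \<in> E"
  shows "act_right \<nu> \<psi> = (\<lambda>s. \<Sum>j\<in>J. c j * (\<integral>t. \<psi> (s + t) \<partial>N j))"
  unfolding act_right_def cb_integral_E(2)[OF R translate_right_E[OF p]] ..

lemma act_left_E: assumes "\<mu> \<in> V" "\<psi> \<in> E" shows "act_left \<mu> \<psi> \<in> E"
proof -
  obtain c N where R: "wrep {..<4::nat} c N \<mu>" by (rule V_wrep[OF assms(1)])
  show ?thesis unfolding act_left_wrep[OF R assms(2)]
    by (intro E_sum action_left wrepD(4)[OF R] wrepD(2)[OF R] assms(2)) auto
qed

lemma act_right_E: assumes "\<nu> \<in> V" "\<psi> \<in> E" shows "act_right \<nu> \<psi> \<in> E"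
proof -
  obtain c N where R: "wrep {..<4::nat} c N \<nu>" by (rule V_wrep[OF assms(1)])
  show ?thesis unfolding act_right_wrep[OF R assms(2)]
    by (intro E_sum action_right wrepD(4)[OF R] wrepD(2)[OF R] assms(2)) auto
qed

lemma NE_act_left: assumes "\<mu> \<in> V" "\<psi> \<in> E" shows "NE (act_left \<mu> \<psi>) \<le> NV \<mu> * NE \<psi>"
proof (rule NE_le)
  fix t
  have "cmod (act_left \<mu> \<psi> t) \<le> NV \<mu> * NE (\<lambda>s. \<psi> (s + t))"
    unfolding act_left_def by (rule pair_le[OF assms(1) translate_left_E[OF assms(2)]])
  also have "\<dots> \<le> NV \<mu> * (NE \<psi> * \<omega> t)"
    using translate_bound[OF assms(2)] by (intro mult_left_mono NV_nonneg NE_le) (simp add: ac_simps)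
  finally show "cmod (act_left \<mu> \<psi> t) \<le> NV \<mu> * NE \<psi> * \<omega> t" by (simp add: mult.assoc)
qed

lemma plus_continuous: "continuous_on UNIV (\<lambda>x::'g \<times> 'g. fst x + snd x)"
  by (intro continuous_on_add continuous_on_fst continuous_on_snd continuous_on_id)

text \<open>Preimages of compact sets under the group law are in general not compact, so their
  finiteness is a matter of the weight. It has a positive lower bound \<open>m\<close> on
  \<open>C\<close>, and by submultiplicativity \<open>\<omega> s * \<omega> t\<close> is at least
  \<open>m\<close> on the preimage.\<close>

lemma weight_preimage_finite:
  assumes P: "radon P" and w: "(\<integral>\<^sup>+x. ennreal (\<omega> (fst x) * \<omega> (snd x)) \<partial>P) < \<infinity>"
    and A: "A \<in> sets borel" "A \<subseteq> C" "compact C"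
  shows "emeasure P ((\<lambda>x. fst x + snd x) -` A) < \<infinity>"
proof -
  let ?p = "\<lambda>x::'g \<times> 'g. fst x + snd x"
  have pm: "?p \<in> borel_measurable borel" by (rule borel_measurable_continuous_onI[OF plus_continuous])
  have pA[measurable]: "?p -` A \<in> sets borel" using measurable_sets[OF pm A(1)] by simp
  show ?thesis
  proof (cases "C = {}")
    case True then show ?thesis using A(2) by simp
  next
    case False
    have "continuous_on C \<omega>" using cont continuous_on_subset by blast
    then obtain x0 where x0: "x0 \<in> C" "\<And>x. x \<in> C \<Longrightarrow> \<omega> x0 \<le> \<omega> x"
      using continuous_attains_inf[OF A(3) False] by blast
    define m where "m = \<omega> x0"
    have m: "m > 0" unfolding m_def by (rule pos)
    have "ennreal m * emeasure P (?p -` A) = (\<integral>\<^sup>+x. ennreal m * indicator (?p -` A) x \<partial>P)"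
      using P pA by (intro nn_integral_cmult_indicator[symmetric]) simp
    also have "\<dots> \<le> (\<integral>\<^sup>+x. ennreal (\<omega> (fst x) * \<omega> (snd x)) \<partial>P)"
    proof (rule nn_integral_mono)
      fix x :: "'g \<times> 'g"
      show "ennreal m * indicator (?p -` A) x \<le> ennreal (\<omega> (fst x) * \<omega> (snd x))"
      proof (cases "fst x + snd x \<in> A")
        case True
        then have "m \<le> \<omega> (fst x + snd x)" unfolding m_def using x0(2) A(2) by blast
        also have "\<dots> \<le> \<omega> (fst x) * \<omega> (snd x)" by (rule submult)
        finally show ?thesis using True by (simp add: ennreal_leI)
      qed simp
    qed
    also have "\<dots> < \<infinity>" by (rule w)
    finally show ?thesis using m by (auto simp: ennreal_mult_less_top)
  qed
qed

text \<open>\<open>\<mu> * \<nu>\<close> is represented by the images under the group law of the products of the components of \<open>\<mu>\<close>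
  and \<open>\<nu>\<close>.\<close>

lemma convolution_facts:
  assumes mu: "\<mu> \<in> V" and nu: "\<nu> \<in> V"
  shows "convolution_exists \<mu> \<nu>" and "convolution \<mu> \<nu> \<in> V"
    and "\<And>\<psi>. \<psi> \<in> E \<Longrightarrow> cb_integral (convolution \<mu> \<nu>) \<psi> = cb_integral \<nu> (act_left \<mu> \<psi>)"
    and "\<And>\<psi>. \<psi> \<in> E \<Longrightarrow> cb_integral (convolution \<mu> \<nu>) \<psi> = cb_integral \<mu> (act_right \<nu> \<psi>)"
proof -
  let ?p = "\<lambda>x::'g \<times> 'g. fst x + snd x"
  have p_eq: "(\<lambda>(s, t). s + t) = ?p" by (simp add: case_prod_unfold)
  note lcP = locally_compact_euclidean_prod[OF lc lc]
  obtain c M where R: "wrep {..<4::nat} c M \<mu>" by (rule V_wrep[OF mu])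
  obtain d N where S: "wrep {..<4::nat} d N \<nu>" by (rule V_wrep[OF nu])
  define J where "J = {..<4::nat} \<times> {..<4::nat}"
  have J: "finite J" by (simp add: J_def)
  have JD: "fst k \<in> {..<4}" "snd k \<in> {..<4}" if "k \<in> J" for k using that by (auto simp: J_def)
  have "\<exists>P. radon P \<and> (\<forall>f\<in>compactly_supported. (\<integral>x. f x \<partial>P) = (\<integral>t. (\<integral>s. f (s, t) \<partial>M (fst k)) \<partial>N (snd k)))" if "k \<in> J" for k
    by (rule product_radon[OF lc lc wrepD(4)[OF R JD(1)[OF that]] wrepD(4)[OF S JD(2)[OF that]]]) blast
  then obtain P where P: "\<And>k. k \<in> J \<Longrightarrow> radon (P k)"
    and Pf: "\<And>k f. k \<in> J \<Longrightarrow> f \<in> compactly_supported \<Longrightarrow>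
       (\<integral>x. f x \<partial>P k) = (\<integral>t. (\<integral>s. f (s, t) \<partial>M (fst k)) \<partial>N (snd k))"
    by metis
  define a where "a k = c (fst k) * d (snd k)" for k
  \<comment> \<open>The two groupings match the two pairing formulas: \<open>sumJ\<close> puts the
    components of \<open>\<nu>\<close> outside, \<open>sumJ'\<close> those of
    \<open>\<mu>\<close>.\<close>
  have sumJ: "(\<Sum>k\<in>J. a k * h (fst k) (snd k)) = (\<Sum>j<4. d j * (\<Sum>i<4. c i * h i j))" for h
  proof -
    have "(\<Sum>k\<in>J. a k * h (fst k) (snd k)) = (\<Sum>i<4. \<Sum>j<4. c i * d j * h i j)"
      unfolding J_def a_def by (simp add: sum.cartesian_product case_prod_unfold)
    also have "\<dots> = (\<Sum>j<4. \<Sum>i<4. c i * d j * h i j)" by (rule sum.swap)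
    also have "\<dots> = (\<Sum>j<4. d j * (\<Sum>i<4. c i * h i j))"
      unfolding sum_distrib_left by (simp only: ac_simps)
    finally show ?thesis .
  qed
  have sumJ': "(\<Sum>k\<in>J. a k * h (fst k) (snd k)) = (\<Sum>i<4. c i * (\<Sum>j<4. d j * h i j))" for h
  proof -
    have "(\<Sum>k\<in>J. a k * h (fst k) (snd k)) = (\<Sum>i<4. \<Sum>j<4. c i * d j * h i j)"
      unfolding J_def a_def by (simp add: sum.cartesian_product case_prod_unfold)
    then show ?thesis unfolding sum_distrib_left by (simp only: ac_simps)
  qed
  have Pw: "(\<integral>\<^sup>+x. ennreal (\<omega> (fst x) * \<omega> (snd x)) \<partial>P k) < \<infinity>" if "k \<in> J" for k
    by (rule product_weight[OF wrepD(4)[OF R JD(1)[OF that]] wrepD(2)[OF R JD(1)[OF that]]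
        wrepD(4)[OF S JD(2)[OF that]] wrepD(2)[OF S JD(2)[OF that]] P[OF that] Pf[OF that]])

  define \<sigma> where "\<sigma> A = (if A \<in> compacted_borel then \<Sum>k\<in>J. a k * of_real (measure (P k) A) else 0)" for A
  have Rs: "represents J a P \<sigma>" unfolding represents_def using J P by (simp add: \<sigma>_def)
  \<comment> \<open>Existence in the defining description is the product formula for the components,
    combined bilinearly; uniqueness is \<open>regular_eqI\<close> on the product space.\<close>
  have prod_eq: "product_cb \<mu> \<nu> = \<sigma>"
    unfolding product_cb_def
  proof (rule the_equality)
    have int: "cb_integral \<sigma> f = cb_integral \<nu> (\<lambda>t. cb_integral \<mu> (\<lambda>s. f (s, t)))"
      if f: "f \<in> compactly_supported" for f
    proof -
      have in1: "cb_integral \<mu> (\<lambda>s. f (s, t)) = (\<Sum>i<4. c i * (\<integral>s. f (s, t) \<partial>M i))" for t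
        by (rule cb_integral_E(2)[OF R cs_in_E[OF compactly_supported_section1[OF f]]])
      have cs: "(\<lambda>t. \<integral>s. f (s, t) \<partial>M i) \<in> compactly_supported" if "i \<in> {..<4}" for i
        by (rule compactly_supported_section_integral[OF wrepD(4)[OF R that] f])
      have "(\<lambda>t. \<Sum>i<4. c i * (\<integral>s. f (s, t) \<partial>M i)) \<in> E"
        by (intro E_sum cs_in_E cs) auto
      then have "cb_integral \<nu> (\<lambda>t. cb_integral \<mu> (\<lambda>s. f (s, t)))
          = (\<Sum>j<4. d j * (\<integral>t. (\<Sum>i<4. c i * (\<integral>s. f (s, t) \<partial>M i)) \<partial>N j))"
        unfolding in1 by (rule cb_integral_E(2)[OF S])
      also have "\<dots> = (\<Sum>j<4. d j * (\<Sum>i<4. c i * (\<integral>t. (\<integral>s. f (s, t) \<partial>M i) \<partial>N j)))"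
      proof (intro sum.cong refl arg_cong2[of _ _ _ _ "(*)"])
        fix j :: nat assume "j \<in> {..<4}"
        then have "integrable (N j) (\<lambda>t. \<integral>s. f (s, t) \<partial>M i)" if "i \<in> {..<4}" for i
          using compactly_supported_integrable[OF wrepD(4)[OF S] cs[OF that]] by blast
        then show "(\<integral>t. (\<Sum>i<4. c i * (\<integral>s. f (s, t) \<partial>M i)) \<partial>N j) = (\<Sum>i<4. c i * (\<integral>t. (\<integral>s. f (s, t) \<partial>M i) \<partial>N j))"
          by (subst Bochner_Integration.integral_sum) auto
      qed
      also have "\<dots> = (\<Sum>k\<in>J. a k * (\<integral>t. (\<integral>s. f (s, t) \<partial>M (fst k)) \<partial>N (snd k)))"
        by (rule sumJ[of "\<lambda>i j. \<integral>t. (\<integral>s. f (s, t) \<partial>M i) \<partial>N j", symmetric])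
      also have "\<dots> = (\<Sum>k\<in>J. a k * (\<integral>x. f x \<partial>P k))"
        using Pf[OF _ f] by (intro sum.cong refl) simp
      also have "\<dots> = cb_integral \<sigma> f" by (rule cb_integral_compactly_supported(1)[OF Rs f, symmetric])
      finally show ?thesis by simp
    qed
    then show "\<sigma> \<in> regular_cb_measures \<and>
        (\<forall>f\<in>compactly_supported. cb_integral \<sigma> f = cb_integral \<nu> (\<lambda>t. cb_integral \<mu> (\<lambda>s. f (s, t))))"
      using regular_represents[OF Rs] by blast
    fix \<tau> assume t: "\<tau> \<in> regular_cb_measures \<and>
        (\<forall>f\<in>compactly_supported. cb_integral \<tau> f = cb_integral \<nu> (\<lambda>t. cb_integral \<mu> (\<lambda>s. f (s, t))))"
    show "\<tau> = \<sigma>"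
      by (rule regular_eqI[OF lcP]) (use t int regular_represents[OF Rs] in auto)
  qed
  obtain T where T: "dominates T J a P" using dominates_exists[OF Rs] .
  then have rT: "radon T" by (simp add: dominates_def)
  have pm: "?p \<in> borel_measurable borel" by (rule borel_measurable_continuous_onI[OF plus_continuous])
  have pA: "?p -` A \<in> sets borel" if "A \<in> sets borel" for A using measurable_sets[OF pm that] by simp

  show "convolution_exists \<mu> \<nu>"
    unfolding convolution_exists_def prod_eq p_eq
  proof
    fix A :: "'g set" assume A: "A \<in> compacted_borel"
    \<comment> \<open>\<open>extended_domain\<close> asks for an open superset of finite variation;
      the preimage of a relatively compact open neighbourhood of \<open>closure A\<close> is
      one.\<close>
    obtain W where W: "open W" "closure A \<subseteq> W" "compact (closure W)"
      by (rule compact_open_between[OF lc _ subset_UNIV open_UNIV, of "closure A"])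
         (use A in \<open>auto simp: compacted_borel_def intro: that\<close>)
    have oW: "open (?p -` W)" using plus_continuous W(1) by (simp add: continuous_on_open_vimage)
    have "sup_variation \<sigma> (?p -` W) \<le> emeasure T (?p -` W)"
      unfolding sup_variation_def
    proof (rule SUP_least)
      fix B assume B: "B \<in> {A \<in> compacted_borel. A \<subseteq> ?p -` W}"
      then have "cb_variation \<sigma> B \<le> emeasure T B" by (intro dominates_tv_le[OF Rs T]) auto
      also have "\<dots> \<le> emeasure T (?p -` W)" using B oW rT by (intro emeasure_mono) auto
      finally show "cb_variation \<sigma> B \<le> emeasure T (?p -` W)" .
    qed
    also have "\<dots> = (\<Sum>k\<in>J. ennreal (cmod (a k)) * emeasure (P k) (?p -` W))"
      using T oW by (simp add: dominates_def)
    also have "\<dots> < \<infinity>"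
    proof -
      have "emeasure (P k) (?p -` W) < \<infinity>" if "k \<in> J" for k
        using weight_preimage_finite[OF P[OF that] Pw[OF that] _ closure_subset W(3)] W(1) by simp
      then show ?thesis using J by (auto simp: ennreal_mult_less_top)
    qed
    finally have "sup_variation \<sigma> (?p -` W) < \<infinity>" .
    moreover have "?p -` A \<subseteq> ?p -` W" using W(2) closure_subset[of A] by auto
    ultimately show "?p -` A \<in> extended_domain \<sigma>"
      unfolding extended_domain_def using pA[OF compacted_borel_borel[OF A]] oW by blast
  qed

  have Pfin: "emeasure (P k) (?p -` A) < \<infinity>" if "k \<in> J" "A \<in> compacted_borel" for k A
    using weight_preimage_finite[OF P[OF that(1)] Pw[OF that(1)] compacted_borel_borel[OF that(2)] closure_subset]
      that(2) by (simp add: compacted_borel_def)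
  have conv: "convolution \<mu> \<nu> A = (\<Sum>k\<in>J. a k * of_real (measure (P k) (?p -` A)))" if A: "A \<in> compacted_borel" for A
  proof -
    let ?B = "?p -` A"
    let ?F = "compact_subsets_at_top ?B"
    have Bm: "?B \<in> sets borel" by (rule pA[OF compacted_borel_borel[OF A]])
    \<comment> \<open>Inner regularity provides a compact \<open>K\<close> such that every compact
      subset containing it has nearly the full measure of the preimage; since that measure is
      finite, this is convergence of real numbers.\<close>
    have lim: "((\<lambda>C. measure (P k) C) \<longlongrightarrow> measure (P k) ?B) ?F" if k: "k \<in> J" for k
    proof (rule tendstoI)
      fix e :: real assume e: "e > 0"
      obtain K where K: "compact K" "K \<subseteq> ?B" "emeasure (P k) (?B - K) < ennreal e"
        by (rule radon_approx[OF P[OF k] Bm Pfin[OF k A] e], rule that)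
      have "dist (measure (P k) C) (measure (P k) ?B) < e" if C: "compact C" "K \<subseteq> C" "C \<subseteq> ?B" for C
      proof -
        have m: "?B \<in> sets (P k)" "C \<in> sets (P k)" "K \<in> sets (P k)"
          using P[OF k] Bm C(1) K(1) by (auto simp: compact_borel)
        have "measure (P k) (?B - C) = measure (P k) ?B - measure (P k) C"
          using Pfin[OF k A] m C(3) by (intro measure_Diff) auto
        moreover have "ennreal (measure (P k) (?B - C)) < ennreal e"
        proof -
          have "emeasure (P k) (?B - C) \<le> emeasure (P k) (?B - K)" using m C(2) by (intro emeasure_mono) auto
          then have lt: "emeasure (P k) (?B - C) < ennreal e" using K(3) by order
          then have "emeasure (P k) (?B - C) \<noteq> \<infinity>" by auto
          then show ?thesis using lt by (simp add: emeasure_eq_ennreal_measure)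
        qed
        ultimately show ?thesis using e measure_nonneg[of "P k" "?B - C"]
          by (simp add: dist_real_def ennreal_less_iff)
      qed
      then show "eventually (\<lambda>C. dist (measure (P k) C) (measure (P k) ?B) < e) ?F"
        unfolding eventually_compact_subsets using K(1,2) by blast
    qed
    have "((\<lambda>C. \<Sum>k\<in>J. a k * of_real (measure (P k) C)) \<longlongrightarrow> (\<Sum>k\<in>J. a k * of_real (measure (P k) ?B))) ?F"
      by (intro tendsto_sum tendsto_mult tendsto_const tendsto_of_real lim)
    moreover have "eventually (\<lambda>C. (\<Sum>k\<in>J. a k * of_real (measure (P k) C)) = \<sigma> C) ?F"
      unfolding eventually_compact_subsets by (intro exI[of _ "{}"]) (auto simp: \<sigma>_def compact_compacted_borel)
    ultimately have "(\<sigma> \<longlongrightarrow> (\<Sum>k\<in>J. a k * of_real (measure (P k) ?B))) ?F"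
      by (rule Lim_transform_eventually)
    then have "Lim ?F \<sigma> = (\<Sum>k\<in>J. a k * of_real (measure (P k) ?B))"
      by (rule tendsto_Lim[OF compact_subsets_at_top_neq_bot])
    then show ?thesis using A by (simp add: convolution_def prod_eq p_eq extend_cb_def)
  qed

  define Q where "Q k = distr (P k) borel ?p" for k
  have pmk: "?p \<in> borel_measurable (P k)" if "k \<in> J" for k by (rule radon_measurable[OF P[OF that] pm])
  have Q: "radon (Q k)" if k: "k \<in> J" for k
    unfolding Q_def by (rule radon_distr[OF P[OF k] plus_continuous Pfin[OF k compact_compacted_borel]])
  have Qr: "wrep J a Q (convolution \<mu> \<nu>)"
    unfolding wrep_def represents_def
  proof (intro conjI ballI allI impI)
    show "convolution \<mu> \<nu> A = (\<Sum>k\<in>J. a k * of_real (measure (Q k) A))" if A: "A \<in> compacted_borel" for A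
      unfolding conv[OF A]
    proof (intro sum.cong refl)
      fix k assume k: "k \<in> J"
      have "measure (Q k) A = measure (P k) (?p -` A)"
        unfolding Q_def using measure_distr[OF pmk[OF k] compacted_borel_borel[OF A]] P[OF k] by simp
      then show "a k * of_real (measure (P k) (?p -` A)) = a k * of_real (measure (Q k) A)" by simp
    qed
    show "convolution \<mu> \<nu> A = 0" if "A \<notin> compacted_borel" for A using that by (simp add: convolution_def)
    fix k assume k: "k \<in> J"
    have "(\<integral>\<^sup>+x. ennreal (\<omega> x) \<partial>Q k) = (\<integral>\<^sup>+x. ennreal (\<omega> (?p x)) \<partial>P k)"
      unfolding Q_def by (rule nn_integral_distr[OF pmk[OF k]]) measurable
    also have "\<dots> \<le> (\<integral>\<^sup>+x. ennreal (\<omega> (fst x) * \<omega> (snd x)) \<partial>P k)"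
      by (intro nn_integral_mono ennreal_leI submult)
    also have "\<dots> < \<infinity>" by (rule Pw[OF k])
    finally show "(\<integral>\<^sup>+x. ennreal (\<omega> x) \<partial>Q k) < \<infinity>" .
  qed (use J Q in auto)
  show "convolution \<mu> \<nu> \<in> V" by (rule wrep_in_V[OF Qr])

  fix \<psi> assume p: "\<psi> \<in> E"
  have pc: "continuous_on UNIV (\<lambda>x. \<psi> (?p x))"
    by (rule continuous_on_compose2[OF E_continuous[OF p] plus_continuous]) simp
  have L: "(\<lambda>t. \<integral>s. \<psi> (s + t) \<partial>M i) \<in> E" if "i \<in> {..<4}" for i
    by (rule action_left[OF wrepD(4)[OF R that] wrepD(2)[OF R that] p])
  have L': "(\<lambda>s. \<integral>t. \<psi> (s + t) \<partial>N j) \<in> E" if "j \<in> {..<4}" for j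
    by (rule action_right[OF wrepD(4)[OF S that] wrepD(2)[OF S that] p])
  have iL: "integrable (N j) (\<lambda>t. \<integral>s. \<psi> (s + t) \<partial>M i)" if "i \<in> {..<4}" "j \<in> {..<4}" for i j
    by (rule integrable_E[OF wrepD(4)[OF S that(2)] wrepD(2)[OF S that(2)] L[OF that(1)]])
  have iL': "integrable (M i) (\<lambda>s. \<integral>t. \<psi> (s + t) \<partial>N j)" if "i \<in> {..<4}" "j \<in> {..<4}" for i j
    by (rule integrable_E[OF wrepD(4)[OF R that(1)] wrepD(2)[OF R that(1)] L'[OF that(2)]])
  \<comment> \<open>The integrability of the inner integrals demanded by
    \<open>product_fubini\<close> holds because each component acts on the predual, whose elements
    are integrable for the components on the other side.\<close>
  have fub: "(\<integral>x. \<psi> x \<partial>Q k) = (\<integral>t. (\<integral>s. \<psi> (s + t) \<partial>M (fst k)) \<partial>N (snd k))"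
    "(\<integral>t. (\<integral>s. \<psi> (s + t) \<partial>M (fst k)) \<partial>N (snd k)) = (\<integral>s. (\<integral>t. \<psi> (s + t) \<partial>N (snd k)) \<partial>M (fst k))"
    if k: "k \<in> J" for k
  proof -
    have b: "cmod (\<psi> (?p (s, t))) \<le> NE \<psi> * \<omega> s * \<omega> t" for s t using translate_bound[OF p] by simp
    have "(\<integral>x. \<psi> x \<partial>Q k) = (\<integral>x. \<psi> (?p x) \<partial>P k)"
      unfolding Q_def by (rule integral_distr[OF pmk[OF k] borel_measurable_continuous_onI[OF E_continuous[OF p]]])
    also have "\<dots> = (\<integral>t. (\<integral>s. \<psi> (?p (s, t)) \<partial>M (fst k)) \<partial>N (snd k))"
      by (rule product_fubini(2)[OF wrepD(4)[OF R JD(1)[OF k]] wrepD(2)[OF R JD(1)[OF k]]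
            wrepD(4)[OF S JD(2)[OF k]] wrepD(2)[OF S JD(2)[OF k]] P[OF k] Pf[OF k] pc b NE_nonneg[OF p]])
         (use iL[OF JD[OF k]] iL'[OF JD[OF k]] in auto)
    finally show "(\<integral>x. \<psi> x \<partial>Q k) = (\<integral>t. (\<integral>s. \<psi> (s + t) \<partial>M (fst k)) \<partial>N (snd k))" by simp
    have "(\<integral>t. (\<integral>s. \<psi> (?p (s, t)) \<partial>M (fst k)) \<partial>N (snd k)) = (\<integral>s. (\<integral>t. \<psi> (?p (s, t)) \<partial>N (snd k)) \<partial>M (fst k))"
      by (rule product_fubini(3)[OF wrepD(4)[OF R JD(1)[OF k]] wrepD(2)[OF R JD(1)[OF k]]
            wrepD(4)[OF S JD(2)[OF k]] wrepD(2)[OF S JD(2)[OF k]] P[OF k] Pf[OF k] pc b NE_nonneg[OF p]])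
         (use iL[OF JD[OF k]] iL'[OF JD[OF k]] in auto)
    then show "(\<integral>t. (\<integral>s. \<psi> (s + t) \<partial>M (fst k)) \<partial>N (snd k)) = (\<integral>s. (\<integral>t. \<psi> (s + t) \<partial>N (snd k)) \<partial>M (fst k))"
      by simp
  qed
  have base: "cb_integral (convolution \<mu> \<nu>) \<psi> = (\<Sum>k\<in>J. a k * (\<integral>t. (\<integral>s. \<psi> (s + t) \<partial>M (fst k)) \<partial>N (snd k)))"
    unfolding cb_integral_E(2)[OF Qr p] using fub(1) by (intro sum.cong refl) simp
  show "cb_integral (convolution \<mu> \<nu>) \<psi> = cb_integral \<nu> (act_left \<mu> \<psi>)"
  proof -
    have "cb_integral (convolution \<mu> \<nu>) \<psi> = (\<Sum>j<4. d j * (\<Sum>i<4. c i * (\<integral>t. (\<integral>s. \<psi> (s + t) \<partial>M i) \<partial>N j)))"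
      unfolding base by (rule sumJ[of "\<lambda>i j. \<integral>t. (\<integral>s. \<psi> (s + t) \<partial>M i) \<partial>N j"])
    also have "\<dots> = (\<Sum>j<4. d j * (\<integral>t. act_left \<mu> \<psi> t \<partial>N j))"
      unfolding act_left_wrep[OF R p]
    proof (intro sum.cong refl arg_cong2[of _ _ _ _ "(*)"])
      fix j :: nat assume "j \<in> {..<4}"
      then show "(\<Sum>i<4. c i * (\<integral>t. (\<integral>s. \<psi> (s + t) \<partial>M i) \<partial>N j)) = (\<integral>t. (\<Sum>i<4. c i * (\<integral>s. \<psi> (s + t) \<partial>M i)) \<partial>N j)"
        using iL by (subst Bochner_Integration.integral_sum) auto
    qed
    also have "\<dots> = cb_integral \<nu> (act_left \<mu> \<psi>)"
      by (rule cb_integral_E(2)[OF S act_left_E[OF mu p], symmetric])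
    finally show ?thesis .
  qed
  show "cb_integral (convolution \<mu> \<nu>) \<psi> = cb_integral \<mu> (act_right \<nu> \<psi>)"
  proof -
    have "cb_integral (convolution \<mu> \<nu>) \<psi> = (\<Sum>k\<in>J. a k * (\<integral>s. (\<integral>t. \<psi> (s + t) \<partial>N (snd k)) \<partial>M (fst k)))"
      unfolding base using fub(2) by (intro sum.cong refl) simp
    also have "\<dots> = (\<Sum>i<4. c i * (\<Sum>j<4. d j * (\<integral>s. (\<integral>t. \<psi> (s + t) \<partial>N j) \<partial>M i)))"
      by (rule sumJ'[of "\<lambda>i j. \<integral>s. (\<integral>t. \<psi> (s + t) \<partial>N j) \<partial>M i"])
    also have "\<dots> = (\<Sum>i<4. c i * (\<integral>s. act_right \<nu> \<psi> s \<partial>M i))"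
      unfolding act_right_wrep[OF S p]
    proof (intro sum.cong refl arg_cong2[of _ _ _ _ "(*)"])
      fix i :: nat assume "i \<in> {..<4}"
      then show "(\<Sum>j<4. d j * (\<integral>s. (\<integral>t. \<psi> (s + t) \<partial>N j) \<partial>M i)) = (\<integral>s. (\<Sum>j<4. d j * (\<integral>t. \<psi> (s + t) \<partial>N j)) \<partial>M i)"
        using iL' by (subst Bochner_Integration.integral_sum) auto
    qed
    also have "\<dots> = cb_integral \<mu> (act_right \<nu> \<psi>)"
      by (rule cb_integral_E(2)[OF R act_right_E[OF nu p], symmetric])
    finally show ?thesis .
  qed
qed

section \<open>The dual Banach algebra\<close>

lemma convolution_assoc:
  assumes x: "x \<in> V" and y: "y \<in> V" and z: "z \<in> V"
  shows "convolution (convolution x y) z = convolution x (convolution y z)"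
proof (rule V_eqI)
  note xy = convolution_facts(2)[OF x y] and yz = convolution_facts(2)[OF y z]
  show "convolution (convolution x y) z \<in> V" by (rule convolution_facts(2)[OF xy z])
  show "convolution x (convolution y z) \<in> V" by (rule convolution_facts(2)[OF x yz])
  fix f :: "'g \<Rightarrow> complex" assume "f \<in> compactly_supported"
  then have f: "f \<in> E" by (rule cs_in_E)
  \<comment> \<open>\<open>act_left\<close> reverses the order of the factors. At a point
    \<open>t\<close> this is the pairing formula for the convolution of \<open>x\<close> and
    \<open>y\<close>, applied to the translate of \<open>f\<close> by \<open>t\<close>.\<close>
  have act: "act_left (convolution x y) f = act_left y (act_left x f)"
  proof
    fix t
    have "act_left (convolution x y) f t = cb_integral y (act_left x (\<lambda>s. f (s + t)))"
      unfolding act_left_def[of "convolution x y"] by (rule convolution_facts(3)[OF x y translate_left_E[OF f]])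
    also have "\<dots> = act_left y (act_left x f) t" by (simp add: act_left_def add.assoc)
    finally show "act_left (convolution x y) f t = act_left y (act_left x f) t" .
  qed
  show "cb_integral (convolution (convolution x y) z) f = cb_integral (convolution x (convolution y z)) f"
    unfolding convolution_facts(3)[OF xy z f] convolution_facts(3)[OF x yz f]
      convolution_facts(3)[OF y z act_left_E[OF x f]] act ..
qed

text \<open>Identities in the first factor are tested with \<open>act_right\<close>, those in the
  second with \<open>act_left\<close>: in this way the factor that varies is the measure paired with
  a fixed element of the predual.\<close>

lemma convolution_algebra: "complex_banach_algebra_on fun_scale V NV convolution"
proof (intro complex_banach_algebra_on.intro V_banach complex_banach_algebra_on_axioms.intro convolution_facts(2) convolution_assoc)
  fix x y z assume x: "x \<in> V" and y: "y \<in> V" and z: "z \<in> V"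
  show "convolution (x + y) z = convolution x z + convolution y z"
    by (rule V_eqI)
      (simp_all add: V_add x y z cs_in_E convolution_facts(2,4) pair_add_left act_right_E)
  show "convolution x (y + z) = convolution x y + convolution x z"
    by (rule V_eqI)
      (simp_all add: V_add x y z cs_in_E convolution_facts(2,3) pair_add_left act_left_E)
next
  fix x y c assume x: "x \<in> V" and y: "y \<in> V"
  show "convolution (fun_scale c x) y = fun_scale c (convolution x y)"
    by (rule V_eqI)
      (simp_all add: V_scale x y cs_in_E convolution_facts(2,4) pair_scale_left act_right_E)
  show "convolution x (fun_scale c y) = fun_scale c (convolution x y)"
    by (rule V_eqI)
      (simp_all add: V_scale x y cs_in_E convolution_facts(2,3) pair_scale_left act_left_E)
  show "NV (convolution x y) \<le> NV x * NV y"
  proof (rule NV_le[OF convolution_facts(2)[OF x y]])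
    fix f :: "'g \<Rightarrow> complex" assume "f \<in> compactly_supported" and le: "\<And>x. cmod (f x) \<le> \<omega> x"
    then have f: "f \<in> E" by (simp add: cs_in_E)
    have "NE f \<le> 1" by (rule NE_le) (simp add: le)
    then have "NE (act_left x f) \<le> NV x"
      using NE_act_left[OF x f] mult_left_le[of "NE f" "NV x"] NV_nonneg[of x] by linarith
    then have "NV y * NE (act_left x f) \<le> NV y * NV x" by (rule mult_left_mono[OF _ NV_nonneg])
    then show "cmod (cb_integral (convolution x y) f) \<le> NV x * NV y"
      unfolding convolution_facts(3)[OF x y f]
      using pair_le[OF y act_left_E[OF x f]] by (simp add: mult.commute)
  qed (simp add: NV_nonneg)
qed

lemma convolution_dual:
  "dual_banach_algebra fun_scale V NV convolution fun_scale E NE cb_integral"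
proof (intro dual_banach_algebra.intro convolution_algebra E_banach dual_banach_algebra_axioms.intro
    pair_add_left pair_scale_left isometric pair_surj)
  fix u assume u: "u \<in> V"
  show "bounded_functional_on fun_scale E NE (cb_integral u)"
    unfolding bounded_functional_on_def
    using pair_add_right[OF u] pair_scale_right[OF u] pair_le[OF u] by blast
  show "continuous_map (weak_star_topology_on V E cb_integral) (weak_star_topology_on V E cb_integral) (convolution u)"
  proof (rule weak_star_continuous)
    fix v assume "v \<in> V"
    then show "convolution u v \<in> V" by (rule convolution_facts(2)[OF u])
  next
    fix \<psi> assume p: "\<psi> \<in> E"
    show "\<exists>\<phi>\<in>E. \<forall>v\<in>V. cb_integral (convolution u v) \<psi> = cb_integral v \<phi>"
      using act_left_E[OF u p] convolution_facts(3)[OF u _ p] by blast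
  qed
  show "continuous_map (weak_star_topology_on V E cb_integral) (weak_star_topology_on V E cb_integral) (\<lambda>v. convolution v u)"
  proof (rule weak_star_continuous)
    fix v assume "v \<in> V"
    then show "convolution v u \<in> V" by (rule convolution_facts(2)[OF _ u])
  next
    fix \<psi> assume p: "\<psi> \<in> E"
    show "\<exists>\<phi>\<in>E. \<forall>v\<in>V. cb_integral (convolution v u) \<psi> = cb_integral v \<phi>"
      using act_right_E[OF u p] convolution_facts(4)[OF _ u p] by blast
  qed
qed

end

theorem corollary2p7:
  fixes \<omega> :: "'g::{topological_group_add, t2_space} \<Rightarrow> real"
  assumes "locally_compact_space (euclidean :: 'g topology)"
    and "continuous_on UNIV \<omega>"
    and "\<And>s. 0 < \<omega> s"
    and "\<And>s t. \<omega> (s + t) \<le> \<omega> s * \<omega> t"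
    and "\<omega> 0 = 1"
  shows "(\<forall>\<mu>\<in>beurling_measures \<omega>. \<forall>\<nu>\<in>beurling_measures \<omega>. convolution_exists \<mu> \<nu>) \<and>
         (\<forall>\<nu>\<in>beurling_measures \<omega>. \<forall>\<psi>\<in>weighted_C0 \<omega>. \<psi> \<in> cb_L1 \<nu>) \<and>
         dual_banach_algebra
           fun_scale (beurling_measures \<omega>) (beurling_norm \<omega>) convolution
           fun_scale (weighted_C0 \<omega>) (weighted_sup_norm \<omega>)
           (\<lambda>\<nu> \<psi>. cb_integral \<nu> \<psi>)"
proof -
  interpret beurling_weight \<omega> by unfold_locales (fact assms)+
  have "\<psi> \<in> cb_L1 \<nu>" if h: "\<nu> \<in> V" "\<psi> \<in> E" for \<nu> \<psi>
  proof -
    obtain c N where "wrep {..<4::nat} c N \<nu>" by (rule V_wrep[OF h(1)])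
    then show ?thesis using h(2) by (rule cb_integral_E(1))
  qed
  then show ?thesis using convolution_facts(1) convolution_dual by (intro conjI ballI) simp_all
qed

end
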